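(* Let $\mathcal{D}=(G,\chi,g,0)$ be a group datum of nilpotent type with $n\ge 2$ the order of $\chi(g)$, let $H=H_{\mathcal D}$, let $r(H)$ be its Green ring, and let the elements $M[i,j]$, $\delta_{M[i,j]}^*$ of $r(H)$ and the $\mathbb{Z}$-bilinear form $(\ ,\ )$ on $r(H)$ be as defined in the context. The following hold in $r(H)$: (1) The bases $\{M[i,j]\mid 1\le i\le m,\ 1\le j\le n\}$ and $\{\delta_{M[i,j]}^*\mid 1\le i\le m,\ 1\le j\le n\}$ form a dual pair of bases for $r(H)$ with respect to the $\mathbb{Z}$-bilinear form $(\ ,\ )$. (2) The Frobenius homomorphism $\phi:r(H)\to\mathbb{Z}$ is given by $\phi(x)=(x,1)$ for any $x\in r(H)$. (3) The Casimir element of $r(H)$ is given by $\sum_{i=1}^m\sum_{j=1}^n\delta_{M[i,j]}^*\otimes M[i,j]=\sum_{i=1}^m\sum_{j=1}^nM[i,j]\otimes\delta_{M[i,j]}^*$. (4) The integral $\int_{r(H)}=\{b\in r(H)\mid bx=\dim(x)b\ \text{for all}\ x\in r(H)\}$ determined by the dimension augmentation $\dim:r(H)\to\mathbb{Z}$ is an ideal of $r(H)$ generated by $[H]$, where $[H]$ is the isomorphism class of the regular representation of $H$. Moreover, the rank of $\int_{r(H)}$ is $1$ and $([H],\ )=\dim$.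
   Context: $\mathbb{K}$ is an algebraically closed field of characteristic zero; modules are finite dimensional left modules; $\otimes=\otimes_{\mathbb K}$ for modules. Group datum: $G$ is a finite group, $g$ an element of the center of $G$, $\chi:G\to\mathbb{K}^\times$ a linear character, $q=\chi(g)$ has order $n\ge 2$. $H=H_{\mathcal D}$ is the $\mathbb K$-algebra generated by $y$ and the elements $h\in G$, containing $\mathbb{K}G$ as a subalgebra, with relations $y^n=0$ and $yh=\chi(h)hy$ for $h\in G$; it has basis $\{y^ih\mid h\in G,\ 0\le i\le n-1\}$. It is a Hopf algebra with $\Delta(y)=y\otimes g+1\otimes y$, $\varepsilon(y)=0$, $S(y)=-yg^{-1}$, and $\Delta(h)=h\otimes h$, $\varepsilon(h)=1$, $S(h)=h^{-1}$ for $h\in G$. $V_1,\dots,V_m$ is a complete set of non-isomorphic simple $\mathbb{K}G$-modules, with $V_1$ the trivial module; each is regarded as a simple $H$-module with $y$ acting by $0$. $V_{\chi^{-1}}$ is the one-dimensional module with character $\chi^{-1}$. For $1\le i\le m$, $1\le j\le n$, $M(i,j)=V_i\oplus xV_i\oplus\cdots\oplus x^{j-1}V_i$ (formal copies $x^kV_i$ of the vector space $V_i$), with $h(x^kv)=\chi^{-k}(h)\,x^k(hv)$ for $h\in G$, and $y(x^kv)=x^{k+1}v$ if $0\le k\le j-2$, $y(x^{j-1}v)=0$, for $v\in V_i$. The $M(i,j)$ form a complete set of non-isomorphic indecomposable $H$-modules. The Green ring $r(H)$ is the free abelian group on isomorphism classes $[V]$ of finite dimensional $H$-modules modulo $[M\oplus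 N]=[M]+[N]$, with product $[M][N]=[M\otimes N]$; it is commutative. $M[i,j]=[M(i,j)]$, $1=[V_1]$, $a=[V_{\chi^{-1}}]$. The dual $M^*=\mathrm{Hom}_{\mathbb K}(M,\mathbb{K})$ of an $H$-module has action $(hf)(v)=f(S(h)v)$; $[M]\mapsto[M^*]$ induces an involutive ring automorphism $*$ of $r(H)$. For $1\le i\le m$, set $\delta_{M[i,j]}=(1+a-M[1,2])M[i,j]$ for $1\le j\le n-1$, and $\delta_{M[i,n]}=M[i,n]-aM[i,n-1]$; $\delta_{M[i,j]}^*$ is the image of $\delta_{M[i,j]}$ under $*$. The form is the $\mathbb{Z}$-bilinear extension of $([V],[W])=\dim\mathrm{Hom}_H(V,W^* )$. Terminology: bases $\{b_s\}$, $\{c_s\}$ form a dual pair if $(b_s,c_t)=\delta_{s,t}$ (Kronecker delta). The Frobenius homomorphism of the form is the $\mathbb Z$-linear functional $\phi$ with $(x,y)=\phi(xy)$ for all $x,y$. The Casimir element is $\sum_s c_s\otimes b_s\in r(H)\otimes_{\mathbb Z}r(H)$ for a dual pair of bases (independent of the choice). *)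

theory Defs
  imports
    "HOL-Algebra.QuotRing"
    "HOL-Algebra.Free_Abelian_Groups"
    "HOL-Library.Function_Algebras"
    "HOL-Computational_Algebra.Polynomial"
begin

section \<open>Coordinate spaces and matrices\<close>

text \<open>
  Finite dimensional vector spaces are taken in coordinates: \<open>fspace I\<close> is the space \<open>K\<^sup>I\<close> of
  functions supported on the finite index set \<open>I\<close>, and a linear map from \<open>K\<^sup>I\<close> to \<open>K\<^sup>J\<close> is a
  matrix in \<open>fspace (J \<times> I)\<close>.
\<close>

definition fscale :: "'k::field \<Rightarrow> ('i \<Rightarrow> 'k) \<Rightarrow> 'i \<Rightarrow> 'k" where
  "fscale c f = (\<lambda>i. c * f i)"

interpretation fvs: vector_space fscale
  by unfold_locales (auto simp: fscale_def fun_eq_iff algebra_simps)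

definition fspace :: "'i set \<Rightarrow> ('i \<Rightarrow> 'k::field) set" where
  "fspace I = {f. \<forall>i. i \<notin> I \<longrightarrow> f i = 0}"

definition evec :: "'i \<Rightarrow> 'i \<Rightarrow> 'k::field" where
  "evec i = (\<lambda>j. if j = i then 1 else 0)"

definition outer :: "('i \<Rightarrow> 'k::field) \<Rightarrow> ('j \<Rightarrow> 'k) \<Rightarrow> 'i \<times> 'j \<Rightarrow> 'k" where
  "outer a b = (\<lambda>(i, j). a i * b j)"

definition lin_ext :: "'b set \<Rightarrow> ('b \<Rightarrow> 'i \<Rightarrow> 'k::field) \<Rightarrow> ('b \<Rightarrow> 'k) \<Rightarrow> 'i \<Rightarrow> 'k" where
  "lin_ext B m a = (\<Sum>p\<in>B. fscale (a p) (m p))"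

definition bilin_ext ::
    "'b set \<Rightarrow> ('b \<Rightarrow> 'b \<Rightarrow> 'b \<Rightarrow> 'k::field) \<Rightarrow> ('b \<Rightarrow> 'k) \<Rightarrow> ('b \<Rightarrow> 'k) \<Rightarrow> 'b \<Rightarrow> 'k" where
  "bilin_ext B m a b = (\<Sum>p\<in>B. \<Sum>q\<in>B. fscale (a p * b q) (m p q))"

definition mmul :: "'j set \<Rightarrow> ('i \<times> 'j \<Rightarrow> 'k::field) \<Rightarrow> ('j \<times> 'l \<Rightarrow> 'k) \<Rightarrow> 'i \<times> 'l \<Rightarrow> 'k" where
  "mmul J A B = (\<lambda>(i, l). \<Sum>j\<in>J. A (i, j) * B (j, l))"

definition mvec :: "'j set \<Rightarrow> ('i \<times> 'j \<Rightarrow> 'k::field) \<Rightarrow> ('j \<Rightarrow> 'k) \<Rightarrow> 'i \<Rightarrow> 'k" where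
  "mvec J A v = (\<lambda>i. \<Sum>j\<in>J. A (i, j) * v j)"

definition idmat :: "'i set \<Rightarrow> 'i \<times> 'i \<Rightarrow> 'k::field" where
  "idmat I = (\<lambda>(i, j). if i = j \<and> i \<in> I then 1 else 0)"

definition mat_ring :: "'i set \<Rightarrow> ('i \<times> 'i \<Rightarrow> 'k::field) ring" where
  "mat_ring I = \<lparr>carrier = fspace (I \<times> I), monoid.mult = mmul I, one = idmat I, ring.zero = 0, ring.add = (+)\<rparr>"


section \<open>Group data of nilpotent type and the Hopf algebra\<close>

record ('g, 'k) datum =
  grp :: "'g monoid"
  chr :: "'g \<Rightarrow> 'k"
  elt :: 'g

definition nil_ord :: "('g, 'k::field) datum \<Rightarrow> nat" where
  "nil_ord D = (LEAST k. 0 < k \<and> chr D (elt D) ^ k = 1)"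

definition mult_group :: "'k::field monoid" where
  "mult_group = \<lparr>carrier = UNIV - {0}, monoid.mult = (*), one = 1\<rparr>"

definition nilpotent_datum :: "('g, 'k::field) datum \<Rightarrow> bool" where
  "nilpotent_datum D \<longleftrightarrow>
     group (grp D) \<and> finite (carrier (grp D)) \<and>
     elt D \<in> carrier (grp D) \<and>
     (\<forall>h\<in>carrier (grp D). elt D \<otimes>\<^bsub>grp D\<^esub> h = h \<otimes>\<^bsub>grp D\<^esub> elt D) \<and>
     chr D \<in> hom (grp D) mult_group \<and>
     2 \<le> nil_ord D"

text \<open>
  The index \<open>(i, h)\<close> stands for the basis element \<open>y\<^sup>i h\<close>. As \<open>h y = \<chi>(h)\<^sup>-\<^sup>1 y h\<close>, the product
  \<open>(y\<^sup>i h)(y\<^sup>j k)\<close> is \<open>\<chi>(h)\<^sup>-\<^sup>j y\<^sup>i\<^sup>+\<^sup>j h k\<close>, which vanishes for \<open>i + j \<ge> n\<close>.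
\<close>

definition hbasis :: "('g, 'k::field) datum \<Rightarrow> (nat \<times> 'g) set" where
  "hbasis D = {..<nil_ord D} \<times> carrier (grp D)"

definition bprod :: "('g, 'k::field) datum \<Rightarrow> nat \<times> 'g \<Rightarrow> nat \<times> 'g \<Rightarrow> nat \<times> 'g \<Rightarrow> 'k" where
  "bprod D p q = (case (p, q) of ((i, h), (j, k)) \<Rightarrow>
     if i + j < nil_ord D
     then fscale (inverse (chr D h) ^ j) (evec (i + j, h \<otimes>\<^bsub>grp D\<^esub> k)) else 0)"

definition hopf_alg :: "('g, 'k::field) datum \<Rightarrow> (nat \<times> 'g \<Rightarrow> 'k) ring" where
  "hopf_alg D = \<lparr>carrier = fspace (hbasis D), monoid.mult = bilin_ext (hbasis D) (bprod D),
     one = evec (0, \<one>\<^bsub>grp D\<^esub>), ring.zero = 0, ring.add = (+)\<rparr>"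

definition gelt :: "('g, 'k::field) datum \<Rightarrow> 'g \<Rightarrow> nat \<times> 'g \<Rightarrow> 'k" where
  "gelt D h = evec (0, h)"

definition yelt :: "('g, 'k::field) datum \<Rightarrow> nat \<times> 'g \<Rightarrow> 'k" where
  "yelt D = evec (1, \<one>\<^bsub>grp D\<^esub>)"

definition hopf_alg2 :: "('g, 'k::field) datum \<Rightarrow> ((nat \<times> 'g) \<times> (nat \<times> 'g) \<Rightarrow> 'k) ring" where
  \<comment> \<open>the tensor product algebra \<open>H \<otimes> H\<close>\<close>
  "hopf_alg2 D = \<lparr>carrier = fspace (hbasis D \<times> hbasis D),
     monoid.mult = bilin_ext (hbasis D \<times> hbasis D)
       (\<lambda>(p, p') (q, q'). outer (bprod D p q) (bprod D p' q')),
     one = outer \<one>\<^bsub>hopf_alg D\<^esub> \<one>\<^bsub>hopf_alg D\<^esub>, ring.zero = 0, ring.add = (+)\<rparr>"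

definition ycomult :: "('g, 'k::field) datum \<Rightarrow> (nat \<times> 'g) \<times> (nat \<times> 'g) \<Rightarrow> 'k" where
  "ycomult D = outer (yelt D) (gelt D (elt D)) + outer \<one>\<^bsub>hopf_alg D\<^esub> (yelt D)"

text \<open>
  \<open>\<Delta>\<close> is multiplicative and \<open>S\<close> anti-multiplicative, so their values on \<open>y\<^sup>i h\<close> are
  \<open>\<Delta>(y)\<^sup>i (h \<otimes> h)\<close> and \<open>h\<^sup>-\<^sup>1 (- y g\<^sup>-\<^sup>1)\<^sup>i\<close>.
\<close>

definition comult :: "('g, 'k::field) datum \<Rightarrow> (nat \<times> 'g \<Rightarrow> 'k) \<Rightarrow> (nat \<times> 'g) \<times> (nat \<times> 'g) \<Rightarrow> 'k" where
  "comult D = lin_ext (hbasis D)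
     (\<lambda>(i, h). ycomult D [^]\<^bsub>hopf_alg2 D\<^esub> i \<otimes>\<^bsub>hopf_alg2 D\<^esub> outer (gelt D h) (gelt D h))"

definition antipode :: "('g, 'k::field) datum \<Rightarrow> (nat \<times> 'g \<Rightarrow> 'k) \<Rightarrow> nat \<times> 'g \<Rightarrow> 'k" where
  "antipode D = lin_ext (hbasis D)
     (\<lambda>(i, h). gelt D (inv\<^bsub>grp D\<^esub> h) \<otimes>\<^bsub>hopf_alg D\<^esub>
        (- (yelt D \<otimes>\<^bsub>hopf_alg D\<^esub> gelt D (inv\<^bsub>grp D\<^esub> elt D))) [^]\<^bsub>hopf_alg D\<^esub> i)"


section \<open>Modules and representations\<close>

text \<open>
  A module with underlying space \<open>K\<^sup>I\<close>: \<open>act M a\<close> is the matrix by which \<open>a\<close> acts. The operators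
  \<open>a\<close> range over the elements of \<open>H\<close> (modules over \<open>H\<close>) or of \<open>G\<close> (representations of \<open>G\<close>, that
  is, modules over the group algebra). Values of \<open>act M\<close> outside the operator domain are
  irrelevant and ignored by \<open>rep_iso\<close> and \<open>Hom\<close> below.
\<close>

record ('x, 'k, 'i) rep =
  idx :: "'i set"
  act :: "'x \<Rightarrow> 'i \<times> 'i \<Rightarrow> 'k"

definition hmodule :: "('g, 'k::field) datum \<Rightarrow> (nat \<times> 'g \<Rightarrow> 'k, 'k, 'i) rep \<Rightarrow> bool" where
  "hmodule D M \<longleftrightarrow> finite (idx M) \<and>
     act M \<in> ring_hom (hopf_alg D) (mat_ring (idx M)) \<and>
     (\<forall>c. \<forall>a\<in>carrier (hopf_alg D). act M (fscale c a) = fscale c (act M a))"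

definition grep :: "('g, 'k::field) datum \<Rightarrow> ('g, 'k, 'i) rep \<Rightarrow> bool" where
  "grep D U \<longleftrightarrow> finite (idx U) \<and> act U \<in> hom (grp D) (units_of (mat_ring (idx U)))"

definition Hom :: "'x set \<Rightarrow> ('x, 'k::field, 'i) rep \<Rightarrow> ('x, 'k, 'j) rep \<Rightarrow> ('j \<times> 'i \<Rightarrow> 'k) set" where
  "Hom X M N = {T \<in> fspace (idx N \<times> idx M).
     \<forall>a\<in>X. mmul (idx M) T (act M a) = mmul (idx N) (act N a) T}"

definition rep_iso :: "'x set \<Rightarrow> ('x, 'k::field, 'i) rep \<Rightarrow> ('x, 'k, 'j) rep \<Rightarrow> bool" where
  "rep_iso X M N \<longleftrightarrow> (\<exists>P \<in> Hom X M N. \<exists>Q \<in> Hom X N M.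
     mmul (idx N) Q P = idmat (idx M) \<and> mmul (idx M) P Q = idmat (idx N))"

definition simple_grep :: "('g, 'k::field) datum \<Rightarrow> ('g, 'k, 'i) rep \<Rightarrow> bool" where
  "simple_grep D U \<longleftrightarrow> grep D U \<and> idx U \<noteq> {} \<and>
     (\<forall>W. fvs.subspace W \<and> W \<subseteq> fspace (idx U) \<and>
          (\<forall>h\<in>carrier (grp D). \<forall>w\<in>W. mvec (idx U) (act U h) w \<in> W) \<longrightarrow>
          W = {0} \<or> W = fspace (idx U))"

definition char_rep :: "('g \<Rightarrow> 'k::field) \<Rightarrow> ('g, 'k, nat) rep" where
  \<comment> \<open>the one-dimensional representation with a given character\<close>
  "char_rep \<psi> = \<lparr>idx = {0}, act = (\<lambda>h. fscale (\<psi> h) (idmat {0}))\<rparr>"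

definition complete_simples ::
    "('g, 'k::field) datum \<Rightarrow> nat \<Rightarrow> (nat \<Rightarrow> ('g, 'k, nat) rep) \<Rightarrow> bool" where
  "complete_simples D m V \<longleftrightarrow>
     (\<forall>i\<in>{1..m}. simple_grep D (V i)) \<and>
     (\<forall>i\<in>{1..m}. \<forall>j\<in>{1..m}. rep_iso (carrier (grp D)) (V i) (V j) \<longrightarrow> i = j) \<and>
     (\<forall>U :: ('g, 'k, nat) rep. simple_grep D U \<longrightarrow>
        (\<exists>i\<in>{1..m}. rep_iso (carrier (grp D)) U (V i)))"

definition gen_module :: "('g, 'k::field) datum \<Rightarrow> 'i set \<Rightarrow> ('g \<Rightarrow> 'i \<times> 'i \<Rightarrow> 'k) \<Rightarrow> ('i \<times> 'i \<Rightarrow> 'k) \<Rightarrow>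
    (nat \<times> 'g \<Rightarrow> 'k, 'k, 'i) rep" where
  \<comment> \<open>the module in which \<open>h \<in> G\<close> acts by \<open>R h\<close> and \<open>y\<close> acts by \<open>Y\<close>\<close>
  "gen_module D I R Y = \<lparr>idx = I,
     act = lin_ext (hbasis D) (\<lambda>(i, h). Y [^]\<^bsub>mat_ring I\<^esub> i \<otimes>\<^bsub>mat_ring I\<^esub> R h)\<rparr>"

definition inflate :: "('g, 'k::field) datum \<Rightarrow> ('g, 'k, 'i) rep \<Rightarrow> (nat \<times> 'g \<Rightarrow> 'k, 'k, 'i) rep" where
  "inflate D U = gen_module D (idx U) (act U) 0"

definition Mmod :: "('g, 'k::field) datum \<Rightarrow> ('g, 'k, 'i) rep \<Rightarrow> nat \<Rightarrow>
    (nat \<times> 'g \<Rightarrow> 'k, 'k, nat \<times> 'i) rep" where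
  \<comment> \<open>\<open>U \<oplus> xU \<oplus> \<dots> \<oplus> x\<^sup>j\<^sup>-\<^sup>1U\<close>; the index \<open>(k, s)\<close> stands for \<open>x\<^sup>k e\<^sub>s\<close>\<close>
  "Mmod D U j = gen_module D ({..<j} \<times> idx U)
     (\<lambda>h ((k, s), (l, t)). if k = l \<and> k < j then inverse (chr D h) ^ k * act U h (s, t) else 0)
     (\<lambda>((k, s), (l, t)). if k = Suc l \<and> k < j \<and> s = t \<and> s \<in> idx U then 1 else 0)"

definition regular_module :: "('g, 'k::field) datum \<Rightarrow> (nat \<times> 'g \<Rightarrow> 'k, 'k, nat \<times> 'g) rep" where
  "regular_module D = \<lparr>idx = hbasis D,
     act = (\<lambda>a (p, q). if q \<in> hbasis D then (a \<otimes>\<^bsub>hopf_alg D\<^esub> evec q) p else 0)\<rparr>"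

definition sum_module :: "('x, 'k::field, 'i) rep \<Rightarrow> ('x, 'k, 'j) rep \<Rightarrow> ('x, 'k, 'i + 'j) rep" where
  "sum_module M N = \<lparr>idx = Sum_Type.Plus (idx M) (idx N),
     act = (\<lambda>a p. case p of (Inl s, Inl t) \<Rightarrow> act M a (s, t) | (Inr s, Inr t) \<Rightarrow> act N a (s, t)
       | _ \<Rightarrow> 0)\<rparr>"

definition tensor_module :: "('g, 'k::field) datum \<Rightarrow> (nat \<times> 'g \<Rightarrow> 'k, 'k, 'i) rep \<Rightarrow>
    (nat \<times> 'g \<Rightarrow> 'k, 'k, 'j) rep \<Rightarrow> (nat \<times> 'g \<Rightarrow> 'k, 'k, 'i \<times> 'j) rep" where
  "tensor_module D M N = \<lparr>idx = idx M \<times> idx N,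
     act = (\<lambda>a. lin_ext (hbasis D \<times> hbasis D)
       (\<lambda>(p, q) ((s, s'), (t, t')). act M (evec p) (s, t) * act N (evec q) (s', t'))
       (comult D a))\<rparr>"

definition dual_module :: "('g, 'k::field) datum \<Rightarrow> (nat \<times> 'g \<Rightarrow> 'k, 'k, 'i) rep \<Rightarrow>
    (nat \<times> 'g \<Rightarrow> 'k, 'k, 'i) rep" where
  \<comment> \<open>in coordinates with respect to the dual basis; whence the transpose\<close>
  "dual_module D M = \<lparr>idx = idx M, act = (\<lambda>a (s, t). act M (antipode D a) (t, s))\<rparr>"

definition hom_dim :: "('g, 'k::field) datum \<Rightarrow> (nat \<times> 'g \<Rightarrow> 'k, 'k, 'i) rep \<Rightarrow>
    (nat \<times> 'g \<Rightarrow> 'k, 'k, 'j) rep \<Rightarrow> int" where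
  "hom_dim D M N = int (fvs.dim (Hom (carrier (hopf_alg D)) M N))"


section \<open>The Green ring\<close>

text \<open>
  Every finite dimensional module is isomorphic to one whose index set is a finite set of natural
  numbers, so the isomorphism class of a module (with indices of any type) is represented by the
  set of all such modules isomorphic to it.
\<close>

type_synonym ('g, 'k) hmod = "(nat \<times> 'g \<Rightarrow> 'k, 'k, nat) rep"

type_synonym ('g, 'k) green = "(('g, 'k) hmod set \<Rightarrow>\<^sub>0 int) set"

definition iso_class :: "('g, 'k::field) datum \<Rightarrow> (nat \<times> 'g \<Rightarrow> 'k, 'k, 'i) rep \<Rightarrow> ('g, 'k) hmod set" where
  "iso_class D M = {N. hmodule D N \<and> rep_iso (carrier (hopf_alg D)) M N}"

definition iso_classes :: "('g, 'k::field) datum \<Rightarrow> ('g, 'k) hmod set set" where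
  "iso_classes D = iso_class D ` {M :: ('g, 'k) hmod. hmodule D M}"

definition repr :: "'a set \<Rightarrow> 'a" where
  "repr c = (SOME M. M \<in> c)"

definition free_green :: "('g, 'k::field) datum \<Rightarrow> (('g, 'k) hmod set \<Rightarrow>\<^sub>0 int) ring" where
  "free_green D = \<lparr>carrier = carrier (free_Abelian_group (iso_classes D)),
     monoid.mult = (\<lambda>x y. frag_extend (\<lambda>c. frag_extend (\<lambda>d.
       frag_of (iso_class D (tensor_module D (repr c) (repr d)))) y) x),
     one = frag_of (iso_class D (inflate D (char_rep (\<lambda>_. 1)))),
     ring.zero = 0, ring.add = (+)\<rparr>"

definition green_rel :: "('g, 'k::field) datum \<Rightarrow> (('g, 'k) hmod set \<Rightarrow>\<^sub>0 int) set" where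
  "green_rel D = generate (free_Abelian_group (iso_classes D))
     {frag_of (iso_class D (sum_module M N)) - (frag_of (iso_class D M) + frag_of (iso_class D N))
      | (M :: ('g, 'k) hmod) (N :: ('g, 'k) hmod). hmodule D M \<and> hmodule D N}"

definition green_ring :: "('g, 'k::field) datum \<Rightarrow> ('g, 'k) green ring" where
  "green_ring D = free_green D Quot green_rel D"

definition green_class :: "('g, 'k::field) datum \<Rightarrow> (nat \<times> 'g \<Rightarrow> 'k, 'k, 'i) rep \<Rightarrow> ('g, 'k) green" where
  "green_class D M = green_rel D +>\<^bsub>free_green D\<^esub> frag_of (iso_class D M)"

text \<open>
  The automorphism \<open>*\<close>, the form and the dimension are (bi)additive extensions from isomorphism
  classes; on a coset they are given by the value at any element of the coset.
\<close>

definition green_dual :: "('g, 'k::field) datum \<Rightarrow> ('g, 'k) green \<Rightarrow> ('g, 'k) green" where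
  "green_dual D X = (\<Union>x\<in>X. green_rel D +>\<^bsub>free_green D\<^esub>
     frag_extend (\<lambda>c. frag_of (iso_class D (dual_module D (repr c)))) x)"

definition green_form :: "('g, 'k::field) datum \<Rightarrow> ('g, 'k) green \<Rightarrow> ('g, 'k) green \<Rightarrow> int" where
  "green_form D X Y = (THE z. \<forall>x\<in>X. \<forall>y\<in>Y.
     (\<Sum>c\<in>Poly_Mapping.keys x. \<Sum>d\<in>Poly_Mapping.keys y.
        Poly_Mapping.lookup x c * Poly_Mapping.lookup y d
          * hom_dim D (repr c) (dual_module D (repr d))) = z)"

definition green_dim :: "('g, 'k::field) datum \<Rightarrow> ('g, 'k) green \<Rightarrow> int" where
  "green_dim D X = (THE z. \<forall>x\<in>X.
     (\<Sum>c\<in>Poly_Mapping.keys x. Poly_Mapping.lookup x c * int (card (idx (repr c)))) = z)"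

definition Mcls :: "('g, 'k::field) datum \<Rightarrow> (nat \<Rightarrow> ('g, 'k, nat) rep) \<Rightarrow> nat \<Rightarrow> nat \<Rightarrow> ('g, 'k) green" where
  "Mcls D V i j = green_class D (Mmod D (V i) j)"

definition acls :: "('g, 'k::field) datum \<Rightarrow> ('g, 'k) green" where
  "acls D = green_class D (inflate D (char_rep (\<lambda>h. inverse (chr D h))))"

definition delta :: "('g, 'k::field) datum \<Rightarrow> (nat \<Rightarrow> ('g, 'k, nat) rep) \<Rightarrow> nat \<Rightarrow> nat \<Rightarrow> ('g, 'k) green" where
  "delta D V i j =
     (if j < nil_ord D
      then (\<one>\<^bsub>green_ring D\<^esub> \<oplus>\<^bsub>green_ring D\<^esub> acls D \<ominus>\<^bsub>green_ring D\<^esub> Mcls D V 1 2)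
             \<otimes>\<^bsub>green_ring D\<^esub> Mcls D V i j
      else Mcls D V i (nil_ord D)
             \<ominus>\<^bsub>green_ring D\<^esub> acls D \<otimes>\<^bsub>green_ring D\<^esub> Mcls D V i (nil_ord D - 1))"

definition delta_star :: "('g, 'k::field) datum \<Rightarrow> (nat \<Rightarrow> ('g, 'k, nat) rep) \<Rightarrow> nat \<Rightarrow> nat \<Rightarrow> ('g, 'k) green" where
  "delta_star D V i j = green_dual D (delta D V i j)"


section \<open>Bilinear forms on rings that are free of finite rank over the integers\<close>

definition Z_basis :: "('r, 'm) ring_scheme \<Rightarrow> 's set \<Rightarrow> ('s \<Rightarrow> 'r) \<Rightarrow> bool" where
  "Z_basis R S b \<longleftrightarrow> finite S \<and> b \<in> S \<rightarrow> carrier R \<and>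
     (\<forall>x\<in>carrier R. \<exists>!f :: 's \<Rightarrow> int. f \<in> extensional S \<and> x = (\<Oplus>\<^bsub>R\<^esub>s\<in>S. [f s] \<cdot>\<^bsub>R\<^esub> b s))"

definition has_Z_rank :: "('r, 'm) ring_scheme \<Rightarrow> 'r set \<Rightarrow> nat \<Rightarrow> bool" where
  \<comment> \<open>the subgroup \<open>A\<close> of the additive group of \<open>R\<close> is free of rank \<open>r\<close>\<close>
  "has_Z_rank R A r \<longleftrightarrow> (\<exists>b. Z_basis (R\<lparr>carrier := A\<rparr>) {..<r} b)"

definition dual_pair ::
    "('r, 'm) ring_scheme \<Rightarrow> ('r \<Rightarrow> 'r \<Rightarrow> int) \<Rightarrow> 's set \<Rightarrow> ('s \<Rightarrow> 'r) \<Rightarrow> ('s \<Rightarrow> 'r) \<Rightarrow> bool" where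
  "dual_pair R \<beta> S b c \<longleftrightarrow> Z_basis R S b \<and> Z_basis R S c \<and>
     (\<forall>s\<in>S. \<forall>t\<in>S. \<beta> (b s) (c t) = (if s = t then 1 else 0))"

definition frobenius_hom ::
    "('r, 'm) ring_scheme \<Rightarrow> ('r \<Rightarrow> 'r \<Rightarrow> int) \<Rightarrow> ('r \<Rightarrow> int) \<Rightarrow> bool" where
  "frobenius_hom R \<beta> \<phi> \<longleftrightarrow>
     (\<forall>x\<in>carrier R. \<forall>y\<in>carrier R. \<phi> (x \<oplus>\<^bsub>R\<^esub> y) = \<phi> x + \<phi> y) \<and>
     (\<forall>x\<in>carrier R. \<forall>y\<in>carrier R. \<beta> x y = \<phi> (x \<otimes>\<^bsub>R\<^esub> y))"

definition tensor_rel :: "('r, 'm) ring_scheme \<Rightarrow> ('r \<times> 'r \<Rightarrow>\<^sub>0 int) set" where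
  "tensor_rel R = generate (free_Abelian_group (carrier R \<times> carrier R))
     ({frag_of (x \<oplus>\<^bsub>R\<^esub> y, z) - (frag_of (x, z) + frag_of (y, z))
        | x y z. x \<in> carrier R \<and> y \<in> carrier R \<and> z \<in> carrier R} \<union>
      {frag_of (z, x \<oplus>\<^bsub>R\<^esub> y) - (frag_of (z, x) + frag_of (z, y))
        | x y z. x \<in> carrier R \<and> y \<in> carrier R \<and> z \<in> carrier R})"

definition tensor_square :: "('r, 'm) ring_scheme \<Rightarrow> ('r \<times> 'r \<Rightarrow>\<^sub>0 int) set monoid" where
  \<comment> \<open>the additive group \<open>R \<otimes> R\<close> over the integers, in the multiplicative notation of \<open>Mod\<close>\<close>
  "tensor_square R = free_Abelian_group (carrier R \<times> carrier R) Mod tensor_rel R"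

definition tensor :: "('r, 'm) ring_scheme \<Rightarrow> 'r \<Rightarrow> 'r \<Rightarrow> ('r \<times> 'r \<Rightarrow>\<^sub>0 int) set" where
  "tensor R x y = tensor_rel R #>\<^bsub>free_Abelian_group (carrier R \<times> carrier R)\<^esub> frag_of (x, y)"

definition casimir_element ::
    "('r, 'm) ring_scheme \<Rightarrow> ('r \<Rightarrow> 'r \<Rightarrow> int) \<Rightarrow> ('r \<times> 'r \<Rightarrow>\<^sub>0 int) set" where
  "casimir_element R \<beta> = (THE z. \<exists>(N :: nat) b c. dual_pair R \<beta> {..<N} b c \<and>
     z = (\<Otimes>\<^bsub>tensor_square R\<^esub>s\<in>{..<N}. tensor R (c s) (b s)))"

definition integrals :: "('r, 'm) ring_scheme \<Rightarrow> ('r \<Rightarrow> int) \<Rightarrow> 'r set" where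
  "integrals R \<epsilon> = {b \<in> carrier R. \<forall>x\<in>carrier R. b \<otimes>\<^bsub>R\<^esub> x = [\<epsilon> x] \<cdot>\<^bsub>R\<^esub> b}"


section \<open>The presentation of the Hopf algebra\<close>

text \<open>
  The lemmas below confirm that \<open>hopf_alg D\<close> is the algebra presented by \<open>y\<close> and \<open>G\<close> with the
  relations \<open>y\<^sup>n = 0\<close> and \<open>y h = \<chi>(h) h y\<close>, with \<open>y\<^sup>i h\<close> (\<open>i < n\<close>) as basis, and that \<open>\<Delta>\<close> and \<open>S\<close> take
  the prescribed values on the generators. By \<open>hmodule_gen_module\<close>, matrices satisfying the
  relations define an \<open>H\<close>-module.
\<close>

lemma sum_fun_app: "(\<Sum>x\<in>X. f x) i = (\<Sum>x\<in>X. f x i)"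
  by (induction X rule: infinite_finite_induct) auto

lemma lin_ext_evec: "finite B \<Longrightarrow> p \<in> B \<Longrightarrow> lin_ext B m (evec p) = m p"
  unfolding lin_ext_def evec_def
  by (subst sum.remove[of _ p]) (auto intro!: sum.neutral)

lemma bilin_ext_evec: "finite B \<Longrightarrow> p \<in> B \<Longrightarrow> q \<in> B \<Longrightarrow> bilin_ext B m (evec p) (evec q) = m p q"
  unfolding bilin_ext_def
  by (subst sum.remove[of _ p], simp, simp, subst sum.remove[of _ q])
    (auto simp: evec_def intro!: sum.neutral)

lemma bilin_ext_add_left: "bilin_ext B m (a + b) c = bilin_ext B m a c + bilin_ext B m b c"
  by (simp add: bilin_ext_def fvs.scale_left_distrib sum.distrib distrib_right)

lemma bilin_ext_add_right: "bilin_ext B m c (a + b) = bilin_ext B m c a + bilin_ext B m c b"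
  by (simp add: bilin_ext_def fvs.scale_left_distrib sum.distrib distrib_left)

lemma bilin_ext_scale_left: "bilin_ext B m (fscale s a) c = fscale s (bilin_ext B m a c)"
  by (auto simp add: bilin_ext_def fun_eq_iff sum_fun_app fscale_def sum_distrib_left mult_ac intro!: sum.cong)

lemma bilin_ext_scale_right: "bilin_ext B m c (fscale s a) = fscale s (bilin_ext B m c a)"
  by (auto simp add: bilin_ext_def fun_eq_iff sum_fun_app fscale_def sum_distrib_left mult_ac intro!: sum.cong)

lemma bilin_ext_zero: "bilin_ext B m 0 c = 0" "bilin_ext B m c 0 = 0"
  by (simp_all add: bilin_ext_def)

lemma bilin_ext_sum_left: "bilin_ext B m (\<Sum>x\<in>X. f x) c = (\<Sum>x\<in>X. bilin_ext B m (f x) c)"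
  by (induction X rule: infinite_finite_induct) (simp_all only: sum.infinite sum.empty sum.insert bilin_ext_zero bilin_ext_add_left not_False_eq_True)

lemma bilin_ext_sum_right: "bilin_ext B m c (\<Sum>x\<in>X. f x) = (\<Sum>x\<in>X. bilin_ext B m c (f x))"
  by (induction X rule: infinite_finite_induct) (simp_all only: sum.infinite sum.empty sum.insert bilin_ext_zero bilin_ext_add_right not_False_eq_True)

lemma fspace_expand:
  assumes "finite B" "a \<in> fspace B"
  shows "a = (\<Sum>p\<in>B. fscale (a p) (evec p))"
proof
  fix x
  have "(\<Sum>p\<in>B. fscale (a p) (evec p)) x = (\<Sum>p\<in>B. if x = p then a x else 0)"
    unfolding sum_fun_app by (auto simp: fscale_def evec_def intro!: sum.cong)
  then show "a x = (\<Sum>p\<in>B. fscale (a p) (evec p)) x"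
    using assms by (auto simp: fspace_def)
qed

lemma fspace_sum: "(\<And>x. x \<in> X \<Longrightarrow> f x \<in> fspace B) \<Longrightarrow> (\<Sum>x\<in>X. f x) \<in> fspace B"
  by (auto simp: fspace_def sum_fun_app)

lemma fspace_scale: "f \<in> fspace B \<Longrightarrow> fscale s f \<in> fspace B"
  by (auto simp: fspace_def fscale_def)

lemma bilin_ext_closed:
  "(\<And>p q. p \<in> B \<Longrightarrow> q \<in> B \<Longrightarrow> m p q \<in> fspace B) \<Longrightarrow> bilin_ext B m a b \<in> fspace B"
  unfolding bilin_ext_def by (intro fspace_sum fspace_scale)

lemma bilin_ext_assoc:
  assumes B: "finite B"
    and assoc: "\<And>p q r. \<lbrakk>p \<in> B; q \<in> B; r \<in> B\<rbrakk> \<Longrightarrow>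
      bilin_ext B m (m p q) (evec r) = bilin_ext B m (evec p) (m q r)"
    and a: "a \<in> fspace B" "b \<in> fspace B" "c \<in> fspace B"
  shows "bilin_ext B m (bilin_ext B m a b) c = bilin_ext B m a (bilin_ext B m b c)"
proof -
  have e: "bilin_ext B m (bilin_ext B m (evec p) (evec q)) (evec r)
         = bilin_ext B m (evec p) (bilin_ext B m (evec q) (evec r))"
    if "p \<in> B" "q \<in> B" "r \<in> B" for p q r
    using that assoc B by (simp add: bilin_ext_evec)
  have 1: "bilin_ext B m (bilin_ext B m (evec p) (evec q)) c
         = bilin_ext B m (evec p) (bilin_ext B m (evec q) c)" if "p \<in> B" "q \<in> B" for p q
    by (subst (1 2) fspace_expand[OF B a(3)])
      (simp add: bilin_ext_sum_right bilin_ext_scale_right e that)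
  have 2: "bilin_ext B m (bilin_ext B m (evec p) b) c
         = bilin_ext B m (evec p) (bilin_ext B m b c)" if "p \<in> B" for p
    by (subst (1 2) fspace_expand[OF B a(2)])
      (simp add: bilin_ext_sum_right bilin_ext_scale_right
        bilin_ext_sum_left bilin_ext_scale_left 1 that)
  show ?thesis
    by (subst (1 2) fspace_expand[OF B a(1)])
      (simp add: bilin_ext_sum_left bilin_ext_scale_left 2)
qed

lemma mmul_closed: "A \<in> fspace (I \<times> J) \<Longrightarrow> B \<in> fspace (J \<times> L) \<Longrightarrow> mmul J A B \<in> fspace (I \<times> L)"
  by (auto simp: fspace_def mmul_def intro!: sum.neutral)

lemma mmul_assoc: "finite I \<Longrightarrow> finite J \<Longrightarrow> mmul J (mmul I A B) C = mmul I A (mmul J B C)"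
  unfolding mmul_def
  by (auto simp: fun_eq_iff sum_distrib_left sum_distrib_right mult.assoc intro: sum.swap)

lemma ring_mat_ring: "finite I \<Longrightarrow> ring (mat_ring I)"
proof (rule ringI)
  assume I: "finite I"
  show "abelian_group (mat_ring I)"
  proof (rule abelian_groupI)
    fix x assume "x \<in> carrier (mat_ring I)"
    then show "\<exists>y\<in>carrier (mat_ring I). y \<oplus>\<^bsub>mat_ring I\<^esub> x = \<zero>\<^bsub>mat_ring I\<^esub>"
      by (intro bexI[of _ "- x"]) (auto simp: mat_ring_def fspace_def)
  qed (auto simp: mat_ring_def fspace_def add_ac)
  show "monoid (mat_ring I)"
  proof
    fix x assume "x \<in> carrier (mat_ring I)"
    then have x: "x \<in> fspace (I \<times> I)" by (simp add: mat_ring_def)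
    have "(\<Sum>j\<in>I. (if i = j \<and> i \<in> I then 1 else 0) * x (j, l)) = x (i, l)" for i l
      using x I by (cases "i \<in> I") (auto simp: fspace_def if_distrib if_distribR cong: if_cong)
    then show "\<one>\<^bsub>mat_ring I\<^esub> \<otimes>\<^bsub>mat_ring I\<^esub> x = x"
      by (simp add: mat_ring_def mmul_def idmat_def fun_eq_iff)
    have "(\<Sum>j\<in>I. x (i, j) * (if j = l \<and> j \<in> I then 1 else 0)) = x (i, l)" for i l
    proof (cases "l \<in> I")
      case True
      have "(\<Sum>j\<in>I. x (i, j) * (if j = l \<and> j \<in> I then 1 else 0)) = (\<Sum>j\<in>I. if j = l then x (i, l) else 0)"
        by (intro sum.cong) auto
      then show ?thesis using True I by simp
    qed (use x in \<open>auto simp: fspace_def intro!: sum.neutral\<close>)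
    then show "x \<otimes>\<^bsub>mat_ring I\<^esub> \<one>\<^bsub>mat_ring I\<^esub> = x"
      by (simp add: mat_ring_def mmul_def idmat_def fun_eq_iff)
  qed (use I in \<open>auto simp: mat_ring_def intro: mmul_closed mmul_assoc\<close>, auto simp: fspace_def idmat_def)
qed (auto simp: mat_ring_def mmul_def fun_eq_iff distrib_left distrib_right sum.distrib)

lemma mmul_scale: "mmul J (fscale c A) B = fscale c (mmul J A B)" "mmul J A (fscale c B) = fscale c (mmul J A B)"
  by (auto simp: mmul_def fscale_def fun_eq_iff sum_distrib_left mult_ac intro!: sum.cong)

lemma mmul_sum:
  "mmul J (\<Sum>x\<in>X. f x) B = (\<Sum>x\<in>X. mmul J (f x) B)" "mmul J A (\<Sum>x\<in>X. f x) = (\<Sum>x\<in>X. mmul J A (f x))"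
  by (auto simp: mmul_def fun_eq_iff sum_fun_app sum_distrib_left sum_distrib_right intro: sum.swap)

lemma lin_ext_sum: "lin_ext B m (\<Sum>x\<in>X. f x) = (\<Sum>x\<in>X. lin_ext B m (f x))"
  by (auto simp: lin_ext_def fun_eq_iff sum_fun_app fscale_def sum_distrib_right intro: sum.swap)

lemma lin_ext_scale: "lin_ext B m (fscale c a) = fscale c (lin_ext B m a)"
  by (simp add: lin_ext_def fscale_def fun_eq_iff sum_fun_app sum_distrib_left mult_ac)

lemma lin_ext_zero: "lin_ext B m 0 = 0"
  by (simp add: lin_ext_def)

context
  fixes D :: "('g, 'k::field) datum"
  assumes D: "nilpotent_datum D"
begin

interpretation G: group "grp D" using D by (simp add: nilpotent_datum_def)

lemma chr_mult: "h \<in> carrier (grp D) \<Longrightarrow> k \<in> carrier (grp D) \<Longrightarrow> chr D (h \<otimes>\<^bsub>grp D\<^esub> k) = chr D h * chr D k"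
  and chr_nz: "h \<in> carrier (grp D) \<Longrightarrow> chr D h \<noteq> 0"
  using D by (auto simp: nilpotent_datum_def hom_def mult_group_def Pi_def)

lemma chr_one: "chr D \<one>\<^bsub>grp D\<^esub> = 1"
  using chr_mult[of "\<one>\<^bsub>grp D\<^esub>" "\<one>\<^bsub>grp D\<^esub>"] chr_nz[of "\<one>\<^bsub>grp D\<^esub>"] by simp

lemma finite_hbasis: "finite (hbasis D)"
  using D by (simp add: hbasis_def nilpotent_datum_def)

lemma bprod_closed: "p \<in> hbasis D \<Longrightarrow> q \<in> hbasis D \<Longrightarrow> bprod D p q \<in> fspace (hbasis D)"
  by (auto simp: bprod_def hbasis_def fspace_def fscale_def evec_def)

lemma bprod_assoc:
  assumes "p \<in> hbasis D" "q \<in> hbasis D" "r \<in> hbasis D"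
  shows "bilin_ext (hbasis D) (bprod D) (bprod D p q) (evec r)
       = bilin_ext (hbasis D) (bprod D) (evec p) (bprod D q r)"
proof -
  obtain i h j k l u where pqr: "p = (i, h)" "q = (j, k)" "r = (l, u)"
    by (cases p, cases q, cases r)
  have c: "h \<in> carrier (grp D)" "k \<in> carrier (grp D)" "u \<in> carrier (grp D)"
    using assms by (auto simp: pqr hbasis_def)
  have L: "bilin_ext (hbasis D) (bprod D) (bprod D p q) (evec r) = (if i + j + l < nil_ord D
     then fscale (inverse (chr D h) ^ j * inverse (chr D h * chr D k) ^ l)
       (evec (i + j + l, h \<otimes>\<^bsub>grp D\<^esub> k \<otimes>\<^bsub>grp D\<^esub> u)) else 0)"
  proof (cases "i + j < nil_ord D")
    case True
    then have "(i + j, h \<otimes>\<^bsub>grp D\<^esub> k) \<in> hbasis D" using c by (simp add: hbasis_def)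
    then show ?thesis using True assms(3) c
      by (simp add: pqr bprod_def[of D "(i,h)"] bilin_ext_scale_left bilin_ext_evec finite_hbasis)
        (simp add: bprod_def chr_mult)
  next
    case False
    then show ?thesis by (simp add: pqr bprod_def bilin_ext_zero)
  qed
  have R: "bilin_ext (hbasis D) (bprod D) (evec p) (bprod D q r) = (if i + j + l < nil_ord D
     then fscale (inverse (chr D k) ^ l * inverse (chr D h) ^ (j + l))
       (evec (i + j + l, h \<otimes>\<^bsub>grp D\<^esub> k \<otimes>\<^bsub>grp D\<^esub> u)) else 0)"
  proof (cases "j + l < nil_ord D")
    case True
    then have "(j + l, k \<otimes>\<^bsub>grp D\<^esub> u) \<in> hbasis D" using c by (simp add: hbasis_def)
    then show ?thesis using True assms(1) c
      by (simp add: pqr bprod_def[of D "(j,k)"] bilin_ext_scale_right bilin_ext_evec finite_hbasis)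
        (simp add: bprod_def G.m_assoc add.assoc)
  next
    case False
    then show ?thesis by (simp add: pqr bprod_def bilin_ext_zero)
  qed
  show ?thesis unfolding L R
    by (simp add: power_add power_mult_distrib inverse_mult_distrib mult_ac)
qed

lemma hbasis_one: "(0, \<one>\<^bsub>grp D\<^esub>) \<in> hbasis D"
  and hbasis_y: "(1, \<one>\<^bsub>grp D\<^esub>) \<in> hbasis D"
  and hbasis_g: "h \<in> carrier (grp D) \<Longrightarrow> (0, h) \<in> hbasis D"
  using D by (auto simp: hbasis_def nilpotent_datum_def)

lemma hopf_sel:
  "carrier (hopf_alg D) = fspace (hbasis D)"
  "a \<otimes>\<^bsub>hopf_alg D\<^esub> b = bilin_ext (hbasis D) (bprod D) a b"
  "\<one>\<^bsub>hopf_alg D\<^esub> = evec (0, \<one>\<^bsub>grp D\<^esub>)"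
  "\<zero>\<^bsub>hopf_alg D\<^esub> = 0"
  "a \<oplus>\<^bsub>hopf_alg D\<^esub> b = a + b"
  by (simp_all add: hopf_alg_def)

lemma hopf_ring: "ring (hopf_alg D)"
proof (rule ringI)
  show "abelian_group (hopf_alg D)"
  proof (rule abelian_groupI)
    fix x assume "x \<in> carrier (hopf_alg D)"
    then show "\<exists>y\<in>carrier (hopf_alg D). y \<oplus>\<^bsub>hopf_alg D\<^esub> x = \<zero>\<^bsub>hopf_alg D\<^esub>"
      by (intro bexI[of _ "- x"]) (auto simp: hopf_alg_def fspace_def)
  qed (auto simp: hopf_alg_def fspace_def add_ac)
  show "monoid (hopf_alg D)"
  proof
    fix x assume "x \<in> carrier (hopf_alg D)"
    then have x: "x \<in> fspace (hbasis D)" by (simp add: hopf_alg_def)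
    have l: "bprod D (0, \<one>\<^bsub>grp D\<^esub>) q = evec q" and r: "bprod D q (0, \<one>\<^bsub>grp D\<^esub>) = evec q"
      if "q \<in> hbasis D" for q
      using that by (auto simp: bprod_def hbasis_def chr_one)
    show "\<one>\<^bsub>hopf_alg D\<^esub> \<otimes>\<^bsub>hopf_alg D\<^esub> x = x"
      unfolding hopf_sel
      by (subst (1 2) fspace_expand[OF finite_hbasis x])
        (simp add: bilin_ext_sum_right bilin_ext_scale_right bilin_ext_evec finite_hbasis hbasis_one l)
    show "x \<otimes>\<^bsub>hopf_alg D\<^esub> \<one>\<^bsub>hopf_alg D\<^esub> = x"
      unfolding hopf_sel
      by (subst (1 2) fspace_expand[OF finite_hbasis x])
        (simp add: bilin_ext_sum_left bilin_ext_scale_left bilin_ext_evec finite_hbasis hbasis_one r)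
  next
    show "\<one>\<^bsub>hopf_alg D\<^esub> \<in> carrier (hopf_alg D)"
      using hbasis_one by (auto simp: hopf_alg_def fspace_def evec_def)
  qed (auto simp: hopf_alg_def bprod_closed intro!: bilin_ext_closed bilin_ext_assoc bprod_assoc finite_hbasis)
qed (auto simp: hopf_alg_def bilin_ext_add_left bilin_ext_add_right)

lemma y_power_gelt:
  assumes "h \<in> carrier (grp D)"
  shows "yelt D [^]\<^bsub>hopf_alg D\<^esub> i \<otimes>\<^bsub>hopf_alg D\<^esub> gelt D h = (if i < nil_ord D then evec (i, h) else 0)"
proof -
  interpret R: ring "hopf_alg D" by (rule hopf_ring)
  have *: "yelt D [^]\<^bsub>hopf_alg D\<^esub> i = (if i < nil_ord D then evec (i, \<one>\<^bsub>grp D\<^esub>) else 0)"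
  proof (induction i)
    case 0
    then show ?case using D by (simp add: hopf_alg_def nilpotent_datum_def)
  next
    case (Suc i)
    have "evec (i, \<one>\<^bsub>grp D\<^esub>) \<otimes>\<^bsub>hopf_alg D\<^esub> yelt D
      = (if Suc i < nil_ord D then evec (Suc i, \<one>\<^bsub>grp D\<^esub>) else 0)" if "i < nil_ord D"
    proof -
      have "(i, \<one>\<^bsub>grp D\<^esub>) \<in> hbasis D" using that by (simp add: hbasis_def)
      then show ?thesis unfolding hopf_sel yelt_def
        by (subst bilin_ext_evec[OF finite_hbasis _ hbasis_y]) (auto simp: bprod_def chr_one)
    qed
    moreover have "0 \<otimes>\<^bsub>hopf_alg D\<^esub> yelt D = 0"
      by (simp add: hopf_alg_def bilin_ext_zero)
    ultimately show ?case using Suc by auto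
  qed
  show ?thesis
  proof (cases "i < nil_ord D")
    case True
    then have "(i, \<one>\<^bsub>grp D\<^esub>) \<in> hbasis D" by (simp add: hbasis_def)
    then show ?thesis using True assms unfolding * hopf_sel gelt_def
      by (simp add: bilin_ext_evec[OF finite_hbasis _ hbasis_g]) (simp add: bprod_def)
  qed (simp add: * hopf_sel bilin_ext_zero)
qed

lemma y_nilpotent: "yelt D [^]\<^bsub>hopf_alg D\<^esub> nil_ord D = \<zero>\<^bsub>hopf_alg D\<^esub>"
proof -
  interpret R: ring "hopf_alg D" by (rule hopf_ring)
  have "yelt D \<in> carrier (hopf_alg D)"
    using hbasis_y by (auto simp: hopf_alg_def yelt_def fspace_def evec_def)
  moreover have "gelt D \<one>\<^bsub>grp D\<^esub> = \<one>\<^bsub>hopf_alg D\<^esub>" by (simp add: gelt_def hopf_alg_def)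
  ultimately show ?thesis using y_power_gelt[of "\<one>\<^bsub>grp D\<^esub>" "nil_ord D"]
    by (simp add: hopf_sel(4))
qed

lemma y_gelt:
  "h \<in> carrier (grp D) \<Longrightarrow>
   yelt D \<otimes>\<^bsub>hopf_alg D\<^esub> gelt D h = fscale (chr D h) (gelt D h \<otimes>\<^bsub>hopf_alg D\<^esub> yelt D)"
  using hbasis_y hbasis_g[of h]
  by (simp add: hopf_alg_def gelt_def yelt_def bilin_ext_evec[OF finite_hbasis])
    (auto simp: bprod_def hbasis_def chr_nz)

lemma gelt_mult:
  "h \<in> carrier (grp D) \<Longrightarrow> k \<in> carrier (grp D) \<Longrightarrow>
   gelt D h \<otimes>\<^bsub>hopf_alg D\<^esub> gelt D k = gelt D (h \<otimes>\<^bsub>grp D\<^esub> k)"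
  using hbasis_g[of h] hbasis_g[of k]
  by (simp add: hopf_alg_def gelt_def bilin_ext_evec[OF finite_hbasis])
    (auto simp: bprod_def hbasis_def)

lemma outer_evec: "outer (evec p) (evec q) = evec (p, q)"
  by (auto simp: outer_def evec_def fun_eq_iff)

lemma outer_mult:
  assumes "p \<in> hbasis D" "q \<in> hbasis D" "p' \<in> hbasis D" "q' \<in> hbasis D"
  shows "evec (p, p') \<otimes>\<^bsub>hopf_alg2 D\<^esub> evec (q, q') = outer (bprod D p q) (bprod D p' q')"
  using assms finite_hbasis by (simp add: hopf_alg2_def bilin_ext_evec)

lemma comult_gelt:
  assumes h: "h \<in> carrier (grp D)"
  shows "comult D (gelt D h) = outer (gelt D h) (gelt D h)"
proof -
  have "comult D (gelt D h) = evec ((0, \<one>\<^bsub>grp D\<^esub>), (0, \<one>\<^bsub>grp D\<^esub>)) \<otimes>\<^bsub>hopf_alg2 D\<^esub> evec ((0, h), (0, h))"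
    unfolding comult_def gelt_def lin_ext_evec[OF finite_hbasis hbasis_g[OF h]]
    by (simp add: outer_evec) (simp add: hopf_alg2_def hopf_sel outer_evec)
  then show ?thesis using D h
    by (simp add: outer_mult hbasis_g[OF h] hbasis_one)
      (simp add: h bprod_def gelt_def hbasis_def nilpotent_datum_def chr_one)
qed

lemma antipode_gelt:
  assumes h: "h \<in> carrier (grp D)"
  shows "antipode D (gelt D h) = gelt D (inv\<^bsub>grp D\<^esub> h)"
proof -
  interpret R: ring "hopf_alg D" by (rule hopf_ring)
  have "gelt D (inv\<^bsub>grp D\<^esub> h) \<in> carrier (hopf_alg D)"
    using hbasis_g[of "inv\<^bsub>grp D\<^esub> h"] h by (auto simp: hopf_sel gelt_def fspace_def evec_def)
  then show ?thesis
    unfolding antipode_def gelt_def[of D h] lin_ext_evec[OF finite_hbasis hbasis_g[OF h]] by simp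
qed

lemma antipode_y: "antipode D (yelt D) = - (yelt D \<otimes>\<^bsub>hopf_alg D\<^esub> gelt D (inv\<^bsub>grp D\<^esub> elt D))"
proof -
  interpret R: ring "hopf_alg D" by (rule hopf_ring)
  let ?z = "- (yelt D \<otimes>\<^bsub>hopf_alg D\<^esub> gelt D (inv\<^bsub>grp D\<^esub> elt D))"
  have "?z \<in> carrier (hopf_alg D)"
    using bilin_ext_closed[of "hbasis D" "bprod D"] bprod_closed by (auto simp: hopf_sel fspace_def)
  moreover have "gelt D (inv\<^bsub>grp D\<^esub> \<one>\<^bsub>grp D\<^esub>) = \<one>\<^bsub>hopf_alg D\<^esub>"
    by (simp add: gelt_def hopf_sel)
  ultimately show ?thesis
    unfolding antipode_def yelt_def[of D] lin_ext_evec[OF finite_hbasis hbasis_y] by (simp add: yelt_def)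
qed

lemma comult_y: "comult D (yelt D) = outer (yelt D) (gelt D (elt D)) + outer \<one>\<^bsub>hopf_alg D\<^esub> (yelt D)"
proof -
  have g: "elt D \<in> carrier (grp D)" using D by (simp add: nilpotent_datum_def)
  let ?o = "(0, \<one>\<^bsub>grp D\<^esub>)" and ?y = "(1, \<one>\<^bsub>grp D\<^esub>)"
  have r: "bprod D q ?o = evec q" and l: "bprod D ?o q = evec q" if "q \<in> hbasis D" for q
    using that by (auto simp: bprod_def hbasis_def chr_one)
  have c: "evec (?o, ?o) \<otimes>\<^bsub>hopf_alg2 D\<^esub> evec (p, q) = evec (p, q)"
    "evec (p, q) \<otimes>\<^bsub>hopf_alg2 D\<^esub> evec (?o, ?o) = evec (p, q)"
    if "p \<in> hbasis D" "q \<in> hbasis D" for p q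
    using that by (simp_all add: outer_mult hbasis_one r l outer_evec)
  have add: "(a + b) \<otimes>\<^bsub>hopf_alg2 D\<^esub> e = a \<otimes>\<^bsub>hopf_alg2 D\<^esub> e + b \<otimes>\<^bsub>hopf_alg2 D\<^esub> e"
    "e \<otimes>\<^bsub>hopf_alg2 D\<^esub> (a + b) = e \<otimes>\<^bsub>hopf_alg2 D\<^esub> a + e \<otimes>\<^bsub>hopf_alg2 D\<^esub> b" for a b e
    by (simp_all add: hopf_alg2_def bilin_ext_add_left bilin_ext_add_right)
  have y: "ycomult D = evec (?y, (0, elt D)) + evec (?o, ?y)"
    by (simp add: ycomult_def yelt_def gelt_def hopf_sel outer_evec)
  have one: "\<one>\<^bsub>hopf_alg2 D\<^esub> = evec (?o, ?o)"
    by (simp add: hopf_alg2_def hopf_sel outer_evec)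
  have "comult D (yelt D) =
      (evec (?o, ?o) \<otimes>\<^bsub>hopf_alg2 D\<^esub> ycomult D) \<otimes>\<^bsub>hopf_alg2 D\<^esub> evec (?o, ?o)"
    unfolding comult_def yelt_def lin_ext_evec[OF finite_hbasis hbasis_y]
    by (simp add: gelt_def outer_evec nat_pow_def one)
  also have "\<dots> = ycomult D"
    unfolding y add using c hbasis_one hbasis_y hbasis_g[OF g] by simp
  finally show ?thesis by (simp add: ycomult_def)
qed


lemma hmodule_gen_module:
  fixes I :: "'i set"
  assumes I: "finite I" and R: "R \<in> hom (grp D) (units_of (mat_ring I))"
    and Y: "Y \<in> carrier (mat_ring I)" "Y [^]\<^bsub>mat_ring I\<^esub> nil_ord D = \<zero>\<^bsub>mat_ring I\<^esub>"
    and YR: "\<And>h. h \<in> carrier (grp D) \<Longrightarrow>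
      Y \<otimes>\<^bsub>mat_ring I\<^esub> R h = fscale (chr D h) (R h \<otimes>\<^bsub>mat_ring I\<^esub> Y)"
  shows "hmodule D (gen_module D I R Y)"
proof -
  interpret M: ring "mat_ring I" using I by (rule ring_mat_ring)
  let ?b = "\<lambda>(i::nat, h). Y [^]\<^bsub>mat_ring I\<^esub> i \<otimes>\<^bsub>mat_ring I\<^esub> R h"
  have Rc: "R h \<in> Units (mat_ring I)" if "h \<in> carrier (grp D)" for h
    using R that by (auto simp: hom_def units_of_def)
  have Rc': "R h \<in> carrier (mat_ring I)" if "h \<in> carrier (grp D)" for h
    using Rc[OF that] by (rule M.Units_closed)
  have Rm: "R (h \<otimes>\<^bsub>grp D\<^esub> k) = R h \<otimes>\<^bsub>mat_ring I\<^esub> R k" if "h \<in> carrier (grp D)" "k \<in> carrier (grp D)" for h k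
    using R that by (auto simp: hom_def units_of_def)
  have R1: "R \<one>\<^bsub>grp D\<^esub> = \<one>\<^bsub>mat_ring I\<^esub>"
    using hom_one[OF R G.is_group M.units_group] by (simp add: units_of_def)
  have sc: "fscale c A \<otimes>\<^bsub>mat_ring I\<^esub> B = fscale c (A \<otimes>\<^bsub>mat_ring I\<^esub> B)"
    "A \<otimes>\<^bsub>mat_ring I\<^esub> fscale c B = fscale c (A \<otimes>\<^bsub>mat_ring I\<^esub> B)"
    "A \<in> carrier (mat_ring I) \<Longrightarrow> fscale c A \<in> carrier (mat_ring I)" for c A B
    by (simp_all add: mat_ring_def mmul_scale fspace_scale)
  have RY: "R h \<otimes>\<^bsub>mat_ring I\<^esub> Y [^]\<^bsub>mat_ring I\<^esub> j = fscale (inverse (chr D h) ^ j) (Y [^]\<^bsub>mat_ring I\<^esub> j \<otimes>\<^bsub>mat_ring I\<^esub> R h)"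
    if h: "h \<in> carrier (grp D)" for h and j :: nat
  proof (induction j)
    case 0
    then show ?case using Rc'[OF h] by simp
  next
    case (Suc j)
    have e: "R h \<otimes>\<^bsub>mat_ring I\<^esub> Y = fscale (inverse (chr D h)) (Y \<otimes>\<^bsub>mat_ring I\<^esub> R h)"
      using YR[OF h] chr_nz[OF h] by simp
    have "R h \<otimes>\<^bsub>mat_ring I\<^esub> Y [^]\<^bsub>mat_ring I\<^esub> Suc j = (R h \<otimes>\<^bsub>mat_ring I\<^esub> Y [^]\<^bsub>mat_ring I\<^esub> j) \<otimes>\<^bsub>mat_ring I\<^esub> Y"
      using Rc'[OF h] Y by (simp add: M.m_assoc)
    also have "\<dots> = fscale (inverse (chr D h) ^ j) (Y [^]\<^bsub>mat_ring I\<^esub> j \<otimes>\<^bsub>mat_ring I\<^esub> (R h \<otimes>\<^bsub>mat_ring I\<^esub> Y))"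
      using Rc'[OF h] Y by (simp add: Suc sc M.m_assoc)
    also have "\<dots> = fscale (inverse (chr D h) ^ Suc j) (Y [^]\<^bsub>mat_ring I\<^esub> Suc j \<otimes>\<^bsub>mat_ring I\<^esub> R h)"
      using Rc'[OF h] Y by (simp add: e sc M.m_assoc mult.commute)
    finally show ?case .
  qed
  have Ynil: "Y [^]\<^bsub>mat_ring I\<^esub> k = \<zero>\<^bsub>mat_ring I\<^esub>" if "nil_ord D \<le> k" for k :: nat
    using Y M.nat_pow_mult[of Y "nil_ord D" "k - nil_ord D"] that by simp
  have bc: "?b p \<in> carrier (mat_ring I)" if "p \<in> hbasis D" for p
    using that Rc' Y by (auto simp: hbasis_def)
  have bm: "lin_ext (hbasis D) ?b (bprod D p q) = ?b p \<otimes>\<^bsub>mat_ring I\<^esub> ?b q"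
    if pq: "p \<in> hbasis D" "q \<in> hbasis D" for p q
  proof -
    obtain i h j k where [simp]: "p = (i, h)" "q = (j, k)" by (cases p, cases q)
    have h: "h \<in> carrier (grp D)" "k \<in> carrier (grp D)" using pq by (auto simp: hbasis_def)
    have "?b p \<otimes>\<^bsub>mat_ring I\<^esub> ?b q = Y [^]\<^bsub>mat_ring I\<^esub> i \<otimes>\<^bsub>mat_ring I\<^esub> (R h \<otimes>\<^bsub>mat_ring I\<^esub> Y [^]\<^bsub>mat_ring I\<^esub> j) \<otimes>\<^bsub>mat_ring I\<^esub> R k"
      using Rc' h Y by (simp add: M.m_assoc)
    also have "\<dots> = fscale (inverse (chr D h) ^ j) (Y [^]\<^bsub>mat_ring I\<^esub> (i + j) \<otimes>\<^bsub>mat_ring I\<^esub> R (h \<otimes>\<^bsub>grp D\<^esub> k))"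
      using Rc' h Y by (simp add: RY sc M.m_assoc Rm flip: M.nat_pow_mult)
    also have "\<dots> = lin_ext (hbasis D) ?b (bprod D p q)"
    proof (cases "i + j < nil_ord D")
      case True
      then have "(i + j, h \<otimes>\<^bsub>grp D\<^esub> k) \<in> hbasis D" using h by (simp add: hbasis_def)
      then show ?thesis using True by (simp add: bprod_def lin_ext_scale lin_ext_evec[OF finite_hbasis])
    next
      case False
      then have "Y [^]\<^bsub>mat_ring I\<^esub> (i + j) \<otimes>\<^bsub>mat_ring I\<^esub> R (h \<otimes>\<^bsub>grp D\<^esub> k) = \<zero>\<^bsub>mat_ring I\<^esub>"
        using Ynil[of "i + j"] Rc' h by simp
      then show ?thesis using False
        by (simp add: bprod_def lin_ext_zero) (simp add: mat_ring_def)
    qed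
    finally show ?thesis by simp
  qed
  have *: "(\<Sum>p\<in>B. \<Sum>q\<in>B. fscale (x p * y q) (b p \<otimes>\<^bsub>mat_ring I\<^esub> b q))
      = lin_ext B b x \<otimes>\<^bsub>mat_ring I\<^esub> lin_ext B b y" for x y and b :: "'b \<Rightarrow> 'i \<times> 'i \<Rightarrow> 'k" and B
    by (simp add: lin_ext_def mat_ring_def mmul_sum mmul_scale fvs.scale_sum_right)
      (subst sum.swap, simp add: mult.commute)
  have "lin_ext (hbasis D) ?b \<in> ring_hom (hopf_alg D) (mat_ring I)"
  proof (rule ring_hom_memI)
    show "lin_ext (hbasis D) ?b x \<in> carrier (mat_ring I)" for x
      using bc unfolding lin_ext_def mat_ring_def by (auto intro!: fspace_sum fspace_scale)
    show "lin_ext (hbasis D) ?b (x \<otimes>\<^bsub>hopf_alg D\<^esub> y) = lin_ext (hbasis D) ?b x \<otimes>\<^bsub>mat_ring I\<^esub> lin_ext (hbasis D) ?b y" for x y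
    proof -
      have "lin_ext (hbasis D) ?b (x \<otimes>\<^bsub>hopf_alg D\<^esub> y) = (\<Sum>p\<in>hbasis D. \<Sum>q\<in>hbasis D. fscale (x p * y q) (?b p \<otimes>\<^bsub>mat_ring I\<^esub> ?b q))"
        by (simp add: hopf_sel bilin_ext_def lin_ext_sum lin_ext_scale bm)
      also have "\<dots> = lin_ext (hbasis D) ?b x \<otimes>\<^bsub>mat_ring I\<^esub> lin_ext (hbasis D) ?b y"
        by (rule *)
      finally show ?thesis .
    qed
    show "lin_ext (hbasis D) ?b (x \<oplus>\<^bsub>hopf_alg D\<^esub> y) = lin_ext (hbasis D) ?b x \<oplus>\<^bsub>mat_ring I\<^esub> lin_ext (hbasis D) ?b y" for x y
      by (simp add: lin_ext_def hopf_sel mat_ring_def fvs.scale_left_distrib sum.distrib)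
    show "lin_ext (hbasis D) ?b \<one>\<^bsub>hopf_alg D\<^esub> = \<one>\<^bsub>mat_ring I\<^esub>"
      by (simp add: hopf_sel lin_ext_evec[OF finite_hbasis hbasis_one] R1)
  qed
  then show ?thesis using I by (simp add: hmodule_def gen_module_def lin_ext_scale)
qed

end

end

theory Submission
  imports Defs "HOL-Algebra.Multiplicative_Group"
begin

text \<open>
  Since \<open>Hom(M \<otimes> N, 1\<^sup>*) = Hom(M, N\<^sup>*)\<close> and \<open>M\<^sup>*\<^sup>* \<cong> M\<close>, the form is associative and symmetric. For
  \<open>l < n\<close> the element \<open>\<delta>\<close> of \<open>M(k, l)\<close> is the alternating sum of the almost split sequence
  \<open>a M(k, l) \<rightarrow> M(1, 2) \<otimes> M(k, l) \<rightarrow> M(k, l)\<close>, and for \<open>l = n\<close> it is the difference of the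
  projective module \<open>M(k, n)\<close> and its radical. A homomorphism \<open>M(i, j) \<rightarrow> Z\<close> is a homomorphism of
  \<open>G\<close>-modules from \<open>V\<^sub>i\<close> to the kernel of \<open>y\<^sup>j\<close> in \<open>Z\<close>; counting those that lift along the almost split
  sequence (or lie in the radical) reduces the pairing of \<open>M[i, j]\<close> with \<open>\<delta>\<^sup>*\<close> to Schur's lemma.
  The \<open>M[i, j]\<close> span because a submodule \<open>M(i, j)\<close> generated at the largest degree \<open>j\<close> of
  nilpotency of \<open>y\<close> is a direct summand, by Maschke's theorem. Duality makes the form
  nondegenerate, and as \<open>([H], x) = dim x\<close>, comparing pairings yields \<open>x [H] = dim(x) [H]\<close> and
  \<open>b = (b, 1) [H]\<close> for every integral \<open>b\<close>.
\<close>

section \<open>Matrices\<close>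

text \<open>Linear independence of the M[i, j] is read off from the pairing: if b spans and (b_s,
  c_t) is the Kronecker delta, then b and c are both bases (\<open>dual_pairI\<close>). The pairing
  is dimension counting, since \<open>hom_dim_Mmod\<close> turns every Hom space out of M(i, j) into
  a space of G-maps. The order n of q = chi(g) enters twice. First, y \<otimes> g + 1 \<otimes> y
  has n-th power 0 because the Gaussian binomials of n over 0 < a < n vanish. Second, the power y^j
  on M(1, 2) \<otimes> Z carries the constant \<open>qsum j\<close> = 1 + q^-1 + ... + q^-(j-1),
  which is nonzero for 0 < j < n and 0 for j = n; this separates the elements delta with l < n from
  those with l = n. Modules are handled as a representation of G together with a matrix Y subject to
  two relations (\<open>ymod\<close>); tensor products and duals are brought into this form before
  anything else is shown about them. Symmetry of the form rests on the element g, whose action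
  intertwines a module with its double dual; it is what moves factors past each other in the
  argument on integrals.\<close>

lemma fspace_eqI:
  "A \<in> fspace I \<Longrightarrow> B \<in> fspace I \<Longrightarrow> (\<And>i. i \<in> I \<Longrightarrow> A i = B i) \<Longrightarrow> A = B"
  by (auto simp: fspace_def fun_eq_iff) metis

lemma subspace_fspace [simp]: "fvs.subspace (fspace I)"
  by (auto simp: fvs.subspace_def fspace_def fscale_def)

lemma fspace_add: "A \<in> fspace I \<Longrightarrow> B \<in> fspace I \<Longrightarrow> A + B \<in> fspace I"
  and fspace_diff: "A \<in> fspace I \<Longrightarrow> B \<in> fspace I \<Longrightarrow> A - B \<in> fspace I"
  and fspace_uminus: "A \<in> fspace I \<Longrightarrow> - A \<in> fspace I"
  and fspace_zero [simp]: "0 \<in> fspace I"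
  by (auto simp: fspace_def)

lemma evec_fspace: "i \<in> I \<Longrightarrow> evec i \<in> fspace I"
  by (auto simp: fspace_def evec_def)

lemma idmat_fspace [simp]: "idmat I \<in> fspace (I \<times> I)"
  by (auto simp: fspace_def idmat_def)

lemma mmul_idmat_left: "finite I \<Longrightarrow> A \<in> fspace (I \<times> J) \<Longrightarrow> mmul I (idmat I) A = A"
proof (rule ext)
  fix p :: "'a \<times> 'b" assume I: "finite I" and A: "A \<in> fspace (I \<times> J)"
  obtain i l where [simp]: "p = (i, l)" by (cases p)
  have "mmul I (idmat I) A p = (\<Sum>j\<in>I. if j = i then A (i, l) else 0)"
    by (auto simp: mmul_def idmat_def intro!: sum.cong)
  then show "mmul I (idmat I) A p = A p"
    using I A by (auto simp: fspace_def)
qed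

lemma mmul_idmat_right: "finite J \<Longrightarrow> A \<in> fspace (I \<times> J) \<Longrightarrow> mmul J A (idmat J) = A"
proof (rule ext)
  fix p :: "'b \<times> 'a" assume I: "finite J" and A: "A \<in> fspace (I \<times> J)"
  obtain i l where [simp]: "p = (i, l)" by (cases p)
  have "mmul J A (idmat J) p = (\<Sum>j\<in>J. if j = l then A (i, l) else 0)"
    by (auto simp: mmul_def idmat_def intro!: sum.cong)
  then show "mmul J A (idmat J) p = A p"
    using I A by (auto simp: fspace_def)
qed

lemma mmul_add: "mmul J (A + A') B = mmul J A B + mmul J A' B"
    "mmul J A (B + B') = mmul J A B + mmul J A B'"
  and mmul_diff: "mmul J (A - A') B = mmul J A B - mmul J A' B"
    "mmul J A (B - B') = mmul J A B - mmul J A B'"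
  and mmul_uminus: "mmul J (- A) B = - mmul J A B" "mmul J A (- B) = - mmul J A B"
  and mmul_zero: "mmul J 0 B = 0" "mmul J A 0 = 0"
  by (auto simp: mmul_def fun_eq_iff distrib_left distrib_right left_diff_distrib right_diff_distrib
      sum.distrib sum_subtractf sum_negf)

lemma mvec_mmul: "finite I \<Longrightarrow> finite J \<Longrightarrow> mvec J (mmul I A B) v = mvec I A (mvec J B v)"
  unfolding mmul_def mvec_def
  by (auto simp: fun_eq_iff sum_distrib_left sum_distrib_right mult.assoc intro: sum.swap)

lemma mvec_fspace: "A \<in> fspace (I \<times> J) \<Longrightarrow> mvec J A v \<in> fspace I"
  by (auto simp: mvec_def fspace_def)

lemma mvec_idmat: "finite I \<Longrightarrow> v \<in> fspace I \<Longrightarrow> mvec I (idmat I) v = v"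
proof
  fix i assume I: "finite I" and A: "v \<in> fspace I"
  have "mvec I (idmat I) v i = (\<Sum>j\<in>I. if j = i then v i else 0)"
    by (auto simp: mvec_def idmat_def intro!: sum.cong)
  then show "mvec I (idmat I) v i = v i"
    using I A by (auto simp: fspace_def)
qed

lemma mvec_evec: "finite J \<Longrightarrow> j \<in> J \<Longrightarrow> mvec J A (evec j) i = A (i, j)"
  by (simp add: mvec_def evec_def if_distrib cong: if_cong)

lemma mvec_add: "mvec J A (v + w) = mvec J A v + mvec J A w"
  and mvec_scale: "mvec J A (fscale c v) = fscale c (mvec J A v)"
  and mvec_zero: "mvec J A 0 = 0" "mvec J 0 v = 0"
  and mvec_diff: "mvec J A (v - w) = mvec J A v - mvec J A w"
  and mvec_diff_left: "mvec J (A - B) v = mvec J A v - mvec J B v"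
  and mvec_scale_left: "mvec J (fscale c A) v = fscale c (mvec J A v)"
  by (auto simp: mvec_def fscale_def fun_eq_iff algebra_simps sum.distrib sum_subtractf sum_distrib_left)

lemma mat_eqI:
  assumes "finite J" "A \<in> fspace (I \<times> J)" "B \<in> fspace (I \<times> J)"
    and "\<And>v. v \<in> fspace J \<Longrightarrow> mvec J A v = mvec J B v"
  shows "A = B"
proof (rule fspace_eqI[OF assms(2,3)])
  fix p assume "p \<in> I \<times> J"
  then obtain i j where p: "p = (i, j)" "j \<in> J" by auto
  then show "A p = B p"
    using assms(4)[OF evec_fspace[OF p(2)]] mvec_evec[OF assms(1) p(2), of A i]
      mvec_evec[OF assms(1) p(2), of B i] by simp
qed

lemma linearI: "(\<And>x y. f (x + y) = f x + f y) \<Longrightarrow> (\<And>c x. f (fscale c x) = fscale c (f x)) \<Longrightarrow>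
    Vector_Spaces.linear fscale fscale f"
  unfolding Vector_Spaces.linear_iff by (auto intro: fvs.vector_space_axioms)

lemma linear_mvec: "Vector_Spaces.linear fscale fscale (mvec J A)"
  by (intro linearI mvec_add mvec_scale)

interpretation fvp: vector_space_pair "fscale :: 'k::field \<Rightarrow> ('i \<Rightarrow> 'k) \<Rightarrow> 'i \<Rightarrow> 'k" "fscale :: 'k \<Rightarrow> ('j \<Rightarrow> 'k) \<Rightarrow> 'j \<Rightarrow> 'k"
  by unfold_locales

definition mat_of :: "'i set \<Rightarrow> 'j set \<Rightarrow> (('j \<Rightarrow> 'k::field) \<Rightarrow> 'i \<Rightarrow> 'k) \<Rightarrow> 'i \<times> 'j \<Rightarrow> 'k" where
  "mat_of I J f = (\<lambda>(i, j). if i \<in> I \<and> j \<in> J then f (evec j) i else 0)"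

lemma mat_of_fspace [simp]: "mat_of I J f \<in> fspace (I \<times> J)"
  by (auto simp: mat_of_def fspace_def)

lemma mvec_mat_of:
  assumes f: "Vector_Spaces.linear fscale fscale f" and J: "finite J"
    and fI: "\<And>v. v \<in> fspace J \<Longrightarrow> f v \<in> fspace I" and v: "v \<in> fspace J"
  shows "mvec J (mat_of I J f) v = f v"
proof
  fix i
  interpret f: Vector_Spaces.linear fscale fscale f by (rule f)
  have "f v = (\<Sum>p\<in>J. fscale (v p) (f (evec p)))"
    by (subst fspace_expand[OF J v]) (simp add: f.sum f.scale)
  moreover have "f (evec p) i = mat_of I J f (i, p)" if "p \<in> J" for p
    using that fI[OF evec_fspace[OF that]] by (auto simp: mat_of_def fspace_def)
  ultimately show "mvec J (mat_of I J f) v i = f v i"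
    by (simp add: mvec_def sum_fun_app fscale_def mult.commute)
qed

section \<open>Bases and dimensions of coordinate spaces\<close>

lemma independent_evec: "finite I \<Longrightarrow> fvs.independent (evec ` I :: ('i \<Rightarrow> 'k::field) set)"
proof (rule fvs.independent_if_scalars_zero)
  fix f :: "('i \<Rightarrow> 'k) \<Rightarrow> 'k" and x :: "'i \<Rightarrow> 'k"
  assume I: "finite I" and s: "(\<Sum>x\<in>evec ` I. fscale (f x) x) = 0" and "x \<in> evec ` I"
  then obtain i where i: "i \<in> I" "x = evec i" by auto
  have inj: "inj_on (evec :: 'i \<Rightarrow> 'i \<Rightarrow> 'k) I"
    by (auto simp: inj_on_def evec_def fun_eq_iff split: if_splits)
  have "0 = (\<Sum>j\<in>I. fscale (f (evec j)) (evec j)) i"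
    using s by (simp add: sum.reindex[OF inj])
  also have "\<dots> = (\<Sum>j\<in>I. if j = i then f (evec i) else 0)"
    unfolding sum_fun_app by (auto simp: fscale_def evec_def intro!: sum.cong)
  also have "\<dots> = f x" using I i by simp
  finally show "f x = 0" by simp
qed auto

lemma span_evec: "finite I \<Longrightarrow> fvs.span (evec ` I) = fspace I"
proof
  assume I: "finite I"
  show "fspace I \<subseteq> fvs.span (evec ` I)"
  proof
    fix v assume v: "v \<in> fspace I"
    show "v \<in> fvs.span (evec ` I)"
      by (subst fspace_expand[OF I v]) (intro fvs.span_sum fvs.span_scale fvs.span_base imageI)
  qed
next
  show "fvs.span (evec ` I) \<subseteq> fspace I" by (rule fvs.span_minimal) (auto intro: evec_fspace)
qed

lemma card_evec: "card (evec ` I :: ('i \<Rightarrow> 'k::field) set) = card I"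
  by (rule card_image) (auto simp: inj_on_def evec_def fun_eq_iff split: if_splits)

lemma dim_fspace: "finite I \<Longrightarrow> fvs.dim (fspace I :: ('i \<Rightarrow> 'k::field) set) = card I"
  by (metis card_evec fvs.dim_span_eq_card_independent independent_evec span_evec)

lemma finite_independent_fspace:
  "finite I \<Longrightarrow> fvs.independent B \<Longrightarrow> B \<subseteq> fspace I \<Longrightarrow> finite B \<and> card B \<le> card I"
  using fvs.independent_span_bound[of "evec ` I" B]
  by (simp add: span_evec) (metis card_evec)

lemma dim_image_inj:
  assumes f: "Vector_Spaces.linear fscale fscale f" and S: "fvs.subspace S" and inj: "inj_on f S"
  shows "fvs.dim (f ` S) = fvs.dim S"
proof -
  interpret f: Vector_Spaces.linear fscale fscale f by (rule f)
  obtain B where B: "B \<subseteq> S" "fvs.independent B" "S \<subseteq> fvs.span B" "card B = fvs.dim S"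
    by (rule fvs.basis_exists)
  have sp: "fvs.span B = S" using B(1,3) S by (rule fvs.span_subspace)
  have "fvs.independent (f ` B)"
    using fvp.linear_independent_injective_image[OF f B(2)] inj sp by simp
  moreover have "f ` S = fvs.span (f ` B)" using sp by (simp add: f.span_image)
  moreover have "card (f ` B) = card B" using inj B(1) by (intro card_image) (auto intro: inj_on_subset)
  ultimately show ?thesis using B(4) by (simp add: fvs.dim_eq_card_independent)
qed

lemma dim_kernel_image:
  assumes f: "Vector_Spaces.linear fscale fscale f" and S: "fvs.subspace S"
    and SI: "S \<subseteq> fspace I" and I: "finite I"
  shows "fvs.dim S = fvs.dim {x \<in> S. f x = 0} + fvs.dim (f ` S)"
proof -
  interpret f: Vector_Spaces.linear fscale fscale f by (rule f)
  let ?K = "{x \<in> S. f x = 0}"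
  have K: "fvs.subspace ?K"
    using S by (auto simp: fvs.subspace_def f.add f.scale f.zero)
  obtain A where A: "A \<subseteq> ?K" "fvs.independent A" "?K \<subseteq> fvs.span A"
    by (rule fvs.basis_exists)
  have "A \<subseteq> S" using A by blast
  then obtain B where B: "A \<subseteq> B" "B \<subseteq> S" "fvs.independent B" "S \<subseteq> fvs.span B"
    using fvs.maximal_independent_subset_extend[of A S] A(2) by metis
  have fin: "finite B" using finite_independent_fspace[OF I B(3)] B(2) SI by auto
  have spA: "fvs.span A = ?K" using A K by (intro fvs.span_subspace)
  have spB: "fvs.span B = S" using B S by (intro fvs.span_subspace)
  have inj: "inj_on f (fvs.span (B - A))"
  proof (subst fvp.linear_inj_on_iff_eq_0[OF f fvs.subspace_span], safe)
    fix x assume x: "x \<in> fvs.span (B - A)" "f x = 0"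
    have "x \<in> S" using x(1) spB fvs.span_mono[of "B - A" B] by auto
    then have "x \<in> fvs.span A" using x spA by simp
    then obtain w where w: "x = (\<Sum>a\<in>A. fscale (w a) a)"
      using fvs.span_finite[of A] fin B(1) finite_subset by auto
    obtain u where u: "x = (\<Sum>a\<in>B - A. fscale (u a) a)"
      using fvs.span_finite[of "B - A"] fin x by auto
    \<comment> \<open>The vector x has an expansion over A and one over B - A; their difference is a
      linear relation on the independent set B.\<close>
    have "(\<Sum>a\<in>B. fscale (if a \<in> A then w a else - u a) a)
        = (\<Sum>a\<in>A. fscale (w a) a) + (\<Sum>a\<in>B - A. fscale (- u a) a)"
      by (subst sum.subset_diff[OF B(1) fin], subst add.commute) (auto intro!: arg_cong2[where f="(+)"] sum.cong)
    also have "\<dots> = 0" using w u by (simp add: sum_negf)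
    finally have s0: "(\<Sum>a\<in>B. fscale (if a \<in> A then w a else - u a) a) = 0" .
    have "\<forall>a\<in>B. (if a \<in> A then w a else - u a) = 0"
      using fvs.independentD[OF B(3) fin order_refl s0] by (rule ballI)
    then have "\<forall>a\<in>B - A. u a = 0" by auto
    then show "x = 0" using u by simp
  qed
  have "fvs.independent (f ` (B - A))"
    using fvp.linear_independent_injective_image[OF f _ inj] fvs.independent_mono[OF B(3)] by auto
  moreover have "f ` S = fvs.span (f ` (B - A))"
  proof -
    have "f ` S = fvs.span (f ` B)" using spB by (simp add: f.span_image)
    also have "\<dots> = fvs.span (f ` (B - A))"
    proof
      have "f ` B \<subseteq> fvs.span (f ` (B - A))"
      proof
        fix y assume "y \<in> f ` B"
        then obtain b where b: "b \<in> B" "y = f b" by auto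
        show "y \<in> fvs.span (f ` (B - A))"
        proof (cases "b \<in> A")
          case True
          then have "y = 0" using A(1) b by auto
          then show ?thesis by (simp add: fvs.span_zero)
        next
          case False
          then show ?thesis using b by (intro fvs.span_base) auto
        qed
      qed
      then show "fvs.span (f ` B) \<subseteq> fvs.span (f ` (B - A))" by (intro fvs.span_minimal) auto
    qed (auto intro!: fvs.span_mono)
    finally show ?thesis .
  qed
  moreover have "card (f ` (B - A)) = card (B - A)"
    by (intro card_image inj_on_subset[OF inj fvs.span_superset])
  ultimately have "fvs.dim (f ` S) = card (B - A)" by (simp add: fvs.dim_eq_card_independent)
  moreover have "fvs.dim S = card B" "fvs.dim ?K = card A"
    using spA spB A(2) B(3) fvs.dim_span_eq_card_independent by metis+
  moreover have "card B = card A + card (B - A)"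
    using B(1) fin by (metis card_Diff_subset card_mono finite_subset le_add_diff_inverse)
  ultimately show ?thesis by simp
qed

lemma subspace_full:
  assumes S: "fvs.subspace S" "S \<subseteq> fspace I" and I: "finite I" and d: "fvs.dim S = card I"
  shows "S = fspace I"
proof (rule ccontr)
  assume "S \<noteq> fspace I"
  then obtain w where w: "w \<in> fspace I" "w \<notin> S" using S by auto
  obtain B where B: "B \<subseteq> S" "fvs.independent B" "S \<subseteq> fvs.span B" "card B = fvs.dim S"
    by (rule fvs.basis_exists)
  have "fvs.span B = S" using B(1,3) S(1) by (rule fvs.span_subspace)
  then have i: "fvs.independent (insert w B)" "w \<notin> B"
    using w B by (auto simp: fvs.independent_insert)
  have "insert w B \<subseteq> fspace I" using w B S by auto
  from finite_independent_fspace[OF I i(1) this] show False using B(4) d i(2) by auto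
qed

text \<open>A linear right inverse of F on its image gives T with F T F = F for an arbitrary matrix.
  This one equation serves as left inverse of injections, as the input to averaging over the group,
  and as a source of idempotents T F.\<close>

lemma generalized_inverse:
  assumes F: "F \<in> fspace (J \<times> I)" and I: "finite I" and J: "finite J"
  obtains T where "T \<in> fspace (I \<times> J)" "mmul I F (mmul J T F) = F"
proof -
  obtain g where g: "g ` UNIV \<subseteq> fspace I" "Vector_Spaces.linear fscale fscale g"
     "\<forall>v\<in>mvec I F ` fspace I. mvec I F (g v) = v"
    using fvp.linear_exists_right_inverse_on[OF linear_mvec subspace_fspace] by blast
  let ?T = "mat_of I J g"
  have e: "mvec J ?T v = g v" if "v \<in> fspace J" for v
    using g that J by (intro mvec_mat_of) auto
  have "mmul I F (mmul J ?T F) = F"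
    using F I J by (intro mat_eqI[OF I]) (auto simp: mvec_mmul e mvec_fspace[OF F] g intro!: mmul_closed)
  then show ?thesis by (intro that[of ?T]) auto
qed

text \<open>F (T F - 1) = 0, and an injective F can be cancelled on the left.\<close>

lemma injective_left_inverse:
  fixes F :: "'a \<times> 'b \<Rightarrow> 'c::field"
  assumes F: "F \<in> fspace (J \<times> I)" and I: "finite I" and J: "finite J"
    and inj: "\<And>v. v \<in> fspace I \<Longrightarrow> mvec I F v = 0 \<Longrightarrow> v = 0"
    and T: "T \<in> fspace (I \<times> J)" "mmul I F (mmul J T F) = F"
  shows "mmul J T F = idmat I"
proof (rule mat_eqI[OF I])
  fix v :: "'b \<Rightarrow> 'c" assume v: "v \<in> fspace I"
  have "mvec I F (mvec I (mmul J T F) v - v) = 0"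
    using T I J by (simp add: mvec_diff flip: mvec_mmul)
  moreover have "mvec I (mmul J T F) v - v \<in> fspace I"
    using v T F by (intro fspace_diff mvec_fspace mmul_closed)
  ultimately show "mvec I (mmul J T F) v = mvec I (idmat I) v"
    using inj v I by (force simp: mvec_idmat)
qed (use T F in \<open>auto intro: mmul_closed\<close>)

text \<open>F is injective between spaces of equal dimension, hence onto; every v is F w, and F T F
  w = F w.\<close>

lemma left_inverse_square:
  assumes F: "F \<in> fspace (J \<times> I)" and I: "finite I" and J: "finite J" and c: "card I = card J"
    and T: "T \<in> fspace (I \<times> J)" "mmul J T F = idmat I"
  shows "mmul I F T = idmat J"
proof (rule mat_eqI[OF J])
  have T': "mvec J T (mvec I F v) = v" if "v \<in> fspace I" for v
    using T I J that by (simp add: mvec_idmat flip: mvec_mmul)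
  then have inj: "inj_on (mvec I F) (fspace I)" by (metis inj_onI)
  have "mvec I F ` fspace I = fspace J"
  proof (rule subspace_full[OF _ _ J])
    interpret l: Vector_Spaces.linear fscale fscale "mvec I F" by (rule linear_mvec)
    show "fvs.subspace (mvec I F ` fspace I)" by (rule l.subspace_image) simp
    show "mvec I F ` fspace I \<subseteq> fspace J" using F by (auto intro: mvec_fspace)
    show "fvs.dim (mvec I F ` fspace I) = card J"
      using dim_image_inj[OF linear_mvec _ inj] I c by (simp add: dim_fspace)
  qed
  then have "\<exists>w\<in>fspace I. v = mvec I F w" if "v \<in> fspace J" for v using that by blast
  then have "mvec I F (mvec J T v) = v" if "v \<in> fspace J" for v using that T' by metis
  then show "mvec J (mmul I F T) v = mvec J (idmat J) v" if "v \<in> fspace J" for v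
    using that I J by (simp add: mvec_mmul mvec_idmat)
qed (use F T in \<open>auto intro: mmul_closed\<close>)

lemma inverse_card_eq:
  assumes F: "F \<in> fspace (J \<times> I)" "T \<in> fspace (I \<times> J)" and I: "finite I" and J: "finite J"
    and T: "mmul J T F = idmat I" "mmul I F T = idmat J"
  shows "card I = card J"
proof -
  have T': "mvec J T (mvec I F v) = v" if "v \<in> fspace I" for v
    using T I J that by (simp add: mvec_idmat flip: mvec_mmul)
  have F': "mvec I F (mvec J T v) = v" if "v \<in> fspace J" for v
    using T I J that by (simp add: mvec_idmat flip: mvec_mmul)
  have "inj_on (mvec I F) (fspace I)" by (metis inj_onI T')
  moreover have "mvec I F ` fspace I = fspace J"
  proof
    show "fspace J \<subseteq> mvec I F ` fspace I"
      using F' mvec_fspace[OF F(2)] by (metis image_eqI subsetI)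
  qed (use mvec_fspace[OF F(1)] in auto)
  ultimately show ?thesis
    using dim_image_inj[OF linear_mvec, of "fspace I" I F] I J by (simp add: dim_fspace)
qed

text \<open>The columns of B are a basis of W and A is a left inverse of B, so A gives coordinates
  on W. In this way a stable subspace becomes a module with index set \<open>{..<r}\<close>.\<close>

lemma subspace_coordinates:
  fixes W :: "('i \<Rightarrow> 'k::field) set"
  assumes W: "fvs.subspace W" "W \<subseteq> fspace I" and I: "finite I"
  obtains A r B where "A \<in> fspace ({..<r::nat} \<times> I)" "B \<in> fspace (I \<times> {..<r})"
    "mmul I A B = idmat {..<r}" "\<forall>w\<in>W. mvec {..<r} B (mvec I A w) = w"
    "\<forall>v. mvec {..<r} B v \<in> W"
proof -
  obtain C where C: "C \<subseteq> W" "fvs.independent C" "W \<subseteq> fvs.span C" "card C = fvs.dim W"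
    by (rule fvs.basis_exists)
  have fin: "finite C" using finite_independent_fspace[OF I C(2)] C W by auto
  have sp: "fvs.span C = W" using C(1,3) W(1) by (rule fvs.span_subspace)
  obtain b where b: "bij_betw b {..<card C} C"
    using ex_bij_betw_nat_finite[OF fin] by (auto simp: atLeast0LessThan)
  define B where "B = (\<lambda>(i, k). if k < card C then b k i else 0)"
  have bW: "b k \<in> W" if "k < card C" for k using b C that by (auto simp: bij_betw_def)
  have B: "B \<in> fspace (I \<times> {..<card C})"
    using bW W by (fastforce simp: B_def fspace_def)
  have mv: "mvec {..<card C} B v = (\<Sum>k<card C. fscale (v k) (b k))" for v
    by (auto simp: mvec_def B_def fun_eq_iff sum_fun_app fscale_def intro!: sum.cong)
  have BW: "mvec {..<card C} B v \<in> W" for v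
    unfolding mv using bW W by (intro fvs.subspace_sum fvs.subspace_scale) auto
  have inj: "v = 0" if v: "v \<in> fspace {..<card C}" "mvec {..<card C} B v = 0" for v
  proof -
    have i: "inv_into {..<card C} b (b k) = k" if "k < card C" for k
      using b that by (simp add: bij_betw_def inv_into_f_f)
    have "(\<Sum>c\<in>C. fscale (v (inv_into {..<card C} b c)) c) = 0"
      using v(2) unfolding mv by (subst sum.reindex_bij_betw[OF b, symmetric]) (simp add: i)
    then have "\<forall>c\<in>C. v (inv_into {..<card C} b c) = 0"
      using fvs.independentD[OF C(2) fin order_refl, of "\<lambda>c. v (inv_into {..<card C} b c)"] by simp
    moreover have "b k \<in> C" if "k < card C" for k using b that by (auto simp: bij_betw_def)
    ultimately have "v k = 0" if "k < card C" for k using that i by metis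
    then show ?thesis using v(1) by (intro fspace_eqI[OF v(1)]) auto
  qed
  obtain A where A: "A \<in> fspace ({..<card C} \<times> I)" "mmul {..<card C} B (mmul I A B) = B"
    using generalized_inverse[OF B _ I] by auto
  have AB: "mmul I A B = idmat {..<card C}"
    using B I A inj by (intro injective_left_inverse[of B I]) auto
  have "\<exists>v\<in>fspace {..<card C}. w = mvec {..<card C} B v" if "w \<in> W" for w
  proof -
    have "w \<in> range (\<lambda>u. \<Sum>c\<in>C. fscale (u c) c)"
      using that unfolding sp[symmetric] fvs.span_finite[OF fin] .
    then obtain u where "w = (\<Sum>c\<in>C. fscale (u c) c)" by auto
    also have "\<dots> = (\<Sum>k<card C. fscale (u (b k)) (b k))"
      by (subst sum.reindex_bij_betw[OF b, symmetric]) simp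
    also have "\<dots> = mvec {..<card C} B (\<lambda>k. if k < card C then u (b k) else 0)"
      unfolding mv by (auto intro!: sum.cong)
    finally show ?thesis by (intro bexI) (auto simp: fspace_def)
  qed
  moreover have "mvec I A (mvec {..<card C} B v) = v" if "v \<in> fspace {..<card C}" for v
    using AB I that by (simp add: mvec_idmat flip: mvec_mmul)
  ultimately have "mvec {..<card C} B (mvec I A w) = w" if "w \<in> W" for w using that by force
  then show ?thesis using that[of A "card C" B] A(1) B AB BW by blast
qed

text \<open>The image of E, with coordinates as in \<open>subspace_coordinates\<close>: E is the
  identity there, which makes the projection onto it factor as B A.\<close>

lemma idempotent_splitting:
  fixes E :: "'i \<times> 'i \<Rightarrow> 'k::field"
  assumes E: "E \<in> fspace (I \<times> I)" "mmul I E E = E" and I: "finite I"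
  obtains A r B where "A \<in> fspace ({..<r::nat} \<times> I)" "B \<in> fspace (I \<times> {..<r})"
    "mmul I A B = idmat {..<r}" "mmul {..<r} B A = E"
proof -
  interpret l: Vector_Spaces.linear fscale fscale "mvec I E" by (rule linear_mvec)
  let ?W = "mvec I E ` fspace I"
  have W: "fvs.subspace ?W" by (rule l.subspace_image) simp
  have WI: "?W \<subseteq> fspace I" using E by (auto intro: mvec_fspace)
  obtain A r B where AB: "A \<in> fspace ({..<r::nat} \<times> I)" "B \<in> fspace (I \<times> {..<r})"
    "mmul I A B = idmat {..<r}" "\<forall>w\<in>?W. mvec {..<r} B (mvec I A w) = w"
    "\<forall>v. mvec {..<r} B v \<in> ?W"
    by (rule subspace_coordinates[OF W WI I])
  have EW: "mvec I E w = w" if "w \<in> ?W" for w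
    using that E I by (auto simp flip: mvec_mmul)
  have EB: "mmul I E B = B"
  proof (rule mat_eqI)
    fix v :: "nat \<Rightarrow> 'k"
    show "mvec {..<r} (mmul I E B) v = mvec {..<r} B v"
      using I EW[OF AB(5)[rule_format]] by (simp add: mvec_mmul)
  qed (use AB(2) E in \<open>auto intro: mmul_closed\<close>)
  have BAE: "mmul {..<r} B (mmul I A E) = E"
  proof (rule mat_eqI[OF I])
    fix v :: "'i \<Rightarrow> 'k" assume "v \<in> fspace I"
    then have "mvec {..<r} B (mvec I A (mvec I E v)) = mvec I E v"
      using AB(4) by blast
    then show "mvec I (mmul {..<r} B (mmul I A E)) v = mvec I E v"
      using I by (simp add: mvec_mmul)
  qed (use AB(1,2) E in \<open>auto intro!: mmul_closed\<close>)
  show ?thesis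
  \<comment> \<open>The coordinate map A is controlled only on the image of E; composing it with E
    makes the product equal to E on the whole space.\<close>
  proof (rule that[of "mmul I A E" r B])
    show "mmul I (mmul I A E) B = idmat {..<r}" using AB EB I by (simp add: mmul_assoc)
  qed (use AB E BAE in \<open>auto intro: mmul_closed\<close>)
qed

section \<open>Eigenvalues\<close>

text \<open>The vector p(T) v.\<close>

definition poly_act :: "'i set \<Rightarrow> ('i \<times> 'i \<Rightarrow> 'k::field) \<Rightarrow> 'k poly \<Rightarrow> ('i \<Rightarrow> 'k) \<Rightarrow> 'i \<Rightarrow> 'k" where
  "poly_act I T p v = (\<Sum>k\<le>degree p. fscale (Polynomial.coeff p k) ((mvec I T ^^ k) v))"

lemma poly_act_bound: "degree p \<le> N \<Longrightarrow> poly_act I T p v = (\<Sum>k\<le>N. fscale (Polynomial.coeff p k) ((mvec I T ^^ k) v))"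
  unfolding poly_act_def by (intro sum.mono_neutral_left) (auto simp: coeff_eq_0 not_le)

lemma poly_act_linear_factor:
  "poly_act I T ([:- c, 1:] * q) v = mvec I T (poly_act I T q v) - fscale c (poly_act I T q v)"
proof -
  interpret l: Vector_Spaces.linear fscale fscale "mvec I T" by (rule linear_mvec)
  let ?N = "Suc (degree q)"
  have "degree ([:- c, 1:] * q) \<le> ?N"
    using degree_mult_le[of "[:- c, 1:]" q] by simp
  then have "poly_act I T ([:- c, 1:] * q) v
     = (\<Sum>k\<le>?N. fscale (Polynomial.coeff (pCons 0 q) k) ((mvec I T ^^ k) v)) - (\<Sum>k\<le>?N. fscale (c * Polynomial.coeff q k) ((mvec I T ^^ k) v))"
    by (simp add: poly_act_bound fvs.scale_left_diff_distrib sum_subtractf)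
  also have "(\<Sum>k\<le>?N. fscale (Polynomial.coeff (pCons 0 q) k) ((mvec I T ^^ k) v)) = mvec I T (poly_act I T q v)"
    unfolding sum.atMost_Suc_shift poly_act_def by (simp add: l.sum l.scale)
  also have "(\<Sum>k\<le>?N. fscale (c * Polynomial.coeff q k) ((mvec I T ^^ k) v)) = fscale c (poly_act I T q v)"
    unfolding poly_act_bound[of q ?N, OF le_SucI[OF order_refl]] fvs.scale_sum_right by simp
  finally show ?thesis .
qed

lemma poly_act_fspace:
  assumes "T \<in> fspace (I \<times> I)" "v \<in> fspace I"
  shows "poly_act I T p v \<in> fspace I"
proof -
  have "(mvec I T ^^ k) v \<in> fspace I" for k
    using assms by (cases k) (auto intro: mvec_fspace)
  then show ?thesis unfolding poly_act_def by (intro fspace_sum fspace_scale)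
qed

text \<open>Split off a root c, p = (X - c) q. If q(T) v is 0, the degree has dropped; otherwise
  q(T) v is an eigenvector for c.\<close>

lemma eigenvector_of_annihilator:
  fixes T :: "'i \<times> 'i \<Rightarrow> 'k::alg_closed_field"
  assumes T: "T \<in> fspace (I \<times> I)" and v: "v \<in> fspace I" "v \<noteq> 0"
  shows "p \<noteq> 0 \<Longrightarrow> poly_act I T p v = 0 \<Longrightarrow> \<exists>c. \<exists>w\<in>fspace I. w \<noteq> 0 \<and> mvec I T w = fscale c w"
proof (induction "degree p" arbitrary: p)
  case 0
  have "poly_act I T p v = fscale (Polynomial.coeff p 0) v" using 0(1) by (simp add: poly_act_def)
  then have "fscale (Polynomial.coeff p 0) v = 0" using 0(3) by (rule trans[OF sym])
  then have "Polynomial.coeff p 0 = 0" using v(2) unfolding fvs.scale_eq_0_iff by blast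
  then show ?case using 0 by (metis leading_coeff_0_iff)
next
  case (Suc d)
  obtain c where "poly p c = 0" using alg_closed_imp_poly_has_root[of p] Suc by auto
  then obtain q where q: "p = [:- c, 1:] * q" by (auto simp: poly_eq_0_iff_dvd elim: dvdE)
  have q0: "q \<noteq> 0" using Suc q by auto
  then have "degree p = Suc (degree q)" unfolding q by (subst degree_mult_eq) auto
  then have d: "d = degree q" using Suc(2) by simp
  show ?case
  proof (cases "poly_act I T q v = 0")
    case True
    then show ?thesis using Suc(1)[OF d] q0 by blast
  next
    case False
    have "mvec I T (poly_act I T q v) = fscale c (poly_act I T q v)"
      using Suc(4) unfolding q poly_act_linear_factor by simp
    then show ?thesis using False poly_act_fspace[OF T v(1)] by blast
  qed
qed

text \<open>The card I + 1 iterates of a unit vector under T are too many to be independent, which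
  yields a nonzero polynomial annihilating it.\<close>

lemma eigenvector_exists:
  fixes T :: "'i \<times> 'i \<Rightarrow> 'k::alg_closed_field"
  assumes I: "finite I" "I \<noteq> {}" and T: "T \<in> fspace (I \<times> I)"
  obtains c w where "w \<in> fspace I" "w \<noteq> 0" "mvec I T w = fscale c w"
proof -
  obtain i where i: "i \<in> I" using I by auto
  let ?v = "evec i :: 'i \<Rightarrow> 'k"
  have v: "?v \<in> fspace I" using i by (rule evec_fspace)
  have v0: "?v \<noteq> 0" by (auto simp: evec_def fun_eq_iff)
  let ?f = "\<lambda>k. (mvec I T ^^ k) ?v"
  have fI: "?f k \<in> fspace I" for k
    using T v by (cases k) (auto intro: mvec_fspace)
  have "\<exists>p. p \<noteq> 0 \<and> poly_act I T p ?v = 0"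
  \<comment> \<open>Dependence is a property of a set of vectors and does not see repetitions, so
    coinciding iterates are treated apart; they give the polynomial X^l - X^k.\<close>
  proof (cases "inj_on ?f {..card I}")
    case True
    then have c: "card (?f ` {..card I}) = Suc (card I)" by (simp add: card_image)
    have "\<not> fvs.independent (?f ` {..card I})"
    proof
      assume i: "fvs.independent (?f ` {..card I})"
      have "?f ` {..card I} \<subseteq> fspace I" using fI by auto
      from finite_independent_fspace[OF I(1) i this] show False using c by simp
    qed
    then obtain S u s where S: "S \<subseteq> ?f ` {..card I}" "finite S" "(\<Sum>x\<in>S. fscale (u x) x) = 0" "s \<in> S" "u s \<noteq> 0"
      unfolding fvs.dependent_explicit by auto
    define a where "a k = (if k \<le> card I \<and> ?f k \<in> S then u (?f k) else 0)" for k
    define p where "p = (\<Sum>k\<le>card I. Polynomial.monom (a k) k)"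
    have cp: "Polynomial.coeff p k = a k" for k
      by (auto simp: p_def coeff_sum a_def)
    have "degree p \<le> card I" by (rule degree_le) (auto simp: cp a_def)
    then have "poly_act I T p ?v = (\<Sum>k\<le>card I. fscale (a k) (?f k))"
      by (simp add: poly_act_bound cp)
    also have "\<dots> = (\<Sum>k\<in>{k. k \<le> card I \<and> ?f k \<in> S}. fscale (u (?f k)) (?f k))"
      by (intro sum.mono_neutral_cong_right) (auto simp: a_def)
    also have "\<dots> = (\<Sum>x\<in>S. fscale (u x) x)"
    proof -
      have e: "?f ` {k. k \<le> card I \<and> ?f k \<in> S} = S" using S(1) by auto
      have "inj_on ?f {k. k \<le> card I \<and> ?f k \<in> S}" using True by (rule inj_on_subset) auto
      from sum.reindex[OF this, of "\<lambda>x. fscale (u x) x"] show ?thesis unfolding e by (simp add: o_def)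
    qed
    finally have "poly_act I T p ?v = 0" using S by simp
    moreover obtain k where "k \<le> card I" "s = ?f k" using S by auto
    then have "Polynomial.coeff p k \<noteq> 0" using S by (simp add: cp a_def)
    then have "p \<noteq> 0" by auto
    ultimately show ?thesis by blast
  next
    case False
    then obtain k l where kl: "k < l" "?f k = ?f l" unfolding inj_on_def by (metis linorder_neqE_nat)
    let ?p = "Polynomial.monom 1 l - Polynomial.monom 1 k :: 'k poly"
    have "degree ?p \<le> l" using kl by (intro degree_le) (auto simp: coeff_monom)
    then have "poly_act I T ?p ?v = (\<Sum>j\<le>l. (if j = l then ?f l else 0) - (if j = k then ?f k else 0))"
      by (simp add: poly_act_bound) (intro sum.cong, auto)
    also have "\<dots> = ?f l - ?f k"
      using kl by (simp add: sum_subtractf)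
    finally have "poly_act I T ?p ?v = 0" using kl by simp
    moreover have "Polynomial.coeff ?p l \<noteq> 0" using kl by simp
    then have "?p \<noteq> 0" by (metis coeff_0)
    ultimately show ?thesis by blast
  qed
  then show ?thesis using eigenvector_of_annihilator[OF T v v0] that by blast
qed

section \<open>Intertwiners\<close>

text \<open>Nothing multiplicative is asked, so the same facts on intertwiners serve for operators
  from G, from H and from the generators of H.\<close>

definition mrep :: "'x set \<Rightarrow> ('x, 'k::field, 'i) rep \<Rightarrow> bool" where
  "mrep X M \<longleftrightarrow> finite (idx M) \<and> (\<forall>a\<in>X. act M a \<in> fspace (idx M \<times> idx M))"

lemma mrep_finite: "mrep X M \<Longrightarrow> finite (idx M)"
  and mrep_act: "mrep X M \<Longrightarrow> a \<in> X \<Longrightarrow> act M a \<in> fspace (idx M \<times> idx M)"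
  by (auto simp: mrep_def)

lemma HomI: "T \<in> fspace (idx N \<times> idx M) \<Longrightarrow>
    (\<And>a. a \<in> X \<Longrightarrow> mmul (idx M) T (act M a) = mmul (idx N) (act N a) T) \<Longrightarrow> T \<in> Hom X M N"
  by (simp add: Hom_def)

lemma Hom_fspace: "T \<in> Hom X M N \<Longrightarrow> T \<in> fspace (idx N \<times> idx M)"
  and Hom_commute: "T \<in> Hom X M N \<Longrightarrow> a \<in> X \<Longrightarrow> mmul (idx M) T (act M a) = mmul (idx N) (act N a) T"
  by (auto simp: Hom_def)

lemma subspace_Hom: "fvs.subspace (Hom X M N)"
  by (auto simp: fvs.subspace_def Hom_def mmul_add mmul_scale mmul_zero intro: fspace_add fspace_scale)

lemma Hom_comp:
  assumes "finite (idx M)" "finite (idx N)" "finite (idx L)"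
    and P: "P \<in> Hom X M N" and Q: "Q \<in> Hom X N L"
  shows "mmul (idx N) Q P \<in> Hom X M L"
proof (rule HomI)
  fix a assume a: "a \<in> X"
  have "mmul (idx M) (mmul (idx N) Q P) (act M a) = mmul (idx N) Q (mmul (idx M) P (act M a))"
    using assms by (simp add: mmul_assoc)
  also have "\<dots> = mmul (idx N) (mmul (idx N) Q (act N a)) P"
    using assms a by (simp add: mmul_assoc Hom_commute[OF P])
  also have "\<dots> = mmul (idx L) (act L a) (mmul (idx N) Q P)"
    using assms a by (simp add: mmul_assoc Hom_commute[OF Q])
  finally show "mmul (idx M) (mmul (idx N) Q P) (act M a) = mmul (idx L) (act L a) (mmul (idx N) Q P)" .
qed (use Hom_fspace[OF P] Hom_fspace[OF Q] in \<open>rule mmul_closed[rotated]\<close>)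

lemma Hom_id: "mrep X M \<Longrightarrow> idmat (idx M) \<in> Hom X M M"
  by (rule HomI) (auto simp: mrep_def mmul_idmat_left[of _ _ "idx M"] mmul_idmat_right[of _ _ "idx M"])

lemma Hom_inverse:
  assumes M: "mrep X M" and N: "mrep X N" and T: "T \<in> Hom X M N" and S: "S \<in> fspace (idx M \<times> idx N)"
    and ST: "mmul (idx N) S T = idmat (idx M)" and TS: "mmul (idx M) T S = idmat (idx N)"
  shows "S \<in> Hom X N M"
proof (rule HomI[OF S])
  fix a assume a: "a \<in> X"
  note fin = mrep_finite[OF M] mrep_finite[OF N]
  have "mmul (idx N) S (act N a) = mmul (idx N) S (mmul (idx N) (act N a) (mmul (idx M) T S))"
    using TS mrep_act[OF N a] fin by (simp add: mmul_idmat_right)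
  also have "\<dots> = mmul (idx N) S (mmul (idx M) (mmul (idx N) (act N a) T) S)"
    using fin by (simp add: mmul_assoc)
  also have "\<dots> = mmul (idx M) (mmul (idx N) S T) (mmul (idx M) (act M a) S)"
    using fin by (simp add: mmul_assoc flip: Hom_commute[OF T a])
  also have "\<dots> = mmul (idx M) (act M a) S"
    using mmul_closed[OF mrep_act[OF M a] S] fin by (simp add: ST mmul_idmat_left)
  finally show "mmul (idx N) S (act N a) = mmul (idx M) (act M a) S" .
qed

lemma rep_isoI:
  assumes "mrep X M" "mrep X N" "T \<in> Hom X M N" "S \<in> fspace (idx M \<times> idx N)"
    "mmul (idx N) S T = idmat (idx M)" "mmul (idx M) T S = idmat (idx N)"
  shows "rep_iso X M N"
  using Hom_inverse[OF assms] assms unfolding rep_iso_def by blast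

lemma rep_iso_refl: "mrep X M \<Longrightarrow> rep_iso X M M"
  using Hom_id[of X M] mmul_idmat_left[OF mrep_finite idmat_fspace, of X M]
  unfolding rep_iso_def by blast

lemma rep_iso_sym: "rep_iso X M N \<Longrightarrow> rep_iso X N M"
  unfolding rep_iso_def by blast

lemma rep_iso_trans:
  assumes fin: "finite (idx M)" "finite (idx N)" "finite (idx L)"
    and MN: "rep_iso X M N" and NL: "rep_iso X N L"
  shows "rep_iso X M L"
proof -
  obtain P Q where PQ: "P \<in> Hom X M N" "Q \<in> Hom X N M"
    "mmul (idx N) Q P = idmat (idx M)" "mmul (idx M) P Q = idmat (idx N)"
    using MN unfolding rep_iso_def by blast
  obtain P' Q' where PQ': "P' \<in> Hom X N L" "Q' \<in> Hom X L N"
    "mmul (idx L) Q' P' = idmat (idx N)" "mmul (idx N) P' Q' = idmat (idx L)"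
    using NL unfolding rep_iso_def by blast
  have "mmul (idx L) (mmul (idx N) Q Q') (mmul (idx N) P' P)
      = mmul (idx N) Q (mmul (idx N) (mmul (idx L) Q' P') P)"
    using fin by (simp add: mmul_assoc)
  then have 1: "mmul (idx L) (mmul (idx N) Q Q') (mmul (idx N) P' P) = idmat (idx M)"
    using fin PQ PQ' Hom_fspace[OF PQ(1)] by (simp add: mmul_idmat_left)
  have "mmul (idx M) (mmul (idx N) P' P) (mmul (idx N) Q Q')
      = mmul (idx N) P' (mmul (idx N) (mmul (idx M) P Q) Q')"
    using fin by (simp add: mmul_assoc)
  then have 2: "mmul (idx M) (mmul (idx N) P' P) (mmul (idx N) Q Q') = idmat (idx L)"
    using fin PQ PQ' Hom_fspace[OF PQ'(2)] by (simp add: mmul_idmat_left)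
  show ?thesis unfolding rep_iso_def
    using Hom_comp[OF fin PQ(1) PQ'(1)] Hom_comp[OF fin(3,2,1) PQ'(2) PQ(2)] 1 2 by blast
qed

lemma rep_iso_card:
  assumes "finite (idx M)" "finite (idx N)" "rep_iso X M N"
  shows "card (idx M) = card (idx N)"
  using assms unfolding rep_iso_def by (meson Hom_fspace inverse_card_eq)

text \<open>Sending T to P' T Q is a linear bijection of the Hom spaces with inverse T to Q' T
  P.\<close>

lemma dim_Hom_iso:
  assumes fin: "finite (idx M)" "finite (idx M')" "finite (idx N)" "finite (idx N')"
    and MN: "rep_iso X M M'" and NL: "rep_iso X N N'"
  shows "fvs.dim (Hom X M N) = fvs.dim (Hom X M' N')"
proof -
  obtain P Q where PQ: "P \<in> Hom X M M'" "Q \<in> Hom X M' M"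
    "mmul (idx M') Q P = idmat (idx M)" "mmul (idx M) P Q = idmat (idx M')"
    using MN unfolding rep_iso_def by blast
  obtain P' Q' where PQ': "P' \<in> Hom X N N'" "Q' \<in> Hom X N' N"
    "mmul (idx N') Q' P' = idmat (idx N)" "mmul (idx N) P' Q' = idmat (idx N')"
    using NL unfolding rep_iso_def by blast
  let ?f = "\<lambda>T. mmul (idx N) P' (mmul (idx M) T Q)"
  let ?g = "\<lambda>T. mmul (idx N') Q' (mmul (idx M') T P)"
  have lin: "Vector_Spaces.linear fscale fscale ?f"
    by (intro linearI) (simp_all add: mmul_add mmul_scale)
  have gf: "?g (?f T) = T" if "T \<in> Hom X M N" for T
  proof -
    have "?g (?f T) = mmul (idx N) (mmul (idx N') Q' P') (mmul (idx M) T (mmul (idx M') Q P))"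
      using fin by (simp add: mmul_assoc)
    then show ?thesis
      using fin PQ PQ' Hom_fspace[OF that] by (simp add: mmul_idmat_left mmul_idmat_right)
  qed
  have fg: "?f (?g T) = T" if "T \<in> Hom X M' N'" for T
  proof -
    have "?f (?g T) = mmul (idx N') (mmul (idx N) P' Q') (mmul (idx M') T (mmul (idx M) P Q))"
      using fin by (simp add: mmul_assoc)
    then show ?thesis
      using fin PQ PQ' Hom_fspace[OF that] by (simp add: mmul_idmat_left mmul_idmat_right)
  qed
  have f: "?f T \<in> Hom X M' N'" if "T \<in> Hom X M N" for T
    using that fin PQ PQ' by (auto intro!: Hom_comp)
  have g: "?g T \<in> Hom X M N" if "T \<in> Hom X M' N'" for T
    using that fin PQ PQ' by (auto intro!: Hom_comp)
  have "?f ` Hom X M N = Hom X M' N'"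
  proof
    show "Hom X M' N' \<subseteq> ?f ` Hom X M N"
    proof
      fix T assume "T \<in> Hom X M' N'"
      then show "T \<in> ?f ` Hom X M N" by (intro image_eqI[of _ ?f, OF fg[symmetric] g])
    qed
  qed (use f in auto)
  moreover have "inj_on ?f (Hom X M N)" using gf by (rule inj_on_inverseI[of _ ?g])
  ultimately show ?thesis using dim_image_inj[OF lin subspace_Hom] by metis
qed

lemma mmul_sum_left: "mmul J (\<Sum>x\<in>X. f x) B = (\<Sum>x\<in>X. mmul J (f x) B)"
  and mmul_sum_right: "mmul J A (\<Sum>x\<in>X. g x) = (\<Sum>x\<in>X. mmul J A (g x))"
  by (auto simp: mmul_def fun_eq_iff sum_fun_app sum_distrib_left sum_distrib_right intro: sum.swap)

section \<open>Renaming the basis and restricting to a stable subspace\<close>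

definition perm_mat :: "'i set \<Rightarrow> ('i \<Rightarrow> 'j) \<Rightarrow> 'j \<times> 'i \<Rightarrow> 'k::field" where
  "perm_mat I \<beta> = (\<lambda>(j, i). if i \<in> I \<and> j = \<beta> i then 1 else 0)"

lemma mmul_perm_mat_left:
  assumes "bij_betw \<beta> I J" "finite I" "i \<in> I"
  shows "mmul I (perm_mat I \<beta>) A (\<beta> i, l) = A (i, l)"
proof -
  have "mmul I (perm_mat I \<beta>) A (\<beta> i, l) = (\<Sum>j\<in>I. if j = i then A (i, l) else 0)"
    unfolding mmul_def perm_mat_def prod.case using assms
    by (intro sum.cong) (auto simp: bij_betw_def inj_on_eq_iff)
  then show ?thesis using assms by simp
qed

lemma mmul_perm_mat_right:
  assumes "bij_betw \<beta> I J" "finite J" "i \<in> I"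
  shows "mmul J A (perm_mat I \<beta>) (l, i) = A (l, \<beta> i)"
proof -
  have "mmul J A (perm_mat I \<beta>) (l, i) = (\<Sum>j\<in>J. if j = \<beta> i then A (l, j) else 0)"
    unfolding mmul_def perm_mat_def prod.case using assms by (intro sum.cong) auto
  also have "\<dots> = A (l, \<beta> i)" using assms by (simp add: bij_betwE)
  finally show ?thesis .
qed

lemma perm_mat_fspace: "bij_betw \<beta> I J \<Longrightarrow> perm_mat I \<beta> \<in> fspace (J \<times> I)"
  by (auto simp: perm_mat_def fspace_def bij_betw_def)

lemma perm_mat_inverse:
  assumes b: "bij_betw \<beta> I J" and I: "finite I"
  shows "mmul J (perm_mat J (inv_into I \<beta>)) (perm_mat I \<beta>) = idmat I"
    "mmul I (perm_mat I \<beta>) (perm_mat J (inv_into I \<beta>)) = idmat J"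
proof -
  have J: "finite J" using b I bij_betw_finite by blast
  have b': "bij_betw (inv_into I \<beta>) J I" using b by (rule bij_betw_inv_into)
  show "mmul J (perm_mat J (inv_into I \<beta>)) (perm_mat I \<beta>) = idmat I"
    using b b' I J
    by (intro fspace_eqI[OF mmul_closed[OF perm_mat_fspace[OF b'] perm_mat_fspace[OF b]] idmat_fspace])
      (auto simp: mmul_perm_mat_right, auto simp: perm_mat_def idmat_def bij_betwE bij_betw_inv_into_left)
  show "mmul I (perm_mat I \<beta>) (perm_mat J (inv_into I \<beta>)) = idmat J"
    using b b' I J
    by (intro fspace_eqI[OF mmul_closed[OF perm_mat_fspace[OF b] perm_mat_fspace[OF b']] idmat_fspace])
      (auto simp: mmul_perm_mat_right, auto simp: perm_mat_def idmat_def bij_betwE bij_betw_inv_into_right)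
qed

text \<open>Associativity, the unit and distributivity of tensor products only rename basis vectors;
  for them an isomorphism reduces to comparing matrix entries.\<close>

lemma relabel_iso:
  assumes M: "mrep X M" and N: "mrep X N" and b: "bij_betw \<beta> (idx M) (idx N)"
    and e: "\<And>a s t. a \<in> X \<Longrightarrow> s \<in> idx M \<Longrightarrow> t \<in> idx M \<Longrightarrow> act M a (s, t) = act N a (\<beta> s, \<beta> t)"
  shows "rep_iso X M N"
proof (rule rep_isoI[OF M N, of "perm_mat (idx M) \<beta>" "perm_mat (idx N) (inv_into (idx M) \<beta>)"])
  note fin = mrep_finite[OF M] mrep_finite[OF N]
  show "perm_mat (idx M) \<beta> \<in> Hom X M N"
  proof (rule HomI[OF perm_mat_fspace[OF b]])
    fix a assume a: "a \<in> X"
    show "mmul (idx M) (perm_mat (idx M) \<beta>) (act M a) = mmul (idx N) (act N a) (perm_mat (idx M) \<beta>)"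
    proof (rule fspace_eqI[OF mmul_closed mmul_closed])
      fix p assume "p \<in> idx N \<times> idx M"
      then have "fst p \<in> \<beta> ` idx M" "snd p \<in> idx M" using b by (auto simp: bij_betw_def)
      then obtain s t where p: "p = (\<beta> s, t)" "s \<in> idx M" "t \<in> idx M"
        by (metis imageE prod.collapse)
      then show "mmul (idx M) (perm_mat (idx M) \<beta>) (act M a) p = mmul (idx N) (act N a) (perm_mat (idx M) \<beta>) p"
        using e[OF a] by (simp add: mmul_perm_mat_left[OF b fin(1)] mmul_perm_mat_right[OF b fin(2)])
    qed (use perm_mat_fspace[OF b] mrep_act[OF M a] mrep_act[OF N a] in auto)
  qed
qed (use perm_mat_inverse[OF b mrep_finite[OF M]] perm_mat_fspace bij_betw_inv_into[OF b] in auto)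

text \<open>When B is the inclusion of a subspace in coordinates and A a left inverse of it, these
  are the matrices of the action restricted to that subspace.\<close>

definition compress :: "'j set \<Rightarrow> ('j \<times> 'i \<Rightarrow> 'k::field) \<Rightarrow> ('i \<times> 'j \<Rightarrow> 'k) \<Rightarrow> ('x, 'k, 'i) rep \<Rightarrow> ('x, 'k, 'j) rep" where
  "compress J A B M = \<lparr>idx = J, act = (\<lambda>a. mmul (idx M) A (mmul (idx M) (act M a) B))\<rparr>"

lemma compress_sel [simp]: "idx (compress J A B M) = J"
  "act (compress J A B M) a = mmul (idx M) A (mmul (idx M) (act M a) B)"
  by (simp_all add: compress_def)

text \<open>Assumption \<open>stable\<close> expresses invariance of the image of B: the product B A
  is the identity exactly on that image, and it must fix every a B.\<close>

locale compression =
  fixes X :: "'x set" and M :: "('x, 'k::field, 'i) rep" and J :: "'j set" and A B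
  assumes M: "mrep X M" and J: "finite J" and A: "A \<in> fspace (J \<times> idx M)" and B: "B \<in> fspace (idx M \<times> J)"
    and AB: "mmul (idx M) A B = idmat J"
    and stable: "\<And>a. a \<in> X \<Longrightarrow> mmul J B (mmul (idx M) A (mmul (idx M) (act M a) B)) = mmul (idx M) (act M a) B"
begin

lemma fin: "finite (idx M)" using M by (rule mrep_finite)

lemma mrep_compress: "mrep X (compress J A B M)"
  using J A B mrep_act[OF M] unfolding mrep_def by (auto intro!: mmul_closed)

lemma B_Hom: "B \<in> Hom X (compress J A B M) M"
  using B by (intro HomI) (simp_all add: stable)

lemma compress_mult:
  assumes "a \<in> X" "b \<in> X" "act M c = mmul (idx M) (act M a) (act M b)"
  shows "act (compress J A B M) c = mmul J (act (compress J A B M) a) (act (compress J A B M) b)"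
proof -
  have "mmul J (act (compress J A B M) a) (act (compress J A B M) b)
     = mmul (idx M) A (mmul (idx M) (act M a) (mmul J B (mmul (idx M) A (mmul (idx M) (act M b) B))))"
    using fin J by (simp add: mmul_assoc)
  then show ?thesis using assms fin by (simp add: stable mmul_assoc)
qed

lemma compress_one: "act M c = idmat (idx M) \<Longrightarrow> act (compress J A B M) c = idmat J"
  using fin B by (simp add: mmul_idmat_left AB)

end

section \<open>Representations of the group\<close>

lemma grep_finite: "grep D U \<Longrightarrow> finite (idx U)"
  by (simp add: grep_def)

context
  fixes D :: "('g, 'k::field) datum"
  assumes D: "nilpotent_datum D"
begin

interpretation G: group "grp D" using D by (simp add: nilpotent_datum_def)

lemma grep_act: "grep D U \<Longrightarrow> h \<in> carrier (grp D) \<Longrightarrow> act U h \<in> fspace (idx U \<times> idx U)"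
  and grep_mult: "grep D U \<Longrightarrow> h \<in> carrier (grp D) \<Longrightarrow> k \<in> carrier (grp D) \<Longrightarrow>
    act U (h \<otimes>\<^bsub>grp D\<^esub> k) = mmul (idx U) (act U h) (act U k)"
  and grep_one: "grep D U \<Longrightarrow> act U \<one>\<^bsub>grp D\<^esub> = idmat (idx U)"
proof -
  assume U: "grep D U"
  then interpret R: ring "mat_ring (idx U)" by (simp add: grep_def ring_mat_ring)
  have hom: "act U \<in> hom (grp D) (units_of (mat_ring (idx U)))" using U by (simp add: grep_def)
  show "act U h \<in> fspace (idx U \<times> idx U)" if "h \<in> carrier (grp D)"
    using hom that by (auto simp: hom_def units_of_def Units_def Pi_def mat_ring_def)
  show "act U (h \<otimes>\<^bsub>grp D\<^esub> k) = mmul (idx U) (act U h) (act U k)"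
    if "h \<in> carrier (grp D)" "k \<in> carrier (grp D)"
    using hom that by (auto simp: hom_def units_of_def mat_ring_def)
  show "act U \<one>\<^bsub>grp D\<^esub> = idmat (idx U)"
    using hom_one[OF hom G.is_group R.units_group] by (simp add: units_of_def mat_ring_def)
qed

lemma grep_inv: "grep D U \<Longrightarrow> h \<in> carrier (grp D) \<Longrightarrow> mmul (idx U) (act U h) (act U (inv\<^bsub>grp D\<^esub> h)) = idmat (idx U)"
  "grep D U \<Longrightarrow> h \<in> carrier (grp D) \<Longrightarrow> mmul (idx U) (act U (inv\<^bsub>grp D\<^esub> h)) (act U h) = idmat (idx U)"
  by (simp_all add: grep_one flip: grep_mult)

lemma mat_hom_units:
  assumes I: "finite I" and R: "\<And>h. h \<in> carrier (grp D) \<Longrightarrow> R h \<in> fspace (I \<times> I)"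
    "\<And>h k. h \<in> carrier (grp D) \<Longrightarrow> k \<in> carrier (grp D) \<Longrightarrow> R (h \<otimes>\<^bsub>grp D\<^esub> k) = mmul I (R h) (R k)"
    "R \<one>\<^bsub>grp D\<^esub> = idmat I"
  shows "R \<in> hom (grp D) (units_of (mat_ring I))"
proof (rule homI)
  fix h assume h: "h \<in> carrier (grp D)"
  have "mmul I (R (inv\<^bsub>grp D\<^esub> h)) (R h) = idmat I" "mmul I (R h) (R (inv\<^bsub>grp D\<^esub> h)) = idmat I"
    using h R(3) by (simp_all flip: R(2))
  then show "R h \<in> carrier (units_of (mat_ring I))"
    using R(1) h by (auto simp: units_of_def Units_def mat_ring_def intro!: bexI[of _ "R (inv\<^bsub>grp D\<^esub> h)"])
qed (use R in \<open>simp add: units_of_def mat_ring_def\<close>)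

lemma grepI:
  assumes I: "finite (idx U)" and R: "\<And>h. h \<in> carrier (grp D) \<Longrightarrow> act U h \<in> fspace (idx U \<times> idx U)"
    "\<And>h k. h \<in> carrier (grp D) \<Longrightarrow> k \<in> carrier (grp D) \<Longrightarrow> act U (h \<otimes>\<^bsub>grp D\<^esub> k) = mmul (idx U) (act U h) (act U k)"
    "act U \<one>\<^bsub>grp D\<^esub> = idmat (idx U)"
  shows "grep D U"
  using mat_hom_units[of "idx U" "act U"] assms unfolding grep_def by blast

lemma grep_mrep: "grep D U \<Longrightarrow> mrep (carrier (grp D)) U"
  by (auto simp: mrep_def grep_finite grep_act)

text \<open>The average over the group of any generalized inverse of an intertwiner is again a
  generalized inverse.\<close>

lemma maschke:
  assumes char: "of_nat (card (carrier (grp D))) \<noteq> (0::'k)"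
    and M: "grep D M" and N: "grep D N" and F: "F \<in> Hom (carrier (grp D)) M N"
  obtains T where "T \<in> Hom (carrier (grp D)) N M" "mmul (idx M) F (mmul (idx N) T F) = F"
proof -
  let ?G = "carrier (grp D)" and ?I = "idx M" and ?J = "idx N"
  note fin = grep_finite[OF M] grep_finite[OF N]
  have finG: "finite ?G" using D by (simp add: nilpotent_datum_def)
  obtain S where S: "S \<in> fspace (?I \<times> ?J)" "mmul ?I F (mmul ?J S F) = F"
    using generalized_inverse[OF Hom_fspace[OF F] fin] by blast
  let ?t = "\<lambda>h. mmul ?I (act M h) (mmul ?J S (act N (inv\<^bsub>grp D\<^esub> h)))"
  let ?c = "inverse (of_nat (card ?G)) :: 'k"
  let ?T = "fscale ?c (\<Sum>h\<in>?G. ?t h)"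
  have T: "?T \<in> fspace (?I \<times> ?J)"
    using S by (auto intro!: fspace_scale fspace_sum mmul_closed grep_act[OF M] grep_act[OF N])
  have "?T \<in> Hom ?G N M"
  proof (rule HomI[OF T])
    fix k assume k: "k \<in> ?G"
    have "mmul ?J (\<Sum>h\<in>?G. ?t h) (act N k) = (\<Sum>h\<in>?G. mmul ?J (?t h) (act N k))"
      by (simp add: mmul_sum_left mmul_sum_right)
    also have "\<dots> = (\<Sum>h\<in>?G. mmul ?I (act M h) (mmul ?J S (act N (inv\<^bsub>grp D\<^esub> h \<otimes>\<^bsub>grp D\<^esub> k))))"
      using fin k by (intro sum.cong refl) (simp add: mmul_assoc grep_mult[OF N])
    also have "\<dots> = (\<Sum>h\<in>?G. mmul ?I (act M (k \<otimes>\<^bsub>grp D\<^esub> h)) (mmul ?J S (act N (inv\<^bsub>grp D\<^esub> h))))"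
    proof (rule sum.reindex_bij_witness[of _ "\<lambda>h. k \<otimes>\<^bsub>grp D\<^esub> h" "\<lambda>h. inv\<^bsub>grp D\<^esub> k \<otimes>\<^bsub>grp D\<^esub> h"])
    qed (use k in \<open>auto simp: G.inv_mult_group simp flip: G.m_assoc\<close>)
    also have "\<dots> = (\<Sum>h\<in>?G. mmul ?I (act M k) (?t h))"
      using fin k by (intro sum.cong refl) (simp add: mmul_assoc grep_mult[OF M])
    also have "\<dots> = mmul ?I (act M k) (\<Sum>h\<in>?G. ?t h)"
      by (simp add: mmul_sum_left mmul_sum_right)
    finally show "mmul ?J ?T (act N k) = mmul ?I (act M k) ?T"
      by (simp add: mmul_scale)
  qed
  moreover have "mmul ?I F (mmul ?J ?T F) = F"
  proof -
    \<comment> \<open>Each conjugate of S by a group element is again a generalized inverse, because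
      F passes h on both sides; so their average is one too.\<close>
    have "mmul ?I F (mmul ?J (?t h) F) = F" if h: "h \<in> ?G" for h
    proof -
      have "mmul ?I F (mmul ?J (?t h) F)
          = mmul ?I (mmul ?I F (act M h)) (mmul ?J S (mmul ?J (act N (inv\<^bsub>grp D\<^esub> h)) F))"
        using fin by (simp add: mmul_assoc)
      also have "\<dots> = mmul ?I (mmul ?J (act N h) F) (mmul ?J S (mmul ?I F (act M (inv\<^bsub>grp D\<^esub> h))))"
        using h by (simp add: Hom_commute[OF F])
      also have "\<dots> = mmul ?J (act N h) (mmul ?I (mmul ?I F (mmul ?J S F)) (act M (inv\<^bsub>grp D\<^esub> h)))"
        using fin by (simp add: mmul_assoc)
      also have "\<dots> = mmul ?J (act N h) (mmul ?J (act N (inv\<^bsub>grp D\<^esub> h)) F)"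
        using h by (simp add: S Hom_commute[OF F])
      also have "\<dots> = mmul ?J (mmul ?J (act N h) (act N (inv\<^bsub>grp D\<^esub> h))) F"
        using fin by (simp add: mmul_assoc)
      also have "\<dots> = F" using h fin Hom_fspace[OF F] by (simp add: grep_inv[OF N] mmul_idmat_left)
      finally show ?thesis .
    qed
    then have "mmul ?I F (mmul ?J ?T F) = fscale ?c (\<Sum>h\<in>?G. F)"
      by (simp add: mmul_scale mmul_sum_left mmul_sum_right)
    also have "\<dots> = F"
      using char by (auto simp: fscale_def fun_eq_iff sum_fun_app)
    finally show ?thesis .
  qed
  ultimately show ?thesis by (rule that)
qed

text \<open>The kernel is stable under G. By simplicity it is zero or everything, and the second
  would give T = 0.\<close>

lemma simple_grep_injective:
  assumes M: "simple_grep D M" and N: "grep D N" and T: "T \<in> Hom (carrier (grp D)) M N" "T \<noteq> 0"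
    and v: "v \<in> fspace (idx M)" "mvec (idx M) T v = 0"
  shows "v = 0"
proof -
  have Mg: "grep D M" using M by (simp add: simple_grep_def)
  note fin = grep_finite[OF Mg] grep_finite[OF N]
  let ?K = "{v \<in> fspace (idx M). mvec (idx M) T v = 0}"
  interpret l: Vector_Spaces.linear fscale fscale "mvec (idx M) T" by (rule linear_mvec)
  have "fvs.subspace ?K"
    by (auto simp: fvs.subspace_def mvec_add mvec_scale mvec_zero intro: fspace_add fspace_scale)
  moreover have "mvec (idx M) (act M h) w \<in> ?K" if h: "h \<in> carrier (grp D)" and w: "w \<in> ?K" for h w
  proof -
    have "mvec (idx M) T (mvec (idx M) (act M h) w) = mvec (idx N) (act N h) (mvec (idx M) T w)"
      using fin Hom_commute[OF T(1) h] by (simp flip: mvec_mmul)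
    then show ?thesis using w mvec_fspace[OF grep_act[OF Mg h]] by (auto simp: mvec_zero)
  qed
  ultimately have "?K = {0} \<or> ?K = fspace (idx M)"
    using M unfolding simple_grep_def by (metis (no_types, lifting) mem_Collect_eq subsetI)
  moreover have "?K \<noteq> fspace (idx M)"
  proof
    assume K: "?K = fspace (idx M)"
    have "T = 0"
      using K by (intro mat_eqI[OF fin(1) Hom_fspace[OF T(1)] fspace_zero]) (auto simp: mvec_zero)
    then show False using T by simp
  qed
  ultimately show "v = 0" using v by blast
qed

text \<open>Kernel and image are both stable, so T is injective and onto; a generalized inverse of T
  is then a two-sided inverse.\<close>

lemma schur_iso:
  fixes M :: "('g, 'k, 'i) rep" and N :: "('g, 'k, 'j) rep"
  assumes M: "simple_grep D M" and N: "simple_grep D N" and T: "T \<in> Hom (carrier (grp D)) M N" "T \<noteq> 0"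
  shows "rep_iso (carrier (grp D)) M N"
proof -
  have Mg: "grep D M" "grep D N" using M N by (simp_all add: simple_grep_def)
  note fin = grep_finite[OF Mg(1)] grep_finite[OF Mg(2)]
  let ?W = "mvec (idx M) T ` fspace (idx M)"
  interpret l: Vector_Spaces.linear fscale fscale "mvec (idx M) T" by (rule linear_mvec)
  have "fvs.subspace ?W" by (rule l.subspace_image) simp
  moreover have WN: "?W \<subseteq> fspace (idx N)" using Hom_fspace[OF T(1)] by (auto intro: mvec_fspace)
  moreover have "mvec (idx N) (act N h) w \<in> ?W" if h: "h \<in> carrier (grp D)" and w: "w \<in> ?W" for h w
  proof -
    obtain v where v: "v \<in> fspace (idx M)" "w = mvec (idx M) T v" using w by auto
    have "mvec (idx N) (act N h) w = mvec (idx M) T (mvec (idx M) (act M h) v)"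
      using fin Hom_commute[OF T(1) h] v(2) by (simp flip: mvec_mmul)
    then show ?thesis using mvec_fspace[OF grep_act[OF Mg(1) h]] by auto
  qed
  ultimately have "?W = {0} \<or> ?W = fspace (idx N)"
    using N unfolding simple_grep_def by blast
  moreover have "?W \<noteq> {0}"
  proof
    assume K: "?W = {0}"
    have "T = 0"
      using K by (intro mat_eqI[OF fin(1) Hom_fspace[OF T(1)] fspace_zero]) (auto simp: mvec_zero)
    then show False using T by simp
  qed
  ultimately have W: "?W = fspace (idx N)" by blast
  obtain S where S: "S \<in> fspace (idx M \<times> idx N)" "mmul (idx M) T (mmul (idx N) S T) = T"
    using generalized_inverse[OF Hom_fspace[OF T(1)] fin] by blast
  have ST: "mmul (idx N) S T = idmat (idx M)"
    using simple_grep_injective[OF M Mg(2) T] by (intro injective_left_inverse[OF Hom_fspace[OF T(1)] fin _ S])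
  have "mmul (idx M) T S = idmat (idx N)"
  proof (rule mat_eqI[OF fin(2)])
    fix w :: "'j \<Rightarrow> 'k" assume w: "w \<in> fspace (idx N)"
    then obtain v where v: "v \<in> fspace (idx M)" "w = mvec (idx M) T v" using W by auto
    have "mvec (idx N) (mmul (idx M) T S) w = mvec (idx M) (mmul (idx M) T (mmul (idx N) S T)) v"
      using fin by (simp add: v(2) mvec_mmul)
    then show "mvec (idx N) (mmul (idx M) T S) w = mvec (idx N) (idmat (idx N)) w"
      using S v w fin by (simp add: mvec_idmat)
  qed (use S Hom_fspace[OF T(1)] in \<open>auto intro: mmul_closed\<close>)
  then show ?thesis
    using rep_isoI[OF grep_mrep[OF Mg(1)] grep_mrep[OF Mg(2)] T(1) S(1) ST] by simp
qed

end

text \<open>For an eigenvalue c the intertwiner T - c has a nonzero kernel, so it cannot be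
  injective and must be 0.\<close>

lemma schur_scalar:
  fixes D :: "('g, 'k::alg_closed_field) datum"
  assumes D: "nilpotent_datum D" and M: "simple_grep D M" and T: "T \<in> Hom (carrier (grp D)) M M"
  obtains c where "T = fscale c (idmat (idx M))"
proof -
  have Mg: "grep D M" using M by (simp add: simple_grep_def)
  obtain c w where w: "w \<in> fspace (idx M)" "w \<noteq> 0" "mvec (idx M) T w = fscale c w"
    using eigenvector_exists[OF grep_finite[OF Mg] _ Hom_fspace[OF T]] M unfolding simple_grep_def by metis
  let ?S = "T - fscale c (idmat (idx M))"
  have S: "?S \<in> Hom (carrier (grp D)) M M"
    by (intro fvs.subspace_diff[OF subspace_Hom] fvs.subspace_scale[OF subspace_Hom] T Hom_id grep_mrep[OF D Mg])
  have "mvec (idx M) ?S w = 0"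
    using w grep_finite[OF Mg] by (simp add: mvec_diff_left mvec_scale_left mvec_idmat)
  then have "?S = 0" using simple_grep_injective[OF D M Mg S _ w(1)] w(2) by blast
  then show ?thesis by (intro that[of c]) simp
qed

lemma complete_simples_simple: "complete_simples D m V \<Longrightarrow> i \<in> {1..m} \<Longrightarrow> simple_grep D (V i)"
  unfolding complete_simples_def by (drule conjunct1) (rule bspec)

lemma complete_simples_distinct:
  "complete_simples D m V \<Longrightarrow> i \<in> {1..m} \<Longrightarrow> k \<in> {1..m} \<Longrightarrow> rep_iso (carrier (grp D)) (V i) (V k) \<Longrightarrow> i = k"
  unfolding complete_simples_def by (drule conjunct2, drule conjunct1) blast

lemma complete_simples_complete:
  fixes U :: "('g, 'k::field, nat) rep"
  shows
  "complete_simples D m V \<Longrightarrow> simple_grep D U \<Longrightarrow> \<exists>i\<in>{1..m}. rep_iso (carrier (grp D)) U (V i)"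
  unfolding complete_simples_def by (drule conjunct2, drule conjunct2) blast

lemma dim_Hom_simple:
  fixes D :: "('g, 'k::alg_closed_field) datum"
  assumes D: "nilpotent_datum D" and V: "complete_simples D m V" and i: "i \<in> {1..m}" "k \<in> {1..m}"
  shows "fvs.dim (Hom (carrier (grp D)) (V i) (V k)) = (if i = k then 1 else 0)"
proof -
  have s: "simple_grep D (V i)" "simple_grep D (V k)" using complete_simples_simple[OF V] i by auto
  show ?thesis
  proof (cases "i = k")
    case True
    have Vg: "grep D (V k)" using s by (simp add: simple_grep_def)
    let ?e = "idmat (idx (V k)) :: nat \<times> nat \<Rightarrow> 'k"
    have "Hom (carrier (grp D)) (V i) (V k) = fvs.span {?e}"
    proof
      show "Hom (carrier (grp D)) (V i) (V k) \<subseteq> fvs.span {?e}"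
      proof
        fix T assume "T \<in> Hom (carrier (grp D)) (V i) (V k)"
        then have T: "T \<in> Hom (carrier (grp D)) (V k) (V k)" using True by simp
        obtain c where c: "T = fscale c ?e" by (rule schur_scalar[OF D s(2) T])
        show "T \<in> fvs.span {?e}" unfolding c by (intro fvs.span_scale fvs.span_base) simp
      qed
      have "?e \<in> Hom (carrier (grp D)) (V i) (V k)" using Hom_id[OF grep_mrep[OF D Vg]] True by simp
      then show "fvs.span {?e} \<subseteq> Hom (carrier (grp D)) (V i) (V k)"
        by (intro fvs.span_minimal subspace_Hom) auto
    qed
    moreover have "?e \<noteq> 0"
    proof
      assume "?e = 0"
      obtain s where "s \<in> idx (V k)" using s by (auto simp: simple_grep_def)
      then have "?e (s, s) = 1" by (simp add: idmat_def)
      then show False using \<open>?e = 0\<close> by simp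
    qed
    ultimately show ?thesis using True fvs.dim_span_eq_card_independent[of "{?e}"] by simp
  next
    case False
    then have "\<not> rep_iso (carrier (grp D)) (V i) (V k)"
      using complete_simples_distinct[OF V i] by blast
    then have "Hom (carrier (grp D)) (V i) (V k) \<subseteq> {0}"
      using schur_iso[OF D s] by auto
    then have "fvs.dim (Hom (carrier (grp D)) (V i) (V k)) \<le> card ({} :: (nat \<times> nat \<Rightarrow> 'k) set)"
      by (intro fvs.dim_le_card) auto
    then show ?thesis using False by simp
  qed
qed

text \<open>By Maschke there is an idempotent intertwiner E = T F with F E = F, and F is injective
  on the image of E. A minimal stable subspace of that image is simple, hence a copy of some V i,
  and F does not vanish on it.\<close>

lemma simple_constituent:
  fixes D :: "('g, 'k::field) datum" and N :: "('g, 'k, 'i) rep" and L :: "('g, 'k, 'j) rep"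
  assumes D: "nilpotent_datum D" and char: "of_nat (card (carrier (grp D))) \<noteq> (0::'k)"
    and V: "complete_simples D m V"
    and N: "grep D N" and L: "grep D L" and F: "F \<in> Hom (carrier (grp D)) N L" "F \<noteq> 0"
  obtains i \<sigma> where "i \<in> {1..m}" "\<sigma> \<in> Hom (carrier (grp D)) (V i) N" "mmul (idx N) F \<sigma> \<noteq> 0"
proof -
  let ?G = "carrier (grp D)" and ?I = "idx N"
  interpret G: group "grp D" using D by (simp add: nilpotent_datum_def)
  note fin = grep_finite[OF N] grep_finite[OF L]
  obtain T where T: "T \<in> Hom ?G L N" "mmul ?I F (mmul (idx L) T F) = F"
    by (rule maschke[OF D char N L F(1)])
  define E where "E = mmul (idx L) T F"
  have E: "E \<in> Hom ?G N N" unfolding E_def by (rule Hom_comp[OF fin fin(1) F(1) T(1)])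
  have EE: "mmul ?I E E = E" using T(2) fin unfolding E_def by (simp add: mmul_assoc)
  have FE: "mmul ?I F E = F" using T(2) by (simp add: E_def)
  interpret l: Vector_Spaces.linear fscale fscale "mvec ?I E" by (rule linear_mvec)
  let ?im = "mvec ?I E ` fspace ?I"
  let ?P = "\<lambda>W. fvs.subspace W \<and> W \<subseteq> ?im \<and> W \<noteq> {0} \<and> (\<forall>h\<in>?G. \<forall>w\<in>W. mvec ?I (act N h) w \<in> W)"
  have im: "?P ?im"
  proof (intro conjI ballI)
    show "fvs.subspace ?im" by (rule l.subspace_image) simp
    show "?im \<noteq> {0}"
    proof
      assume K: "?im = {0}"
      have "E = 0"
        using K by (intro mat_eqI[OF fin(1) Hom_fspace[OF E] fspace_zero]) (auto simp: mvec_zero)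
      then show False using FE F(2) by (simp add: mmul_zero)
    qed
    fix h w assume h: "h \<in> ?G" and "w \<in> ?im"
    then obtain v where v: "v \<in> fspace ?I" "w = mvec ?I E v" by auto
    have "mvec ?I (act N h) w = mvec ?I E (mvec ?I (act N h) v)"
      using fin Hom_commute[OF E h] v(2) by (simp flip: mvec_mmul)
    then show "mvec ?I (act N h) w \<in> ?im" using mvec_fspace[OF grep_act[OF D N h]] by auto
  qed simp
  \<comment> \<open>A nonzero stable subspace of least dimension inside the image of E; minimality
    of the dimension is what makes it simple.\<close>
  obtain W where W: "?P W" and min: "\<And>W'. ?P W' \<Longrightarrow> fvs.dim W \<le> fvs.dim W'"
    using ex_has_least_nat[of ?P ?im fvs.dim, OF im] by blast
  have WE: "mvec ?I E w = w" if "w \<in> W" for w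
  proof -
    have "w \<in> ?im" using W that by blast
    then show ?thesis using fin EE by (auto simp flip: mvec_mmul)
  qed
  have Wsub: "fvs.subspace W" "W \<subseteq> fspace ?I"
    using W mvec_fspace[OF Hom_fspace[OF E]] by blast+
  obtain A r B where AB: "A \<in> fspace ({..<r::nat} \<times> ?I)" "B \<in> fspace (?I \<times> {..<r})"
    "mmul ?I A B = idmat {..<r}" "\<forall>w\<in>W. mvec {..<r} B (mvec ?I A w) = w"
    "\<forall>v. mvec {..<r} B v \<in> W"
    by (rule subspace_coordinates[OF Wsub fin(1)])
  have stab: "mmul {..<r} B (mmul ?I A (mmul ?I (act N h) B)) = mmul ?I (act N h) B" if h: "h \<in> ?G" for h
  proof (rule mat_eqI)
    fix v :: "nat \<Rightarrow> 'k"
    have "mvec ?I (act N h) (mvec {..<r} B v) \<in> W" using W AB(5) h by blast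
    then show "mvec {..<r} (mmul {..<r} B (mmul ?I A (mmul ?I (act N h) B))) v = mvec {..<r} (mmul ?I (act N h) B) v"
      using AB(4) fin by (simp add: mvec_mmul)
  qed (use AB grep_act[OF D N h] in \<open>auto intro!: mmul_closed\<close>)
  interpret C: compression ?G N "{..<r}" A B
    using AB stab by unfold_locales (simp_all add: grep_mrep[OF D N])
  let ?U = "compress {..<r} A B N"
  have U: "grep D ?U"
    using C.mrep_compress C.compress_mult grep_mult[OF D N] C.compress_one[OF grep_one[OF D N]]
    by (intro grepI[OF D]) (auto simp: mrep_def simp del: compress_sel(2))
  have BA: "mvec ?I A (mvec {..<r} B v) = v" if "v \<in> fspace {..<r}" for v
    using AB(3) fin that by (simp add: mvec_idmat flip: mvec_mmul)
  have injB: "inj_on (mvec {..<r} B) (fspace {..<r})"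
    by (rule inj_on_inverseI[of _ "mvec ?I A"]) (rule BA)
  have imB: "mvec {..<r} B ` fspace {..<r} = W"
  proof
    show "W \<subseteq> mvec {..<r} B ` fspace {..<r}"
      using AB(4) mvec_fspace[OF AB(1)] by (metis image_eqI subsetI)
  qed (use AB(5) in auto)
  have r: "fvs.dim W = r"
    using dim_image_inj[OF linear_mvec subspace_fspace injB] imB by (simp add: dim_fspace)
  have "simple_grep D ?U"
    unfolding simple_grep_def
  proof (intro conjI allI impI)
    show "idx ?U \<noteq> {}"
    proof
      assume "idx ?U = {}"
      then have "fspace {..<r} = {0 :: nat \<Rightarrow> 'k}" by (auto simp: fspace_def)
      then show False using imB W by (simp add: mvec_zero)
    qed
    fix W' assume W': "fvs.subspace W' \<and> W' \<subseteq> fspace (idx ?U) \<and>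
       (\<forall>h\<in>?G. \<forall>w\<in>W'. mvec (idx ?U) (act ?U h) w \<in> W')"
    then have Wr: "W' \<subseteq> fspace {..<r}" by simp
    interpret b: Vector_Spaces.linear fscale fscale "mvec {..<r} B" by (rule linear_mvec)
    have d: "fvs.dim (mvec {..<r} B ` W') = fvs.dim W'"
      using W' inj_on_subset[OF injB Wr] by (intro dim_image_inj linear_mvec) auto
    show "W' = {0} \<or> W' = fspace (idx ?U)"
    proof (cases "W' = {0}")
      case False
      have "?P (mvec {..<r} B ` W')"
      proof (intro conjI ballI)
        show "fvs.subspace (mvec {..<r} B ` W')" using W' by (intro b.subspace_image) simp
        show "mvec {..<r} B ` W' \<subseteq> ?im" using W AB(5) by blast
        obtain w where w: "w \<in> W'" "w \<noteq> 0" using False fvs.subspace_0 W' by blast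
        have "mvec {..<r} B w \<noteq> 0"
          using BA[of w] w Wr by (auto simp: mvec_zero)
        then show "mvec {..<r} B ` W' \<noteq> {0}" using w by blast
        fix h w assume h: "h \<in> ?G" and "w \<in> mvec {..<r} B ` W'"
        then obtain v where v: "v \<in> W'" "w = mvec {..<r} B v" by auto
        have "mvec ?I (act N h) w = mvec {..<r} B (mvec {..<r} (act ?U h) v)"
          using stab[OF h] fin v(2) by (simp flip: mvec_mmul)
        then show "mvec ?I (act N h) w \<in> mvec {..<r} B ` W'" using W' h v by auto
      qed
      then have "r \<le> fvs.dim W'" using min d r by metis
      moreover have "fvs.dim W' \<le> card (evec ` {..<r} :: (nat \<Rightarrow> 'k) set)"
        using Wr by (intro fvs.dim_le_card) (auto simp: span_evec)
      ultimately have "fvs.dim W' = r" by (simp add: card_evec)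
      then show ?thesis using subspace_full[of W' "{..<r}"] W' by simp
    qed simp
  qed (rule U)
  then obtain i where i: "i \<in> {1..m}" "rep_iso ?G ?U (V i)"
    using complete_simples_complete[OF V] by blast
  then obtain P Q where PQ: "P \<in> Hom ?G ?U (V i)" "Q \<in> Hom ?G (V i) ?U" "mmul (idx (V i)) Q P = idmat {..<r}"
    unfolding rep_iso_def by auto
  have finV: "finite (idx (V i))"
    using complete_simples_simple[OF V i(1)] by (simp add: simple_grep_def grep_def)
  have "mmul {..<r} B Q \<in> Hom ?G (V i) N"
    using Hom_comp[OF _ _ _ PQ(2) C.B_Hom] finV fin by simp
  moreover have "mmul ?I F (mmul {..<r} B Q) \<noteq> 0"
  proof
    assume "mmul ?I F (mmul {..<r} B Q) = 0"
    then have "mmul (idx (V i)) (mmul ?I F (mmul {..<r} B Q)) P = 0" by (simp add: mmul_zero)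
    then have "mmul ?I F (mmul {..<r} B (mmul (idx (V i)) Q P)) = 0"
      using fin finV by (simp add: mmul_assoc)
    then have FB: "mmul ?I F B = 0" using AB(2) by (simp add: PQ(3) mmul_idmat_right)
    \<comment> \<open>If F killed the copy of V i, it would kill W; but T F is the identity on
      W.\<close>
    have "mvec {..<r} B v = 0" for v
    proof -
      have "mvec {..<r} B v = mvec ?I E (mvec {..<r} B v)" using WE AB(5) by simp
      also have "\<dots> = mvec (idx L) T (mvec {..<r} (mmul ?I F B) v)"
        using fin by (simp add: E_def mvec_mmul)
      finally show ?thesis by (simp add: FB mvec_zero)
    qed
    then have "W \<subseteq> {0}" using imB by auto
    then show False using W fvs.subspace_0[OF Wsub(1)] by blast
  qed
  ultimately show ?thesis using that i by blast
qed

section \<open>Modules over the Hopf algebra\<close>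

text \<open>Powers phrased with \<open>mmul\<close> alone, so that they combine directly with
  products of rectangular matrices; \<open>mat_ring_pow\<close> links them to the ring of
  matrices.\<close>

primrec mpow :: "'i set \<Rightarrow> ('i \<times> 'i \<Rightarrow> 'k::field) \<Rightarrow> nat \<Rightarrow> 'i \<times> 'i \<Rightarrow> 'k" where
  "mpow I A 0 = idmat I"
| "mpow I A (Suc k) = mmul I (mpow I A k) A"

lemma mat_ring_pow: "A [^]\<^bsub>mat_ring I\<^esub> (k::nat) = mpow I A k"
  by (induction k) (simp_all add: nat_pow_def mat_ring_def)

lemma mpow_fspace: "A \<in> fspace (I \<times> I) \<Longrightarrow> mpow I A k \<in> fspace (I \<times> I)"
  by (induction k) (auto intro: mmul_closed)

lemma mmul_idmat_idmat [simp]: "finite I \<Longrightarrow> mmul I (idmat I) (idmat I) = idmat I"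
  by (rule mmul_idmat_left[OF _ idmat_fspace])

lemma mpow_add: "finite I \<Longrightarrow> A \<in> fspace (I \<times> I) \<Longrightarrow> mpow I A (k + l) = mmul I (mpow I A k) (mpow I A l)"
proof (induction l)
  case 0
  then show ?case using mmul_idmat_right[OF 0(1) mpow_fspace[OF 0(2)]] by simp
qed (simp add: mmul_assoc)

lemma mpow_commute:
  assumes I: "finite I" and A: "A \<in> fspace (I \<times> I)" and e: "mmul I B A = fscale q (mmul I A B)"
  shows "mmul I (mpow I B k) A = fscale (q ^ k) (mmul I A (mpow I B k))"
proof (induction k)
  case (Suc k)
  have "mmul I (mpow I B (Suc k)) A = mmul I (mpow I B k) (mmul I B A)" using I by (simp add: mmul_assoc)
  also have "\<dots> = fscale q (mmul I (mmul I (mpow I B k) A) B)" using I by (simp add: e mmul_scale mmul_assoc)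
  finally show ?case using I by (simp add: Suc mmul_scale mmul_assoc mult.commute)
qed (use I A in \<open>simp add: mmul_idmat_left mmul_idmat_right\<close>)

text \<open>Sorting the factors of (A B)^k costs powers of q; the scalar is q to the power k(k-1)/2.
  Only the vanishing of such a power is read off later, so it stays existential.\<close>

lemma mpow_mmul:
  assumes I: "finite I" and A: "A \<in> fspace (I \<times> I)" and e: "mmul I B A = fscale q (mmul I A B)"
  shows "\<exists>c. mpow I (mmul I A B) k = fscale c (mmul I (mpow I A k) (mpow I B k))"
proof (induction k)
  case 0
  then show ?case using I by (intro exI[of _ 1]) (simp add: mmul_idmat_left)
next
  case (Suc k)
  then obtain c where c: "mpow I (mmul I A B) k = fscale c (mmul I (mpow I A k) (mpow I B k))" by blast
  have "mpow I (mmul I A B) (Suc k) = fscale c (mmul I (mpow I A k) (mmul I (mmul I (mpow I B k) A) B))"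
    using I by (simp add: c mmul_scale mmul_assoc)
  also have "\<dots> = fscale (c * q ^ k) (mmul I (mpow I A (Suc k)) (mpow I B (Suc k)))"
    using I by (simp add: mpow_commute[OF assms] mmul_scale mmul_assoc)
  finally show ?case by blast
qed

text \<open>Coefficients of \<open>(A + B)\<^sup>m = \<Sum>\<^sub>a c\<^sub>a A\<^sup>a B\<^sup>m\<^sup>-\<^sup>a\<close> when \<open>BA = qAB\<close> (Gaussian binomials).\<close>

primrec qbin :: "'k::field \<Rightarrow> nat \<Rightarrow> nat \<Rightarrow> 'k" where
  "qbin q 0 a = (if a = 0 then 1 else 0)"
| "qbin q (Suc m) a = (case a of 0 \<Rightarrow> 0 | Suc b \<Rightarrow> qbin q m b * q ^ (m - b)) + qbin q m a"

lemma qbin_outside: "m < a \<Longrightarrow> qbin q m a = 0"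
  by (induction m arbitrary: a) (auto split: nat.split)

text \<open>The q-Pochhammer symbol, which is the q-factorial times (1 - q)^m. In this form it needs
  no division by 1 - q.\<close>

definition qfact :: "'k::field \<Rightarrow> nat \<Rightarrow> 'k" where
  "qfact q m = (\<Prod>i=1..m. 1 - q ^ i)"

text \<open>The factorial formula for Gaussian binomials, multiplied out so that it holds for roots
  of unity as well. For m = n the right-hand side is 0 while the two factorials are nonzero for 0 <
  a < n, which forces the binomial to vanish.\<close>

lemma qbin_qfact: "a \<le> m \<Longrightarrow> qbin q m a * qfact q a * qfact q (m - a) = qfact q m"
proof (induction m arbitrary: a)
  case (Suc m)
  have f: "qfact q (Suc k) = qfact q k * (1 - q ^ Suc k)" for k by (simp add: qfact_def)
  show ?case
  proof (cases a)
    case 0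
    have "qbin q k 0 = 1" for k by (induction k) simp_all
    then show ?thesis using 0 by (simp add: qfact_def)
  next
    case (Suc b)
    then have b: "b \<le> m" using Suc.prems by simp
    have 1: "qbin q m b * qfact q b * qfact q (m - b) = qfact q m" using b by (rule Suc.IH)
    \<comment> \<open>At b = m the binomial lies outside the triangle and is 0, in agreement with
      the factor 1 - q^0 on the right.\<close>
    have 2: "qbin q m (Suc b) * qfact q (Suc b) * qfact q (m - b) = qfact q m * (1 - q ^ (m - b))"
    proof (cases "b = m")
      case False
      then have "Suc b \<le> m" "m - b = Suc (m - Suc b)" using b by auto
      then show ?thesis using Suc.IH[of "Suc b"] by (simp add: f[of "m - Suc b"] flip: mult.assoc)
    qed (simp add: qbin_outside)
    have "qbin q (Suc m) a * qfact q a * qfact q (Suc m - a)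
      = q ^ (m - b) * (1 - q ^ Suc b) * (qbin q m b * qfact q b * qfact q (m - b))
        + qbin q m (Suc b) * qfact q (Suc b) * qfact q (m - b)"
      using Suc by (simp add: f algebra_simps)
    also have "\<dots> = qfact q m * (1 - q ^ (m - b + Suc b))"
      unfolding 1 2 by (simp add: power_add algebra_simps)
    also have "\<dots> = qfact q (Suc m)" using b by (simp add: f)
    finally show ?thesis .
  qed
qed (simp add: qfact_def)

text \<open>The q-binomial theorem. Multiplying A^a B^(m-a) by A on the right moves A through m - a
  factors B and produces q^(m-a), which is the weight in the recursion of
  \<open>qbin\<close>.\<close>

lemma mpow_plus:
  assumes I: "finite I" and A: "A \<in> fspace (I \<times> I)" and B: "B \<in> fspace (I \<times> I)"
    and e: "mmul I B A = fscale q (mmul I A B)"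
  shows "mpow I (A + B) m = (\<Sum>a\<le>m. fscale (qbin q m a) (mmul I (mpow I A a) (mpow I B (m - a))))"
proof (induction m)
  case 0
  then show ?case using I by (simp add: mmul_idmat_left)
next
  case (Suc m)
  let ?X = "\<lambda>a. mmul I (mpow I A a) (mpow I B (Suc m - a))"
  have 1: "mmul I (mmul I (mpow I A a) (mpow I B (m - a))) A = fscale (q ^ (m - a)) (?X (Suc a))" for a
    using I by (simp add: mmul_assoc mpow_commute[OF I A e] mmul_scale)
  have 2: "mmul I (mmul I (mpow I A a) (mpow I B (m - a))) B = ?X a" if "a \<le> m" for a
    using I that by (simp add: mmul_assoc Suc_diff_le)
  have "mpow I (A + B) (Suc m) = (\<Sum>a\<le>m. fscale (qbin q m a * q ^ (m - a)) (?X (Suc a))) + (\<Sum>a\<le>m. fscale (qbin q m a) (?X a))"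
    unfolding mpow.simps Suc by (simp add: mmul_sum_left mmul_scale mmul_add 1 2 fvs.scale_right_distrib sum.distrib)
  also have "(\<Sum>a\<le>m. fscale (qbin q m a * q ^ (m - a)) (?X (Suc a)))
      = (\<Sum>a\<le>Suc m. fscale (case a of 0 \<Rightarrow> 0 | Suc b \<Rightarrow> qbin q m b * q ^ (m - b)) (?X a))"
    by (subst sum.atMost_Suc_shift) simp
  also have "(\<Sum>a\<le>m. fscale (qbin q m a) (?X a)) = (\<Sum>a\<le>Suc m. fscale (qbin q m a) (?X a))"
    by (simp add: qbin_outside)
  finally show ?case
    unfolding sum.distrib[symmetric] fvs.scale_left_distrib[symmetric] by simp
qed

section \<open>Kronecker products, transposes and block sums\<close>

definition kron :: "('i \<times> 'l \<Rightarrow> 'k::field) \<Rightarrow> ('j \<times> 'm \<Rightarrow> 'k) \<Rightarrow> ('i \<times> 'j) \<times> ('l \<times> 'm) \<Rightarrow> 'k" where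
  "kron A B = (\<lambda>((s, s'), (t, t')). A (s, t) * B (s', t'))"

lemma kron_fspace: "A \<in> fspace (I \<times> I') \<Longrightarrow> B \<in> fspace (J \<times> J') \<Longrightarrow> kron A B \<in> fspace ((I \<times> J) \<times> (I' \<times> J'))"
  by (auto simp: fspace_def kron_def)

lemma mmul_kron: "mmul (I \<times> J) (kron A B) (kron A' B') = kron (mmul I A A') (mmul J B B')"
  by (auto simp: mmul_def kron_def fun_eq_iff sum_product sum.cartesian_product mult_ac split_def)

lemma kron_idmat: "kron (idmat I) (idmat J) = idmat (I \<times> J)"
  by (auto simp: kron_def idmat_def fun_eq_iff)

lemma mpow_kron: "mpow (I \<times> J) (kron A B) k = kron (mpow I A k) (mpow J B k)"
  by (induction k) (simp_all add: kron_idmat mmul_kron)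

lemma kron_app: "kron A B ((s, s'), (t, t')) = A (s, t) * B (s', t')"
  by (simp add: kron_def)

lemma kron_scale: "kron (fscale c A) B = fscale c (kron A B)" "kron A (fscale c B) = fscale c (kron A B)"
  and kron_zero: "kron 0 B = 0" "kron A 0 = 0"
  by (auto simp: kron_def fscale_def fun_eq_iff)

lemma kron_sum: "kron (\<Sum>x\<in>X. f x) B = (\<Sum>x\<in>X. kron (f x) B)"
  and kron_sum': "kron A (\<Sum>x\<in>X. g x) = (\<Sum>x\<in>X. kron A (g x))"
  by (auto simp: kron_def fun_eq_iff sum_fun_app sum_distrib_left sum_distrib_right)

definition tr :: "('i \<times> 'j \<Rightarrow> 'k) \<Rightarrow> 'j \<times> 'i \<Rightarrow> 'k" where
  "tr A = (\<lambda>(s, t). A (t, s))"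

lemma tr_fspace: "A \<in> fspace (I \<times> J) \<Longrightarrow> tr A \<in> fspace (J \<times> I)"
  by (auto simp: fspace_def tr_def)

lemma tr_tr [simp]: "tr (tr A) = A"
  by (auto simp: tr_def)

lemma mmul_tr: "mmul J (tr A) (tr B) = tr (mmul J B A)"
  by (auto simp: mmul_def tr_def fun_eq_iff mult.commute)

lemma tr_idmat: "tr (idmat I) = idmat I"
  by (auto simp: tr_def idmat_def)

lemma tr_scale: "tr (fscale c A) = fscale c (tr A)"
  and tr_zero: "tr (0 :: _ \<Rightarrow> 'k::field) = 0"
  and tr_add: "tr (A + B) = tr A + tr (B :: _ \<Rightarrow> 'k)"
  and tr_uminus: "tr (- A) = - tr A"
  by (auto simp: tr_def fscale_def fun_eq_iff)

lemma tr_sum: "tr (\<Sum>x\<in>X. f x) = (\<Sum>x\<in>X. tr (f x :: _ \<Rightarrow> 'k::field))"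
  by (auto simp: tr_def fun_eq_iff sum_fun_app)

lemma mpow_tr: "finite I \<Longrightarrow> A \<in> fspace (I \<times> I) \<Longrightarrow> mpow I (tr A) k = tr (mpow I A k)"
proof (induction k)
  case (Suc k)
  have "mmul I (mpow I A k) A = mmul I A (mpow I A k)"
    using mpow_add[of I A 1 k] mpow_add[of I A k 1] Suc by (simp add: mmul_idmat_left)
  then show ?case using Suc by (simp add: mmul_tr)
qed (simp add: tr_idmat)

definition bdiag :: "('i \<times> 'l \<Rightarrow> 'k::field) \<Rightarrow> ('j \<times> 'm \<Rightarrow> 'k) \<Rightarrow> ('i + 'j) \<times> ('l + 'm) \<Rightarrow> 'k" where
  "bdiag A B = (\<lambda>p. case p of (Inl s, Inl t) \<Rightarrow> A (s, t) | (Inr s, Inr t) \<Rightarrow> B (s, t) | _ \<Rightarrow> 0)"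

lemma bdiag_app [simp]: "bdiag A B (Inl s, Inl t) = A (s, t)" "bdiag A B (Inr s', Inr t') = B (s', t')"
  "bdiag A B (Inl s, Inr t') = 0" "bdiag A B (Inr s', Inl t) = 0"
  by (simp_all add: bdiag_def)

lemma sum_Plus: "finite I \<Longrightarrow> finite J \<Longrightarrow> sum f (I <+> J) = (\<Sum>i\<in>I. f (Inl i)) + (\<Sum>j\<in>J. f (Inr j))"
  by (simp add: sum.Plus o_def)

lemma fun_eq_sum_prodI:
  "(\<And>s t. A (Inl s, Inl t) = B (Inl s, Inl t)) \<Longrightarrow> (\<And>s t. A (Inl s, Inr t) = B (Inl s, Inr t)) \<Longrightarrow>
   (\<And>s t. A (Inr s, Inl t) = B (Inr s, Inl t)) \<Longrightarrow> (\<And>s t. A (Inr s, Inr t) = B (Inr s, Inr t)) \<Longrightarrow> A = B"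
  by (rule ext) (metis prod.exhaust sum.exhaust)

lemma mmul_bdiag:
  assumes "finite I" "finite J"
  shows "mmul (I <+> J) (bdiag A B) (bdiag A' B') = bdiag (mmul I A A') (mmul J B B')"
  by (rule fun_eq_sum_prodI) (simp_all add: mmul_def sum_Plus[OF assms])

lemma bdiag_fspace: "A \<in> fspace (I \<times> I') \<Longrightarrow> B \<in> fspace (J \<times> J') \<Longrightarrow> bdiag A B \<in> fspace ((I <+> J) \<times> (I' <+> J'))"
  by (auto simp: fspace_def bdiag_def split: sum.split)

lemma bdiag_add: "bdiag (A + A') (B + B') = bdiag A B + bdiag A' B'"
  and bdiag_scale: "bdiag (fscale c A) (fscale c B) = fscale c (bdiag A B)"
  and bdiag_idmat: "bdiag (idmat I) (idmat J) = idmat (I <+> J)"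
  by (rule fun_eq_sum_prodI; auto simp: fscale_def idmat_def)+

section \<open>H-modules as solutions of the defining relations\<close>

definition gens :: "('g, 'k::field) datum \<Rightarrow> (nat \<times> 'g \<Rightarrow> 'k) set" where
  "gens D = insert (yelt D) (gelt D ` carrier (grp D))"

text \<open>The presentation of H read in matrices: R is a representation of G, Y^n = 0 and Y h =
  chi(h) h Y. By \<open>ymod_hmodule\<close> and \<open>hmodule_ymod\<close> such pairs amount to
  H-modules, and all module constructions are verified through them.\<close>

definition ymod :: "('g, 'k::field) datum \<Rightarrow> 'i set \<Rightarrow> ('g \<Rightarrow> 'i \<times> 'i \<Rightarrow> 'k) \<Rightarrow> ('i \<times> 'i \<Rightarrow> 'k) \<Rightarrow> bool" where
  "ymod D I R Y \<longleftrightarrow> finite I \<and> (\<forall>h\<in>carrier (grp D). R h \<in> fspace (I \<times> I)) \<and> R \<one>\<^bsub>grp D\<^esub> = idmat I \<and>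
     (\<forall>h\<in>carrier (grp D). \<forall>k\<in>carrier (grp D). R (h \<otimes>\<^bsub>grp D\<^esub> k) = mmul I (R h) (R k)) \<and>
     Y \<in> fspace (I \<times> I) \<and> mpow I Y (nil_ord D) = 0 \<and>
     (\<forall>h\<in>carrier (grp D). mmul I Y (R h) = fscale (chr D h) (mmul I (R h) Y))"

lemma ymod_finite: "ymod D I R Y \<Longrightarrow> finite I"
  and ymod_R: "ymod D I R Y \<Longrightarrow> h \<in> carrier (grp D) \<Longrightarrow> R h \<in> fspace (I \<times> I)"
  and ymod_one: "ymod D I R Y \<Longrightarrow> R \<one>\<^bsub>grp D\<^esub> = idmat I"
  and ymod_mult: "ymod D I R Y \<Longrightarrow> h \<in> carrier (grp D) \<Longrightarrow> k \<in> carrier (grp D) \<Longrightarrow>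
    R (h \<otimes>\<^bsub>grp D\<^esub> k) = mmul I (R h) (R k)"
  and ymod_Y: "ymod D I R Y \<Longrightarrow> Y \<in> fspace (I \<times> I)"
  and ymod_nil: "ymod D I R Y \<Longrightarrow> mpow I Y (nil_ord D) = 0"
  and ymod_YR: "ymod D I R Y \<Longrightarrow> h \<in> carrier (grp D) \<Longrightarrow> mmul I Y (R h) = fscale (chr D h) (mmul I (R h) Y)"
  by (auto simp: ymod_def)

context
  fixes D :: "('g, 'k::field) datum"
  assumes D: "nilpotent_datum D"
begin

interpretation G: group "grp D" using D by (simp add: nilpotent_datum_def)
interpretation H: ring "hopf_alg D" using D by (rule hopf_ring)

lemma gelt_carrier: "h \<in> carrier (grp D) \<Longrightarrow> gelt D h \<in> carrier (hopf_alg D)"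
  using hbasis_g[OF D] by (auto simp: hopf_sel[OF D] gelt_def intro: evec_fspace)

lemma yelt_carrier: "yelt D \<in> carrier (hopf_alg D)"
  using hbasis_y[OF D] by (auto simp: hopf_sel[OF D] yelt_def intro: evec_fspace)

lemma gens_carrier: "gens D \<subseteq> carrier (hopf_alg D)"
  by (auto simp: gens_def gelt_carrier yelt_carrier)

lemma elt_carrier: "elt D \<in> carrier (grp D)"
  and elt_central: "h \<in> carrier (grp D) \<Longrightarrow> elt D \<otimes>\<^bsub>grp D\<^esub> h = h \<otimes>\<^bsub>grp D\<^esub> elt D"
  and nil_ord_ge: "2 \<le> nil_ord D"
  using D by (auto simp: nilpotent_datum_def)

lemma chr_inv: "h \<in> carrier (grp D) \<Longrightarrow> chr D (inv\<^bsub>grp D\<^esub> h) = inverse (chr D h)"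
  using chr_mult[OF D, of h "inv\<^bsub>grp D\<^esub> h"] chr_nz[OF D, of h] chr_one[OF D]
  by (simp add: field_simps)

text \<open>The least exponent in \<open>nil_ord\<close> is attained because g has finite order: its
  order-of-the-group power is 1, hence so is that power of chi(g).\<close>

lemma nil_ord_pow: "chr D (elt D) ^ nil_ord D = 1"
  and nil_ord_least: "0 < k \<Longrightarrow> k < nil_ord D \<Longrightarrow> chr D (elt D) ^ k \<noteq> 1"
proof -
  let ?Q = "\<lambda>k. 0 < k \<and> chr D (elt D) ^ k = 1"
  have p: "chr D (elt D [^]\<^bsub>grp D\<^esub> k) = chr D (elt D) ^ k" for k :: nat
    using elt_carrier by (induction k) (simp_all add: chr_one[OF D] chr_mult[OF D])
  have fin: "finite (carrier (grp D))" using D by (simp add: nilpotent_datum_def)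
  have "0 < Coset.order (grp D)" using fin G.order_gt_0_iff_finite by simp
  moreover have "elt D [^]\<^bsub>grp D\<^esub> Coset.order (grp D) = \<one>\<^bsub>grp D\<^esub>"
    using elt_carrier by (rule G.pow_order_eq_1)
  ultimately have "?Q (Coset.order (grp D))" using p[of "Coset.order (grp D)"] chr_one[OF D] by simp
  then have "?Q (nil_ord D)" unfolding nil_ord_def by (rule LeastI)
  then show "chr D (elt D) ^ nil_ord D = 1" by simp
  show "chr D (elt D) ^ k \<noteq> 1" if "0 < k" "k < nil_ord D"
    using that(2) not_less_Least[of k ?Q] that(1) unfolding nil_ord_def by blast
qed

lemma qfact_nonzero: "k < nil_ord D \<Longrightarrow> qfact (chr D (elt D)) k \<noteq> 0"
  and qfact_nil_ord: "qfact (chr D (elt D)) (nil_ord D) = 0"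
  using nil_ord_least nil_ord_pow nil_ord_ge by (auto simp: qfact_def)

lemma hmodule_finite: "hmodule D M \<Longrightarrow> finite (idx M)"
  and hmodule_act: "hmodule D M \<Longrightarrow> a \<in> carrier (hopf_alg D) \<Longrightarrow> act M a \<in> fspace (idx M \<times> idx M)"
  and hmodule_mult: "hmodule D M \<Longrightarrow> a \<in> carrier (hopf_alg D) \<Longrightarrow> b \<in> carrier (hopf_alg D) \<Longrightarrow>
      act M (a \<otimes>\<^bsub>hopf_alg D\<^esub> b) = mmul (idx M) (act M a) (act M b)"
  and hmodule_add: "hmodule D M \<Longrightarrow> a \<in> carrier (hopf_alg D) \<Longrightarrow> b \<in> carrier (hopf_alg D) \<Longrightarrow>
      act M (a + b) = act M a + act M b"
  and hmodule_one: "hmodule D M \<Longrightarrow> act M \<one>\<^bsub>hopf_alg D\<^esub> = idmat (idx M)"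
  and hmodule_scale: "hmodule D M \<Longrightarrow> a \<in> carrier (hopf_alg D) \<Longrightarrow> act M (fscale c a) = fscale c (act M a)"
  unfolding hmodule_def
  by (auto simp: ring_hom_def mat_ring_def hopf_sel(5)[OF D] Pi_def)

lemma hmoduleI:
  assumes "finite (idx M)"
    "\<And>a. a \<in> carrier (hopf_alg D) \<Longrightarrow> act M a \<in> fspace (idx M \<times> idx M)"
    "\<And>a b. a \<in> carrier (hopf_alg D) \<Longrightarrow> b \<in> carrier (hopf_alg D) \<Longrightarrow>
      act M (a \<otimes>\<^bsub>hopf_alg D\<^esub> b) = mmul (idx M) (act M a) (act M b)"
    "\<And>a b. a \<in> carrier (hopf_alg D) \<Longrightarrow> b \<in> carrier (hopf_alg D) \<Longrightarrow> act M (a + b) = act M a + act M b"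
    "act M \<one>\<^bsub>hopf_alg D\<^esub> = idmat (idx M)"
    "\<And>c a. a \<in> carrier (hopf_alg D) \<Longrightarrow> act M (fscale c a) = fscale c (act M a)"
  shows "hmodule D M"
  using assms unfolding hmodule_def
  by (auto intro!: ring_hom_memI simp: mat_ring_def hopf_sel(5)[OF D])

lemma hopf_scale: "a \<in> carrier (hopf_alg D) \<Longrightarrow> fscale c a \<in> carrier (hopf_alg D)"
  and hopf_add: "a \<in> carrier (hopf_alg D) \<Longrightarrow> b \<in> carrier (hopf_alg D) \<Longrightarrow> a + b \<in> carrier (hopf_alg D)"
  and hopf_sum: "(\<And>x. x \<in> X \<Longrightarrow> f x \<in> carrier (hopf_alg D)) \<Longrightarrow> (\<Sum>x\<in>X. f x) \<in> carrier (hopf_alg D)"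
  and hopf_uminus: "a \<in> carrier (hopf_alg D) \<Longrightarrow> - a \<in> carrier (hopf_alg D)"
  by (auto simp: hopf_sel[OF D] intro: fspace_scale fspace_add fspace_sum fspace_uminus)

lemma hmodule_cong:
  assumes N: "hmodule D N" and "idx M = idx N" "\<And>a. a \<in> carrier (hopf_alg D) \<Longrightarrow> act M a = act N a"
  shows "hmodule D M"
  using assms hmodule_finite[OF N] hmodule_act[OF N] hmodule_mult[OF N] hmodule_add[OF N] hmodule_one[OF N] hmodule_scale[OF N]
  by (intro hmoduleI) (simp_all add: hopf_add hopf_scale)

lemma hmodule_mrep: "hmodule D M \<Longrightarrow> mrep (carrier (hopf_alg D)) M"
  and hmodule_mrep_gens: "hmodule D M \<Longrightarrow> mrep (gens D) M"
  using gens_carrier by (auto simp: mrep_def hmodule_finite hmodule_act)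

lemma hmodule_zero: "hmodule D M \<Longrightarrow> act M 0 = 0"
  using hmodule_scale[of M "yelt D" 0] yelt_carrier by simp

lemma hmodule_sum:
  "hmodule D M \<Longrightarrow> (\<And>x. x \<in> X \<Longrightarrow> f x \<in> carrier (hopf_alg D)) \<Longrightarrow> act M (\<Sum>x\<in>X. f x) = (\<Sum>x\<in>X. act M (f x))"
proof (induction X rule: infinite_finite_induct)
  case (insert x X)
  have "act M (f x + (\<Sum>x\<in>X. f x)) = act M (f x) + act M (\<Sum>x\<in>X. f x)"
    using insert.prems by (intro hmodule_add hopf_sum) auto
  also have "act M (\<Sum>x\<in>X. f x) = (\<Sum>x\<in>X. act M (f x))" using insert by blast
  finally show ?case by (simp only: sum.insert[OF insert.hyps])
qed (simp_all only: sum.infinite sum.empty hmodule_zero not_False_eq_True)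

lemma hmodule_uminus: "hmodule D M \<Longrightarrow> a \<in> carrier (hopf_alg D) \<Longrightarrow> act M (- a) = - act M a"
  using hmodule_scale[of M a "-1"] by simp

lemma hmodule_pow:
  "hmodule D M \<Longrightarrow> a \<in> carrier (hopf_alg D) \<Longrightarrow> act M (a [^]\<^bsub>hopf_alg D\<^esub> (i::nat)) = mpow (idx M) (act M a) i"
  by (induction i) (simp_all add: hmodule_one hmodule_mult)

lemma hmodule_lin_ext:
  assumes M: "hmodule D M" and m: "\<And>p. p \<in> B \<Longrightarrow> m p \<in> carrier (hopf_alg D)"
  shows "act M (lin_ext B m a) = lin_ext B (\<lambda>p. act M (m p)) a"
  unfolding lin_ext_def using m
  by (subst hmodule_sum[OF M]) (auto intro!: sum.cong hopf_scale hmodule_scale[OF M])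

lemma evec_carrier: "p \<in> hbasis D \<Longrightarrow> evec p \<in> carrier (hopf_alg D)"
  by (simp add: hopf_sel[OF D] evec_fspace)

lemma lin_ext_evec_id: "a \<in> carrier (hopf_alg D) \<Longrightarrow> lin_ext (hbasis D) evec a = a"
  using fspace_expand[OF finite_hbasis[OF D], of a] by (simp add: lin_ext_def hopf_sel[OF D])

lemma act_expand:
  "hmodule D M \<Longrightarrow> a \<in> carrier (hopf_alg D) \<Longrightarrow> act M a = lin_ext (hbasis D) (\<lambda>p. act M (evec p)) a"
  using hmodule_lin_ext[of M "hbasis D" evec a] by (simp add: lin_ext_evec_id evec_carrier)

lemma act_evec:
  assumes M: "hmodule D M" and p: "(i, h) \<in> hbasis D"
  shows "act M (evec (i, h)) = mmul (idx M) (mpow (idx M) (act M (yelt D)) i) (act M (gelt D h))"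
proof -
  have h: "h \<in> carrier (grp D)" "i < nil_ord D" using p by (auto simp: hbasis_def)
  have "evec (i, h) = yelt D [^]\<^bsub>hopf_alg D\<^esub> i \<otimes>\<^bsub>hopf_alg D\<^esub> gelt D h"
    using y_power_gelt[OF D h(1), of i] h(2) by simp
  then show ?thesis
    using h by (simp add: hmodule_mult[OF M] hmodule_pow[OF M] gelt_carrier yelt_carrier)
qed

lemma act_gen_module: "act (gen_module D I R Y) = lin_ext (hbasis D) (\<lambda>(i, h). mmul I (mpow I Y i) (R h))"
  by (simp add: gen_module_def mat_ring_pow) (simp add: mat_ring_def)

lemma idx_gen_module [simp]: "idx (gen_module D I R Y) = I"
  by (simp add: gen_module_def)

lemma ymod_hmodule:
  assumes "ymod D I R Y" shows "hmodule D (gen_module D I R Y)"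
proof (rule hmodule_gen_module[OF D])
  show "R \<in> hom (grp D) (units_of (mat_ring I))"
    using assms by (intro mat_hom_units[OF D]) (auto simp: ymod_def)
  show "Y [^]\<^bsub>mat_ring I\<^esub> nil_ord D = \<zero>\<^bsub>mat_ring I\<^esub>"
    unfolding mat_ring_pow using assms by (simp add: ymod_def mat_ring_def)
qed (use assms in \<open>auto simp: ymod_def mat_ring_def\<close>)

lemma gen_module_gelt:
  assumes "ymod D I R Y" "h \<in> carrier (grp D)"
  shows "act (gen_module D I R Y) (gelt D h) = R h"
  unfolding act_gen_module gelt_def lin_ext_evec[OF finite_hbasis[OF D] hbasis_g[OF D assms(2)]]
  by (simp add: mmul_idmat_left[OF ymod_finite[OF assms(1)] ymod_R[OF assms]])

lemma gen_module_yelt: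
  assumes "ymod D I R Y"
  shows "act (gen_module D I R Y) (yelt D) = Y"
  unfolding act_gen_module yelt_def lin_ext_evec[OF finite_hbasis[OF D] hbasis_y[OF D]]
  using mmul_idmat_left[OF ymod_finite[OF assms] ymod_Y[OF assms]] mmul_idmat_right[OF ymod_finite[OF assms] ymod_Y[OF assms]]
  by (simp add: ymod_one[OF assms])

text \<open>Tensor and dual modules are defined through the comultiplication and the antipode. Once
  their action is recognised as that of a pair R, Y, this gives the module axioms and the action of
  the generators in one stroke.\<close>

lemma hmodule_if_gen_module:
  assumes Y: "ymod D (idx M) R Y"
    and e: "\<And>a. a \<in> carrier (hopf_alg D) \<Longrightarrow> act M a = act (gen_module D (idx M) R Y) a"
  shows "hmodule D M" "h \<in> carrier (grp D) \<Longrightarrow> act M (gelt D h) = R h" "act M (yelt D) = Y"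
  using hmodule_cong[OF ymod_hmodule[OF Y]] gen_module_gelt[OF Y] gen_module_yelt[OF Y] e
  by (simp_all add: gelt_carrier yelt_carrier)

lemma hmodule_ymod:
  assumes M: "hmodule D M"
  shows "ymod D (idx M) (\<lambda>h. act M (gelt D h)) (act M (yelt D))"
  unfolding ymod_def
proof (intro conjI ballI)
  show "act M (gelt D \<one>\<^bsub>grp D\<^esub>) = idmat (idx M)"
    using hmodule_one[OF M] by (simp add: gelt_def hopf_sel[OF D])
  fix h assume h: "h \<in> carrier (grp D)"
  show "act M (gelt D h) \<in> fspace (idx M \<times> idx M)" using h by (intro hmodule_act[OF M] gelt_carrier)
  show "act M (gelt D (h \<otimes>\<^bsub>grp D\<^esub> k)) = mmul (idx M) (act M (gelt D h)) (act M (gelt D k))"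
    if "k \<in> carrier (grp D)" for k
    using h that hmodule_mult[OF M gelt_carrier gelt_carrier] by (simp add: gelt_mult[OF D])
  show "mmul (idx M) (act M (yelt D)) (act M (gelt D h)) = fscale (chr D h) (mmul (idx M) (act M (gelt D h)) (act M (yelt D)))"
    using h by (simp add: y_gelt[OF D] hmodule_scale[OF M] gelt_carrier yelt_carrier flip: hmodule_mult[OF M])
next
  show "mpow (idx M) (act M (yelt D)) (nil_ord D) = 0"
    using y_nilpotent[OF D] hmodule_zero[OF M] hmodule_pow[OF M yelt_carrier, of "nil_ord D"] by (simp only: hopf_sel[OF D])
qed (use M in \<open>auto intro: hmodule_finite hmodule_act yelt_carrier\<close>)

text \<open>A matrix commuting with y and with every h commutes with each basis element y^i h, hence
  with H by linearity.\<close>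

lemma Hom_gens:
  assumes M: "hmodule D M" and N: "hmodule D N"
  shows "Hom (carrier (hopf_alg D)) M N = Hom (gens D) M N"
proof
  show "Hom (carrier (hopf_alg D)) M N \<subseteq> Hom (gens D) M N"
    using gens_carrier by (auto simp: Hom_def)
  show "Hom (gens D) M N \<subseteq> Hom (carrier (hopf_alg D)) M N"
  proof
    fix T assume T: "T \<in> Hom (gens D) M N"
    let ?I = "idx M" and ?J = "idx N"
    note fin = hmodule_finite[OF M] hmodule_finite[OF N]
    have y: "mmul ?I T (act M (yelt D)) = mmul ?J (act N (yelt D)) T"
      and g: "\<And>h. h \<in> carrier (grp D) \<Longrightarrow> mmul ?I T (act M (gelt D h)) = mmul ?J (act N (gelt D h)) T"
      using Hom_commute[OF T] by (auto simp: gens_def)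
    have pw: "mmul ?I T (mpow ?I (act M (yelt D)) i) = mmul ?J (mpow ?J (act N (yelt D)) i) T" for i
    proof (induction i)
      case 0
      then show ?case using fin Hom_fspace[OF T] by (simp add: mmul_idmat_left mmul_idmat_right)
    next
      case (Suc i)
      have "mmul ?I T (mpow ?I (act M (yelt D)) (Suc i)) = mmul ?I (mmul ?I T (mpow ?I (act M (yelt D)) i)) (act M (yelt D))"
        using fin by (simp add: mmul_assoc)
      then show ?case using fin by (simp add: Suc y mmul_assoc)
    qed
    have ev: "mmul ?I T (act M (evec p)) = mmul ?J (act N (evec p)) T" if "p \<in> hbasis D" for p
    proof -
      obtain i h where p: "p = (i, h)" by (cases p)
      have "mmul ?I T (act M (evec p)) = mmul ?I (mmul ?I T (mpow ?I (act M (yelt D)) i)) (act M (gelt D h))"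
        using that fin by (simp add: p act_evec[OF M] mmul_assoc)
      also have "\<dots> = mmul ?J (mpow ?J (act N (yelt D)) i) (mmul ?I T (act M (gelt D h)))"
        using fin by (simp add: pw mmul_assoc)
      also have "\<dots> = mmul ?J (act N (evec p)) T"
        using that fin g[of h] by (simp add: p act_evec[OF N] mmul_assoc hbasis_def)
      finally show ?thesis .
    qed
    show "T \<in> Hom (carrier (hopf_alg D)) M N"
    proof (rule HomI[OF Hom_fspace[OF T]])
      fix a assume a: "a \<in> carrier (hopf_alg D)"
      show "mmul ?I T (act M a) = mmul ?J (act N a) T"
        unfolding act_expand[OF M a] act_expand[OF N a] lin_ext_def
        by (simp add: mmul_sum_left mmul_sum_right mmul_scale ev)
    qed
  qed
qed

lemma rep_iso_gens:
  assumes M: "hmodule D M" and N: "hmodule D N"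
  shows "rep_iso (carrier (hopf_alg D)) M N = rep_iso (gens D) M N"
  unfolding rep_iso_def Hom_gens[OF M N] Hom_gens[OF N M] ..

end

section \<open>Module constructions: copies, sums, tensor products, duals, M(U, j)\<close>

lemma lin_ext_add: "lin_ext B m (a + b) = lin_ext B m a + lin_ext B m b"
  by (simp add: lin_ext_def fvs.scale_left_distrib sum.distrib)

lemma fscale_app: "fscale c f i = c * f i"
  by (simp add: fscale_def)

lemma lin_ext_cong: "(\<And>p. p \<in> B \<Longrightarrow> m p = m' p) \<Longrightarrow> lin_ext B m a = lin_ext B m' a"
  by (simp add: lin_ext_def)

definition relabel :: "('i \<Rightarrow> 'j) \<Rightarrow> ('x, 'k::field, 'i) rep \<Rightarrow> ('x, 'k, 'j) rep" where
  "relabel \<beta> M = compress (\<beta> ` idx M) (perm_mat (idx M) \<beta>) (perm_mat (\<beta> ` idx M) (inv_into (idx M) \<beta>)) M"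

lemma idx_tensor [simp]: "idx (tensor_module D M N) = idx M \<times> idx N"
  and idx_dual [simp]: "idx (dual_module D M) = idx M"
  and idx_sum [simp]: "idx (sum_module M N) = idx M <+> idx N"
  and idx_regular [simp]: "idx (regular_module D) = hbasis D"
  and idx_inflate [simp]: "idx (inflate D U) = idx U"
  and idx_Mmod [simp]: "idx (Mmod D U j) = {..<j} \<times> idx U"
  and idx_char_rep [simp]: "idx (char_rep \<psi>) = {0}"
  by (simp_all add: tensor_module_def dual_module_def sum_module_def regular_module_def inflate_def
      Mmod_def char_rep_def gen_module_def)

lemma act_sum_module: "act (sum_module M N) a = bdiag (act M a) (act N a)"
  by (auto simp: sum_module_def bdiag_def)

text \<open>The action of y on the formal powers 1, x, ..., x^(j-1): a nilpotent Jordan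
  block.\<close>

definition shift :: "nat \<Rightarrow> nat \<times> nat \<Rightarrow> 'k::field" where
  "shift j = (\<lambda>(k, l). if k = Suc l \<and> k < j then 1 else 0)"

text \<open>For c = chi(h)^-1 this is the action of h on the formal powers, where x^k carries the
  character chi^-k.\<close>

definition scal :: "nat \<Rightarrow> 'k::field \<Rightarrow> nat \<times> nat \<Rightarrow> 'k" where
  "scal j c = (\<lambda>(k, l). if k = l \<and> k < j then c ^ k else 0)"

lemma shift_fspace [simp]: "shift j \<in> fspace ({..<j} \<times> {..<j})"
  and scal_fspace [simp]: "scal j c \<in> fspace ({..<j} \<times> {..<j})"
  by (auto simp: fspace_def shift_def scal_def)

lemma mmul_scal_left: "k < j \<Longrightarrow> mmul {..<j} (scal j c) A (k, l) = c ^ k * A (k, l)"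
proof -
  assume k: "k < j"
  have "mmul {..<j} (scal j c) A (k, l) = (\<Sum>p<j. if p = k then c ^ k * A (k, l) else 0)"
    unfolding mmul_def scal_def prod.case by (intro sum.cong) auto
  then show ?thesis using k by simp
qed

lemma mmul_scal_right: "l < j \<Longrightarrow> mmul {..<j} A (scal j c) (k, l) = A (k, l) * c ^ l"
proof -
  assume k: "l < j"
  have "mmul {..<j} A (scal j c) (k, l) = (\<Sum>p<j. if p = l then A (k, l) * c ^ l else 0)"
    unfolding mmul_def scal_def prod.case by (intro sum.cong) auto
  then show ?thesis using k by simp
qed

lemma scal_mult: "mmul {..<j} (scal j c) (scal j d) = scal j (c * d)"
  by (rule fspace_eqI[OF mmul_closed[OF scal_fspace scal_fspace] scal_fspace])
    (auto simp: mmul_scal_left, auto simp: scal_def power_mult_distrib)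

lemma scal_one: "scal j 1 = idmat {..<j}"
  by (auto simp: scal_def idmat_def)

lemma shift_scal: "c \<noteq> 0 \<Longrightarrow> mmul {..<j} (shift j) (scal j (inverse c)) = fscale c (mmul {..<j} (scal j (inverse c)) (shift j))"
  by (rule fspace_eqI[OF mmul_closed[OF shift_fspace scal_fspace] fspace_scale[OF mmul_closed[OF scal_fspace shift_fspace]]])
    (auto simp: mmul_scal_left mmul_scal_right fscale_def, auto simp: shift_def)

lemma mpow_shift: "mpow {..<j} (shift j :: nat \<times> nat \<Rightarrow> 'k::field) i = (\<lambda>(k, l). if k = l + i \<and> k < j then 1 else 0)"
proof (induction i)
  case (Suc i)
  show ?case
  proof
    fix p :: "nat \<times> nat"
    obtain k l where p: "p = (k, l)" by (cases p)
    have "mpow {..<j} (shift j :: nat \<times> nat \<Rightarrow> 'k) (Suc i) p = (\<Sum>m<j. if m = Suc l then (if k = l + Suc i \<and> k < j then 1 else 0) else 0)"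
      unfolding p mpow.simps Suc unfolding mmul_def shift_def prod.case by (intro sum.cong) auto
    also have "\<dots> = (if k = l + Suc i \<and> k < j then 1 else 0)" by auto
    finally show "mpow {..<j} (shift j :: nat \<times> nat \<Rightarrow> 'k) (Suc i) p = (case p of (k, l) \<Rightarrow> if k = l + Suc i \<and> k < j then 1 else 0)"
      by (simp only: p prod.case)
  qed
qed (auto simp: idmat_def)

context
  fixes D :: "('g, 'k::field) datum"
  assumes D: "nilpotent_datum D"
begin

interpretation G: group "grp D" using D by (simp add: nilpotent_datum_def)
interpretation H: ring "hopf_alg D" using D by (rule hopf_ring)

lemma compress_hmodule:
  assumes M: "hmodule D M" and C: "compression (carrier (hopf_alg D)) M J A B"
  shows "hmodule D (compress J A B M)"
proof -
  interpret C: compression "carrier (hopf_alg D)" M J A B by (rule C)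
  show ?thesis
  proof (rule hmoduleI[OF D])
    fix a b assume ab: "a \<in> carrier (hopf_alg D)" "b \<in> carrier (hopf_alg D)"
    show "act (compress J A B M) (a \<otimes>\<^bsub>hopf_alg D\<^esub> b) = mmul (idx (compress J A B M)) (act (compress J A B M) a) (act (compress J A B M) b)"
      unfolding compress_sel(1) by (rule C.compress_mult[OF ab hmodule_mult[OF D M ab]])
  next
    show "act (compress J A B M) \<one>\<^bsub>hopf_alg D\<^esub> = idmat (idx (compress J A B M))"
      unfolding compress_sel(1) by (rule C.compress_one[OF hmodule_one[OF D M]])
  qed (use C.mrep_compress in \<open>auto simp: mrep_def mmul_add mmul_scale hmodule_add[OF D M] hmodule_scale[OF D M]\<close>)
qed

text \<open>Transport of structure along an injection of the index set. Its purpose is to replace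
  pairs, sums and other indices by natural numbers, which is where isomorphism classes live.\<close>

lemma relabel_hmodule:
  assumes M: "hmodule D M" and b: "inj_on \<beta> (idx M)"
  shows "hmodule D (relabel \<beta> M)" "rep_iso (carrier (hopf_alg D)) M (relabel \<beta> M)"
proof -
  let ?I = "idx M" and ?J = "\<beta> ` idx M"
  let ?A = "perm_mat ?I \<beta>" and ?B = "perm_mat ?J (inv_into ?I \<beta>)"
  have bij: "bij_betw \<beta> ?I ?J" using b by (rule inj_on_imp_bij_betw)
  note fin = hmodule_finite[OF D M] hmodule_finite[OF D M, THEN finite_imageI, of \<beta>]
  note inv = perm_mat_inverse[OF bij fin(1)]
  have A: "?A \<in> fspace (?J \<times> ?I)" using bij by (rule perm_mat_fspace)
  have B: "?B \<in> fspace (?I \<times> ?J)" using bij_betw_inv_into[OF bij] by (rule perm_mat_fspace)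
  interpret C: compression "carrier (hopf_alg D)" M ?J ?A ?B
  proof
    show "mmul ?J ?B (mmul ?I ?A (mmul ?I (act M a) ?B)) = mmul ?I (act M a) ?B"
      if "a \<in> carrier (hopf_alg D)" for a
    proof -
      have "mmul ?J ?B (mmul ?I ?A (mmul ?I (act M a) ?B)) = mmul ?I (idmat ?I) (mmul ?I (act M a) ?B)"
        using fin by (simp flip: inv(1)) (simp add: mmul_assoc)
      then show ?thesis
        using fin mmul_closed[OF hmodule_act[OF D M that] B] by (simp add: mmul_idmat_left)
    qed
  qed (use A B inv fin in \<open>simp_all add: hmodule_mrep[OF D M]\<close>)
  show h: "hmodule D (relabel \<beta> M)"
    unfolding relabel_def by (rule compress_hmodule[OF M C.compression_axioms])
  show "rep_iso (carrier (hopf_alg D)) M (relabel \<beta> M)"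
    by (rule rep_iso_sym, rule rep_isoI[OF hmodule_mrep[OF D h] hmodule_mrep[OF D M], of ?B ?A])
      (use A B C.B_Hom inv in \<open>simp_all add: relabel_def\<close>)
qed

lemma hmodule_relabel_iso:
  assumes M: "hmodule D M" and N: "hmodule D N" and b: "bij_betw \<beta> (idx M) (idx N)"
    and R: "\<And>h s t. h \<in> carrier (grp D) \<Longrightarrow> s \<in> idx M \<Longrightarrow> t \<in> idx M \<Longrightarrow>
      act M (gelt D h) (s, t) = act N (gelt D h) (\<beta> s, \<beta> t)"
    and Y: "\<And>s t. s \<in> idx M \<Longrightarrow> t \<in> idx M \<Longrightarrow> act M (yelt D) (s, t) = act N (yelt D) (\<beta> s, \<beta> t)"
  shows "rep_iso (carrier (hopf_alg D)) M N"
  unfolding rep_iso_gens[OF D M N]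
  by (rule relabel_iso[OF hmodule_mrep_gens[OF D M] hmodule_mrep_gens[OF D N] b])
    (auto simp: gens_def R Y)

lemma sum_hmodule:
  assumes M: "hmodule D M" and N: "hmodule D N"
  shows "hmodule D (sum_module M N)"
  using hmodule_finite[OF D M] hmodule_finite[OF D N]
  by (intro hmoduleI[OF D])
    (auto simp: act_sum_module mmul_bdiag hmodule_mult[OF D M] hmodule_mult[OF D N]
      hmodule_add[OF D M] hmodule_add[OF D N] bdiag_add hmodule_one[OF D M] hmodule_one[OF D N] bdiag_idmat
      hmodule_scale[OF D M] hmodule_scale[OF D N] bdiag_scale
      intro: bdiag_fspace hmodule_act[OF D M] hmodule_act[OF D N])

lemma regular_act: "a \<in> carrier (hopf_alg D) \<Longrightarrow> act (regular_module D) a \<in> fspace (hbasis D \<times> hbasis D)"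
proof -
  assume a: "a \<in> carrier (hopf_alg D)"
  have "a \<otimes>\<^bsub>hopf_alg D\<^esub> evec q \<in> fspace (hbasis D)" if "q \<in> hbasis D" for q
    using H.m_closed[OF a evec_carrier[OF D that]] by (simp add: hopf_sel[OF D])
  then show ?thesis by (auto simp: regular_module_def fspace_def)
qed

lemma mvec_regular:
  assumes a: "a \<in> carrier (hopf_alg D)" and v: "v \<in> carrier (hopf_alg D)"
  shows "mvec (hbasis D) (act (regular_module D) a) v = a \<otimes>\<^bsub>hopf_alg D\<^esub> v"
proof
  fix p
  have v': "v \<in> fspace (hbasis D)" using v by (simp add: hopf_sel[OF D])
  have "a \<otimes>\<^bsub>hopf_alg D\<^esub> v = (\<Sum>q\<in>hbasis D. fscale (v q) (a \<otimes>\<^bsub>hopf_alg D\<^esub> evec q))"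
    by (subst fspace_expand[OF finite_hbasis[OF D] v'])
      (simp add: hopf_sel[OF D] bilin_ext_sum_right bilin_ext_scale_right)
  then show "mvec (hbasis D) (act (regular_module D) a) v p = (a \<otimes>\<^bsub>hopf_alg D\<^esub> v) p"
    by (auto simp: mvec_def regular_module_def sum_fun_app fscale_def intro!: sum.cong)
qed

lemma regular_hmodule: "hmodule D (regular_module D)"
proof (rule hmoduleI[OF D])
  let ?B = "hbasis D" and ?M = "regular_module D"
  note fin = finite_hbasis[OF D]
  have e: "A = B" if "A \<in> fspace (?B \<times> ?B)" "B \<in> fspace (?B \<times> ?B)"
    "\<And>v. v \<in> carrier (hopf_alg D) \<Longrightarrow> mvec ?B A v = mvec ?B B v" for A B
    using that by (intro mat_eqI[OF fin]) (auto simp: hopf_sel[OF D])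
  have id: "mvec ?B (idmat ?B) v = v" if "v \<in> carrier (hopf_alg D)" for v
    using that fin by (simp add: hopf_sel[OF D] mvec_idmat)
  show "act ?M (a \<otimes>\<^bsub>hopf_alg D\<^esub> b) = mmul (idx ?M) (act ?M a) (act ?M b)"
    if "a \<in> carrier (hopf_alg D)" "b \<in> carrier (hopf_alg D)" for a b
    using that fin by (intro e) (auto simp: mvec_mmul mvec_regular H.m_assoc intro: regular_act mmul_closed)
  show "act ?M \<one>\<^bsub>hopf_alg D\<^esub> = idmat (idx ?M)"
    by (intro e) (auto simp: mvec_regular id intro: regular_act)
  show "act ?M (a + b) = act ?M a + act ?M b" for a b
    by (auto simp: regular_module_def hopf_sel[OF D] bilin_ext_add_left fun_eq_iff)
  show "act ?M (fscale c a) = fscale c (act ?M a)" for c a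
    by (rule ext) (auto simp: regular_module_def hopf_sel[OF D] bilin_ext_scale_left fscale_app)
qed (use finite_hbasis[OF D] regular_act in auto)

text \<open>The linear map sending u \<otimes> v to the Kronecker product of the two actions is
  multiplicative on H \<otimes> H. It therefore carries Delta(y)^i (h \<otimes> h) to the i-th power
  of the image of Delta(y) times the action of h.\<close>

lemma tensor_act_eq:
  assumes M: "hmodule D M" and N: "hmodule D N"
  shows "act (tensor_module D M N) a = act (gen_module D (idx M \<times> idx N)
     (\<lambda>h. kron (act M (gelt D h)) (act N (gelt D h)))
     (kron (act M (yelt D)) (act N (gelt D (elt D))) + kron (idmat (idx M)) (act N (yelt D)))) a"
proof -
  let ?B = "hbasis D" and ?I = "idx M" and ?J = "idx N"
  define K where "K = (\<lambda>(p, q). kron (act M (evec p)) (act N (evec q)))"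
  define \<Phi> where "\<Phi> = lin_ext (?B \<times> ?B) K"
  note finB = finite_hbasis[OF D]
  have outer: "\<Phi> (outer u v) = kron (act M u) (act N v)"
    if u: "u \<in> carrier (hopf_alg D)" and v: "v \<in> carrier (hopf_alg D)" for u v
  proof -
    have "kron (act M u) (act N v) = (\<Sum>p\<in>?B. \<Sum>q\<in>?B. fscale (u p * v q) (K (p, q)))"
      unfolding act_expand[OF D M u] act_expand[OF D N v] lin_ext_def
      by (simp add: kron_sum kron_sum' kron_scale K_def fvs.scale_sum_right)
        (subst sum.swap, simp add: mult.commute)
    also have "\<dots> = (\<Sum>(p, q)\<in>?B \<times> ?B. fscale (u p * v q) (K (p, q)))"
      by (rule sum.cartesian_product)
    finally show ?thesis unfolding \<Phi>_def lin_ext_def by (simp add: outer_def split_def)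
  qed
  have ev: "\<Phi> (outer (bprod D p q) (bprod D p' q')) = mmul (?I \<times> ?J) (K (p, p')) (K (q, q'))"
    if "p \<in> ?B" "q \<in> ?B" "p' \<in> ?B" "q' \<in> ?B" for p q p' q'
  proof -
    have b: "bprod D r s = evec r \<otimes>\<^bsub>hopf_alg D\<^esub> evec s" if "r \<in> ?B" "s \<in> ?B" for r s
      using that by (simp add: hopf_sel[OF D] bilin_ext_evec finB)
    show ?thesis using that
      by (simp add: b outer evec_carrier[OF D] hmodule_mult[OF D M] hmodule_mult[OF D N] K_def mmul_kron)
  qed
  have mult: "\<Phi> (x \<otimes>\<^bsub>hopf_alg2 D\<^esub> y) = mmul (?I \<times> ?J) (\<Phi> x) (\<Phi> y)" for x y
  proof -
    have "\<Phi> (x \<otimes>\<^bsub>hopf_alg2 D\<^esub> y) = (\<Sum>p\<in>?B \<times> ?B. \<Sum>q\<in>?B \<times> ?B. fscale (x p * y q) (mmul (?I \<times> ?J) (K p) (K q)))"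
      unfolding hopf_alg2_def bilin_ext_def by (auto simp: \<Phi>_def lin_ext_sum lin_ext_scale simp flip: ev intro!: sum.cong)
    also have "\<dots> = mmul (?I \<times> ?J) (\<Phi> x) (\<Phi> y)"
      unfolding \<Phi>_def lin_ext_def by (simp add: mmul_sum_left mmul_sum_right mmul_scale fvs.scale_sum_right)
        (subst sum.swap, simp add: mult.commute)
    finally show ?thesis .
  qed
  define Y where "Y = kron (act M (yelt D)) (act N (gelt D (elt D))) + kron (idmat ?I) (act N (yelt D))"
  have one: "\<Phi> \<one>\<^bsub>hopf_alg2 D\<^esub> = idmat (?I \<times> ?J)"
    by (simp add: hopf_alg2_def outer hmodule_one[OF D M] hmodule_one[OF D N] kron_idmat)
  have y: "\<Phi> (ycomult D) = Y"
    unfolding ycomult_def \<Phi>_def lin_ext_add unfolding \<Phi>_def[symmetric] Y_def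
    by (simp add: outer yelt_carrier[OF D] gelt_carrier[OF D] elt_carrier[OF D] hmodule_one[OF D M])
  have pow: "\<Phi> (ycomult D [^]\<^bsub>hopf_alg2 D\<^esub> i) = mpow (?I \<times> ?J) Y i" for i :: nat
    by (induction i) (simp_all add: nat_pow_def one mult y)
  have "act (tensor_module D M N) a = \<Phi> (comult D a)"
    by (simp add: tensor_module_def \<Phi>_def K_def kron_def)
  also have "\<dots> = lin_ext ?B (\<lambda>p. \<Phi> (case p of (i, h) \<Rightarrow> ycomult D [^]\<^bsub>hopf_alg2 D\<^esub> i \<otimes>\<^bsub>hopf_alg2 D\<^esub> outer (gelt D h) (gelt D h))) a"
    unfolding comult_def lin_ext_def[of ?B] \<Phi>_def lin_ext_sum lin_ext_scale ..
  also have "\<dots> = lin_ext ?B (\<lambda>(i, h). mmul (?I \<times> ?J) (mpow (?I \<times> ?J) Y i) (kron (act M (gelt D h)) (act N (gelt D h)))) a"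
    by (rule lin_ext_cong) (auto simp: mult pow hbasis_def outer gelt_carrier[OF D])
  finally show ?thesis unfolding act_gen_module[OF D] Y_def .
qed

text \<open>Nilpotency is the point. With A = y \<otimes> g and B = 1 \<otimes> y one has B A = q A
  B for q = chi(g), so the q-binomial theorem expands (A + B)^n. The relation with h uses that g is
  central.\<close>

lemma tensor_ymod:
  assumes M: "hmodule D M" and N: "hmodule D N"
  shows "ymod D (idx M \<times> idx N) (\<lambda>h. kron (act M (gelt D h)) (act N (gelt D h)))
     (kron (act M (yelt D)) (act N (gelt D (elt D))) + kron (idmat (idx M)) (act N (yelt D)))"
proof -
  let ?I = "idx M" and ?J = "idx N" and ?n = "nil_ord D" and ?q = "chr D (elt D)"
  note YM = hmodule_ymod[OF D M] and YN = hmodule_ymod[OF D N]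
  note fin = ymod_finite[OF YM] ymod_finite[OF YN]
  note g = elt_carrier[OF D]
  note fs = ymod_R[OF YM] ymod_R[OF YN] ymod_Y[OF YM] ymod_Y[OF YN]
  let ?A = "kron (act M (yelt D)) (act N (gelt D (elt D)))" and ?B = "kron (idmat ?I) (act N (yelt D))"
  have id: "mmul ?I (idmat ?I) (act M a) = act M a" "mmul ?I (act M a) (idmat ?I) = act M a"
    if "a \<in> carrier (hopf_alg D)" for a
    using fin hmodule_act[OF D M that] by (simp_all add: mmul_idmat_left mmul_idmat_right)
  note id' = id[OF yelt_carrier[OF D]] id[OF gelt_carrier[OF D]]
  have A: "?A \<in> fspace ((?I \<times> ?J) \<times> (?I \<times> ?J))" and B: "?B \<in> fspace ((?I \<times> ?J) \<times> (?I \<times> ?J))"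
    using fs g by (auto intro: kron_fspace)
  have BA: "mmul (?I \<times> ?J) ?B ?A = fscale ?q (mmul (?I \<times> ?J) ?A ?B)"
    using g by (simp add: mmul_kron id' ymod_YR[OF YN] kron_scale)
  have "mpow (?I \<times> ?J) (?A + ?B) ?n =
      (\<Sum>a\<le>?n. fscale (qbin ?q ?n a) (mmul (?I \<times> ?J) (mpow (?I \<times> ?J) ?A a) (mpow (?I \<times> ?J) ?B (?n - a))))"
    using fin A B BA by (intro mpow_plus) auto
  also have "\<dots> = 0"
  proof (rule sum.neutral, rule ballI)
    fix a assume "a \<in> {..?n}"
    \<comment> \<open>The two outer terms contain y^n on one of the factors; the inner coefficients
      vanish since q has order n.\<close>
    then consider "a = 0" | "a = ?n" | "0 < a" "a < ?n" by fastforce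
    then show "fscale (qbin ?q ?n a) (mmul (?I \<times> ?J) (mpow (?I \<times> ?J) ?A a) (mpow (?I \<times> ?J) ?B (?n - a))) = 0"
    proof cases
      case 1
      then have "mpow (?I \<times> ?J) ?B (?n - a) = 0" by (simp add: mpow_kron ymod_nil[OF YN] kron_zero)
      then show ?thesis by (simp only: mmul_zero fvs.scale_zero_right)
    next
      case 2
      then have "mpow (?I \<times> ?J) ?A a = 0" by (simp add: mpow_kron ymod_nil[OF YM] kron_zero)
      then show ?thesis by (simp only: mmul_zero fvs.scale_zero_right)
    next
      case 3
      have "qbin ?q ?n a * qfact ?q a * qfact ?q (?n - a) = 0"
        using qbin_qfact[of a ?n ?q] 3 qfact_nil_ord[OF D] by simp
      then have "qbin ?q ?n a = 0" using qfact_nonzero[OF D, of a] qfact_nonzero[OF D, of "?n - a"] 3 by simp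
      then show ?thesis by (simp only: fvs.scale_zero_left)
    qed
  qed
  finally have nil: "mpow (?I \<times> ?J) (?A + ?B) ?n = 0" .
  have YR: "mmul (?I \<times> ?J) (?A + ?B) (kron (act M (gelt D h)) (act N (gelt D h)))
      = fscale (chr D h) (mmul (?I \<times> ?J) (kron (act M (gelt D h)) (act N (gelt D h))) (?A + ?B))"
    if h: "h \<in> carrier (grp D)" for h
  proof -
    have c: "mmul ?J (act N (gelt D (elt D))) (act N (gelt D h)) = mmul ?J (act N (gelt D h)) (act N (gelt D (elt D)))"
      using h g by (simp add: elt_central[OF D] flip: ymod_mult[OF YN])
    show ?thesis
      using h by (simp add: mmul_add mmul_kron id' c ymod_YR[OF YM] ymod_YR[OF YN] kron_scale fvs.scale_right_distrib)
  qed
  show ?thesis unfolding ymod_def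
    using fin nil YR A B fs ymod_one[OF YM] ymod_one[OF YN] ymod_mult[OF YM] ymod_mult[OF YN]
    by (auto simp: kron_idmat mmul_kron intro: kron_fspace fspace_add)
qed

lemma tensor_hmodule: "hmodule D M \<Longrightarrow> hmodule D N \<Longrightarrow> hmodule D (tensor_module D M N)"
  and tensor_gelt: "hmodule D M \<Longrightarrow> hmodule D N \<Longrightarrow> h \<in> carrier (grp D) \<Longrightarrow>
    act (tensor_module D M N) (gelt D h) = kron (act M (gelt D h)) (act N (gelt D h))"
  and tensor_yelt: "hmodule D M \<Longrightarrow> hmodule D N \<Longrightarrow> act (tensor_module D M N) (yelt D) =
    kron (act M (yelt D)) (act N (gelt D (elt D))) + kron (idmat (idx M)) (act N (yelt D))"
proof -
  assume M: "hmodule D M" and N: "hmodule D N"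
  have *: "ymod D (idx (tensor_module D M N)) (\<lambda>h. kron (act M (gelt D h)) (act N (gelt D h)))
     (kron (act M (yelt D)) (act N (gelt D (elt D))) + kron (idmat (idx M)) (act N (yelt D)))"
    using tensor_ymod[OF M N] by simp
  note ** = hmodule_if_gen_module[OF D *, unfolded idx_tensor, OF tensor_act_eq[OF M N]]
  show "hmodule D (tensor_module D M N)" by (rule **(1))
  show "h \<in> carrier (grp D) \<Longrightarrow> act (tensor_module D M N) (gelt D h) = kron (act M (gelt D h)) (act N (gelt D h))"
    by (rule **(2))
  show "act (tensor_module D M N) (yelt D) = kron (act M (yelt D)) (act N (gelt D (elt D))) + kron (idmat (idx M)) (act N (yelt D))"
    by (rule **(3))
qed

text \<open>The antipode reverses products and so does transposition. Together they preserve the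
  order, so y^i h acts on the dual by the i-th power of the transpose of S(y) times the transpose of
  the inverse of h.\<close>

lemma dual_act_eq:
  assumes M: "hmodule D M"
  shows "act (dual_module D M) a = act (gen_module D (idx M) (\<lambda>h. tr (act M (gelt D (inv\<^bsub>grp D\<^esub> h))))
     (- tr (mmul (idx M) (act M (yelt D)) (act M (gelt D (inv\<^bsub>grp D\<^esub> elt D)))))) a"
proof -
  let ?I = "idx M" and ?g' = "inv\<^bsub>grp D\<^esub> elt D"
  let ?z = "- (yelt D \<otimes>\<^bsub>hopf_alg D\<^esub> gelt D ?g')"
  have g': "gelt D ?g' \<in> carrier (hopf_alg D)" using elt_carrier[OF D] by (simp add: gelt_carrier[OF D])
  have z: "?z \<in> carrier (hopf_alg D)" using g' by (intro hopf_uminus[OF D] H.m_closed yelt_carrier[OF D])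
  have az: "act M ?z = - mmul ?I (act M (yelt D)) (act M (gelt D ?g'))"
    using g' by (simp add: hmodule_uminus[OF D M] hmodule_mult[OF D M] yelt_carrier[OF D])
  have fin: "finite ?I" using M by (rule hmodule_finite[OF D])
  have "act (dual_module D M) a = tr (act M (antipode D a))"
    by (simp add: dual_module_def tr_def)
  also have "\<dots> = tr (lin_ext (hbasis D) (\<lambda>p. act M (case p of (i, h) \<Rightarrow> gelt D (inv\<^bsub>grp D\<^esub> h) \<otimes>\<^bsub>hopf_alg D\<^esub> ?z [^]\<^bsub>hopf_alg D\<^esub> i)) a)"
    unfolding antipode_def using z
    by (subst hmodule_lin_ext[OF D M]) (auto simp: hbasis_def intro!: H.m_closed gelt_carrier[OF D])
  also have "\<dots> = lin_ext (hbasis D) (\<lambda>p. tr (act M (case p of (i, h) \<Rightarrow> gelt D (inv\<^bsub>grp D\<^esub> h) \<otimes>\<^bsub>hopf_alg D\<^esub> ?z [^]\<^bsub>hopf_alg D\<^esub> i))) a"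
    unfolding lin_ext_def by (simp add: tr_sum tr_scale)
  also have "\<dots> = lin_ext (hbasis D) (\<lambda>(i, h). mmul ?I (mpow ?I (tr (act M ?z)) i) (tr (act M (gelt D (inv\<^bsub>grp D\<^esub> h))))) a"
  proof (rule lin_ext_cong, clarify)
    fix i h assume "(i, h) \<in> hbasis D"
    then have h: "gelt D (inv\<^bsub>grp D\<^esub> h) \<in> carrier (hopf_alg D)" by (simp add: hbasis_def gelt_carrier[OF D])
    show "tr (act M (gelt D (inv\<^bsub>grp D\<^esub> h) \<otimes>\<^bsub>hopf_alg D\<^esub> ?z [^]\<^bsub>hopf_alg D\<^esub> i))
       = mmul ?I (mpow ?I (tr (act M ?z)) i) (tr (act M (gelt D (inv\<^bsub>grp D\<^esub> h))))"
      using h z fin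
      by (simp add: hmodule_mult[OF D M] hmodule_pow[OF D M] hmodule_act[OF D M] mpow_tr mmul_tr)
  qed
  finally show ?thesis unfolding act_gen_module[OF D] az tr_uminus .
qed

text \<open>Since y and the inverse of g commute up to a scalar, the n-th power of S(y) is a scalar
  times y^n times a group element, hence 0.\<close>

lemma dual_ymod:
  assumes M: "hmodule D M"
  shows "ymod D (idx M) (\<lambda>h. tr (act M (gelt D (inv\<^bsub>grp D\<^esub> h))))
     (- tr (mmul (idx M) (act M (yelt D)) (act M (gelt D (inv\<^bsub>grp D\<^esub> elt D)))))"
proof -
  let ?I = "idx M" and ?n = "nil_ord D" and ?g' = "inv\<^bsub>grp D\<^esub> elt D" and ?Y = "act M (yelt D)"
  let ?R = "\<lambda>h. act M (gelt D h)"
  note Y = hmodule_ymod[OF D M]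
  note fin = ymod_finite[OF Y]
  have g': "?g' \<in> carrier (grp D)" using elt_carrier[OF D] by simp
  have RY: "mmul ?I (?R h) ?Y = fscale (inverse (chr D h)) (mmul ?I ?Y (?R h))" if "h \<in> carrier (grp D)" for h
    using ymod_YR[OF Y that] chr_nz[OF D that] by simp
  \<comment> \<open>The sign of S(y) is attached to the group factor so that the matrix is a product
    to which \<open>mpow_mmul\<close> applies.\<close>
  let ?Z = "mmul ?I ?Y (- ?R ?g')"
  have Z: "?Z \<in> fspace (?I \<times> ?I)"
    using ymod_Y[OF Y] ymod_R[OF Y g'] by (intro mmul_closed fspace_uminus)
  obtain c where "mpow ?I ?Z ?n = fscale c (mmul ?I (mpow ?I ?Y ?n) (mpow ?I (- ?R ?g') ?n))"
    using mpow_mmul[OF fin ymod_Y[OF Y], of "- ?R ?g'" "inverse (chr D ?g')"] RY[OF g']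
    by (auto simp: mmul_uminus fvs.scale_minus_right)
  then have nil: "mpow ?I ?Z ?n = 0" by (simp only: ymod_nil[OF Y] mmul_zero fvs.scale_zero_right)
  have tZ: "- tr (mmul ?I ?Y (?R ?g')) = tr ?Z" by (simp add: mmul_uminus tr_uminus)
  have comm: "mmul ?I (?R h) ?Z = fscale (inverse (chr D h)) (mmul ?I ?Z (?R h))" if h: "h \<in> carrier (grp D)" for h
  proof -
    have "?g' \<otimes>\<^bsub>grp D\<^esub> h = h \<otimes>\<^bsub>grp D\<^esub> ?g'"
      using elt_central[OF D h] elt_carrier[OF D] h
      by (metis G.inv_solve_left G.inv_solve_right G.m_assoc G.m_closed g')
    then have c: "mmul ?I (?R ?g') (?R h) = mmul ?I (?R h) (?R ?g')"
      using h g' by (simp flip: ymod_mult[OF Y])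
    have "mmul ?I (?R h) (mmul ?I ?Y (?R ?g')) = fscale (inverse (chr D h)) (mmul ?I ?Y (mmul ?I (?R h) (?R ?g')))"
      using fin RY[OF h] by (simp add: mmul_scale flip: mmul_assoc)
    then show ?thesis using fin by (simp add: mmul_uminus mmul_assoc c fvs.scale_minus_right)
  qed
  have "chr D h \<noteq> 0" if "h \<in> carrier (grp D)" for h using chr_nz[OF D that] .
  then show ?thesis unfolding tZ ymod_def
    using fin nil Z comm ymod_R[OF Y] ymod_mult[OF Y] ymod_one[OF Y]
    by (auto simp: tr_idmat mmul_tr mpow_tr tr_zero G.inv_mult_group chr_inv[OF D] tr_scale intro: tr_fspace)
qed

lemma dual_hmodule: "hmodule D M \<Longrightarrow> hmodule D (dual_module D M)"
  and dual_gelt: "hmodule D M \<Longrightarrow> h \<in> carrier (grp D) \<Longrightarrow>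
    act (dual_module D M) (gelt D h) = tr (act M (gelt D (inv\<^bsub>grp D\<^esub> h)))"
  and dual_yelt: "hmodule D M \<Longrightarrow> act (dual_module D M) (yelt D) =
     - tr (mmul (idx M) (act M (yelt D)) (act M (gelt D (inv\<^bsub>grp D\<^esub> elt D))))"
proof -
  assume M: "hmodule D M"
  have *: "ymod D (idx (dual_module D M)) (\<lambda>h. tr (act M (gelt D (inv\<^bsub>grp D\<^esub> h))))
     (- tr (mmul (idx M) (act M (yelt D)) (act M (gelt D (inv\<^bsub>grp D\<^esub> elt D)))))"
    using dual_ymod[OF M] by simp
  note ** = hmodule_if_gen_module[OF D *, unfolded idx_dual, OF dual_act_eq[OF M]]
  show "hmodule D (dual_module D M)" by (rule **(1))
  show "h \<in> carrier (grp D) \<Longrightarrow> act (dual_module D M) (gelt D h) = tr (act M (gelt D (inv\<^bsub>grp D\<^esub> h)))"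
    by (rule **(2))
  show "act (dual_module D M) (yelt D) = - tr (mmul (idx M) (act M (yelt D)) (act M (gelt D (inv\<^bsub>grp D\<^esub> elt D))))"
    by (rule **(3))
qed

lemma inflate_ymod: "grep D U \<Longrightarrow> ymod D (idx U) (act U) 0"
proof -
  have "mpow I 0 (nil_ord D) = (0 :: 'i \<times> 'i \<Rightarrow> 'k)" for I :: "'i set"
    using nil_ord_ge[OF D] by (cases "nil_ord D") (simp_all add: mmul_zero)
  then show "grep D U \<Longrightarrow> ymod D (idx U) (act U) 0"
    by (auto simp: ymod_def grep_finite grep_act[OF D] grep_one[OF D] grep_mult[OF D] mmul_zero)
qed

lemma inflate_hmodule: "grep D U \<Longrightarrow> hmodule D (inflate D U)"
  and inflate_gelt: "grep D U \<Longrightarrow> h \<in> carrier (grp D) \<Longrightarrow> act (inflate D U) (gelt D h) = act U h"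
  and inflate_yelt: "grep D U \<Longrightarrow> act (inflate D U) (yelt D) = 0"
  unfolding inflate_def using inflate_ymod
  by (auto intro: ymod_hmodule[OF D] gen_module_gelt[OF D] gen_module_yelt[OF D])

lemma char_rep_grep:
  assumes "\<psi> \<one>\<^bsub>grp D\<^esub> = 1" "\<And>h k. h \<in> carrier (grp D) \<Longrightarrow> k \<in> carrier (grp D) \<Longrightarrow> \<psi> (h \<otimes>\<^bsub>grp D\<^esub> k) = \<psi> h * \<psi> k"
  shows "grep D (char_rep \<psi>)"
  by (rule grepI[OF D])
    (auto simp: char_rep_def assms mmul_scale mult.commute, auto simp: fspace_def fscale_def idmat_def)

text \<open>Both generators act on M(U, j) by Kronecker products, one factor acting on the powers of
  x and one on U; the relations then split into those of \<open>shift\<close> and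
  \<open>scal\<close> and those of U.\<close>

lemma Mmod_eq: "Mmod D U j = gen_module D ({..<j} \<times> idx U)
    (\<lambda>h. kron (scal j (inverse (chr D h))) (act U h)) (kron (shift j) (idmat (idx U)))"
  unfolding Mmod_def
  by (intro arg_cong2[of _ _ _ _ "gen_module D ({..<j} \<times> idx U)"])
    (auto simp: kron_def scal_def shift_def idmat_def fun_eq_iff)

lemma Mmod_ymod:
  assumes U: "grep D U" and j: "j \<le> nil_ord D"
  shows "ymod D ({..<j} \<times> idx U) (\<lambda>h. kron (scal j (inverse (chr D h))) (act U h)) (kron (shift j) (idmat (idx U)))"
proof -
  note fin = grep_finite[OF U]
  have "mpow {..<j} (shift j) (nil_ord D) = (0 :: nat \<times> nat \<Rightarrow> 'k)"
    using j by (auto simp: mpow_shift fun_eq_iff)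
  then have nil: "mpow ({..<j} \<times> idx U) (kron (shift j) (idmat (idx U))) (nil_ord D) = (0 :: _ \<Rightarrow> 'k)"
    by (simp add: mpow_kron kron_zero)
  show ?thesis
    unfolding ymod_def using fin nil grep_act[OF D U] grep_one[OF D U] grep_mult[OF D U]
    by (auto simp: mmul_kron scal_mult chr_mult[OF D] chr_one[OF D] scal_one kron_idmat
        mmul_idmat_left[OF fin grep_act[OF D U]] mmul_idmat_right[OF fin grep_act[OF D U]] shift_scal[OF chr_nz[OF D]] kron_scale inverse_mult_distrib
        intro: kron_fspace)
qed

lemma Mmod_hmodule: "grep D U \<Longrightarrow> j \<le> nil_ord D \<Longrightarrow> hmodule D (Mmod D U j)"
  and Mmod_gelt: "grep D U \<Longrightarrow> j \<le> nil_ord D \<Longrightarrow> h \<in> carrier (grp D) \<Longrightarrow>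
    act (Mmod D U j) (gelt D h) = kron (scal j (inverse (chr D h))) (act U h)"
  and Mmod_yelt: "grep D U \<Longrightarrow> j \<le> nil_ord D \<Longrightarrow> act (Mmod D U j) (yelt D) = kron (shift j) (idmat (idx U))"
  unfolding Mmod_eq using Mmod_ymod
  by (auto intro!: ymod_hmodule[OF D] gen_module_gelt[OF D] gen_module_yelt[OF D])

end

section \<open>Tensor products, duals and Hom dimensions up to isomorphism\<close>

lemma dim_le_inj:
  assumes f: "Vector_Spaces.linear fscale fscale f" and S: "fvs.subspace S" and inj: "inj_on f S"
    and T: "f ` S \<subseteq> T" "T \<subseteq> fspace I" and I: "finite I"
  shows "fvs.dim S \<le> fvs.dim T"
proof -
  obtain B where B: "B \<subseteq> T" "fvs.independent B" "T \<subseteq> fvs.span B" "card B = fvs.dim T"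
    by (rule fvs.basis_exists)
  have "finite B" using finite_independent_fspace[OF I B(2)] B(1) T by auto
  moreover have "f ` S \<subseteq> fvs.span B" using T B(3) by auto
  ultimately have "fvs.dim (f ` S) \<le> card B" by (intro fvs.dim_le_card)
  then show ?thesis using dim_image_inj[OF f S inj] B(4) by simp
qed

lemma dim_bij:
  "Vector_Spaces.linear fscale fscale f \<Longrightarrow> fvs.subspace S \<Longrightarrow> inj_on f S \<Longrightarrow> f ` S = T \<Longrightarrow> fvs.dim S = fvs.dim T"
  using dim_image_inj[of f S] by simp

lemma gens_cases: "a \<in> gens D \<Longrightarrow> (a = yelt D \<Longrightarrow> P) \<Longrightarrow> (\<And>h. h \<in> carrier (grp D) \<Longrightarrow> a = gelt D h \<Longrightarrow> P) \<Longrightarrow> P"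
  by (auto simp: gens_def)

lemma dual_sum_module: "dual_module D (sum_module M N) = sum_module (dual_module D M) (dual_module D N)"
  by (auto simp: dual_module_def sum_module_def fun_eq_iff split: sum.split)

context
  fixes D :: "('g, 'k::field) datum"
  assumes D: "nilpotent_datum D"
begin

interpretation G: group "grp D" using D by (simp add: nilpotent_datum_def)
interpretation H: ring "hopf_alg D" using D by (rule hopf_ring)

abbreviation hiso :: "(nat \<times> 'g \<Rightarrow> 'k, 'k, 'i) rep \<Rightarrow> (nat \<times> 'g \<Rightarrow> 'k, 'k, 'j) rep \<Rightarrow> bool" where
  "hiso M N \<equiv> rep_iso (carrier (hopf_alg D)) M N"

lemma hiso_trans: "hmodule D M \<Longrightarrow> hmodule D N \<Longrightarrow> hmodule D L \<Longrightarrow> hiso M N \<Longrightarrow> hiso N L \<Longrightarrow> hiso M L"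
  by (rule rep_iso_trans) (auto intro: hmodule_finite[OF D])

lemma hiso_refl: "hmodule D M \<Longrightarrow> hiso M M"
  by (rule rep_iso_refl[OF hmodule_mrep[OF D]])

lemma hom_dim_iso: "hmodule D M \<Longrightarrow> hmodule D M' \<Longrightarrow> hmodule D N \<Longrightarrow> hmodule D N' \<Longrightarrow>
    hiso M M' \<Longrightarrow> hiso N N' \<Longrightarrow> hom_dim D M N = hom_dim D M' N'"
  unfolding hom_dim_def by (simp add: dim_Hom_iso[of M M' N N'] hmodule_finite[OF D])

lemma HomI_gens:
  assumes M: "hmodule D M" and N: "hmodule D N" and T: "T \<in> fspace (idx N \<times> idx M)"
    and R: "\<And>h. h \<in> carrier (grp D) \<Longrightarrow> mmul (idx M) T (act M (gelt D h)) = mmul (idx N) (act N (gelt D h)) T"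
    and Y: "mmul (idx M) T (act M (yelt D)) = mmul (idx N) (act N (yelt D)) T"
  shows "T \<in> Hom (carrier (hopf_alg D)) M N"
  unfolding Hom_gens[OF D M N] using R Y by (intro HomI[OF T]) (auto elim: gens_cases)

lemma Hom_gelt: "T \<in> Hom (carrier (hopf_alg D)) M N \<Longrightarrow> h \<in> carrier (grp D) \<Longrightarrow>
    mmul (idx M) T (act M (gelt D h)) = mmul (idx N) (act N (gelt D h)) T"
  and Hom_yelt: "T \<in> Hom (carrier (hopf_alg D)) M N \<Longrightarrow>
    mmul (idx M) T (act M (yelt D)) = mmul (idx N) (act N (yelt D)) T"
  by (auto intro: Hom_commute gelt_carrier[OF D] yelt_carrier[OF D])

lemma hmodule_gelt: "hmodule D M \<Longrightarrow> h \<in> carrier (grp D) \<Longrightarrow> act M (gelt D h) \<in> fspace (idx M \<times> idx M)"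
  and hmodule_yelt: "hmodule D M \<Longrightarrow> act M (yelt D) \<in> fspace (idx M \<times> idx M)"
  and hmodule_gelt_mult: "hmodule D M \<Longrightarrow> h \<in> carrier (grp D) \<Longrightarrow> k \<in> carrier (grp D) \<Longrightarrow>
     mmul (idx M) (act M (gelt D h)) (act M (gelt D k)) = act M (gelt D (h \<otimes>\<^bsub>grp D\<^esub> k))"
  and hmodule_gelt_one: "hmodule D M \<Longrightarrow> act M (gelt D \<one>\<^bsub>grp D\<^esub>) = idmat (idx M)"
  using ymod_R[OF hmodule_ymod[OF D, of M]] ymod_Y[OF hmodule_ymod[OF D, of M]]
    ymod_mult[OF hmodule_ymod[OF D, of M]] ymod_one[OF hmodule_ymod[OF D, of M]] by simp_all

lemma hmodule_gelt_inv: 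
  assumes "hmodule D M" "h \<in> carrier (grp D)"
  shows "mmul (idx M) (act M (gelt D h)) (act M (gelt D (inv\<^bsub>grp D\<^esub> h))) = idmat (idx M)"
    "mmul (idx M) (act M (gelt D (inv\<^bsub>grp D\<^esub> h))) (act M (gelt D h)) = idmat (idx M)"
  using assms by (simp_all add: hmodule_gelt_mult hmodule_gelt_one)

lemma tensor_iso:
  assumes h: "hmodule D M" "hmodule D M'" "hmodule D N" "hmodule D N'" and MM: "hiso M M'" and NN: "hiso N N'"
  shows "hiso (tensor_module D M N) (tensor_module D M' N')"
proof -
  obtain P Q where PQ: "P \<in> Hom (carrier (hopf_alg D)) M M'" "Q \<in> Hom (carrier (hopf_alg D)) M' M"
    "mmul (idx M') Q P = idmat (idx M)" "mmul (idx M) P Q = idmat (idx M')"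
    using MM unfolding rep_iso_def by blast
  obtain P' Q' where PQ': "P' \<in> Hom (carrier (hopf_alg D)) N N'" "Q' \<in> Hom (carrier (hopf_alg D)) N' N"
    "mmul (idx N') Q' P' = idmat (idx N)" "mmul (idx N) P' Q' = idmat (idx N')"
    using NN unfolding rep_iso_def by blast
  note fs = PQ(1,2)[THEN Hom_fspace] PQ'(1,2)[THEN Hom_fspace]
  note fin = h[THEN hmodule_finite[OF D]]
  have id: "mmul (idx M) P (idmat (idx M)) = mmul (idx M') (idmat (idx M')) P"
    using fs(1) fin by (simp add: mmul_idmat_left mmul_idmat_right)
  show ?thesis
    by (rule rep_isoI[where T = "kron P P'" and S = "kron Q Q'"])
      (use h fs in \<open>auto intro!: hmodule_mrep[OF D] tensor_hmodule[OF D] HomI_gens kron_fspace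
        simp: tensor_gelt[OF D] tensor_yelt[OF D] mmul_kron mmul_add PQ(3,4) PQ'(3,4) kron_idmat id
          Hom_gelt[OF PQ(1)] Hom_gelt[OF PQ'(1)] Hom_yelt[OF PQ(1)] Hom_yelt[OF PQ'(1)] elt_carrier[OF D]\<close>)
qed

lemma sum_iso:
  assumes h: "hmodule D M" "hmodule D M'" "hmodule D N" "hmodule D N'" and MM: "hiso M M'" and NN: "hiso N N'"
  shows "hiso (sum_module M N) (sum_module M' N')"
proof -
  obtain P Q where PQ: "P \<in> Hom (carrier (hopf_alg D)) M M'" "Q \<in> Hom (carrier (hopf_alg D)) M' M"
    "mmul (idx M') Q P = idmat (idx M)" "mmul (idx M) P Q = idmat (idx M')"
    using MM unfolding rep_iso_def by blast
  obtain P' Q' where PQ': "P' \<in> Hom (carrier (hopf_alg D)) N N'" "Q' \<in> Hom (carrier (hopf_alg D)) N' N"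
    "mmul (idx N') Q' P' = idmat (idx N)" "mmul (idx N) P' Q' = idmat (idx N')"
    using NN unfolding rep_iso_def by blast
  note fs = PQ(1,2)[THEN Hom_fspace] PQ'(1,2)[THEN Hom_fspace]
  note fin = h[THEN hmodule_finite[OF D]]
  show ?thesis
    by (rule rep_isoI[where T = "bdiag P P'" and S = "bdiag Q Q'"])
      (use h fs fin in \<open>auto intro!: hmodule_mrep[OF D] sum_hmodule[OF D] HomI bdiag_fspace
        simp: act_sum_module mmul_bdiag PQ(3,4) PQ'(3,4) bdiag_idmat Hom_commute[OF PQ(1)] Hom_commute[OF PQ'(1)]\<close>)
qed

lemma dual_iso:
  assumes h: "hmodule D M" "hmodule D M'" and MM: "hiso M M'"
  shows "hiso (dual_module D M) (dual_module D M')"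
proof -
  obtain P Q where PQ: "P \<in> Hom (carrier (hopf_alg D)) M M'" "Q \<in> Hom (carrier (hopf_alg D)) M' M"
    "mmul (idx M') Q P = idmat (idx M)" "mmul (idx M) P Q = idmat (idx M')"
    using MM unfolding rep_iso_def by blast
  note fs = PQ(1,2)[THEN Hom_fspace]
  note fin = h[THEN hmodule_finite[OF D]]
  have g': "inv\<^bsub>grp D\<^esub> elt D \<in> carrier (grp D)" using elt_carrier[OF D] by simp
  have y: "mmul (idx M') Q (mmul (idx M') (act M' (yelt D)) (act M' (gelt D (inv\<^bsub>grp D\<^esub> elt D)))) =
    mmul (idx M) (mmul (idx M) (act M (yelt D)) (act M (gelt D (inv\<^bsub>grp D\<^esub> elt D)))) Q"
    using Hom_gelt[OF PQ(2) g'] fin by (simp add: Hom_yelt[OF PQ(2)] mmul_assoc flip: mmul_assoc[of "idx M'" "idx M'" Q])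
  show ?thesis
    by (rule rep_isoI[where T = "tr Q" and S = "tr P"])
      (use h fs in \<open>auto intro!: hmodule_mrep[OF D] dual_hmodule[OF D] HomI_gens tr_fspace
        simp: dual_gelt[OF D] dual_yelt[OF D] mmul_tr PQ(3,4) tr_idmat Hom_gelt[OF PQ(2)] y mmul_uminus\<close>)
qed

text \<open>The square of the antipode is conjugation by g, as S(S(y)) = g y g^-1. Hence the action
  of g is itself an isomorphism from M to its double dual; g^-1 gives the inverse.\<close>

lemma double_dual_iso:
  assumes M: "hmodule D M"
  shows "hiso M (dual_module D (dual_module D M))"
proof -
  note g = elt_carrier[OF D] G.inv_closed[OF elt_carrier[OF D]]
  note fin = hmodule_finite[OF D M]
  let ?I = "idx M" and ?g = "act M (gelt D (elt D))" and ?g' = "act M (gelt D (inv\<^bsub>grp D\<^esub> elt D))"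
  note fs = hmodule_gelt[OF M g(1)] hmodule_gelt[OF M g(2)]
  have y: "mmul ?I ?g (act M (yelt D)) = mmul ?I (mmul ?I ?g (mmul ?I (act M (yelt D)) ?g')) ?g"
    using fin hmodule_gelt_inv(2)[OF M g(1)] hmodule_yelt[OF M] by (simp add: mmul_assoc mmul_idmat_right)
  have c: "mmul ?I ?g (act M (gelt D h)) = mmul ?I (act M (gelt D h)) ?g" if "h \<in> carrier (grp D)" for h
    using that g elt_central[OF D that] by (simp add: hmodule_gelt_mult[OF M])
  show ?thesis
  proof (rule rep_isoI[where T = ?g and S = ?g'])
    show "?g \<in> Hom (carrier (hopf_alg D)) M (dual_module D (dual_module D M))"
      using M g fs by (intro HomI_gens dual_hmodule[OF D])
        (auto simp: dual_gelt[OF D] dual_yelt[OF D] dual_hmodule[OF D] mmul_tr c y tr_uminus mmul_uminus)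
  qed (use M fs in \<open>auto intro!: hmodule_mrep[OF D] dual_hmodule[OF D] hmodule_gelt_inv g\<close>)
qed

text \<open>Rebracketing the indices is an H-map by coassociativity, which only has to be checked on
  y and on G.\<close>

lemma tensor_assoc:
  assumes h: "hmodule D M" "hmodule D N" "hmodule D L"
  shows "hiso (tensor_module D (tensor_module D M N) L) (tensor_module D M (tensor_module D N L))"
proof (rule hmodule_relabel_iso[OF D, where \<beta> = "\<lambda>((s, t), u). (s, (t, u))"])
  show "bij_betw (\<lambda>((s, t), u). (s, (t, u))) (idx (tensor_module D (tensor_module D M N) L)) (idx (tensor_module D M (tensor_module D N L)))"
    by (rule bij_betwI[where g = "\<lambda>(s, (t, u)). ((s, t), u)"]) auto
qed (use h elt_carrier[OF D] in \<open>auto simp: tensor_hmodule[OF D] tensor_gelt[OF D] tensor_yelt[OF D] kron_app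
    algebra_simps simp flip: kron_idmat\<close>)

lemma trivial_grep: "grep D (char_rep (\<lambda>_. 1))"
  by (rule char_rep_grep[OF D]) simp_all

lemma act_char_rep: "act (char_rep \<psi>) h = fscale (\<psi> h) (idmat {0})"
  by (simp add: char_rep_def)

lemma tensor_unit_left:
  assumes M: "hmodule D M"
  shows "hiso (tensor_module D (inflate D (char_rep (\<lambda>_. 1))) M) M"
proof (rule hmodule_relabel_iso[OF D, where \<beta> = snd])
  show "bij_betw snd (idx (tensor_module D (inflate D (char_rep (\<lambda>_. 1))) M)) (idx M)"
    by (rule bij_betwI[where g = "\<lambda>s. (0, s)"]) auto
qed (use M in \<open>auto simp: tensor_hmodule[OF D] tensor_gelt[OF D] tensor_yelt[OF D] kron_app inflate_hmodule[OF D]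
    inflate_gelt[OF D] inflate_yelt[OF D] trivial_grep act_char_rep idmat_def\<close>)

lemma tensor_unit_right:
  assumes M: "hmodule D M"
  shows "hiso (tensor_module D M (inflate D (char_rep (\<lambda>_. 1)))) M"
proof (rule hmodule_relabel_iso[OF D, where \<beta> = fst])
  show "bij_betw fst (idx (tensor_module D M (inflate D (char_rep (\<lambda>_. 1))))) (idx M)"
    by (rule bij_betwI[where g = "\<lambda>s. (s, 0)"]) auto
qed (use M elt_carrier[OF D] in \<open>auto simp: tensor_hmodule[OF D] tensor_gelt[OF D] tensor_yelt[OF D] kron_app inflate_hmodule[OF D]
    inflate_gelt[OF D] inflate_yelt[OF D] trivial_grep act_char_rep idmat_def\<close>)

lemma tensor_sum_left:
  assumes h: "hmodule D M" "hmodule D N" "hmodule D L"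
  shows "hiso (tensor_module D (sum_module M N) L) (sum_module (tensor_module D M L) (tensor_module D N L))"
proof (rule hmodule_relabel_iso[OF D, where \<beta> = "\<lambda>(s, u). case s of Inl x \<Rightarrow> Inl (x, u) | Inr x \<Rightarrow> Inr (x, u)"])
  show "bij_betw (\<lambda>(s, u). case s of Inl x \<Rightarrow> Inl (x, u) | Inr x \<Rightarrow> Inr (x, u))
     (idx (tensor_module D (sum_module M N) L)) (idx (sum_module (tensor_module D M L) (tensor_module D N L)))"
    by (rule bij_betwI[where g = "\<lambda>s. case s of Inl (x, u) \<Rightarrow> (Inl x, u) | Inr (x, u) \<Rightarrow> (Inr x, u)"])
      (auto split: sum.splits)
qed (use h in \<open>auto simp: tensor_hmodule[OF D] sum_hmodule[OF D] tensor_gelt[OF D] tensor_yelt[OF D] kron_app act_sum_module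
    idmat_def\<close>)

lemma tensor_sum_right:
  assumes h: "hmodule D M" "hmodule D N" "hmodule D L"
  shows "hiso (tensor_module D L (sum_module M N)) (sum_module (tensor_module D L M) (tensor_module D L N))"
proof (rule hmodule_relabel_iso[OF D, where \<beta> = "\<lambda>(u, s). case s of Inl x \<Rightarrow> Inl (u, x) | Inr x \<Rightarrow> Inr (u, x)"])
  show "bij_betw (\<lambda>(u, s). case s of Inl x \<Rightarrow> Inl (u, x) | Inr x \<Rightarrow> Inr (u, x))
     (idx (tensor_module D L (sum_module M N))) (idx (sum_module (tensor_module D L M) (tensor_module D L N)))"
    by (rule bij_betwI[where g = "\<lambda>s. case s of Inl (u, x) \<Rightarrow> (u, Inl x) | Inr (u, x) \<Rightarrow> (u, Inr x)"])
      (auto split: sum.splits)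
qed (use h in \<open>auto simp: tensor_hmodule[OF D] sum_hmodule[OF D] tensor_gelt[OF D] tensor_yelt[OF D] kron_app act_sum_module
    idmat_def\<close>)

lemma Mmod_iso:
  assumes U: "grep D U" "grep D U'" and j: "j \<le> nil_ord D" and UU: "rep_iso (carrier (grp D)) U U'"
  shows "hiso (Mmod D U j) (Mmod D U' j)"
proof -
  obtain P Q where PQ: "P \<in> Hom (carrier (grp D)) U U'" "Q \<in> Hom (carrier (grp D)) U' U"
    "mmul (idx U') Q P = idmat (idx U)" "mmul (idx U) P Q = idmat (idx U')"
    using UU unfolding rep_iso_def by blast
  note fs = PQ(1,2)[THEN Hom_fspace]
  note fin = U[THEN grep_finite]
  have id: "mmul (idx U) P (idmat (idx U)) = mmul (idx U') (idmat (idx U')) P"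
    using fs(1) fin by (simp add: mmul_idmat_left mmul_idmat_right)
  have js: "mmul {..<j} (idmat {..<j}) A = mmul {..<j} A (idmat {..<j})" if "A \<in> fspace ({..<j} \<times> {..<j})"
    for A :: "nat \<times> nat \<Rightarrow> 'k"
    using that by (simp add: mmul_idmat_left mmul_idmat_right)
  show ?thesis
    by (rule rep_isoI[where T = "kron (idmat {..<j}) P" and S = "kron (idmat {..<j}) Q"])
      (use U j fs in \<open>auto intro!: hmodule_mrep[OF D] Mmod_hmodule[OF D] HomI_gens kron_fspace
        simp: Mmod_gelt[OF D] Mmod_yelt[OF D] mmul_kron PQ(3,4) kron_idmat id js Hom_commute[OF PQ(1)]\<close>)
qed

text \<open>Restriction to the first summand is onto Hom(M, L), since maps on the summands can be
  glued, and its kernel is Hom(N, L).\<close>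

lemma hom_dim_sum:
  fixes M :: "(nat \<times> 'g \<Rightarrow> 'k, 'k, 'i) rep" and N :: "(nat \<times> 'g \<Rightarrow> 'k, 'k, 'j) rep" and L :: "(nat \<times> 'g \<Rightarrow> 'k, 'k, 'l) rep"
  assumes M: "hmodule D M" and N: "hmodule D N" and L: "hmodule D L"
  shows "hom_dim D (sum_module M N) L = hom_dim D M L + hom_dim D N L"
proof -
  let ?H = "Hom (carrier (hopf_alg D))"
  let ?S = "?H (sum_module M N) L"
  let ?l = "\<lambda>T (k, i). T (k, Inl i)" and ?r = "\<lambda>T (k, i). T (k, Inr i)"
  note fin = hmodule_finite[OF D M] hmodule_finite[OF D N] hmodule_finite[OF D L]
  have lin: "Vector_Spaces.linear fscale fscale ?l" "Vector_Spaces.linear fscale fscale ?r"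
    by (auto intro!: linearI simp: fscale_def fun_eq_iff)
  have l: "mmul (idx M <+> idx N) T (bdiag A B) (k, Inl i) = mmul (idx M) (?l T) A (k, i)"
    and r: "mmul (idx M <+> idx N) T (bdiag A B) (k, Inr j) = mmul (idx N) (?r T) B (k, j)" for T A B k i j
    using fin by (simp_all add: mmul_def sum_Plus)
  have Sl: "?l T \<in> ?H M L" and Sr: "?r T \<in> ?H N L" if T: "T \<in> ?S" for T
  proof -
    have e: "mmul (idx M <+> idx N) T (bdiag (act M a) (act N a)) = mmul (idx L) (act L a) T"
      if "a \<in> carrier (hopf_alg D)" for a
      using Hom_commute[OF T that] by (simp add: act_sum_module)
    have f: "T \<in> fspace (idx L \<times> (idx M <+> idx N))" using Hom_fspace[OF T] by simp
    show "?l T \<in> ?H M L"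
    proof (rule HomI)
      show "?l T \<in> fspace (idx L \<times> idx M)" using f by (auto simp: fspace_def)
      fix a assume a: "a \<in> carrier (hopf_alg D)"
      have "mmul (idx M) (?l T) (act M a) (k, i) = mmul (idx L) (act L a) (?l T) (k, i)" for k i
      proof -
        have "mmul (idx M) (?l T) (act M a) (k, i) = mmul (idx L) (act L a) T (k, Inl i)"
          unfolding l[of T _ "act N a", symmetric] e[OF a] ..
        then show ?thesis by (simp add: mmul_def)
      qed
      then show "mmul (idx M) (?l T) (act M a) = mmul (idx L) (act L a) (?l T)"
        by auto
    qed
    show "?r T \<in> ?H N L"
    proof (rule HomI)
      show "?r T \<in> fspace (idx L \<times> idx N)" using f by (auto simp: fspace_def)
      fix a assume a: "a \<in> carrier (hopf_alg D)"
      have "mmul (idx N) (?r T) (act N a) (k, i) = mmul (idx L) (act L a) (?r T) (k, i)" for k i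
      proof -
        have "mmul (idx N) (?r T) (act N a) (k, i) = mmul (idx L) (act L a) T (k, Inr i)"
          unfolding r[of T "act M a", symmetric] e[OF a] ..
        then show ?thesis by (simp add: mmul_def)
      qed
      then show "mmul (idx N) (?r T) (act N a) = mmul (idx L) (act L a) (?r T)"
        by auto
    qed
  qed
  define c where "c A B = (\<lambda>(k, x). case x of Inl i \<Rightarrow> A (k, i) | Inr j \<Rightarrow> B (k, j))"
    for A :: "'l \<times> 'i \<Rightarrow> 'k" and B :: "'l \<times> 'j \<Rightarrow> 'k"
  have cl: "?l (c A B) = A" and cr: "?r (c A B) = B" for A B by (auto simp: c_def)
  have cS: "c A B \<in> ?S" if A: "A \<in> ?H M L" and B: "B \<in> ?H N L" for A B
  proof (rule HomI)
    show "c A B \<in> fspace (idx L \<times> idx (sum_module M N))"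
      using Hom_fspace[OF A] Hom_fspace[OF B] by (auto simp: fspace_def c_def split: sum.split)
    fix a assume a: "a \<in> carrier (hopf_alg D)"
    show "mmul (idx (sum_module M N)) (c A B) (act (sum_module M N) a) = mmul (idx L) (act L a) (c A B)"
    proof
      fix p show "mmul (idx (sum_module M N)) (c A B) (act (sum_module M N) a) p = mmul (idx L) (act L a) (c A B) p"
      proof (cases p)
        case (Pair k x)
        then show ?thesis
          by (cases x) (simp_all add: act_sum_module l r cl cr Hom_commute[OF A a] Hom_commute[OF B a], simp_all add: mmul_def c_def)
      qed
    qed
  qed
  have lr: "T = c (?l T) (?r T)" for T
    by (auto simp: c_def fun_eq_iff split: sum.split)
  have zero: "0 \<in> ?H M' N'" for M' :: "(_, 'k, 'x) rep" and N' :: "(_, 'k, 'y) rep"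
    by (rule fvs.subspace_0[OF subspace_Hom])
  have "fvs.dim ?S = fvs.dim {T \<in> ?S. ?l T = 0} + fvs.dim (?l ` ?S)"
    by (rule dim_kernel_image[OF lin(1) subspace_Hom, where I = "idx L \<times> (idx M <+> idx N)"])
      (use fin Hom_fspace in \<open>fastforce+\<close>)
  moreover have "?l ` ?S = ?H M L"
  proof
    show "?H M L \<subseteq> ?l ` ?S"
    proof
      fix A assume "A \<in> ?H M L"
      then show "A \<in> ?l ` ?S" by (intro image_eqI[of _ ?l, OF cl[symmetric] cS[OF _ zero]])
    qed
    show "?l ` ?S \<subseteq> ?H M L" by (rule image_subsetI) (rule Sl)
  qed
  moreover have "fvs.dim {T \<in> ?S. ?l T = 0} = fvs.dim (?H N L)"
  proof -
    have im: "?r ` {T \<in> ?S. ?l T = 0} = ?H N L"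
    proof
      show "?H N L \<subseteq> ?r ` {T \<in> ?S. ?l T = 0}"
      proof
        fix B assume "B \<in> ?H N L"
        then have "c 0 B \<in> {T \<in> ?S. ?l T = 0}" using cS[OF zero] cl[of 0 B] by simp
        then show "B \<in> ?r ` {T \<in> ?S. ?l T = 0}" by (rule image_eqI[of _ ?r, OF cr[symmetric]])
      qed
      show "?r ` {T \<in> ?S. ?l T = 0} \<subseteq> ?H N L"
        by (rule image_subsetI) (rule Sr, simp)
    qed
    have inj: "inj_on ?r {T \<in> ?S. ?l T = 0}"
    proof (rule inj_onI)
      fix T T' assume "T \<in> {T \<in> ?S. ?l T = 0}" "T' \<in> {T \<in> ?S. ?l T = 0}" "?r T = ?r T'"
      then have "c (?l T) (?r T) = c (?l T') (?r T')" by simp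
      then show "T = T'" unfolding lr[symmetric] .
    qed
    have sub: "fvs.subspace {T \<in> ?S. ?l T = 0}"
    proof -
      interpret Vector_Spaces.linear fscale fscale ?l by (rule lin(1))
      have "{T \<in> ?S. ?l T = 0} = ?S \<inter> {T. ?l T = 0}" by blast
      then show ?thesis using fvs.subspace_inter[OF subspace_Hom subspace_kernel] by simp
    qed
    show ?thesis by (rule dim_bij[OF lin(2) sub inj im])
  qed
  ultimately show ?thesis by (simp add: hom_dim_def)
qed

text \<open>The transpose of an H-map from M to the dual of N starts at the double dual of N.
  Composing with the isomorphism N to its double dual, which is the action of g, gives an injection
  of Hom spaces; exchanging M and N turns the inequality into the symmetry of the form.\<close>

lemma hom_dim_dual_le:
  assumes M: "hmodule D M" and N: "hmodule D N"
  shows "hom_dim D M (dual_module D N) \<le> hom_dim D N (dual_module D M)"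
proof -
  let ?I = "idx M" and ?J = "idx N"
  let ?g = "elt D" and ?g' = "inv\<^bsub>grp D\<^esub> elt D"
  let ?RM = "\<lambda>h. act M (gelt D h)" and ?RN = "\<lambda>h. act N (gelt D h)" and ?YM = "act M (yelt D)" and ?YN = "act N (yelt D)"
  note g = elt_carrier[OF D] G.inv_closed[OF elt_carrier[OF D]]
  note fin = hmodule_finite[OF D M] hmodule_finite[OF D N]
  note dM = dual_hmodule[OF D M] and dN = dual_hmodule[OF D N]
  let ?f = "\<lambda>T. mmul ?J (tr T) (?RN ?g)"
  have lin: "Vector_Spaces.linear fscale fscale ?f"
    by (auto intro!: linearI simp: tr_add tr_scale mmul_add mmul_scale)
  have f: "?f T \<in> Hom (carrier (hopf_alg D)) N (dual_module D M)"
    if T: "T \<in> Hom (carrier (hopf_alg D)) M (dual_module D N)" for T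
  proof (rule HomI_gens[OF N dM])
    have Tf: "T \<in> fspace (?J \<times> ?I)" using Hom_fspace[OF T] by simp
    show fT: "?f T \<in> fspace (idx (dual_module D M) \<times> idx N)"
      using hmodule_gelt[OF N g(1)] tr_fspace[OF Tf] by (auto intro: mmul_closed)
    have R: "mmul ?I T (?RM h) = mmul ?J (tr (?RN (inv\<^bsub>grp D\<^esub> h))) T" if "h \<in> carrier (grp D)" for h
      using Hom_gelt[OF T that] that by (simp add: dual_gelt[OF D N])
    have R': "mmul ?J (tr T) (?RN h) = mmul ?I (tr (?RM (inv\<^bsub>grp D\<^esub> h))) (tr T)" if "h \<in> carrier (grp D)" for h
      using arg_cong[OF R[of "inv\<^bsub>grp D\<^esub> h"], of tr] that by (simp add: mmul_tr[symmetric])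
    have Y: "mmul ?I T ?YM = - mmul ?J (tr (mmul ?J ?YN (?RN ?g'))) T"
      using Hom_yelt[OF T] by (simp add: dual_yelt[OF D N] mmul_uminus)
    have Y': "mmul ?I (tr ?YM) (tr T) = - mmul ?J (tr T) (mmul ?J ?YN (?RN ?g'))"
      using arg_cong[OF Y, of tr] by (simp only: tr_uminus mmul_tr[symmetric] tr_tr)
    show "mmul ?J (?f T) (?RN h) = mmul (idx (dual_module D M)) (act (dual_module D M) (gelt D h)) (?f T)"
      if h: "h \<in> carrier (grp D)" for h
    proof -
      have "mmul ?J (?f T) (?RN h) = mmul ?J (mmul ?J (tr T) (?RN h)) (?RN ?g)"
        using fin h g by (simp add: mmul_assoc hmodule_gelt_mult[OF N] elt_central[OF D])
      then show ?thesis using h fin by (simp add: R' dual_gelt[OF D M] mmul_assoc)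
    qed
    have "mmul ?I (tr (mmul ?I ?YM (?RM ?g'))) (?f T) = mmul ?I (tr (?RM ?g')) (mmul ?J (mmul ?I (tr ?YM) (tr T)) (?RN ?g))"
      using fin by (simp add: mmul_tr[symmetric] mmul_assoc)
    also have "\<dots> = - mmul ?J (mmul ?I (tr (?RM ?g')) (tr T)) ?YN"
      using fin g hmodule_yelt[OF N]
      by (simp add: Y' mmul_uminus mmul_assoc hmodule_gelt_inv[OF N] mmul_idmat_right)
    also have "\<dots> = - mmul ?J (?f T) ?YN" using g by (simp add: R'[OF g(1)])
    finally show "mmul ?J (?f T) ?YN = mmul (idx (dual_module D M)) (act (dual_module D M) (yelt D)) (?f T)"
      by (simp add: dual_yelt[OF D M] mmul_uminus)
  qed
  have inj: "inj_on ?f (Hom (carrier (hopf_alg D)) M (dual_module D N))"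
  proof (rule inj_on_inverseI[where g = "\<lambda>U. tr (mmul ?J U (?RN ?g'))"])
    fix T assume "T \<in> Hom (carrier (hopf_alg D)) M (dual_module D N)"
    then have "tr T \<in> fspace (?I \<times> ?J)" using Hom_fspace tr_fspace by fastforce
    then show "tr (mmul ?J (?f T) (?RN ?g')) = T"
      using fin g by (simp add: mmul_assoc hmodule_gelt_inv[OF N] mmul_idmat_right)
  qed
  have "fvs.dim (Hom (carrier (hopf_alg D)) M (dual_module D N)) \<le> fvs.dim (Hom (carrier (hopf_alg D)) N (dual_module D M))"
    by (rule dim_le_inj[OF lin subspace_Hom inj, of _ "?I \<times> ?J"]) (use f Hom_fspace fin in \<open>fastforce+\<close>)
  then show ?thesis by (simp add: hom_dim_def)
qed

lemma hom_dim_dual_sym: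
  "hmodule D M \<Longrightarrow> hmodule D N \<Longrightarrow> hom_dim D M (dual_module D N) = hom_dim D N (dual_module D M)"
  by (intro antisym hom_dim_dual_le)

text \<open>A matrix from M to the dual of N is a bilinear form on M and N, that is, a functional on
  M \<otimes> N. Both intertwining conditions say that this functional is invariant. On Green ring
  level this is associativity of the form.\<close>

lemma hom_dim_adjunction:
  fixes M :: "(nat \<times> 'g \<Rightarrow> 'k, 'k, 'i) rep" and N :: "(nat \<times> 'g \<Rightarrow> 'k, 'k, 'j) rep"
  assumes M: "hmodule D M" and N: "hmodule D N"
  shows "hom_dim D M (dual_module D N) = hom_dim D (tensor_module D M N) (dual_module D (inflate D (char_rep (\<lambda>_. 1))))"
proof -
  let ?I = "idx M" and ?J = "idx N" and ?K = "inflate D (char_rep (\<lambda>_. 1))"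
  let ?RM = "\<lambda>h. act M (gelt D h)" and ?RN = "\<lambda>h. act N (gelt D h)" and ?YM = "act M (yelt D)" and ?YN = "act N (yelt D)"
  let ?g = "elt D" and ?g' = "inv\<^bsub>grp D\<^esub> elt D"
  note g = elt_carrier[OF D] G.inv_closed[OF elt_carrier[OF D]]
  note fin = hmodule_finite[OF D M] hmodule_finite[OF D N]
  have K: "hmodule D ?K" by (rule inflate_hmodule[OF D trivial_grep])
  \<comment> \<open>The row index 0 belongs to the single basis vector of the trivial
    module.\<close>
  define F where "F T = (\<lambda>(z, (i, j)). if z = (0::nat) then T (j, i) else 0)" for T :: "'j \<times> 'i \<Rightarrow> 'k"
  have lin: "Vector_Spaces.linear fscale fscale F"
    by (auto intro!: linearI simp: F_def fscale_def fun_eq_iff)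
  have Finj: "T = T'" if "F T = F T'" for T T'
  proof
    fix p show "T p = T' p"
      using fun_cong[OF that, of "(0, (snd p, fst p))"] by (simp add: F_def)
  qed
  have Ff: "F T \<in> fspace ({0} \<times> (?I \<times> ?J)) \<longleftrightarrow> T \<in> fspace (?J \<times> ?I)" for T
    by (auto simp: F_def fspace_def)
  have kr: "mmul (?I \<times> ?J) (F T) (kron A B) = F (mmul ?J (tr B) (mmul ?I T A))" for T A B
  proof
    fix p :: "nat \<times> 'i \<times> 'j"
    obtain z i j where p: "p = (z, (i, j))" by (metis prod.exhaust)
    show "mmul (?I \<times> ?J) (F T) (kron A B) p = F (mmul ?J (tr B) (mmul ?I T A)) p"
    proof (cases "z = 0")
      case True
      have "mmul (?I \<times> ?J) (F T) (kron A B) p = (\<Sum>(s, t)\<in>?I \<times> ?J. T (t, s) * (A (s, i) * B (t, j)))"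
        using True by (auto simp: p mmul_def kron_def F_def intro!: sum.cong)
      also have "\<dots> = (\<Sum>t\<in>?J. \<Sum>s\<in>?I. T (t, s) * (A (s, i) * B (t, j)))"
        by (subst sum.cartesian_product[symmetric]) (rule sum.swap)
      also have "\<dots> = F (mmul ?J (tr B) (mmul ?I T A)) p"
        using True by (simp add: p F_def mmul_def tr_def sum_distrib_left mult_ac)
      finally show ?thesis .
    qed (simp add: p F_def mmul_def)
  qed
  have id: "mmul {0} (idmat {0}) (F T) = F T" for T
    by (auto simp: mmul_def idmat_def F_def fun_eq_iff)
  have FA: "F T + F T' = F (T + T')" for T T' by (auto simp: F_def fun_eq_iff)
  have F0: "F T = 0 \<longleftrightarrow> T = 0" for T by (auto simp: F_def fun_eq_iff)
  have iff: "F T \<in> Hom (carrier (hopf_alg D)) (tensor_module D M N) (dual_module D ?K)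
      \<longleftrightarrow> T \<in> Hom (carrier (hopf_alg D)) M (dual_module D N)" (is "?L \<longleftrightarrow> ?R") for T
  proof (cases "T \<in> fspace (?J \<times> ?I)")
    case T: True
    have c: "mmul ?J (tr (?RN h)) (mmul ?J (tr (?RN (inv\<^bsub>grp D\<^esub> h))) A) = A"
      "mmul ?J (tr (?RN (inv\<^bsub>grp D\<^esub> h))) (mmul ?J (tr (?RN h)) A) = A"
      if "h \<in> carrier (grp D)" "A \<in> fspace (?J \<times> ?I)" for A h
    proof -
      have "mmul ?J (tr (?RN h)) (tr (?RN (inv\<^bsub>grp D\<^esub> h))) = idmat ?J"
        "mmul ?J (tr (?RN (inv\<^bsub>grp D\<^esub> h))) (tr (?RN h)) = idmat ?J"
        using that by (simp_all add: mmul_tr hmodule_gelt_inv[OF N] tr_idmat)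
      then show "mmul ?J (tr (?RN h)) (mmul ?J (tr (?RN (inv\<^bsub>grp D\<^esub> h))) A) = A"
        "mmul ?J (tr (?RN (inv\<^bsub>grp D\<^esub> h))) (mmul ?J (tr (?RN h)) A) = A"
        using that fin by (simp_all add: mmul_assoc[symmetric] mmul_idmat_left)
    qed
    have Tc: "mmul ?I T A \<in> fspace (?J \<times> ?I)" if "A \<in> fspace (?I \<times> ?I)" for A
      using T that by (rule mmul_closed)
    have 1: "mmul ?J (tr (?RN h)) (mmul ?I T (?RM h)) = T \<longleftrightarrow> mmul ?I T (?RM h) = mmul ?J (tr (?RN (inv\<^bsub>grp D\<^esub> h))) T"
      if h: "h \<in> carrier (grp D)" for h
      using c[OF h T] c[OF h Tc[OF hmodule_gelt[OF M h]]] by metis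
    \<comment> \<open>Invariance under Delta(y) = y \<otimes> g + 1 \<otimes> y, multiplied by the
      transpose of g^-1, becomes compatibility with S(y) on the dual.\<close>
    have 2: "mmul ?J (tr (?RN ?g)) (mmul ?I T ?YM) + mmul ?J (tr ?YN) (mmul ?I T (idmat ?I)) = 0
       \<longleftrightarrow> mmul ?I T ?YM = mmul ?J (- tr (mmul ?J ?YN (?RN ?g'))) T"
    proof
      assume "mmul ?J (tr (?RN ?g)) (mmul ?I T ?YM) + mmul ?J (tr ?YN) (mmul ?I T (idmat ?I)) = 0"
      then have "mmul ?J (tr (?RN ?g)) (mmul ?I T ?YM) = - mmul ?J (tr ?YN) T"
        using T fin by (simp add: mmul_idmat_right eq_neg_iff_add_eq_0)
      then have "mmul ?J (tr (?RN ?g')) (mmul ?J (tr (?RN ?g)) (mmul ?I T ?YM)) = mmul ?J (tr (?RN ?g')) (- mmul ?J (tr ?YN) T)"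
        by (rule arg_cong)
      then show "mmul ?I T ?YM = mmul ?J (- tr (mmul ?J ?YN (?RN ?g'))) T"
        using c(2)[OF g(1) Tc[OF hmodule_yelt[OF M]]] fin by (simp add: mmul_uminus mmul_tr[symmetric] mmul_assoc)
    next
      assume "mmul ?I T ?YM = mmul ?J (- tr (mmul ?J ?YN (?RN ?g'))) T"
      then have "mmul ?J (tr (?RN ?g)) (mmul ?I T ?YM) = - mmul ?J (tr (?RN ?g)) (mmul ?J (tr (?RN ?g')) (mmul ?J (tr ?YN) T))"
        using fin by (simp add: mmul_uminus mmul_tr[symmetric] mmul_assoc)
      also have "\<dots> = - mmul ?J (tr ?YN) T"
        using c(1)[OF g(1) mmul_closed[OF tr_fspace[OF hmodule_yelt[OF N]] T]] by simp
      finally show "mmul ?J (tr (?RN ?g)) (mmul ?I T ?YM) + mmul ?J (tr ?YN) (mmul ?I T (idmat ?I)) = 0"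
        using T fin by (simp add: mmul_idmat_right)
    qed
    have "?L \<longleftrightarrow> (\<forall>h\<in>carrier (grp D). mmul ?J (tr (?RN h)) (mmul ?I T (?RM h)) = T) \<and>
       mmul ?J (tr (?RN ?g)) (mmul ?I T ?YM) + mmul ?J (tr ?YN) (mmul ?I T (idmat ?I)) = 0"
      using T g unfolding Hom_gens[OF D tensor_hmodule[OF D M N] dual_hmodule[OF D K]] unfolding Hom_def gens_def
      by (auto simp: Ff tensor_gelt[OF D M N] tensor_yelt[OF D M N] dual_gelt[OF D K] dual_yelt[OF D K]
        inflate_gelt[OF D trivial_grep] inflate_yelt[OF D trivial_grep] act_char_rep tr_idmat
        mmul_zero tr_zero kr id mmul_add FA F0 dest: Finj)
    moreover have "?R \<longleftrightarrow> (\<forall>h\<in>carrier (grp D). mmul ?I T (?RM h) = mmul ?J (tr (?RN (inv\<^bsub>grp D\<^esub> h))) T) \<and>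
       mmul ?I T ?YM = mmul ?J (- tr (mmul ?J ?YN (?RN ?g'))) T"
      using T unfolding Hom_gens[OF D M dual_hmodule[OF D N]] unfolding Hom_def gens_def
      by (auto simp: dual_gelt[OF D N] dual_yelt[OF D N])
    ultimately show ?thesis using 1 2 by simp
  next
    case False
    then show ?thesis
      using Hom_fspace[of "F T" _ "tensor_module D M N" "dual_module D ?K"] Hom_fspace[of T _ M "dual_module D N"] Ff[of T]
      by auto
  qed
  have im: "F ` Hom (carrier (hopf_alg D)) M (dual_module D N) = Hom (carrier (hopf_alg D)) (tensor_module D M N) (dual_module D ?K)"
  proof
    show "Hom (carrier (hopf_alg D)) (tensor_module D M N) (dual_module D ?K) \<subseteq> F ` Hom (carrier (hopf_alg D)) M (dual_module D N)"
    proof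
      fix T assume T: "T \<in> Hom (carrier (hopf_alg D)) (tensor_module D M N) (dual_module D ?K)"
      have "T = F (\<lambda>(j, i). T (0, (i, j)))"
        using Hom_fspace[OF T] by (auto simp: F_def fspace_def fun_eq_iff)
      then show "T \<in> F ` Hom (carrier (hopf_alg D)) M (dual_module D N)" using T iff[of "\<lambda>(j, i). T (0, (i, j))"] by simp
    qed
    show "F ` Hom (carrier (hopf_alg D)) M (dual_module D N) \<subseteq> Hom (carrier (hopf_alg D)) (tensor_module D M N) (dual_module D ?K)"
      by (rule image_subsetI) (simp add: iff)
  qed
  have inj: "inj_on F (Hom (carrier (hopf_alg D)) M (dual_module D N))"
    using Finj by (rule inj_onI)
  show ?thesis
    unfolding hom_dim_def using dim_bij[OF lin subspace_Hom inj im] by simp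
qed

text \<open>The regular module is free on 1: evaluating at 1 identifies its H-maps into N with the
  vectors of N.\<close>

lemma hom_dim_regular:
  fixes N :: "(nat \<times> 'g \<Rightarrow> 'k, 'k, 'i) rep"
  assumes N: "hmodule D N"
  shows "hom_dim D (regular_module D) N = int (card (idx N))"
proof -
  let ?B = "hbasis D" and ?H = "Hom (carrier (hopf_alg D)) (regular_module D) N" and ?e = "\<one>\<^bsub>hopf_alg D\<^esub>"
  note fin = finite_hbasis[OF D] hmodule_finite[OF D N]
  let ?f = "\<lambda>T. mvec ?B T ?e"
  have lin: "Vector_Spaces.linear fscale fscale ?f"
    by (auto intro!: linearI simp: mvec_def fscale_def fun_eq_iff algebra_simps sum.distrib sum_distrib_left)
  have key: "mvec ?B T x = mvec (idx N) (act N x) (?f T)" if T: "T \<in> ?H" and x: "x \<in> carrier (hopf_alg D)" for T x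
  proof -
    have "mvec ?B T x = mvec ?B T (mvec ?B (act (regular_module D) x) ?e)"
      using x by (simp add: mvec_regular[OF D])
    also have "\<dots> = mvec ?B (mmul ?B T (act (regular_module D) x)) ?e"
      using fin by (simp add: mvec_mmul)
    also have "\<dots> = mvec (idx N) (act N x) (?f T)"
      using fin Hom_commute[OF T x] by (simp add: mvec_mmul)
    finally show ?thesis .
  qed
  have inj: "inj_on ?f ?H"
  proof (rule inj_onI)
    fix T T' assume TT: "T \<in> ?H" "T' \<in> ?H" "?f T = ?f T'"
    show "T = T'"
      by (rule mat_eqI[OF fin(1), where I = "idx N"])
        (use key TT Hom_fspace[OF TT(1)] Hom_fspace[OF TT(2)] in \<open>auto simp: hopf_sel[OF D]\<close>)
  qed
  have "fspace (idx N) \<subseteq> ?f ` ?H"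
  proof
    fix v :: "'i \<Rightarrow> 'k" assume v: "v \<in> fspace (idx N)"
    \<comment> \<open>The linear extension from the basis is used in place of \<open>act N x\<close>
      because \<open>act N\<close> is arbitrary off the carrier, while a linear map on all functions
      is required.\<close>
    let ?l = "\<lambda>x. mvec (idx N) (lin_ext ?B (\<lambda>p. act N (evec p)) x) v"
    have l: "?l x = mvec (idx N) (act N x) v" if "x \<in> carrier (hopf_alg D)" for x
      using act_expand[OF D N that] by simp
    have "Vector_Spaces.linear fscale fscale ?l"
      by (intro linearI) (auto simp: lin_ext_add lin_ext_scale mvec_scale_left, auto simp: mvec_def fun_eq_iff distrib_right sum.distrib)
    then have m: "mvec ?B (mat_of (idx N) ?B ?l) x = mvec (idx N) (act N x) v" if x: "x \<in> carrier (hopf_alg D)" for x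
      using mvec_mat_of[of ?l ?B "idx N" x] fin x hmodule_act[OF D N]
      by (auto simp: l hopf_sel[OF D, symmetric] intro: mvec_fspace)
    let ?T = "mat_of (idx N) ?B ?l"
    have "?T \<in> ?H"
    proof (rule HomI)
      fix a assume a: "a \<in> carrier (hopf_alg D)"
      have "mvec ?B (mmul ?B ?T (act (regular_module D) a)) x = mvec ?B (mmul (idx N) (act N a) ?T) x"
        if x: "x \<in> carrier (hopf_alg D)" for x
        using fin a x by (simp add: mvec_mmul mvec_regular[OF D] m hmodule_mult[OF D N])
      then show "mmul (idx (regular_module D)) ?T (act (regular_module D) a) = mmul (idx N) (act N a) ?T"
        using a by (intro mat_eqI[OF fin(1), where I = "idx N"])
          (auto simp: hopf_sel[OF D, symmetric] intro!: mmul_closed regular_act[OF D] hmodule_act[OF D N])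
    qed simp
    moreover have "v = ?f ?T" using v fin by (simp add: m hmodule_one[OF D N] mvec_idmat)
    ultimately show "v \<in> ?f ` ?H" by blast
  qed
  moreover have "?f ` ?H \<subseteq> fspace (idx N)"
  proof clarify
    fix T assume "T \<in> ?H"
    then have "T \<in> fspace (idx N \<times> ?B)" using Hom_fspace by fastforce
    then show "?f T \<in> fspace (idx N)" by (rule mvec_fspace)
  qed
  ultimately have "?f ` ?H = fspace (idx N)" by blast
  then show ?thesis
    using dim_image_inj[OF lin subspace_Hom inj] fin by (simp add: hom_dim_def dim_fspace)
qed

end

section \<open>Homomorphisms from the indecomposable modules\<close>

text \<open>Row block p. For a map into M(W, l) it is the component with values in x^p W.\<close>

definition blk :: "(('p \<times> 'i) \<times> 'j \<Rightarrow> 'k) \<Rightarrow> 'p \<Rightarrow> 'i \<times> 'j \<Rightarrow> 'k" where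
  "blk u p = (\<lambda>(s, t). u ((p, s), t))"

definition unblk :: "('p \<Rightarrow> 'i \<times> 'j \<Rightarrow> 'k) \<Rightarrow> ('p \<times> 'i) \<times> 'j \<Rightarrow> 'k" where
  "unblk f = (\<lambda>((p, s), t). f p (s, t))"

lemma blk_unblk [simp]: "blk (unblk f) p = f p"
  by (auto simp: blk_def unblk_def)

lemma unblk_blk [simp]: "unblk (blk u) = u"
  by (auto simp: blk_def unblk_def)

lemma blk_eqI: "(\<And>p. blk u p = blk v p) \<Longrightarrow> u = v"
  by (metis unblk_blk ext)

lemma blk_fspace_iff:
  "u \<in> fspace ((P \<times> I) \<times> J) \<longleftrightarrow> (\<forall>p. blk u p \<in> (if p \<in> P then fspace (I \<times> J) else {0}))"
  by (auto simp: fspace_def blk_def fun_eq_iff split: if_splits)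

lemma blk_outside: "u \<in> fspace ((P \<times> I) \<times> J) \<Longrightarrow> p \<notin> P \<Longrightarrow> blk u p = 0"
  and blk_fspace: "u \<in> fspace ((P \<times> I) \<times> J) \<Longrightarrow> blk u p \<in> fspace (I \<times> J)"
  by (auto simp: fspace_def blk_def fun_eq_iff)

lemma blk_zero [simp]: "blk (0 :: _ \<Rightarrow> 'k::field) p = 0"
  and blk_add: "blk (u + v) p = blk u p + blk (v :: _ \<Rightarrow> 'k) p"
  and blk_scale: "blk (fscale c u) p = fscale c (blk u p)"
  by (auto simp: blk_def fscale_def fun_eq_iff)

lemma blk_mmul_right: "blk (mmul I u A) p = mmul I (blk u p) A"
  by (auto simp: blk_def mmul_def)

lemma blk_mmul_kron:
  fixes A :: "'p \<times> 'p \<Rightarrow> 'k::field" and B :: "'i \<times> 'l \<Rightarrow> 'k" and u :: "('p \<times> 'l) \<times> 'j \<Rightarrow> 'k"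
  assumes "finite P" "finite J"
  shows "blk (mmul (P \<times> J) (kron A B) u) p = (\<Sum>r\<in>P. fscale (A (p, r)) (mmul J B (blk u r)))"
proof
  fix x :: "'i \<times> 'j"
  obtain s t where x: "x = (s, t)" by (cases x)
  have "blk (mmul (P \<times> J) (kron A B) u) p x = (\<Sum>(r, s')\<in>P \<times> J. A (p, r) * (B (s, s') * u ((r, s'), t)))"
    by (auto simp: x blk_def mmul_def kron_def mult_ac intro!: sum.cong)
  also have "\<dots> = (\<Sum>r\<in>P. \<Sum>s'\<in>J. A (p, r) * (B (s, s') * u ((r, s'), t)))"
    by (rule sum.cartesian_product[symmetric])
  finally show "blk (mmul (P \<times> J) (kron A B) u) p x = (\<Sum>r\<in>P. fscale (A (p, r)) (mmul J B (blk u r))) x"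
    by (simp add: x sum_fun_app fscale_def mmul_def blk_def sum_distrib_left)
qed

lemma blk_mmul_scal:
  assumes "finite J"
  shows "blk (mmul ({..<l} \<times> J) (kron (scal l c) B) u) p = (if p < l then fscale (c ^ p) (mmul J B (blk u p)) else 0)"
proof -
  have "blk (mmul ({..<l} \<times> J) (kron (scal l c) B) u) p = (\<Sum>r<l. if r = p then fscale (c ^ p) (mmul J B (blk u p)) else 0)"
    unfolding blk_mmul_kron[OF finite_lessThan assms] by (intro sum.cong) (auto simp: scal_def)
  then show ?thesis by simp
qed

lemma blk_mmul_shift:
  assumes J: "finite J" and u: "u \<in> fspace (({..<l} \<times> J) \<times> I)"
  shows "blk (mmul ({..<l} \<times> J) (mpow ({..<l} \<times> J) (kron (shift l) (idmat J)) j) u) p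
    = (if j \<le> p \<and> p < l then blk u (p - j) else 0)"
proof -
  have id: "mpow J (idmat J) j = idmat J" by (induction j) (simp_all add: J)
  have "blk (mmul ({..<l} \<times> J) (mpow ({..<l} \<times> J) (kron (shift l) (idmat J)) j) u) p
     = (\<Sum>r<l. if r = p - j then (if j \<le> p \<and> p < l then blk u r else 0) else 0)"
    unfolding mpow_kron blk_mmul_kron[OF finite_lessThan J] id mpow_shift
    by (intro sum.cong) (auto simp: mmul_idmat_left[OF J blk_fspace[OF u]])
  also have "\<dots> = (if j \<le> p \<and> p < l then blk u (p - j) else 0)" by auto
  finally show ?thesis .
qed

definition gh :: "('g, 'k::field) datum \<Rightarrow> ('g, 'k, 'i) rep \<Rightarrow> nat \<Rightarrow> nat \<Rightarrow>
    (nat \<times> 'g \<Rightarrow> 'k, 'k, 'j) rep \<Rightarrow> ('j \<times> 'i \<Rightarrow> 'k) set" where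
  \<comment> \<open>the maps \<open>U \<rightarrow> \<chi>\<^sup>-\<^sup>e Z\<close> over the group with image in the kernel of \<open>y\<^sup>j\<close>\<close>
  "gh D U e j Z = {u \<in> fspace (idx Z \<times> idx U).
     (\<forall>h\<in>carrier (grp D). mmul (idx U) u (act U h) = fscale (inverse (chr D h) ^ e) (mmul (idx Z) (act Z (gelt D h)) u)) \<and>
     mmul (idx Z) (mpow (idx Z) (act Z (yelt D)) j) u = 0}"

lemma subspace_gh: "fvs.subspace (gh D U e j Z)"
  by (auto simp: fvs.subspace_def gh_def mmul_add mmul_scale mmul_zero fvs.scale_right_distrib mult.commute
      intro: fspace_add fspace_scale)

lemma gh_fspace: "u \<in> gh D U e j Z \<Longrightarrow> u \<in> fspace (idx Z \<times> idx U)"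
  and gh_commute: "u \<in> gh D U e j Z \<Longrightarrow> h \<in> carrier (grp D) \<Longrightarrow>
    mmul (idx U) u (act U h) = fscale (inverse (chr D h) ^ e) (mmul (idx Z) (act Z (gelt D h)) u)"
  and gh_nil: "u \<in> gh D U e j Z \<Longrightarrow> mmul (idx Z) (mpow (idx Z) (act Z (yelt D)) j) u = 0"
  by (auto simp: gh_def)

text \<open>The extension of u from the generating copy of U to all of M(U, j), sending x^k v to y^k
  u(v).\<close>

definition ext_map :: "'j set \<Rightarrow> ('j \<times> 'j \<Rightarrow> 'k::field) \<Rightarrow> nat \<Rightarrow> ('j \<times> 'i \<Rightarrow> 'k) \<Rightarrow> 'j \<times> (nat \<times> 'i) \<Rightarrow> 'k" where
  "ext_map J Y j u = (\<lambda>(z, (k, s)). if k < j then mmul J (mpow J Y k) u (z, s) else 0)"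

text \<open>Column block p. For a map out of M(U, j) it is the restriction to x^p U.\<close>

definition cblk :: "('j \<times> ('p \<times> 'i) \<Rightarrow> 'k) \<Rightarrow> 'p \<Rightarrow> 'j \<times> 'i \<Rightarrow> 'k" where
  "cblk F p = (\<lambda>(z, s). F (z, (p, s)))"

lemma cblk_eqI: "(\<And>p. cblk F p = cblk F' p) \<Longrightarrow> F = F'"
  by (auto simp: cblk_def fun_eq_iff)

lemma cblk_ext_map: "cblk (ext_map J Y j u) k = (if k < j then mmul J (mpow J Y k) u else 0)"
  by (auto simp: cblk_def ext_map_def fun_eq_iff)

lemma cblk_mmul_left: "cblk (mmul J A F) p = mmul J A (cblk F p)"
  by (auto simp: cblk_def mmul_def)

lemma cblk_mmul_kron:
  fixes A :: "'p \<times> 'p \<Rightarrow> 'k::field" and B :: "'l \<times> 'i \<Rightarrow> 'k" and F :: "'j \<times> ('p \<times> 'l) \<Rightarrow> 'k"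
  assumes "finite P" "finite I"
  shows "cblk (mmul (P \<times> I) F (kron A B)) p = (\<Sum>r\<in>P. fscale (A (r, p)) (mmul I (cblk F r) B))"
proof
  fix x :: "'j \<times> 'i"
  obtain z t where x: "x = (z, t)" by (cases x)
  have "cblk (mmul (P \<times> I) F (kron A B)) p x = (\<Sum>(r, s)\<in>P \<times> I. A (r, p) * (F (z, (r, s)) * B (s, t)))"
    by (auto simp: x cblk_def mmul_def kron_def mult_ac intro!: sum.cong)
  also have "\<dots> = (\<Sum>r\<in>P. \<Sum>s\<in>I. A (r, p) * (F (z, (r, s)) * B (s, t)))"
    by (rule sum.cartesian_product[symmetric])
  finally show "cblk (mmul (P \<times> I) F (kron A B)) p x = (\<Sum>r\<in>P. fscale (A (r, p)) (mmul I (cblk F r) B)) x"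
    by (simp add: x sum_fun_app fscale_def mmul_def cblk_def sum_distrib_left)
qed

lemma cblk_mmul_scal:
  assumes "finite I"
  shows "cblk (mmul ({..<l} \<times> I) F (kron (scal l c) B)) p = (if p < l then fscale (c ^ p) (mmul I (cblk F p) B) else 0)"
proof -
  have "cblk (mmul ({..<l} \<times> I) F (kron (scal l c) B)) p = (\<Sum>r<l. if r = p then fscale (c ^ p) (mmul I (cblk F p) B) else 0)"
    unfolding cblk_mmul_kron[OF finite_lessThan assms]
    by (intro sum.cong) (auto simp: scal_def)
  then show ?thesis by simp
qed

lemma cblk_mmul_shift:
  assumes "finite I" "F \<in> fspace (J \<times> ({..<l} \<times> I))"
  shows "cblk (mmul ({..<l} \<times> I) F (kron (shift l) (idmat I))) p = (if Suc p < l then cblk F (Suc p) else 0)"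
proof -
  have f: "cblk F r \<in> fspace (J \<times> I)" for r using assms(2) by (auto simp: fspace_def cblk_def)
  have "cblk (mmul ({..<l} \<times> I) F (kron (shift l) (idmat I))) p = (\<Sum>r<l. if r = Suc p then cblk F (Suc p) else 0)"
    unfolding cblk_mmul_kron[OF finite_lessThan assms(1)]
    by (intro sum.cong) (auto simp: shift_def mmul_idmat_right[OF assms(1) f])
  then show ?thesis by simp
qed

context
  fixes D :: "('g, 'k::field) datum"
  assumes D: "nilpotent_datum D"
begin

interpretation G: group "grp D" using D by (simp add: nilpotent_datum_def)

lemma mpow_yelt_gelt:
  assumes Z: "hmodule D Z" and h: "h \<in> carrier (grp D)"
  shows "mmul (idx Z) (mpow (idx Z) (act Z (yelt D)) k) (act Z (gelt D h))
    = fscale (chr D h ^ k) (mmul (idx Z) (act Z (gelt D h)) (mpow (idx Z) (act Z (yelt D)) k))"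
  by (rule mpow_commute[OF hmodule_finite[OF D Z] hmodule_gelt[OF D Z h] ymod_YR[OF hmodule_ymod[OF D Z] h]])

text \<open>Moving h through y^k produces chi(h)^k, which cancels the character chi^-k of x^k U. At
  the last power of x, compatibility with y is the condition y^j u = 0.\<close>

lemma ext_map_Hom:
  assumes U: "grep D U" and j: "j \<le> nil_ord D" and Z: "hmodule D Z" and u: "u \<in> gh D U 0 j Z"
  shows "ext_map (idx Z) (act Z (yelt D)) j u \<in> Hom (carrier (hopf_alg D)) (Mmod D U j) Z"
proof (rule HomI_gens[OF D Mmod_hmodule[OF D U j] Z])
  let ?J = "idx Z" and ?Y = "act Z (yelt D)"
  note fin = grep_finite[OF U] hmodule_finite[OF D Z]
  have f: "mmul ?J (mpow ?J ?Y k) u \<in> fspace (?J \<times> idx U)" for k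
    using gh_fspace[OF u] hmodule_yelt[OF D Z] by (auto intro!: mmul_closed mpow_fspace)
  show F: "ext_map ?J ?Y j u \<in> fspace (?J \<times> idx (Mmod D U j))"
    using f by (auto simp: ext_map_def fspace_def)
  show "mmul (idx (Mmod D U j)) (ext_map ?J ?Y j u) (act (Mmod D U j) (gelt D h)) = mmul ?J (act Z (gelt D h)) (ext_map ?J ?Y j u)"
    if h: "h \<in> carrier (grp D)" for h
  proof (rule cblk_eqI)
    fix p
    have "fscale (inverse (chr D h) ^ p) (mmul (idx U) (mmul ?J (mpow ?J ?Y p) u) (act U h))
      = mmul ?J (act Z (gelt D h)) (mmul ?J (mpow ?J ?Y p) u)"
    proof -
      have "mmul (idx U) (mmul ?J (mpow ?J ?Y p) u) (act U h) = mmul ?J (mmul ?J (mpow ?J ?Y p) (act Z (gelt D h))) u"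
        using gh_commute[OF u h] fin by (simp add: mmul_assoc)
      then show ?thesis
        using fin chr_nz[OF D h] by (simp add: mpow_yelt_gelt[OF Z h] mmul_scale mmul_assoc power_inverse)
    qed
    then show "cblk (mmul (idx (Mmod D U j)) (ext_map ?J ?Y j u) (act (Mmod D U j) (gelt D h))) p
        = cblk (mmul ?J (act Z (gelt D h)) (ext_map ?J ?Y j u)) p"
      using fin by (simp add: Mmod_gelt[OF D U j h] cblk_mmul_scal cblk_mmul_left[of ?J] cblk_ext_map mmul_zero)
  qed
  show "mmul (idx (Mmod D U j)) (ext_map ?J ?Y j u) (act (Mmod D U j) (yelt D)) = mmul ?J ?Y (ext_map ?J ?Y j u)"
  proof (rule cblk_eqI)
    fix p
    have e: "mmul ?J ?Y (mmul ?J (mpow ?J ?Y p) u) = mmul ?J (mpow ?J ?Y (Suc p)) u" for p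
      using mpow_add[OF fin(2) hmodule_yelt[OF D Z], of 1 p] hmodule_yelt[OF D Z] fin
      by (simp add: mmul_idmat_left mmul_assoc[symmetric])
    have "mmul ?J (mpow ?J ?Y (Suc p)) u = 0" if "p < j" "\<not> Suc p < j"
    proof -
      have "Suc p = j" using that by simp
      then show ?thesis using gh_nil[OF u] by simp
    qed
    then show "cblk (mmul (idx (Mmod D U j)) (ext_map ?J ?Y j u) (act (Mmod D U j) (yelt D))) p
        = cblk (mmul ?J ?Y (ext_map ?J ?Y j u)) p"
      using fin F by (auto simp: Mmod_yelt[OF D U j] cblk_mmul_shift[where J = ?J] cblk_mmul_left[of ?J] cblk_ext_map mmul_zero e
          simp del: mpow.simps)
  qed
qed

text \<open>M(U, j) is generated by its degree 0 copy of U: commuting with y determines each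
  restriction to x^k U from the one at k = 0, and y annihilates the last one.\<close>

lemma Hom_Mmod:
  assumes U: "grep D U" and j: "1 \<le> j" "j \<le> nil_ord D" and Z: "hmodule D Z"
    and F: "F \<in> Hom (carrier (hopf_alg D)) (Mmod D U j) Z"
  shows "cblk F 0 \<in> gh D U 0 j Z" "F = ext_map (idx Z) (act Z (yelt D)) j (cblk F 0)"
proof -
  let ?J = "idx Z" and ?Y = "act Z (yelt D)"
  note fin = grep_finite[OF U] hmodule_finite[OF D Z]
  have Ff: "F \<in> fspace (?J \<times> ({..<j} \<times> idx U))" using Hom_fspace[OF F] by simp
  have f0: "cblk F p \<in> fspace (?J \<times> idx U)" for p using Ff by (auto simp: fspace_def cblk_def)
  have out: "cblk F p = 0" if "\<not> p < j" for p using Ff that by (auto simp: fspace_def cblk_def fun_eq_iff)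
  have Y: "mmul ?J ?Y (cblk F p) = (if Suc p < j then cblk F (Suc p) else 0)" for p
    using arg_cong[OF Hom_yelt[OF D F], of "\<lambda>A. cblk A p"] fin Ff
    by (simp add: Mmod_yelt[OF D U j(2)] cblk_mmul_shift[where J = ?J] cblk_mmul_left[of ?J])
  have pw: "mmul ?J (mpow ?J ?Y k) (cblk F 0) = (if k < j then cblk F k else 0)" for k
  proof (induction k)
    case 0
    then show ?case using j by (simp add: mmul_idmat_left[OF fin(2) f0])
  next
    case (Suc k)
    have "mmul ?J (mpow ?J ?Y (Suc k)) (cblk F 0) = mmul ?J ?Y (mmul ?J (mpow ?J ?Y k) (cblk F 0))"
      using mpow_add[OF fin(2) hmodule_yelt[OF D Z], of 1 k] hmodule_yelt[OF D Z] fin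
      by (simp add: mmul_idmat_left mmul_assoc[symmetric])
    then show ?case
      using Y[of k] by (cases "k < j"; cases "Suc k < j"; simp only: Suc mmul_zero if_True if_False Suc_lessD)
  qed
  have G: "mmul (idx U) (cblk F 0) (act U h) = mmul ?J (act Z (gelt D h)) (cblk F 0)" if "h \<in> carrier (grp D)" for h
    using arg_cong[OF Hom_gelt[OF D F that], of "\<lambda>A. cblk A 0"] fin j
    by (simp add: Mmod_gelt[OF D U j(2) that] cblk_mmul_scal cblk_mmul_left[of ?J])
  show "cblk F 0 \<in> gh D U 0 j Z"
    unfolding gh_def using f0 G pw[of j] by simp
  show "F = ext_map ?J ?Y j (cblk F 0)"
    by (rule cblk_eqI) (simp add: cblk_ext_map pw out)
qed

lemma hom_dim_Mmod:
  assumes U: "grep D U" and j: "1 \<le> j" "j \<le> nil_ord D" and Z: "hmodule D Z"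
  shows "hom_dim D (Mmod D U j) Z = int (fvs.dim (gh D U 0 j Z))"
proof -
  let ?H = "Hom (carrier (hopf_alg D)) (Mmod D U j) Z" and ?f = "\<lambda>F. cblk F (0::nat)"
  have lin: "Vector_Spaces.linear fscale fscale ?f"
    by (auto intro!: linearI simp: cblk_def fscale_def fun_eq_iff)
  have inj: "inj_on ?f ?H"
    by (rule inj_on_inverseI[where g = "ext_map (idx Z) (act Z (yelt D)) j"])
      (rule Hom_Mmod(2)[OF U j Z, symmetric])
  have im: "?f ` ?H = gh D U 0 j Z"
  proof
    show "?f ` ?H \<subseteq> gh D U 0 j Z" by (rule image_subsetI) (rule Hom_Mmod(1)[OF U j Z])
    show "gh D U 0 j Z \<subseteq> ?f ` ?H"
    proof
      fix u assume u: "u \<in> gh D U 0 j Z"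
      have "u = ?f (ext_map (idx Z) (act Z (yelt D)) j u)"
        using j gh_fspace[OF u] hmodule_finite[OF D Z] by (simp add: cblk_ext_map mmul_idmat_left)
      then show "u \<in> ?f ` ?H" by (rule image_eqI[of _ ?f, OF _ ext_map_Hom[OF U j(2) Z u]])
    qed
  qed
  show ?thesis unfolding hom_dim_def dim_bij[OF lin subspace_Hom inj im] ..
qed

text \<open>Everything can be read off block by block: the copy x^p W adds p to the exponent of the
  twist, and y^j raises degrees by j, so it kills exactly the maps whose components of degree below
  l - j are 0.\<close>

lemma gh_Mmod:
  assumes W: "grep D W" and l: "l \<le> nil_ord D"
  shows "u \<in> gh D U e j (Mmod D W l) \<longleftrightarrow> u \<in> fspace (({..<l} \<times> idx W) \<times> idx U) \<and>
     (\<forall>h\<in>carrier (grp D). \<forall>p<l. mmul (idx U) (blk u p) (act U h)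
        = fscale (inverse (chr D h) ^ (e + p)) (mmul (idx W) (act W h) (blk u p))) \<and>
     (\<forall>p. p + j < l \<longrightarrow> blk u p = 0)"
proof (cases "u \<in> fspace (({..<l} \<times> idx W) \<times> idx U)")
  case u: True
  let ?J = "{..<l} \<times> idx W"
  note fin = grep_finite[OF W]
  have 1: "mmul (idx U) u (act U h) = fscale (inverse (chr D h) ^ e) (mmul ?J (act (Mmod D W l) (gelt D h)) u)
     \<longleftrightarrow> (\<forall>p<l. mmul (idx U) (blk u p) (act U h)
        = fscale (inverse (chr D h) ^ (e + p)) (mmul (idx W) (act W h) (blk u p)))" (is "?L \<longleftrightarrow> ?R")
    if h: "h \<in> carrier (grp D)" for h
  proof -
    have "?L \<longleftrightarrow> (\<forall>p. mmul (idx U) (blk u p) (act U h)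
       = (if p < l then fscale (inverse (chr D h) ^ (e + p)) (mmul (idx W) (act W h) (blk u p)) else 0))" (is "_ \<longleftrightarrow> ?M")
    proof
      assume ?L
      show ?M
      proof
        fix p show "mmul (idx U) (blk u p) (act U h)
           = (if p < l then fscale (inverse (chr D h) ^ (e + p)) (mmul (idx W) (act W h) (blk u p)) else 0)"
          using arg_cong[OF \<open>?L\<close>, of "\<lambda>A. blk A p"] fin
          by (simp add: blk_mmul_right[of _ u] blk_scale Mmod_gelt[OF D W l h] blk_mmul_scal power_add)
      qed
    next
      assume ?M
      then show ?L
        by (intro blk_eqI) (simp add: blk_mmul_right[of _ u] blk_scale Mmod_gelt[OF D W l h] blk_mmul_scal power_add fin)
    qed
    moreover have "blk u p = 0" if "\<not> p < l" for p using blk_outside[OF u] that by simp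
    ultimately show ?thesis by (auto simp: mmul_zero)
  qed
  have 2: "mmul ?J (mpow ?J (act (Mmod D W l) (yelt D)) j) u = 0 \<longleftrightarrow> (\<forall>p. p + j < l \<longrightarrow> blk u p = 0)" (is "?L \<longleftrightarrow> ?R")
  proof
    assume ?L
    show ?R
    proof (intro allI impI)
      fix p assume "p + j < l"
      then show "blk u p = 0"
        using arg_cong[OF \<open>?L\<close>, of "\<lambda>A. blk A (p + j)"] fin u
        by (simp add: Mmod_yelt[OF D W l] blk_mmul_shift)
    qed
  next
    assume ?R
    then show ?L
      by (intro blk_eqI) (simp add: Mmod_yelt[OF D W l] blk_mmul_shift[OF fin u])
  qed
  show ?thesis using u 1 2 by (simp add: gh_def)
qed (auto simp: gh_def)

text \<open>Only the component of degree 0 distinguishes \<open>M(W, l)\<close> from its radical.\<close>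

lemma dim_gh_top:
  assumes U: "grep D U" and W: "grep D W" and l: "1 \<le> l" "l \<le> nil_ord D" and j: "l \<le> j"
  shows "fvs.dim (gh D U 0 j (Mmod D W l))
    = fvs.dim {u \<in> gh D U 0 j (Mmod D W l). blk u 0 = 0} + fvs.dim (Hom (carrier (grp D)) U W)"
proof -
  let ?S = "gh D U 0 j (Mmod D W l)" and ?f = "\<lambda>u. blk u (0::nat)"
  note fin = grep_finite[OF U] grep_finite[OF W]
  have lin: "Vector_Spaces.linear fscale fscale ?f"
    by (intro linearI) (simp_all add: blk_add blk_scale)
  have "fvs.dim ?S = fvs.dim {u \<in> ?S. ?f u = 0} + fvs.dim (?f ` ?S)"
    by (rule dim_kernel_image[OF lin subspace_gh, where I = "({..<l} \<times> idx W) \<times> idx U"])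
      (use fin gh_Mmod[OF W l(2)] in auto)
  moreover have "?f ` ?S = Hom (carrier (grp D)) U W"
  proof
    show "?f ` ?S \<subseteq> Hom (carrier (grp D)) U W"
    proof (rule image_subsetI)
      fix u assume "u \<in> ?S"
      then show "?f u \<in> Hom (carrier (grp D)) U W"
        using l unfolding gh_Mmod[OF W l(2)] by (intro HomI) (auto intro: blk_fspace)
    qed
    show "Hom (carrier (grp D)) U W \<subseteq> ?f ` ?S"
    proof
      fix T assume T: "T \<in> Hom (carrier (grp D)) U W"
      \<comment> \<open>A map concentrated in degree 0 satisfies the nilpotency condition because j
        is at least l.\<close>
      let ?u = "unblk (\<lambda>p::nat. if p = 0 then T else 0)"
      have "?u \<in> ?S"
        unfolding gh_Mmod[OF W l(2)] using l j Hom_fspace[OF T] Hom_commute[OF T]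
        by (auto simp: blk_fspace_iff mmul_zero)
      then show "T \<in> ?f ` ?S" by (rule image_eqI[rotated]) simp
    qed
  qed
  ultimately show ?thesis by simp
qed

lemma trivial_twist_grep: "grep D (char_rep (\<lambda>h. inverse (chr D h)))"
  by (rule char_rep_grep[OF D]) (simp_all add: chr_one[OF D] chr_mult[OF D])

text \<open>Tensoring with the one-dimensional module of chi^-1 leaves y unchanged, as y acts by 0
  on that factor, and multiplies the action of h by chi(h)^-1; this raises the exponent of the twist
  from 0 to 1.\<close>

lemma dim_gh_twist:
  assumes Z: "hmodule D Z"
  shows "fvs.dim (gh D U 0 j (tensor_module D (inflate D (char_rep (\<lambda>h. inverse (chr D h)))) Z)) = fvs.dim (gh D U 1 j Z)"
proof -
  let ?A = "inflate D (char_rep (\<lambda>h. inverse (chr D h)))"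
  let ?T = "tensor_module D ?A Z" and ?J = "idx Z"
  have A: "hmodule D ?A" by (rule inflate_hmodule[OF D trivial_twist_grep])
  note fin = hmodule_finite[OF D Z]
  let ?f = "\<lambda>u. blk u (0::nat)"
  have lin: "Vector_Spaces.linear fscale fscale ?f"
    by (intro linearI) (simp_all add: blk_add blk_scale)
  have R: "act ?T (gelt D h) = kron (fscale (inverse (chr D h)) (idmat {0})) (act Z (gelt D h))" if "h \<in> carrier (grp D)" for h
    using that by (simp add: tensor_gelt[OF D A Z] inflate_gelt[OF D trivial_twist_grep] act_char_rep[OF D])
  have Y: "act ?T (yelt D) = kron (idmat {0}) (act Z (yelt D))"
    by (simp add: tensor_yelt[OF D A Z] inflate_yelt[OF D trivial_twist_grep] kron_zero)
  have pw: "mpow ({0} \<times> ?J) (act ?T (yelt D)) j = kron (idmat {0}) (mpow ?J (act Z (yelt D)) j)"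
  proof -
    have "mpow {0} (idmat {0}) j = (idmat {0} :: nat \<times> nat \<Rightarrow> 'k)" by (induction j) simp_all
    then show ?thesis unfolding Y mpow_kron by simp
  qed
  have b: "blk (mmul ({0} \<times> ?J) (kron (fscale c (idmat {0})) B) u) p = (if p = 0 then fscale c (mmul ?J B (blk u 0)) else 0)"
    for c B p and u :: "(nat \<times> 'a) \<times> 'b \<Rightarrow> 'k"
    using fin by (auto simp: blk_mmul_kron fscale_app idmat_def)
  have b1: "blk (mmul ({0} \<times> ?J) (kron (idmat {0}) B) u) p = (if p = 0 then mmul ?J B (blk u 0) else 0)"
    for B p and u :: "(nat \<times> 'a) \<times> 'b \<Rightarrow> 'k"
    using b[of 1 B u p] by simp
  have iff: "u \<in> gh D U 0 j ?T \<longleftrightarrow> blk u 0 \<in> gh D U 1 j Z \<and> (\<forall>p. p \<noteq> 0 \<longrightarrow> blk u p = 0)" for u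
  proof (cases "u \<in> fspace (({0} \<times> ?J) \<times> idx U)")
    case u: True
    have 0: "blk u p = 0" if "p \<noteq> 0" for p using blk_outside[OF u] that by simp
    have 1: "mmul (idx U) u (act U h) = mmul ({0} \<times> ?J) (act ?T (gelt D h)) u \<longleftrightarrow>
       mmul (idx U) (blk u 0) (act U h) = fscale (inverse (chr D h)) (mmul ?J (act Z (gelt D h)) (blk u 0))" (is "?L \<longleftrightarrow> ?R")
      if h: "h \<in> carrier (grp D)" for h
    proof
      assume ?L
      from arg_cong[OF this, of "\<lambda>A. blk A 0"] show ?R by (simp add: R[OF h] b blk_mmul_right[of _ u])
    next
      assume ?R
      then show ?L by (intro blk_eqI) (simp add: R[OF h] b blk_mmul_right[of _ u] 0 mmul_zero)
    qed
    have 2: "mmul ({0} \<times> ?J) (mpow ({0} \<times> ?J) (act ?T (yelt D)) j) u = 0 \<longleftrightarrow>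
       mmul ?J (mpow ?J (act Z (yelt D)) j) (blk u 0) = 0" (is "?L \<longleftrightarrow> ?R")
    proof
      assume ?L
      from arg_cong[OF this, of "\<lambda>A. blk A 0"] show ?R by (simp add: pw b1)
    next
      assume ?R
      then show ?L by (intro blk_eqI) (simp add: pw b1)
    qed
    show ?thesis using u 0 1 2 blk_fspace[OF u] by (simp add: gh_def)
  next
    case False
    moreover have "u \<in> fspace (({0} \<times> ?J) \<times> idx U)" if "blk u 0 \<in> gh D U 1 j Z" "\<forall>p. p \<noteq> 0 \<longrightarrow> blk u p = 0"
      using that gh_fspace[OF that(1)] unfolding blk_fspace_iff by auto
    ultimately show ?thesis using gh_fspace[of u D U 0 j ?T] by auto
  qed
  have inj: "inj_on ?f (gh D U 0 j ?T)"
  proof (rule inj_onI)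
    fix u v assume uv: "u \<in> gh D U 0 j ?T" "v \<in> gh D U 0 j ?T" "?f u = ?f v"
    show "u = v"
    proof (rule blk_eqI)
      fix p show "blk u p = blk v p"
        using uv unfolding iff by (cases "p = 0") auto
    qed
  qed
  have im: "?f ` gh D U 0 j ?T = gh D U 1 j Z"
  proof
    show "?f ` gh D U 0 j ?T \<subseteq> gh D U 1 j Z" by (rule image_subsetI) (simp add: iff)
    show "gh D U 1 j Z \<subseteq> ?f ` gh D U 0 j ?T"
    proof
      fix v assume v: "v \<in> gh D U 1 j Z"
      have "unblk (\<lambda>p. if p = 0 then v else 0) \<in> gh D U 0 j ?T"
        unfolding iff blk_unblk using v by (intro conjI allI impI) (simp_all only: if_True if_False refl)
      then show "v \<in> ?f ` gh D U 0 j ?T" by (rule image_eqI[rotated]) simp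
    qed
  qed
  show ?thesis by (rule dim_bij[OF lin subspace_gh inj im])
qed

text \<open>The radical xW + ... + x^l W of M(W, l + 1) is M(W, l) twisted by chi^-1. Moving every
  component up by one degree matches both the characters and the nilpotency conditions.\<close>

lemma dim_gh_radical:
  assumes W: "grep D W" and l: "l < nil_ord D"
  shows "fvs.dim (gh D U 1 j (Mmod D W l)) = fvs.dim {u \<in> gh D U 0 j (Mmod D W (Suc l)). blk u 0 = 0}"
proof -
  let ?f = "\<lambda>u. unblk (\<lambda>p. case p of 0 \<Rightarrow> 0 | Suc r \<Rightarrow> blk u r)"
  have lin: "Vector_Spaces.linear fscale fscale ?f"
    by (intro linearI) (auto simp: unblk_def blk_def fun_eq_iff fscale_def split: nat.split)
  have l': "l \<le> nil_ord D" "Suc l \<le> nil_ord D" using l by auto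
  have iff: "?f u \<in> gh D U 0 j (Mmod D W (Suc l)) \<longleftrightarrow> u \<in> gh D U 1 j (Mmod D W l)" for u
  proof -
    have b: "blk (?f u) 0 = 0" "blk (?f u) (Suc p) = blk u p" for p by (simp_all add: zero_fun_def)
    show ?thesis
    proof
      assume A: "?f u \<in> gh D U 0 j (Mmod D W (Suc l))"
      note A' = A[unfolded gh_Mmod[OF W l'(2)]]
      have "blk u p \<in> (if p \<in> {..<l} then fspace (idx W \<times> idx U) else {0})" for p
        using conjunct1[OF A', unfolded blk_fspace_iff, rule_format, of "Suc p"] unfolding b by simp
      moreover have "mmul (idx U) (blk u p) (act U h) = fscale (inverse (chr D h) ^ (1 + p)) (mmul (idx W) (act W h) (blk u p))"
        if "h \<in> carrier (grp D)" "p < l" for h p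
        using conjunct1[OF conjunct2[OF A'], rule_format, OF that(1), of "Suc p"] that(2) unfolding b by simp
      moreover have "blk u p = 0" if "p + j < l" for p
        using conjunct2[OF conjunct2[OF A'], rule_format, of "Suc p"] that unfolding b by simp
      ultimately show "u \<in> gh D U 1 j (Mmod D W l)"
        unfolding gh_Mmod[OF W l'(1)] blk_fspace_iff by blast
    next
      assume A: "u \<in> gh D U 1 j (Mmod D W l)"
      note A' = A[unfolded gh_Mmod[OF W l'(1)]]
      have "blk (?f u) p \<in> (if p \<in> {..<Suc l} then fspace (idx W \<times> idx U) else {0})" for p
      proof (cases p)
        case (Suc r)
        then show ?thesis
          using conjunct1[OF A', unfolded blk_fspace_iff, rule_format, of r] unfolding Suc b by simp
      qed (simp only: b, simp)
      moreover have "mmul (idx U) (blk (?f u) p) (act U h) = fscale (inverse (chr D h) ^ (0 + p)) (mmul (idx W) (act W h) (blk (?f u) p))"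
        if "h \<in> carrier (grp D)" "p < Suc l" for h p
      proof (cases p)
        case (Suc r)
        then show ?thesis
          using conjunct1[OF conjunct2[OF A'], rule_format, OF that(1), of r] that(2) unfolding Suc b by simp
      qed (simp only: b mmul_zero fvs.scale_zero_right)
      moreover have "blk (?f u) p = 0" if "p + j < Suc l" for p
      proof (cases p)
        case (Suc r)
        then show ?thesis
          using conjunct2[OF conjunct2[OF A'], rule_format, of r] that unfolding Suc b by simp
      qed (simp only: b)
      ultimately show "?f u \<in> gh D U 0 j (Mmod D W (Suc l))"
        unfolding gh_Mmod[OF W l'(2)] blk_fspace_iff by blast
    qed
  qed
  have inj: "inj_on ?f (gh D U 1 j (Mmod D W l))"
  proof (rule inj_onI, rule blk_eqI)
    fix u v p assume "?f u = ?f v"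
    from arg_cong[OF this, of "\<lambda>A. blk A (Suc p)"] show "blk u p = blk v p" by simp
  qed
  have im: "?f ` gh D U 1 j (Mmod D W l) = {u \<in> gh D U 0 j (Mmod D W (Suc l)). blk u 0 = 0}" (is "_ = ?S")
  proof
    show "?f ` gh D U 1 j (Mmod D W l) \<subseteq> ?S" using iff by auto
    show "?S \<subseteq> ?f ` gh D U 1 j (Mmod D W l)"
    proof
      fix u assume u: "u \<in> ?S"
      let ?v = "unblk (\<lambda>p. blk u (Suc p))"
      have e: "u = ?f ?v" using u by (intro blk_eqI) (simp split: nat.split)
      then have "?f ?v \<in> gh D U 0 j (Mmod D W (Suc l))" using u by simp
      then have "?v \<in> gh D U 1 j (Mmod D W l)" unfolding iff .
      then show "u \<in> ?f ` gh D U 1 j (Mmod D W l)" by (rule image_eqI[of _ ?f, OF e])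
    qed
  qed
  show ?thesis by (rule dim_bij[OF lin subspace_gh inj im])
qed

end

section \<open>The sequence a Z -> M(1, 2) \<otimes> Z -> Z and the maps that lift along it\<close>

lemma sum_two: "(\<Sum>r\<in>{..<2::nat} \<times> {0::nat}. f r) = f (0, 0) + f (1, 0)"
proof -
  have "{..<2::nat} \<times> {0::nat} = {(0, 0), (1, 0)}" by auto
  then show ?thesis by simp
qed

context
  fixes D :: "('g, 'k::field) datum"
  assumes D: "nilpotent_datum D"
begin

interpretation G: group "grp D" using D by (simp add: nilpotent_datum_def)

text \<open>M(1, 2) built on the trivial character itself, so that its matrices are explicit;
  \<open>Mcls_one_two\<close> compares it with the module built on V 1.\<close>

abbreviation "Mtwo \<equiv> Mmod D (char_rep (\<lambda>_. 1)) 2"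

lemma Mtwo_hmodule: "hmodule D Mtwo"
  by (rule Mmod_hmodule[OF D trivial_grep[OF D] nil_ord_ge[OF D]])

text \<open>The sum of q^-s for s < j, with q = chi(g). It collects the scalars that arise when the
  single g in y^j on M(1, 2) \<otimes> Z is moved past the powers of y standing to its
  right.\<close>

definition qsum :: "nat \<Rightarrow> 'k" where
  "qsum j = (\<Sum>s<j. inverse (chr D (elt D)) ^ s)"

lemma qsum_nonzero: "0 < j \<Longrightarrow> j < nil_ord D \<Longrightarrow> qsum j \<noteq> 0"
proof
  let ?q = "chr D (elt D)"
  assume j: "0 < j" "j < nil_ord D" and "qsum j = 0"
  then have "(inverse ?q - 1) * (\<Sum>s<j. inverse ?q ^ s) = 0" by (simp add: qsum_def)
  then have "inverse ?q ^ j - 1 = 0" by (simp only: power_diff_1_eq)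
  then have "inverse (?q ^ j) = 1" by (simp add: power_inverse)
  then have "?q ^ j = 1" by (metis inverse_1 inverse_inverse_eq)
  then show False using nil_ord_least[OF D j] by simp
qed

lemma Mtwo_gelt: "hmodule D Z \<Longrightarrow> h \<in> carrier (grp D) \<Longrightarrow> act (tensor_module D Mtwo Z) (gelt D h)
    = kron (kron (scal 2 (inverse (chr D h))) (idmat {0})) (act Z (gelt D h))"
  and Mtwo_yelt: "hmodule D Z \<Longrightarrow> act (tensor_module D Mtwo Z) (yelt D)
    = kron (kron (shift 2) (idmat {0})) (act Z (gelt D (elt D))) + kron (idmat ({..<2} \<times> {0})) (act Z (yelt D))"
  by (simp_all add: tensor_gelt[OF D Mtwo_hmodule] tensor_yelt[OF D Mtwo_hmodule] Mmod_gelt[OF D trivial_grep[OF D] nil_ord_ge[OF D]]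
      Mmod_yelt[OF D trivial_grep[OF D] nil_ord_ge[OF D]] act_char_rep[OF D])

context
  fixes Z :: "(nat \<times> 'g \<Rightarrow> 'k, 'k, 'j) rep" and U :: "('g, 'k, 'i) rep"
  assumes Z: "hmodule D Z" and U: "grep D U"
begin

abbreviation "P2 \<equiv> {..<2::nat} \<times> {0::nat}"
abbreviation "TZ \<equiv> tensor_module D Mtwo Z"

lemma finZ: "finite (idx Z)" using Z by (rule hmodule_finite[OF D])

lemma blk_Mtwo_gelt:
  assumes h: "h \<in> carrier (grp D)" 
  shows "blk (mmul (P2 \<times> idx Z) (act TZ (gelt D h)) u) (0, 0) = mmul (idx Z) (act Z (gelt D h)) (blk u (0, 0))"
    "blk (mmul (P2 \<times> idx Z) (act TZ (gelt D h)) u) (1, 0)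
      = fscale (inverse (chr D h)) (mmul (idx Z) (act Z (gelt D h)) (blk u (1, 0)))"
  using finZ by (simp_all add: Mtwo_gelt[OF Z h] blk_mmul_kron sum_two kron_app scal_def idmat_def)

lemma blk_Mtwo_yelt:
  "blk (mmul (P2 \<times> idx Z) (act TZ (yelt D)) u) (0, 0) = mmul (idx Z) (act Z (yelt D)) (blk u (0, 0))"
  "blk (mmul (P2 \<times> idx Z) (act TZ (yelt D)) u) (1, 0)
      = mmul (idx Z) (act Z (gelt D (elt D))) (blk u (0, 0)) + mmul (idx Z) (act Z (yelt D)) (blk u (1, 0))"
  using finZ by (simp_all add: Mtwo_yelt[OF Z] mmul_add blk_add blk_mmul_kron sum_two kron_app shift_def idmat_def)

text \<open>On a pair (z0, z1) the element y acts by (y z0, g z0 + y z1). In the second component of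
  y^j the element g stands at each of j places, and g y^s = q^-s y^s g brings all these terms to
  y^(j-1) g z0.\<close>

lemma blk_Mtwo_pow:
  fixes I :: "'b set"
  assumes u: "u \<in> fspace ((P2 \<times> idx Z) \<times> I)"
  shows "blk (mmul (P2 \<times> idx Z) (mpow (P2 \<times> idx Z) (act TZ (yelt D)) j) u) (0, 0)
      = mmul (idx Z) (mpow (idx Z) (act Z (yelt D)) j) (blk u (0, 0))" (is "?A j")
    "blk (mmul (P2 \<times> idx Z) (mpow (P2 \<times> idx Z) (act TZ (yelt D)) j) u) (1, 0)
      = mmul (idx Z) (mpow (idx Z) (act Z (yelt D)) j) (blk u (1, 0))
        + fscale (qsum j) (mmul (idx Z) (mpow (idx Z) (act Z (yelt D)) (j - 1)) (mmul (idx Z) (act Z (gelt D (elt D))) (blk u (0, 0))))" (is "?B j")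
proof -
  let ?J = "idx Z" and ?Y = "act Z (yelt D)" and ?R = "act Z (gelt D (elt D))" and ?YT = "act TZ (yelt D)"
  let ?q = "chr D (elt D)"
  have finP: "finite (P2 \<times> ?J)" using finZ by simp
  have YT: "?YT \<in> fspace ((P2 \<times> ?J) \<times> (P2 \<times> ?J))"
    using hmodule_yelt[OF D tensor_hmodule[OF D Mtwo_hmodule Z]] by simp
  have sT: "mmul (P2 \<times> ?J) (mpow (P2 \<times> ?J) ?YT (Suc j)) u = mmul (P2 \<times> ?J) ?YT (mmul (P2 \<times> ?J) (mpow (P2 \<times> ?J) ?YT j) u)" for j
    using mpow_add[OF finP YT, of 1 j] finP by (simp add: mmul_idmat_left[OF finP YT] mmul_assoc[symmetric])
  have sY: "mmul ?J (mpow ?J ?Y (Suc j)) v = mmul ?J ?Y (mmul ?J (mpow ?J ?Y j) v)" for j and v :: "'j \<times> 'b \<Rightarrow> 'k"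
    using mpow_add[OF finZ hmodule_yelt[OF D Z], of 1 j] finZ
    by (simp add: mmul_idmat_left[OF finZ hmodule_yelt[OF D Z]] mmul_assoc[symmetric])
  have RY: "mmul ?J ?R (mmul ?J (mpow ?J ?Y j) v) = fscale (inverse ?q ^ j) (mmul ?J (mpow ?J ?Y j) (mmul ?J ?R v))" for j and v :: "'j \<times> 'b \<Rightarrow> 'k"
    using finZ chr_nz[OF D elt_carrier[OF D]]
    by (simp add: mmul_assoc[symmetric] mpow_yelt_gelt[OF D Z elt_carrier[OF D]] mmul_scale power_inverse)
  have "?A j \<and> ?B j"
  proof (induction j)
    case 0
    have "mmul (P2 \<times> ?J) (idmat (P2 \<times> ?J)) u = u" by (rule mmul_idmat_left[OF finP u])
    then show ?case
      using mmul_idmat_left[OF finZ blk_fspace[OF u]] by (simp add: qsum_def)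
  next
    case (Suc j)
    \<comment> \<open>At j = 0 the exponent j - 1 is truncated to 0; the term then carries the
      factor \<open>qsum 0\<close>, which is 0.\<close>
    have c: "fscale (qsum j) (mmul ?J ?Y (mmul ?J (mpow ?J ?Y (j - 1)) v)) = fscale (qsum j) (mmul ?J (mpow ?J ?Y j) v)" for v :: "'j \<times> 'b \<Rightarrow> 'k"
    proof (cases j)
      case (Suc r)
      then show ?thesis using sY[of r] by (simp del: mpow.simps)
    qed (simp add: qsum_def)
    have qs: "qsum (Suc j) = qsum j + inverse ?q ^ j" by (simp add: qsum_def)
    have A: "?A (Suc j)" unfolding sT sY blk_Mtwo_yelt using Suc by simp
    have "?B (Suc j)"
      unfolding sT sY blk_Mtwo_yelt conjunct1[OF Suc] conjunct2[OF Suc] RY mmul_add mmul_scale c diff_Suc_1 qs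
        fvs.scale_left_distrib by (simp only: add_ac)
    then show ?case using A by simp
  qed
  then show "?A j" "?B j" by auto
qed

lemma gh_Mtwo:
  assumes "1 \<le> j"
  shows "u \<in> gh D U 0 j TZ \<longleftrightarrow> u \<in> fspace ((P2 \<times> idx Z) \<times> idx U) \<and> blk u (0, 0) \<in> gh D U 0 j Z \<and>
     (\<forall>h\<in>carrier (grp D). mmul (idx U) (blk u (1, 0)) (act U h)
        = fscale (inverse (chr D h)) (mmul (idx Z) (act Z (gelt D h)) (blk u (1, 0)))) \<and>
     mmul (idx Z) (mpow (idx Z) (act Z (yelt D)) j) (blk u (1, 0))
        + fscale (qsum j) (mmul (idx Z) (mpow (idx Z) (act Z (yelt D)) (j - 1)) (mmul (idx Z) (act Z (gelt D (elt D))) (blk u (0, 0)))) = 0"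
proof (cases "u \<in> fspace ((P2 \<times> idx Z) \<times> idx U)")
  case u: True
  have e: "v = w \<longleftrightarrow> blk v (0, 0) = blk w (0, 0) \<and> blk v (1, 0) = blk w (1, 0)"
    if "v \<in> fspace ((P2 \<times> idx Z) \<times> idx U)" "w \<in> fspace ((P2 \<times> idx Z) \<times> idx U)" for v w :: "((nat \<times> nat) \<times> 'j) \<times> 'i \<Rightarrow> 'k"
  proof (intro iffI blk_eqI)
    fix p :: "nat \<times> nat" assume *: "blk v (0, 0) = blk w (0, 0) \<and> blk v (1, 0) = blk w (1, 0)"
    have "p = (0, 0) \<or> p = (1, 0) \<or> p \<notin> P2" by (cases p) auto
    then show "blk v p = blk w p" using * blk_outside[OF that(1)] blk_outside[OF that(2)] by metis
  qed simp
  have T: "hmodule D TZ" by (rule tensor_hmodule[OF D Mtwo_hmodule Z])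
  have iT: "idx TZ = P2 \<times> idx Z" by simp
  have 1: "mmul (idx U) u (act U h) = mmul (P2 \<times> idx Z) (act TZ (gelt D h)) u \<longleftrightarrow>
     mmul (idx U) (blk u (0, 0)) (act U h) = mmul (idx Z) (act Z (gelt D h)) (blk u (0, 0)) \<and>
     mmul (idx U) (blk u (1, 0)) (act U h) = fscale (inverse (chr D h)) (mmul (idx Z) (act Z (gelt D h)) (blk u (1, 0)))"
    if h: "h \<in> carrier (grp D)" for h
  proof -
    have f1: "mmul (idx U) u (act U h) \<in> fspace ((P2 \<times> idx Z) \<times> idx U)"
      by (rule mmul_closed[OF u grep_act[OF D U h]])
    have f2: "mmul (P2 \<times> idx Z) (act TZ (gelt D h)) u \<in> fspace ((P2 \<times> idx Z) \<times> idx U)"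
      using mmul_closed[OF hmodule_gelt[OF D T h, unfolded iT] u] .
    show ?thesis unfolding e[OF f1 f2] blk_mmul_right[of _ u] blk_Mtwo_gelt[OF h] ..
  qed
  have 2: "mmul (P2 \<times> idx Z) (mpow (P2 \<times> idx Z) (act TZ (yelt D)) j) u = 0 \<longleftrightarrow>
     mmul (idx Z) (mpow (idx Z) (act Z (yelt D)) j) (blk u (0, 0)) = 0 \<and>
     mmul (idx Z) (mpow (idx Z) (act Z (yelt D)) j) (blk u (1, 0))
        + fscale (qsum j) (mmul (idx Z) (mpow (idx Z) (act Z (yelt D)) (j - 1)) (mmul (idx Z) (act Z (gelt D (elt D))) (blk u (0, 0)))) = 0"
  proof -
    have f1: "mmul (P2 \<times> idx Z) (mpow (P2 \<times> idx Z) (act TZ (yelt D)) j) u \<in> fspace ((P2 \<times> idx Z) \<times> idx U)"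
      using mmul_closed[OF mpow_fspace[OF hmodule_yelt[OF D T, unfolded iT]] u] .
    show ?thesis unfolding e[OF f1 fspace_zero] blk_Mtwo_pow[OF u] blk_zero ..
  qed
  show ?thesis
    using u blk_fspace[OF u, of "(0, 0)"] 1 2 unfolding gh_def iT by (simp) blast
qed (auto simp: gh_def)

text \<open>The first component is the projection M(1, 2) \<otimes> Z -> Z. Its kernel accounts for
  the maps into a Z, and its image consists of the u for which a second component v solves the
  equation of \<open>gh_Mtwo\<close>.\<close>

lemma dim_gh_Mtwo:
  assumes j: "1 \<le> j"
  shows "fvs.dim (gh D U 0 j TZ) = fvs.dim (gh D U 1 j Z) + fvs.dim {u \<in> gh D U 0 j Z. \<exists>v\<in>fspace (idx Z \<times> idx U).
     (\<forall>h\<in>carrier (grp D). mmul (idx U) v (act U h) = fscale (inverse (chr D h)) (mmul (idx Z) (act Z (gelt D h)) v)) \<and>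
     mmul (idx Z) (mpow (idx Z) (act Z (yelt D)) j) v
        + fscale (qsum j) (mmul (idx Z) (mpow (idx Z) (act Z (yelt D)) (j - 1)) (mmul (idx Z) (act Z (gelt D (elt D))) u)) = 0}"
    (is "_ = _ + fvs.dim ?L")
proof -
  let ?S = "gh D U 0 j TZ" and ?f = "\<lambda>u. blk u (0::nat, 0::nat)" and ?g = "\<lambda>u. blk u (1::nat, 0::nat)"
  note fin = grep_finite[OF U] finZ
  have lin: "Vector_Spaces.linear fscale fscale ?f" "Vector_Spaces.linear fscale fscale ?g"
    by (auto intro!: linearI simp: blk_add blk_scale)
  let ?K = "{u \<in> ?S. ?f u = 0}"
  have "fvs.dim ?S = fvs.dim ?K + fvs.dim (?f ` ?S)"
    by (rule dim_kernel_image[OF lin(1) subspace_gh, where I = "(P2 \<times> idx Z) \<times> idx U"])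
      (use fin gh_Mtwo[OF j] in auto)
  moreover have "fvs.dim ?K = fvs.dim (gh D U 1 j Z)"
  proof -
    have e: "blk u p = 0" if "u \<in> ?K" "p \<noteq> (1, 0)" for u p
    proof -
      have u: "u \<in> fspace ((P2 \<times> idx Z) \<times> idx U)" "blk u (0, 0) = 0"
        using that(1) unfolding mem_Collect_eq gh_Mtwo[OF j] by simp_all
      have "p = (0, 0) \<or> p \<notin> P2" using that(2) by (cases p) auto
      then show ?thesis using u(2) blk_outside[OF u(1), of p] by auto
    qed
    have sub: "fvs.subspace ?K"
    proof -
      interpret Vector_Spaces.linear fscale fscale ?f by (rule lin(1))
      have "?K = ?S \<inter> {u. ?f u = 0}" by blast
      then show ?thesis using fvs.subspace_inter[OF subspace_gh subspace_kernel] by simp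
    qed
    have inj: "inj_on ?g ?K"
    proof (rule inj_onI, rule blk_eqI)
      fix u v p assume "u \<in> ?K" "v \<in> ?K" "?g u = ?g v"
      then show "blk u p = blk v p" using e[of u p] e[of v p] by (cases "p = (1, 0)") simp_all
    qed
    have im: "?g ` ?K = gh D U 1 j Z"
    proof
      show "?g ` ?K \<subseteq> gh D U 1 j Z"
      proof (rule image_subsetI)
        fix u assume u: "u \<in> ?K"
        then have "u \<in> fspace ((P2 \<times> idx Z) \<times> idx U)" unfolding mem_Collect_eq gh_Mtwo[OF j] by simp
        then show "?g u \<in> gh D U 1 j Z"
          using u unfolding gh_Mtwo[OF j] unfolding gh_def mem_Collect_eq
          by (auto simp: mmul_zero intro: blk_fspace)
      qed
      show "gh D U 1 j Z \<subseteq> ?g ` ?K"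
      proof
        fix v assume v: "v \<in> gh D U 1 j Z"
        define u where "u = unblk (\<lambda>p. if p = (1::nat, 0::nat) then v else 0)"
        have b: "blk u (0, 0) = 0" "blk u (1, 0) = v" by (simp_all add: u_def zero_fun_def)
        have "u \<in> fspace ((P2 \<times> idx Z) \<times> idx U)"
          using gh_fspace[OF v] unfolding blk_fspace_iff u_def blk_unblk by auto
        moreover have "0 \<in> gh D U 0 j Z" by (rule fvs.subspace_0[OF subspace_gh])
        ultimately have "u \<in> ?K"
          using v unfolding mem_Collect_eq gh_Mtwo[OF j] b mmul_zero unfolding gh_def
          by (simp add: fvs.scale_zero_right)
        then show "v \<in> ?g ` ?K" by (rule image_eqI[of _ ?g, OF b(2)[symmetric]])
      qed
    qed
    show ?thesis by (rule dim_bij[OF lin(2) sub inj im])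
  qed
  moreover have "?f ` ?S = ?L"
  proof
    show "?f ` ?S \<subseteq> ?L"
    proof (rule image_subsetI)
      fix u assume u: "u \<in> ?S"
      note u' = u[unfolded gh_Mtwo[OF j]]
      have "blk u (1, 0) \<in> fspace (idx Z \<times> idx U)" by (rule blk_fspace[OF conjunct1[OF u']])
      then show "?f u \<in> ?L"
        by (intro CollectI conjI bexI[of _ "blk u (1, 0)"] conjunct1[OF conjunct2[OF u']] conjunct2[OF conjunct2[OF conjunct2[OF u']]]
            conjunct1[OF conjunct2[OF conjunct2[OF u']]])
    qed
    show "?L \<subseteq> ?f ` ?S"
    proof
      fix u0 assume "u0 \<in> ?L"
      then obtain v where u0: "u0 \<in> gh D U 0 j Z" and v: "v \<in> fspace (idx Z \<times> idx U)"
        "\<forall>h\<in>carrier (grp D). mmul (idx U) v (act U h) = fscale (inverse (chr D h)) (mmul (idx Z) (act Z (gelt D h)) v)"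
        "mmul (idx Z) (mpow (idx Z) (act Z (yelt D)) j) v
          + fscale (qsum j) (mmul (idx Z) (mpow (idx Z) (act Z (yelt D)) (j - 1)) (mmul (idx Z) (act Z (gelt D (elt D))) u0)) = 0"
        by blast
      define u where "u = unblk (\<lambda>p. if p = (0::nat, 0::nat) then u0 else if p = (1, 0) then v else 0)"
      have b: "blk u (0, 0) = u0" "blk u (1, 0) = v" by (simp_all add: u_def)
      have "u \<in> fspace ((P2 \<times> idx Z) \<times> idx U)"
        using gh_fspace[OF u0] v(1) unfolding blk_fspace_iff u_def blk_unblk by auto
      then have "u \<in> ?S" unfolding gh_Mtwo[OF j] b using u0 v(2,3) by (intro conjI)
      then show "u0 \<in> ?f ` ?S" by (rule image_eqI[of _ ?f, OF b(1)[symmetric]])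
    qed
  qed
  ultimately show ?thesis by simp
qed

end

text \<open>The maps in \<open>Hom(U, ker y\<^sup>j)\<close> that lift along \<open>M(1, 2) \<otimes> Y \<rightarrow> Y\<close> for \<open>Y = M(W, l)\<close>: all of
  them, unless \<open>j = l\<close>, when they are those with vanishing component of degree 0. This is the
  almost split property of the sequence ending in \<open>M(W, l)\<close>.\<close>

lemma liftable_iff:
  assumes U: "grep D U" and W: "grep D W" and j: "1 \<le> j" and l: "1 \<le> l" "l < nil_ord D"
    and u: "u \<in> gh D U 0 j (Mmod D W l)"
  shows "(\<exists>v\<in>fspace (idx (Mmod D W l) \<times> idx U).
     (\<forall>h\<in>carrier (grp D). mmul (idx U) v (act U h) = fscale (inverse (chr D h)) (mmul (idx (Mmod D W l)) (act (Mmod D W l) (gelt D h)) v)) \<and>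
     mmul (idx (Mmod D W l)) (mpow (idx (Mmod D W l)) (act (Mmod D W l) (yelt D)) j) v
        + fscale (qsum j) (mmul (idx (Mmod D W l)) (mpow (idx (Mmod D W l)) (act (Mmod D W l) (yelt D)) (j - 1))
            (mmul (idx (Mmod D W l)) (act (Mmod D W l) (gelt D (elt D))) u)) = 0)
    \<longleftrightarrow> (j = l \<longrightarrow> blk u 0 = 0)" (is "?L \<longleftrightarrow> ?R")
proof -
  let ?Z = "Mmod D W l"
  let ?J = "{..<l} \<times> idx W" and ?g = "elt D"
  note fin = grep_finite[OF W] grep_finite[OF U]
  have l': "l \<le> nil_ord D" using l by simp
  note g = elt_carrier[OF D]
  have Zh: "hmodule D ?Z" by (rule Mmod_hmodule[OF D W l'])
  have iZ: "idx ?Z = ?J" by simp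
  have finJ: "finite ?J" using fin by simp
  note u' = u[unfolded gh_Mmod[OF D W l']]
  have uf: "u \<in> fspace (?J \<times> idx U)" using u' by blast
  define ru where "ru = mmul ?J (act ?Z (gelt D ?g)) u"
  define w where "w = mmul ?J (mpow ?J (act ?Z (yelt D)) (j - 1)) ru"
  have ruf: "ru \<in> fspace (?J \<times> idx U)"
    unfolding ru_def using mmul_closed[OF hmodule_gelt[OF D Zh g, unfolded iZ] uf] .
  have wf: "w \<in> fspace (?J \<times> idx U)"
    unfolding w_def using mmul_closed[OF mpow_fspace[OF hmodule_yelt[OF D Zh, unfolded iZ]] ruf] .
  have bru: "blk ru p = (if p < l then fscale (inverse (chr D ?g) ^ p) (mmul (idx W) (act W ?g) (blk u p)) else 0)" for p
    unfolding ru_def Mmod_gelt[OF D W l' g] by (rule blk_mmul_scal[OF fin(1)])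
  have bpow: "blk (mmul ?J (mpow ?J (act ?Z (yelt D)) k) v) p = (if k \<le> p \<and> p < l then blk v (p - k) else 0)"
    if "v \<in> fspace (?J \<times> idx U)" for v k p
    unfolding Mmod_yelt[OF D W l'] by (rule blk_mmul_shift[OF fin(1) that])
  have bw: "blk w p = (if j - 1 \<le> p \<and> p < l then blk ru (p - (j - 1)) else 0)" for p
    unfolding w_def by (rule bpow[OF ruf])
  have ru0: "blk ru p = 0" if "p + j < l" for p
    using u' that unfolding bru by (simp add: mmul_zero)
  show ?thesis
  proof
    assume ?L
    then obtain v where v: "v \<in> fspace (?J \<times> idx U)"
      and e: "mmul ?J (mpow ?J (act ?Z (yelt D)) j) v + fscale (qsum j) w = 0"
      unfolding iZ w_def ru_def by blast
    show ?R
    proof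
      assume jl: "j = l"
      \<comment> \<open>For j = l the power y^j is 0 on M(W, l), so the equation in degree l - 1
        leaves only \<open>qsum l\<close> times g u_0, with a nonzero constant.\<close>
      have "blk (mmul ?J (mpow ?J (act ?Z (yelt D)) j) v) (l - 1) = 0"
        using bpow[OF v, of j "l - 1"] jl l by simp
      moreover have "blk w (l - 1) = mmul (idx W) (act W ?g) (blk u 0)"
        using bw[of "l - 1"] bru[of 0] jl l by simp
      ultimately have "fscale (qsum j) (mmul (idx W) (act W ?g) (blk u 0)) = 0"
        using arg_cong[OF e, of "\<lambda>A. blk A (l - 1)"] by (simp add: blk_add blk_scale)
      then have 0: "mmul (idx W) (act W ?g) (blk u 0) = 0"
        using qsum_nonzero[of j] jl l unfolding fvs.scale_eq_0_iff by simp
      have "blk u 0 = mmul (idx W) (mmul (idx W) (act W (inv\<^bsub>grp D\<^esub> ?g)) (act W ?g)) (blk u 0)"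
        using mmul_idmat_left[OF fin(1) blk_fspace[OF uf]] grep_inv(2)[OF D W g] by simp
      also have "\<dots> = 0" using fin(1) by (simp add: mmul_assoc 0 mmul_zero)
      finally show "blk u 0 = 0" .
    qed
  next
    assume R: ?R
    \<comment> \<open>A preimage of - \<open>qsum j\<close> w under y^j: since y^j raises degrees by
      j, the components of w are moved down by j.\<close>
    define v where "v = unblk (\<lambda>p. if p + j < l then fscale (- qsum j) (blk w (p + j)) else 0)"
    have bv: "blk v p = (if p + j < l then fscale (- qsum j) (blk w (p + j)) else 0)" for p
      by (simp add: v_def)
    have vf: "v \<in> fspace (?J \<times> idx U)"
      unfolding blk_fspace_iff bv using blk_fspace[OF wf] by (auto intro: fspace_scale fspace_uminus)
    have wR: "mmul (idx U) w (act U h) = fscale (chr D h ^ (j - 1)) (mmul ?J (act ?Z (gelt D h)) w)" if h: "h \<in> carrier (grp D)" for h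
    proof -
      have "mmul (idx U) w (act U h) = mmul ?J (mpow ?J (act ?Z (yelt D)) (j - 1))
          (mmul ?J (act ?Z (gelt D ?g)) (mmul ?J (act ?Z (gelt D h)) u))"
        unfolding w_def ru_def using gh_commute[OF u h] finJ fin by (simp add: mmul_assoc)
      also have "\<dots> = mmul ?J (mmul ?J (mpow ?J (act ?Z (yelt D)) (j - 1)) (act ?Z (gelt D h))) ru"
        unfolding ru_def using finJ hmodule_gelt_mult[OF D Zh, unfolded iZ] g h elt_central[OF D h]
        by (simp add: mmul_assoc mmul_assoc[of ?J ?J "act ?Z (gelt D ?g)" "act ?Z (gelt D h)", symmetric]
            mmul_assoc[of ?J ?J "act ?Z (gelt D h)" "act ?Z (gelt D ?g)", symmetric])
      also have "\<dots> = fscale (chr D h ^ (j - 1)) (mmul ?J (act ?Z (gelt D h)) w)"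
        unfolding w_def using finJ mpow_yelt_gelt[OF D Zh h, unfolded iZ] by (simp add: mmul_scale mmul_assoc)
      finally show ?thesis .
    qed
    have wb: "mmul (idx U) (blk w (p + j)) (act U h) = fscale (inverse (chr D h) ^ Suc p) (mmul (idx W) (act W h) (blk w (p + j)))"
      if h: "h \<in> carrier (grp D)" and p: "p + j < l" for h p
    proof -
      have "mmul (idx U) (blk w (p + j)) (act U h)
          = fscale (chr D h ^ (j - 1) * inverse (chr D h) ^ (p + j)) (mmul (idx W) (act W h) (blk w (p + j)))"
        using arg_cong[OF wR[OF h], of "\<lambda>A. blk A (p + j)"] p fin
        by (simp add: blk_mmul_right[of _ w] blk_scale Mmod_gelt[OF D W l' h] blk_mmul_scal)
      \<comment> \<open>Passing y^(j-1) contributes chi(h)^(j-1) and degree p + j contributes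
        chi(h)^-(p+j). What remains is chi(h)^-(p+1), the character of degree p in a M(W,
        l).\<close>
      moreover have "chr D h ^ (j - 1) * inverse (chr D h) ^ (p + j) = inverse (chr D h) ^ Suc p"
      proof -
        have "p + j = (j - 1) + Suc p" using j by simp
        then have "chr D h ^ (j - 1) * inverse (chr D h) ^ (p + j) = (chr D h * inverse (chr D h)) ^ (j - 1) * inverse (chr D h) ^ Suc p"
          by (simp only: power_add power_mult_distrib mult.assoc)
        then show ?thesis using chr_nz[OF D h] by simp
      qed
      ultimately show ?thesis by simp
    qed
    have "mmul (idx U) v (act U h) = fscale (inverse (chr D h)) (mmul ?J (act ?Z (gelt D h)) v)" if h: "h \<in> carrier (grp D)" for h
    proof (rule blk_eqI)
      fix p
      show "blk (mmul (idx U) v (act U h)) p = blk (fscale (inverse (chr D h)) (mmul ?J (act ?Z (gelt D h)) v)) p"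
        using wb[OF h, of p] fin
        by (cases "p + j < l")
          (simp_all add: blk_mmul_right[of _ v] blk_scale Mmod_gelt[OF D W l' h] blk_mmul_scal bv mmul_scale mmul_zero mmul_uminus
            fvs.scale_minus_right mult_ac)
    qed
    moreover have "mmul ?J (mpow ?J (act ?Z (yelt D)) j) v + fscale (qsum j) w = 0"
    proof (rule blk_eqI)
      fix p
      \<comment> \<open>Since w is in the image of y^(j-1), only its component of degree j - 1 can
        obstruct membership in the image of y^j. That component is g u_0: it is 0 by hypothesis if j
        = l, and by y^j u = 0 if j < l.\<close>
      have "blk w p = 0" if "\<not> (j \<le> p \<and> p < l)"
      proof (cases "j - 1 \<le> p \<and> p < l")
        case True
        then have p: "p = j - 1" using that by auto
        show ?thesis
        proof (cases "j = l")
          case True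
          then show ?thesis using R p bw[of p] bru[of 0] l by (simp add: mmul_zero)
        next
          case False
          then have "0 + j < l" using True p j by simp
          then show ?thesis using ru0[of 0] p bw[of p] by simp
        qed
      qed (simp only: bw if_False)
      then show "blk (mmul ?J (mpow ?J (act ?Z (yelt D)) j) v + fscale (qsum j) w) p = blk 0 p"
        unfolding blk_add blk_scale bpow[OF vf] bv by (cases "j \<le> p \<and> p < l") simp_all
    qed
    ultimately show ?L unfolding iZ using vf unfolding w_def ru_def by blast
  qed
qed

text \<open>Maps into a M(W, l) cancel against the kernel part of the maps into M(1, 2) \<otimes>
  M(W, l). What is left is the number of all maps minus those that lift, which is concentrated in
  degree 0 and occurs only for j = l.\<close>

lemma hom_dim_delta:
  assumes U: "grep D U" and W: "grep D W" and j: "1 \<le> j" "j \<le> nil_ord D" and l: "1 \<le> l" "l < nil_ord D"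
  shows "hom_dim D (Mmod D U j) (Mmod D W l)
     + hom_dim D (Mmod D U j) (tensor_module D (inflate D (char_rep (\<lambda>h. inverse (chr D h)))) (Mmod D W l))
     - hom_dim D (Mmod D U j) (tensor_module D Mtwo (Mmod D W l))
     = (if j = l then int (fvs.dim (Hom (carrier (grp D)) U W)) else 0)"
proof -
  have l': "l \<le> nil_ord D" using l by simp
  let ?Z = "Mmod D W l"
  have Z: "hmodule D ?Z" by (rule Mmod_hmodule[OF D W l'])
  have A: "hmodule D (inflate D (char_rep (\<lambda>h. inverse (chr D h))))"
    by (rule inflate_hmodule[OF D trivial_twist_grep[OF D]])
  have "fvs.dim (gh D U 0 j (tensor_module D Mtwo ?Z))
     = fvs.dim (gh D U 1 j ?Z) + fvs.dim {u \<in> gh D U 0 j ?Z. j = l \<longrightarrow> blk u 0 = 0}"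
    unfolding dim_gh_Mtwo[OF Z U j(1)]
    by (intro arg_cong2[where f = "(+)"] arg_cong[where f = fvs.dim] refl Collect_cong conj_cong liftable_iff[OF U W j(1) l])
  moreover have "fvs.dim (gh D U 0 j ?Z) = fvs.dim {u \<in> gh D U 0 j ?Z. j = l \<longrightarrow> blk u 0 = 0}
     + (if j = l then fvs.dim (Hom (carrier (grp D)) U W) else 0)"
    using dim_gh_top[OF D U W l(1) l', of j] by (cases "j = l") simp_all
  moreover have "(if j = l then int (fvs.dim (Hom (carrier (grp D)) U W)) else 0)
      = int (if j = l then fvs.dim (Hom (carrier (grp D)) U W) else 0)" by simp
  ultimately show ?thesis
    unfolding hom_dim_Mmod[OF D U j Z] hom_dim_Mmod[OF D U j tensor_hmodule[OF D A Z]]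
      hom_dim_Mmod[OF D U j tensor_hmodule[OF D Mtwo_hmodule Z]] dim_gh_twist[OF D Z]
    by linarith
qed

text \<open>The subtracted module is the radical of M(W, n). For j < n a map killed by y^j already
  lands in the radical; for j = n its degree 0 component is an arbitrary G-map.\<close>

lemma hom_dim_delta_top:
  assumes U: "grep D U" and W: "grep D W" and j: "1 \<le> j" "j \<le> nil_ord D"
  shows "hom_dim D (Mmod D U j) (Mmod D W (nil_ord D))
     - hom_dim D (Mmod D U j) (tensor_module D (inflate D (char_rep (\<lambda>h. inverse (chr D h)))) (Mmod D W (nil_ord D - 1)))
     = (if j = nil_ord D then int (fvs.dim (Hom (carrier (grp D)) U W)) else 0)"
proof -
  let ?n = "nil_ord D"
  have n: "?n - 1 < ?n" "1 \<le> ?n" "Suc (?n - 1) = ?n" "?n - 1 \<le> ?n" using nil_ord_ge[OF D] by auto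
  have A: "hmodule D (inflate D (char_rep (\<lambda>h. inverse (chr D h))))"
    by (rule inflate_hmodule[OF D trivial_twist_grep[OF D]])
  have Z: "hmodule D (Mmod D W ?n)" "hmodule D (Mmod D W (?n - 1))"
    by (rule Mmod_hmodule[OF D W order_refl], rule Mmod_hmodule[OF D W n(4)])
  have "fvs.dim (gh D U 0 j (Mmod D W ?n)) = fvs.dim (gh D U 1 j (Mmod D W (?n - 1)))
     + (if j = ?n then fvs.dim (Hom (carrier (grp D)) U W) else 0)"
  proof (cases "j = ?n")
    case True
    then show ?thesis
      using dim_gh_top[OF D U W n(2) order_refl, of j] dim_gh_radical[OF D W n(1), of U j, unfolded n(3)] by simp
  next
    case False
    then have "0 + j < ?n" using j by simp
    then have "u \<in> gh D U 0 j (Mmod D W ?n) \<Longrightarrow> blk u 0 = 0" for u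
      unfolding gh_Mmod[OF D W order_refl] by blast
    then have "{u \<in> gh D U 0 j (Mmod D W ?n). blk u 0 = 0} = gh D U 0 j (Mmod D W ?n)" by blast
    then show ?thesis using False dim_gh_radical[OF D W n(1), of U j, unfolded n(3)] by simp
  qed
  then show ?thesis
    unfolding hom_dim_Mmod[OF D U j Z(1)] hom_dim_Mmod[OF D U j tensor_hmodule[OF D A Z(2)]] dim_gh_twist[OF D Z(2)]
    by simp
qed

end

section \<open>Splitting off an indecomposable summand\<close>

lemma injective_square_inverse:
  fixes F :: "'i \<times> 'i \<Rightarrow> 'k::field"
  assumes F: "F \<in> fspace (I \<times> I)" and I: "finite I"
    and inj: "\<And>v. v \<in> fspace I \<Longrightarrow> mvec I F v = 0 \<Longrightarrow> v = 0"
  obtains T where "T \<in> fspace (I \<times> I)" "mmul I T F = idmat I" "mmul I F T = idmat I"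
proof -
  obtain T where T: "T \<in> fspace (I \<times> I)" "mmul I F (mmul I T F) = F"
    by (rule generalized_inverse[OF F I I])
  have "mmul I T F = idmat I" by (rule injective_left_inverse[OF F I I inj T])
  then show ?thesis using that[OF T(1) _ left_inverse_square[OF F I I refl T(1)]] by blast
qed

context
  fixes D :: "('g, 'k::field) datum"
  assumes D: "nilpotent_datum D"
begin

interpretation G: group "grp D" using D by (simp add: nilpotent_datum_def)

text \<open>If P Q = 1, then E = 1 - Q P is an idempotent H-map; L is its image in coordinates, and
  stacking P over the coordinate map A gives the isomorphism.\<close>

lemma split_off:
  fixes N :: "(nat \<times> 'g \<Rightarrow> 'k, 'k, 'i) rep" and M :: "(nat \<times> 'g \<Rightarrow> 'k, 'k, 'j) rep"
  assumes N: "hmodule D N" and M: "hmodule D M"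
    and P: "P \<in> Hom (carrier (hopf_alg D)) N M" and Q: "Q \<in> Hom (carrier (hopf_alg D)) M N"
    and PQ: "mmul (idx N) P Q = idmat (idx M)"
  obtains L :: "(nat \<times> 'g \<Rightarrow> 'k, 'k, nat) rep" where "hmodule D L"
    "rep_iso (carrier (hopf_alg D)) N (sum_module M L)"
proof -
  let ?I = "idx N" and ?J = "idx M"
  note fin = hmodule_finite[OF D N] hmodule_finite[OF D M]
  note Pf = Hom_fspace[OF P] and Qf = Hom_fspace[OF Q]
  define E where "E = idmat ?I - mmul ?J Q P"
  have QPQ: "mmul ?I (mmul ?J Q P) Q = Q" "mmul ?I P (mmul ?J Q P) = P"
    using fin Pf Qf PQ by (simp_all add: mmul_assoc mmul_idmat_right mmul_assoc[symmetric, of ?I ?J P Q P] mmul_idmat_left)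
  have QP: "mmul ?J Q P \<in> fspace (?I \<times> ?I)" by (rule mmul_closed[OF Qf Pf])
  have E: "E \<in> fspace (?I \<times> ?I)" unfolding E_def by (rule fspace_diff[OF idmat_fspace QP])
  have PE: "mmul ?I P E = 0" and EQ: "mmul ?I E Q = 0"
    using fin Pf Qf QPQ by (simp_all add: E_def mmul_diff mmul_idmat_right mmul_idmat_left)
  have EE: "mmul ?I E E = E"
  proof -
    have "mmul ?I E E = mmul ?I E (idmat ?I) - mmul ?J (mmul ?I E Q) P"
      using fin by (simp add: E_def[of] mmul_diff mmul_assoc)
    then show ?thesis using E fin by (simp add: EQ mmul_zero mmul_idmat_right)
  qed
  have Ec: "mmul ?I E (act N a) = mmul ?I (act N a) E" if a: "a \<in> carrier (hopf_alg D)" for a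
  proof -
    have "mmul ?I (mmul ?J Q P) (act N a) = mmul ?I (act N a) (mmul ?J Q P)"
      using fin Hom_commute[OF P a] Hom_commute[OF Q a] by (simp add: mmul_assoc flip: mmul_assoc[of ?J ?J Q])
    then show ?thesis
      using fin hmodule_act[OF D N a] by (simp add: E_def mmul_diff mmul_idmat_left mmul_idmat_right)
  qed
  obtain A r B where AB: "A \<in> fspace ({..<r::nat} \<times> ?I)" "B \<in> fspace (?I \<times> {..<r})"
    "mmul ?I A B = idmat {..<r}" "mmul {..<r} B A = E"
    by (rule idempotent_splitting[OF E EE fin(1)])
  have EB: "mmul ?I E B = B" and AE: "mmul ?I A E = A"
    using AB fin by (simp_all add: mmul_assoc mmul_idmat_right mmul_assoc[symmetric, of ?I "{..<r}" A B A] mmul_idmat_left flip: AB(4))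
  have PB: "mmul ?I P B = 0"
  proof -
    have "mmul ?I P B = mmul ?I (mmul ?I P E) B" using fin by (simp add: mmul_assoc EB)
    then show ?thesis by (simp add: PE mmul_zero)
  qed
  have AQ: "mmul ?I A Q = 0"
  proof -
    have "mmul ?I A Q = mmul ?I A (mmul ?I E Q)" using fin by (simp add: mmul_assoc[symmetric] AE)
    then show ?thesis by (simp add: EQ mmul_zero)
  qed
  have C: "compression (carrier (hopf_alg D)) N {..<r} A B"
  proof
    fix a assume a: "a \<in> carrier (hopf_alg D)"
    have "mmul {..<r} B (mmul ?I A (mmul ?I (act N a) B)) = mmul ?I (mmul ?I E (act N a)) B"
      using fin by (simp add: mmul_assoc AB(4)[symmetric])
    then show "mmul {..<r} B (mmul ?I A (mmul ?I (act N a) B)) = mmul ?I (act N a) B"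
      using fin by (simp add: Ec[OF a] mmul_assoc EB)
  qed (use AB in \<open>simp_all add: hmodule_mrep[OF D N]\<close>)
  let ?L = "compress {..<r} A B N"
  have L: "hmodule D ?L" by (rule compress_hmodule[OF D N C])
  have AL: "mmul ?I A (act N a) = mmul {..<r} (act ?L a) A" if a: "a \<in> carrier (hopf_alg D)" for a
  proof -
    have "mmul {..<r} (act ?L a) A = mmul ?I A (mmul ?I (act N a) E)"
      using fin by (simp add: mmul_assoc AB(4))
    also have "\<dots> = mmul ?I (mmul ?I A E) (act N a)" using fin by (simp add: mmul_assoc Ec[OF a])
    finally show ?thesis by (simp add: AE)
  qed
  define T where "T = (\<lambda>(x, i). case x of Inl s \<Rightarrow> P (s, i) | Inr s \<Rightarrow> A (s, i))"
  define S where "S = (\<lambda>(i, x). case x of Inl s \<Rightarrow> Q (i, s) | Inr s \<Rightarrow> B (i, s))"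
  have Tf: "T \<in> fspace ((?J <+> {..<r}) \<times> ?I)" and Sf: "S \<in> fspace (?I \<times> (?J <+> {..<r}))"
    using Pf Qf AB(1,2) by (auto simp: T_def S_def fspace_def split: sum.split)
  have "rep_iso (carrier (hopf_alg D)) N (sum_module M ?L)"
  proof (rule rep_isoI[OF hmodule_mrep[OF D N] hmodule_mrep[OF D sum_hmodule[OF D M L]]])
    show "T \<in> Hom (carrier (hopf_alg D)) N (sum_module M ?L)"
    proof (rule HomI)
      fix a assume a: "a \<in> carrier (hopf_alg D)"
      have "mmul ?I T (act N a) (x, i) = mmul (?J <+> {..<r}) (bdiag (act M a) (act ?L a)) T (x, i)" for x i
      proof (cases x)
        case (Inl s)
        have "mmul ?I T (act N a) (x, i) = mmul ?I P (act N a) (s, i)" by (simp add: mmul_def T_def Inl)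
        also have "\<dots> = mmul ?J (act M a) P (s, i)" by (simp add: Hom_commute[OF P a])
        also have "\<dots> = mmul (?J <+> {..<r}) (bdiag (act M a) (act ?L a)) T (x, i)"
          using fin by (simp add: mmul_def sum_Plus Inl T_def del: compress_sel)
        finally show ?thesis .
      next
        case (Inr s)
        have "mmul ?I T (act N a) (x, i) = mmul ?I A (act N a) (s, i)" by (simp add: mmul_def T_def Inr)
        also have "\<dots> = mmul {..<r} (act ?L a) A (s, i)" by (simp only: AL[OF a])
        also have "\<dots> = mmul (?J <+> {..<r}) (bdiag (act M a) (act ?L a)) T (x, i)"
          using fin by (simp add: mmul_def sum_Plus Inr T_def del: compress_sel)
        finally show ?thesis .
      qed
      then show "mmul (idx N) T (act N a) = mmul (idx (sum_module M ?L)) (act (sum_module M ?L) a) T"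
        by (auto simp: act_sum_module simp del: compress_sel(2))
    qed (use Tf in simp)
    have "mmul (?J <+> {..<r}) S T (i, i') = (mmul ?J Q P + mmul {..<r} B A) (i, i')" for i i'
      using fin by (simp add: mmul_def sum_Plus S_def T_def)
    then show "mmul (idx (sum_module M ?L)) S T = idmat (idx N)"
      by (auto simp: AB(4) E_def)
    show "mmul (idx N) T S = idmat (idx (sum_module M ?L))"
    proof (rule fun_eq_sum_prodI)
      fix s t
      have "mmul (idx N) T S (Inl s, Inl t) = mmul ?I P Q (s, t)" by (simp add: mmul_def T_def S_def)
      then show "mmul (idx N) T S (Inl s, Inl t) = idmat (idx (sum_module M ?L)) (Inl s, Inl t)"
        by (auto simp: PQ idmat_def)
    next
      fix s t
      have "mmul (idx N) T S (Inl s, Inr t) = mmul ?I P B (s, t)" by (simp add: mmul_def T_def S_def)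
      then show "mmul (idx N) T S (Inl s, Inr t) = idmat (idx (sum_module M ?L)) (Inl s, Inr t)"
        by (auto simp: PB idmat_def)
    next
      fix s t
      have "mmul (idx N) T S (Inr s, Inl t) = mmul ?I A Q (s, t)" by (simp add: mmul_def T_def S_def)
      then show "mmul (idx N) T S (Inr s, Inl t) = idmat (idx (sum_module M ?L)) (Inr s, Inl t)"
        by (auto simp: AQ idmat_def)
    next
      fix s t
      have "mmul (idx N) T S (Inr s, Inr t) = mmul ?I A B (s, t)" by (simp add: mmul_def T_def S_def)
      then show "mmul (idx N) T S (Inr s, Inr t) = idmat (idx (sum_module M ?L)) (Inr s, Inr t)"
        by (auto simp: AB(3) idmat_def)
    qed
  qed (use Sf in simp)
  then show ?thesis using L that by blast
qed

text \<open>Commuting with y makes F block lower triangular, with block (p, k) depending only on p -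
  k. The diagonal blocks are the identity, so F is injective by forward substitution, and its
  inverse matrix is again an H-map.\<close>

lemma Mmod_endo_inverse:
  assumes U: "grep D U" and j: "1 \<le> j" "j \<le> nil_ord D"
    and F: "F \<in> Hom (carrier (hopf_alg D)) (Mmod D U j) (Mmod D U j)" and F0: "blk (cblk F 0) 0 = idmat (idx U)"
  obtains T where "T \<in> Hom (carrier (hopf_alg D)) (Mmod D U j) (Mmod D U j)"
    "mmul ({..<j} \<times> idx U) T F = idmat ({..<j} \<times> idx U)"
proof -
  let ?M = "Mmod D U j" and ?I = "{..<j} \<times> idx U"
  have M: "hmodule D ?M" by (rule Mmod_hmodule[OF D U j(2)])
  note fin = grep_finite[OF U]
  have finI: "finite ?I" using fin by simp
  have Ff: "F \<in> fspace (?I \<times> ?I)" using Hom_fspace[OF F] by simp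
  define u where "u = cblk F 0"
  have uf: "u \<in> fspace (?I \<times> idx U)"
    using gh_fspace[OF Hom_Mmod(1)[OF D U j M F]] by (simp add: u_def)
  have Fe: "F = ext_map ?I (act ?M (yelt D)) j u"
    using Hom_Mmod(2)[OF D U j M F] by (simp add: u_def)
  have entry: "F ((p, s), (k, t)) = (if k < j \<and> k \<le> p \<and> p < j then blk u (p - k) (s, t) else 0)" for p s k t
  proof -
    have "F ((p, s), (k, t)) = (if k < j then blk (mmul ?I (mpow ?I (act ?M (yelt D)) k) u) p (s, t) else 0)"
      by (subst Fe) (simp add: ext_map_def blk_def)
    then show ?thesis by (simp add: Mmod_yelt[OF D U j(2)] blk_mmul_shift[OF fin uf])
  qed
  have "v = 0" if v: "v \<in> fspace ?I" "mvec ?I F v = 0" for v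
  proof -
    have "\<forall>s\<in>idx U. v (p, s) = 0" if "p < j" for p
      using that
    proof (induction p rule: less_induct)
      case (less p)
      show ?case
      proof
        fix s assume s: "s \<in> idx U"
        have "0 = mvec ?I F v (p, s)" using v by simp
        also have "\<dots> = (\<Sum>k<j. \<Sum>t\<in>idx U. F ((p, s), (k, t)) * v (k, t))"
          unfolding mvec_def by (simp add: sum.cartesian_product)
        also have "\<dots> = (\<Sum>k<j. if k = p then (\<Sum>t\<in>idx U. idmat (idx U) (s, t) * v (p, t)) else 0)"
        proof (intro sum.cong refl)
          fix k assume k: "k \<in> {..<j}"
          show "(\<Sum>t\<in>idx U. F ((p, s), (k, t)) * v (k, t)) = (if k = p then (\<Sum>t\<in>idx U. idmat (idx U) (s, t) * v (p, t)) else 0)"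
          proof (cases k p rule: linorder_cases)
            case less
            then show ?thesis using less.IH[of k] k by simp
          next
            case equal
            then show ?thesis using less.prems F0 by (simp add: entry u_def)
          next
            case greater
            then show ?thesis by (simp add: entry)
          qed
        qed
        also have "\<dots> = v (p, s)"
          using less.prems s fin by (simp add: idmat_def if_distrib if_distribR cong: if_cong)
        finally show "v (p, s) = 0" by simp
      qed
    qed
    then show ?thesis by (intro fspace_eqI[OF v(1) fspace_zero]) auto
  qed
  then obtain T where T: "T \<in> fspace (?I \<times> ?I)" "mmul ?I T F = idmat ?I" "mmul ?I F T = idmat ?I"
    by (rule injective_square_inverse[OF Ff finI])
  have "T \<in> Hom (carrier (hopf_alg D)) ?M ?M"
    by (rule Hom_inverse[OF hmodule_mrep[OF D M] hmodule_mrep[OF D M] F]) (use T in simp_all)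
  then show ?thesis using T(2) by (rule that)
qed

text \<open>A copy of some V i on which y^(j-1) does not vanish generates a submodule, included by
  Q. Maschke provides a G-map \<pi> inverting y^(j-1) on this copy, and \<pi> combined with powers
  of y gives an H-map P back. P Q need not be 1 but is unitriangular, hence invertible.\<close>

lemma split_indecomposable:
  fixes N :: "(nat \<times> 'g \<Rightarrow> 'k, 'k, 'i) rep"
  assumes char: "of_nat (card (carrier (grp D))) \<noteq> (0::'k)" and V: "complete_simples D m V"
    and N: "hmodule D N" and ne: "idx N \<noteq> {}"
  obtains i j and L :: "(nat \<times> 'g \<Rightarrow> 'k, 'k, nat) rep"
  where "i \<in> {1..m}" "j \<in> {1..nil_ord D}" "hmodule D L" "rep_iso (carrier (hopf_alg D)) N (sum_module (Mmod D (V i) j) L)"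
proof -
  let ?J = "idx N" and ?G = "carrier (grp D)" and ?R = "\<lambda>h. act N (gelt D h)" and ?Y = "act N (yelt D)"
  note fin = hmodule_finite[OF D N]
  note Yf = hmodule_yelt[OF D N]
  have nil: "mpow ?J ?Y (nil_ord D) = 0" by (rule ymod_nil[OF hmodule_ymod[OF D N]])
  \<comment> \<open>The largest block size occurring in N; only for this size does the complement
    exist in general.\<close>
  define j where "j = (LEAST k. mpow ?J ?Y k = 0)"
  have j0: "mpow ?J ?Y j = 0" unfolding j_def by (rule LeastI[of _ "nil_ord D"]) (rule nil)
  have jn: "j \<le> nil_ord D" unfolding j_def by (rule Least_le) (rule nil)
  have "mpow ?J ?Y 0 \<noteq> 0"
  proof
    obtain s where s: "s \<in> ?J" using ne by blast
    assume "mpow ?J ?Y 0 = 0"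
    then have "idmat ?J (s, s) = (0::'k)" by simp
    then show False using s by (simp add: idmat_def)
  qed
  then have j1: "1 \<le> j" using j0 by (cases j) auto
  define F where "F = mpow ?J ?Y (j - 1)"
  have Ff: "F \<in> fspace (?J \<times> ?J)" unfolding F_def by (rule mpow_fspace[OF Yf])
  have F0: "F \<noteq> 0"
  proof
    assume "F = 0"
    then have "j \<le> j - 1" unfolding F_def j_def by (rule Least_le)
    then show False using j1 by simp
  qed
  have FR: "mmul ?J F (?R h) = fscale (chr D h ^ (j - 1)) (mmul ?J (?R h) F)" if "h \<in> ?G" for h
    unfolding F_def by (rule mpow_yelt_gelt[OF D N that])
  define N0 where "N0 = \<lparr>idx = ?J, act = ?R\<rparr>"
  \<comment> \<open>The power y^(j-1) is not a G-map from N to N, but becomes one when the target is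
    twisted by chi^(j-1).\<close>
  define N1 where "N1 = \<lparr>idx = ?J, act = (\<lambda>h. fscale (chr D h ^ (j - 1)) (?R h))\<rparr>"
  note sel = rep.select_convs
  have N0: "grep D N0"
    by (rule grepI[OF D]) (use fin in \<open>simp_all add: N0_def hmodule_gelt[OF D N] hmodule_gelt_mult[OF D N] hmodule_gelt_one[OF D N]\<close>)
  have N1: "grep D N1"
    by (rule grepI[OF D]) (use fin in \<open>simp_all add: N1_def hmodule_gelt[OF D N] fspace_scale hmodule_gelt_one[OF D N]
        chr_one[OF D] chr_mult[OF D] mmul_scale hmodule_gelt_mult[OF D N] power_mult_distrib mult_ac\<close>)
  have FH: "F \<in> Hom ?G N0 N1"
    by (rule HomI) (simp_all add: N0_def N1_def Ff FR mmul_scale)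
  obtain i \<sigma> where i: "i \<in> {1..m}" and \<sigma>: "\<sigma> \<in> Hom ?G (V i) N0" and F\<sigma>: "mmul (idx N0) F \<sigma> \<noteq> 0"
    by (rule simple_constituent[OF D char V N0 N1 FH F0])
  have Vs: "simple_grep D (V i)" by (rule complete_simples_simple[OF V i])
  then have Vg: "grep D (V i)" by (simp add: simple_grep_def)
  note finV = grep_finite[OF Vg]
  let ?U = "idx (V i)"
  have iN: "idx N0 = ?J" "idx N1 = ?J" by (simp_all add: N0_def N1_def)
  define \<tau> where "\<tau> = mmul ?J F \<sigma>"
  have \<tau>: "\<tau> \<in> Hom ?G (V i) N1"
    using Hom_comp[OF finV _ _ \<sigma> FH] fin by (simp add: iN \<tau>_def)
  have \<tau>0: "\<tau> \<noteq> 0" using F\<sigma> by (simp add: iN \<tau>_def)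
  obtain \<pi> where \<pi>: "\<pi> \<in> Hom ?G N1 (V i)" "mmul ?U \<tau> (mmul ?J \<pi> \<tau>) = \<tau>"
    using maschke[OF D char Vg N1 \<tau>] unfolding iN by blast
  have \<tau>f: "\<tau> \<in> fspace (?J \<times> ?U)" and \<pi>f: "\<pi> \<in> fspace (?U \<times> ?J)" and \<sigma>f: "\<sigma> \<in> fspace (?J \<times> ?U)"
    using Hom_fspace[OF \<tau>] Hom_fspace[OF \<pi>(1)] Hom_fspace[OF \<sigma>] by (simp_all add: iN)
  have \<pi>\<tau>: "mmul ?J \<pi> \<tau> = idmat ?U"
    by (rule injective_left_inverse[OF \<tau>f finV fin simple_grep_injective[OF D Vs N1 \<tau> \<tau>0] \<pi>f \<pi>(2)])
  let ?M = "Mmod D (V i) j" and ?I = "{..<j} \<times> ?U"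
  have M: "hmodule D ?M" by (rule Mmod_hmodule[OF D Vg jn])
  have \<sigma>gh: "\<sigma> \<in> gh D (V i) 0 j N"
    using \<sigma>f Hom_commute[OF \<sigma>] by (simp add: gh_def j0 mmul_zero iN) (simp add: N0_def)
  define Q where "Q = ext_map ?J ?Y j \<sigma>"
  have Q: "Q \<in> Hom (carrier (hopf_alg D)) ?M N" unfolding Q_def by (rule ext_map_Hom[OF D Vg jn N \<sigma>gh])
  have cQ: "cblk Q 0 = \<sigma>" using j1 \<sigma>f fin by (simp add: Q_def cblk_ext_map mmul_idmat_left)
  \<comment> \<open>The component of P in degree k must satisfy P_k y = P_(k-1) and take its value
    \<pi> in degree j - 1, which dictates the exponents j - 1 - k.\<close>
  define P where "P = unblk (\<lambda>k. if k < j then mmul ?J \<pi> (mpow ?J ?Y (j - 1 - k)) else 0)"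
  have bP: "blk P k = (if k < j then mmul ?J \<pi> (mpow ?J ?Y (j - 1 - k)) else 0)" for k
    by (simp add: P_def)
  have Pf: "P \<in> fspace (?I \<times> ?J)"
    unfolding blk_fspace_iff bP using mmul_closed[OF \<pi>f mpow_fspace[OF Yf]] by auto
  have "P \<in> Hom (carrier (hopf_alg D)) N ?M"
  proof (rule HomI_gens[OF D N M])
    show "P \<in> fspace (idx ?M \<times> idx N)" using Pf by simp
    show "mmul (idx N) P (act N (gelt D h)) = mmul (idx ?M) (act ?M (gelt D h)) P" if h: "h \<in> ?G" for h
    proof (rule blk_eqI)
      fix k
      have \<pi>R: "mmul ?U (act (V i) h) \<pi> = fscale (chr D h ^ (j - 1)) (mmul ?J \<pi> (?R h))"
        using Hom_commute[OF \<pi>(1) h] by (simp add: N1_def mmul_scale)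
      have "mmul ?J (mmul ?J \<pi> (mpow ?J ?Y (j - 1 - k))) (?R h)
         = fscale (inverse (chr D h) ^ k) (mmul ?U (act (V i) h) (mmul ?J \<pi> (mpow ?J ?Y (j - 1 - k))))" if "k < j"
      proof -
        have 1: "mmul ?J (mmul ?J \<pi> (mpow ?J ?Y (j - 1 - k))) (?R h) = fscale (chr D h ^ (j - 1 - k)) (mmul ?J (mmul ?J \<pi> (?R h)) (mpow ?J ?Y (j - 1 - k)))"
          using fin by (simp add: mmul_assoc mpow_yelt_gelt[OF D N h] mmul_scale)
        have 2: "mmul ?U (act (V i) h) (mmul ?J \<pi> (mpow ?J ?Y (j - 1 - k))) = fscale (chr D h ^ (j - 1)) (mmul ?J (mmul ?J \<pi> (?R h)) (mpow ?J ?Y (j - 1 - k)))"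
          using fin finV by (simp add: mmul_assoc[symmetric] \<pi>R mmul_scale)
        have "j - 1 = k + (j - 1 - k)" using that by simp
        then have "inverse (chr D h) ^ k * chr D h ^ (j - 1) = (inverse (chr D h) * chr D h) ^ k * chr D h ^ (j - 1 - k)"
          by (metis mult.assoc power_add power_mult_distrib)
        then have 3: "inverse (chr D h) ^ k * chr D h ^ (j - 1) = chr D h ^ (j - 1 - k)"
          using chr_nz[OF D h] by simp
        show ?thesis unfolding 1 2 by (simp only: fvs.scale_scale 3)
      qed
      then show "blk (mmul (idx N) P (act N (gelt D h))) k = blk (mmul (idx ?M) (act ?M (gelt D h)) P) k"
        by (simp add: blk_mmul_right[of _ P] Mmod_gelt[OF D Vg jn h] blk_mmul_scal[OF finV] bP mmul_zero)
    qed
    have yP: "blk (mmul ?I (act ?M (yelt D)) P) k = (if 1 \<le> k \<and> k < j then blk P (k - 1) else 0)" for k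
    proof -
      have s1: "mpow ?I (act ?M (yelt D)) 1 = act ?M (yelt D)"
        using hmodule_yelt[OF D M] finV by (simp add: mmul_idmat_left)
      have "blk (mmul ?I (mpow ?I (act ?M (yelt D)) 1) P) k = (if 1 \<le> k \<and> k < j then blk P (k - 1) else 0)"
        unfolding Mmod_yelt[OF D Vg jn] by (rule blk_mmul_shift[OF finV Pf])
      then show ?thesis unfolding s1 .
    qed
    show "mmul (idx N) P (act N (yelt D)) = mmul (idx ?M) (act ?M (yelt D)) P"
    proof (rule blk_eqI)
      fix k
      have "mmul ?J (blk P k) ?Y = (if 1 \<le> k \<and> k < j then blk P (k - 1) else 0)"
      proof (cases "k < j")
        case k: True
        have "mmul ?J (blk P k) ?Y = mmul ?J \<pi> (mpow ?J ?Y (Suc (j - 1 - k)))"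
          using k fin by (simp add: bP mmul_assoc)
        also have "\<dots> = (if 1 \<le> k \<and> k < j then blk P (k - 1) else 0)"
        proof (cases "1 \<le> k")
          case True
          then have "Suc (j - 1 - k) = j - 1 - (k - 1)" using k by simp
          then show ?thesis using True k unfolding bP by simp
        next
          case False
          then have "Suc (j - 1 - k) = j" using j1 by simp
          then show ?thesis using False j0 by (simp only: mmul_zero if_False conj_absorb simp_thms)
        qed
        finally show ?thesis .
      qed (simp add: bP mmul_zero)
      then show "blk (mmul (idx N) P (act N (yelt D))) k = blk (mmul (idx ?M) (act ?M (yelt D)) P) k"
        using yP[of k] by (simp add: blk_mmul_right[of _ P])
    qed
  qed
  note P = this
  have PQ: "mmul ?J P Q \<in> Hom (carrier (hopf_alg D)) ?M ?M"
    using Hom_comp[OF _ _ _ Q P] hmodule_finite[OF D M] fin by simp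
  have "blk (cblk (mmul ?J P Q) 0) 0 = idmat ?U"
  proof -
    have "blk (cblk (mmul ?J P Q) 0) 0 = mmul ?J (blk P 0) (cblk Q 0)"
      by (auto simp: blk_def cblk_def mmul_def)
    also have "\<dots> = mmul ?J \<pi> \<tau>" using j1 fin by (simp add: bP cQ \<tau>_def F_def mmul_assoc)
    finally show ?thesis using \<pi>\<tau> by simp
  qed
  \<comment> \<open>The degree 0 corner of P Q is \<pi> y^(j-1) \<sigma> = 1, so P Q can be inverted
    and T P is an exact left inverse of Q.\<close>
  then obtain T where T: "T \<in> Hom (carrier (hopf_alg D)) ?M ?M" "mmul ?I T (mmul ?J P Q) = idmat ?I"
    by (rule Mmod_endo_inverse[OF Vg j1 jn PQ])
  have "mmul ?I T P \<in> Hom (carrier (hopf_alg D)) N ?M"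
    using Hom_comp[OF _ _ _ P T(1)] hmodule_finite[OF D M] fin by simp
  moreover have "mmul ?J (mmul ?I T P) Q = idmat (idx ?M)"
    using T(2) fin finV by (simp add: mmul_assoc)
  ultimately obtain L :: "(nat \<times> 'g \<Rightarrow> 'k, 'k, nat) rep" where "hmodule D L"
    "rep_iso (carrier (hopf_alg D)) N (sum_module ?M L)"
    using split_off[OF N M _ Q] by blast
  then show ?thesis using that i j1 jn by simp
qed

end

section \<open>The Green ring\<close>

lemma frag_extend_fun_add: "frag_extend (\<lambda>c. f c + g c) x = frag_extend f x + frag_extend g x"
  by (simp add: frag_extend_def frag_cmul_distrib2 sum.distrib)

lemma frag_extend_fun_zero: "frag_extend (\<lambda>c. 0) x = 0"
  by (simp add: frag_extend_def)

lemma frag_extend_fun_minus: "frag_extend (\<lambda>c. - f c) x = - frag_extend f x"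
  using frag_extend_fun_add[of "\<lambda>c. - f c" f x] by (simp add: frag_extend_fun_zero eq_neg_iff_add_eq_0)

lemma frag_extend_fun_diff: "frag_extend (\<lambda>c. f c - g c) x = frag_extend f x - frag_extend g x"
  using frag_extend_fun_add[of f "\<lambda>c. - g c" x] by (simp add: frag_extend_fun_minus)

lemma keys_frag_extend_subset:
  assumes "Poly_Mapping.keys x \<subseteq> S" "\<And>c. c \<in> S \<Longrightarrow> Poly_Mapping.keys (f c) \<subseteq> T"
  shows "Poly_Mapping.keys (frag_extend f x) \<subseteq> T"
  using keys_frag_extend[of f x] assms by blast

definition zext :: "('a \<Rightarrow> int) \<Rightarrow> ('a \<Rightarrow>\<^sub>0 int) \<Rightarrow> int" where
  "zext f x = (\<Sum>c\<in>Poly_Mapping.keys x. Poly_Mapping.lookup x c * f c)"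

lemma zext_superset:
  "finite A \<Longrightarrow> Poly_Mapping.keys x \<subseteq> A \<Longrightarrow> zext f x = (\<Sum>c\<in>A. Poly_Mapping.lookup x c * f c)"
  unfolding zext_def by (rule sum.mono_neutral_left) (auto simp: in_keys_iff)

lemma zext_add: "zext f (x + y) = zext f x + zext f y"
proof -
  let ?A = "Poly_Mapping.keys x \<union> Poly_Mapping.keys y"
  have A: "finite ?A" by simp
  show ?thesis
    using zext_superset[OF A keys_add] zext_superset[OF A Un_upper1] zext_superset[OF A Un_upper2]
    by (simp add: lookup_add distrib_right sum.distrib)
qed

lemma zext_minus: "zext f (- x) = - zext f x"
  by (simp add: zext_def sum_negf)

lemma zext_diff: "zext f (x - y) = zext f x - zext f y"
  using zext_add[of f x "- y"] by (simp add: zext_minus)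

lemma zext_zero [simp]: "zext f 0 = 0"
  by (simp add: zext_def)

lemma zext_frag_of [simp]: "zext f (frag_of c) = f c"
  by (simp add: zext_def)

lemma zext_fun_add: "zext (\<lambda>c. f c + g c) x = zext f x + zext g x"
  by (simp add: zext_def distrib_left sum.distrib)

lemma zext_cong: "Poly_Mapping.keys x \<subseteq> S \<Longrightarrow> (\<And>c. c \<in> S \<Longrightarrow> f c = g c) \<Longrightarrow> zext f x = zext g x"
  unfolding zext_def by (intro sum.cong) auto

lemma zext_swap: "zext (\<lambda>c. zext (h c) y) x = zext (\<lambda>d. zext (\<lambda>c. h c d) x) y"
  unfolding zext_def sum_distrib_left by (subst sum.swap) (simp add: mult_ac)

lemma ex_nat_relabel: "finite I \<Longrightarrow> \<exists>\<beta> :: 'i \<Rightarrow> nat. inj_on \<beta> I"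
  by (rule finite_imp_inj_to_nat_seg[THEN exE]) auto

context
  fixes D :: "('g, 'k::field) datum"
  assumes D: "nilpotent_datum D"
begin

abbreviation cls :: "(nat \<times> 'g \<Rightarrow> 'k, 'k, 'i) rep \<Rightarrow> ('g, 'k) hmod set" where
  "cls M \<equiv> iso_class D M"

text \<open>Members of an isomorphism class are indexed by natural numbers; a module with any other
  index type has to be copied before its class is known to be nonempty.\<close>

lemma nat_copy:
  fixes M :: "(nat \<times> 'g \<Rightarrow> 'k, 'k, 'i) rep"
  assumes M: "hmodule D M"
  obtains N :: "('g, 'k) hmod" where "hmodule D N" "rep_iso (carrier (hopf_alg D)) M N"
proof -
  obtain \<beta> :: "'i \<Rightarrow> nat" where "inj_on \<beta> (idx M)" using ex_nat_relabel[OF hmodule_finite[OF D M]] by blast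
  then show ?thesis using relabel_hmodule[OF D M] that by blast
qed

lemma iso_class_eqI:
  assumes M: "hmodule D M" and N: "hmodule D N" and MN: "rep_iso (carrier (hopf_alg D)) M N"
  shows "cls M = cls N"
proof -
  have "rep_iso (carrier (hopf_alg D)) M L \<longleftrightarrow> rep_iso (carrier (hopf_alg D)) N L" if "hmodule D L" for L :: "('g, 'k) hmod"
    using hiso_trans[OF D N M that rep_iso_sym[OF MN]] hiso_trans[OF D M N that MN] by blast
  then show ?thesis unfolding iso_class_def by blast
qed

lemma repr_iso_class:
  assumes M: "hmodule D M"
  shows "hmodule D (repr (cls M))" "rep_iso (carrier (hopf_alg D)) M (repr (cls M))"
proof -
  obtain N :: "('g, 'k) hmod" where "hmodule D N" "rep_iso (carrier (hopf_alg D)) M N" by (rule nat_copy[OF M])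
  then have "N \<in> cls M" by (simp add: iso_class_def)
  then have "repr (cls M) \<in> cls M" unfolding repr_def by (rule someI)
  then show "hmodule D (repr (cls M))" "rep_iso (carrier (hopf_alg D)) M (repr (cls M))"
    by (simp_all add: iso_class_def)
qed

lemma iso_class_repr: "hmodule D M \<Longrightarrow> cls (repr (cls M)) = cls M"
  using iso_class_eqI[OF _ repr_iso_class] by metis

lemma iso_class_in:
  assumes "hmodule D M" shows "cls M \<in> iso_classes D"
proof -
  have "cls M = cls (repr (cls M))" using iso_class_repr[OF assms] by simp
  then show ?thesis unfolding iso_classes_def using repr_iso_class(1)[OF assms] by blast
qed

lemma iso_classes_cases:
  assumes "c \<in> iso_classes D"
  obtains "hmodule D (repr c)" "cls (repr c) = c"
  using assms repr_iso_class(1) iso_class_repr unfolding iso_classes_def by auto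

lemma repr_hmodule: "c \<in> iso_classes D \<Longrightarrow> hmodule D (repr c)"
  and cls_repr: "c \<in> iso_classes D \<Longrightarrow> cls (repr c) = c"
  by (auto elim: iso_classes_cases)

definition tcls :: "('g, 'k) hmod set \<Rightarrow> ('g, 'k) hmod set \<Rightarrow> ('g, 'k) hmod set" where
  "tcls c d = cls (tensor_module D (repr c) (repr d))"

text \<open>Independence of the chosen representatives, from invariance of tensor products under
  isomorphism.\<close>

lemma tcls_cls:
  assumes M: "hmodule D M" and N: "hmodule D N"
  shows "tcls (cls M) (cls N) = cls (tensor_module D M N)"
  unfolding tcls_def using repr_iso_class[OF M] repr_iso_class[OF N] M N
  by (intro iso_class_eqI tensor_hmodule[OF D] tensor_iso[OF D] rep_iso_sym[OF repr_iso_class(2)]) auto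

lemma tcls_in: "c \<in> iso_classes D \<Longrightarrow> d \<in> iso_classes D \<Longrightarrow> tcls c d \<in> iso_classes D"
  unfolding tcls_def by (intro iso_class_in tensor_hmodule[OF D] repr_hmodule)

lemma tcls_assoc:
  assumes "c \<in> iso_classes D" "d \<in> iso_classes D" "e \<in> iso_classes D"
  shows "tcls (tcls c d) e = tcls c (tcls d e)"
proof -
  note h = assms[THEN repr_hmodule]
  have "tcls (tcls (cls (repr c)) (cls (repr d))) (cls (repr e)) = tcls (cls (repr c)) (tcls (cls (repr d)) (cls (repr e)))"
    using h by (simp add: tcls_cls tensor_hmodule[OF D] iso_class_eqI[OF _ _ tensor_assoc[OF D]])
  then show ?thesis using assms by (simp add: cls_repr)
qed

abbreviation triv :: "(nat \<times> 'g \<Rightarrow> 'k, 'k, nat) rep" where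
  "triv \<equiv> inflate D (char_rep (\<lambda>_. 1))"

lemma triv_hmodule: "hmodule D triv"
  by (rule inflate_hmodule[OF D trivial_grep[OF D]])

lemma tcls_unit:
  assumes "c \<in> iso_classes D"
  shows "tcls (cls triv) c = c" "tcls c (cls triv) = c"
proof -
  note h = repr_hmodule[OF assms]
  have "tcls (cls triv) (cls (repr c)) = cls (repr c)" "tcls (cls (repr c)) (cls triv) = cls (repr c)"
    using h triv_hmodule
    by (simp_all add: tcls_cls tensor_hmodule[OF D] iso_class_eqI[OF _ _ tensor_unit_left[OF D]] iso_class_eqI[OF _ _ tensor_unit_right[OF D]])
  then show "tcls (cls triv) c = c" "tcls c (cls triv) = c" using assms by (simp_all add: cls_repr)
qed

section \<open>The ring on isomorphism classes and its ideal of relations\<close>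

abbreviation FG where "FG \<equiv> free_green D"

lemma free_green_sel:
  "x \<in> carrier FG \<longleftrightarrow> Poly_Mapping.keys x \<subseteq> iso_classes D"
  "x \<otimes>\<^bsub>FG\<^esub> y = frag_extend (\<lambda>c. frag_extend (\<lambda>d. frag_of (tcls c d)) y) x"
  "\<one>\<^bsub>FG\<^esub> = frag_of (cls triv)" "\<zero>\<^bsub>FG\<^esub> = 0" "x \<oplus>\<^bsub>FG\<^esub> y = x + y"
  by (simp_all add: free_green_def tcls_def)

lemma add_monoid_free_green: "add_monoid FG = free_Abelian_group (iso_classes D)"
  by (simp add: free_green_def free_Abelian_group_def)

lemma free_green_mult:
  "frag_of c \<otimes>\<^bsub>FG\<^esub> frag_of d = frag_of (tcls c d)"
  "(x - x') \<otimes>\<^bsub>FG\<^esub> y = x \<otimes>\<^bsub>FG\<^esub> y - x' \<otimes>\<^bsub>FG\<^esub> y" "y \<otimes>\<^bsub>FG\<^esub> (x - x') = y \<otimes>\<^bsub>FG\<^esub> x - y \<otimes>\<^bsub>FG\<^esub> x'"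
  "(x + x') \<otimes>\<^bsub>FG\<^esub> y = x \<otimes>\<^bsub>FG\<^esub> y + x' \<otimes>\<^bsub>FG\<^esub> y" "y \<otimes>\<^bsub>FG\<^esub> (x + x') = y \<otimes>\<^bsub>FG\<^esub> x + y \<otimes>\<^bsub>FG\<^esub> x'"
  "0 \<otimes>\<^bsub>FG\<^esub> y = 0" "y \<otimes>\<^bsub>FG\<^esub> 0 = 0"
  "(- x) \<otimes>\<^bsub>FG\<^esub> y = - (x \<otimes>\<^bsub>FG\<^esub> y)" "y \<otimes>\<^bsub>FG\<^esub> (- x) = - (y \<otimes>\<^bsub>FG\<^esub> x)"
  by (simp_all add: free_green_sel(2) frag_extend_diff frag_extend_add frag_extend_minus frag_extend_fun_diff
      frag_extend_fun_add frag_extend_fun_minus frag_extend_fun_zero)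

lemma free_green_mult_closed: "x \<in> carrier FG \<Longrightarrow> y \<in> carrier FG \<Longrightarrow> x \<otimes>\<^bsub>FG\<^esub> y \<in> carrier FG"
  unfolding free_green_sel by (intro keys_frag_extend_subset[of x "iso_classes D"] keys_frag_extend_subset[of y "iso_classes D"])
    (auto simp: tcls_in)

text \<open>Each law is additive in every argument, so induction on the free group, one argument at
  a time, reduces it to classes of modules.\<close>

lemma free_green_ring: "ring FG"
proof (rule ringI)
  show "abelian_group FG"
    by (rule comm_group_abelian_groupI)
      (simp add: add_monoid_free_green[simplified] abelian_free_Abelian_group)
  show "monoid FG"
  proof (rule monoidI)
    show one: "\<one>\<^bsub>FG\<^esub> \<in> carrier FG" by (simp add: free_green_sel iso_class_in triv_hmodule)
    fix x assume x: "x \<in> carrier FG"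
    show "\<one>\<^bsub>FG\<^esub> \<otimes>\<^bsub>FG\<^esub> x = x"
      using x unfolding free_green_sel(1,3)
      by (rule free_Abelian_group_induct) (simp_all add: free_green_mult tcls_unit)
    show "x \<otimes>\<^bsub>FG\<^esub> \<one>\<^bsub>FG\<^esub> = x"
      using x unfolding free_green_sel(1,3)
      by (rule free_Abelian_group_induct) (simp_all add: free_green_mult tcls_unit)
    fix y z assume y: "y \<in> carrier FG" and z: "z \<in> carrier FG"
    have 1: "frag_of c \<otimes>\<^bsub>FG\<^esub> frag_of d \<otimes>\<^bsub>FG\<^esub> z = frag_of c \<otimes>\<^bsub>FG\<^esub> (frag_of d \<otimes>\<^bsub>FG\<^esub> z)"
      if "c \<in> iso_classes D" "d \<in> iso_classes D" for c d
      using z unfolding free_green_sel(1)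
      by (rule free_Abelian_group_induct) (simp_all add: free_green_mult tcls_assoc that)
    have 2: "frag_of c \<otimes>\<^bsub>FG\<^esub> y \<otimes>\<^bsub>FG\<^esub> z = frag_of c \<otimes>\<^bsub>FG\<^esub> (y \<otimes>\<^bsub>FG\<^esub> z)"
      if "c \<in> iso_classes D" for c
      using y unfolding free_green_sel(1)
      by (rule free_Abelian_group_induct) (simp_all only: free_green_mult(2,3,6,7) 1[OF that])
    show "x \<otimes>\<^bsub>FG\<^esub> y \<otimes>\<^bsub>FG\<^esub> z = x \<otimes>\<^bsub>FG\<^esub> (y \<otimes>\<^bsub>FG\<^esub> z)"
      using x unfolding free_green_sel(1)
      by (rule free_Abelian_group_induct) (simp_all only: free_green_mult(2,3,6,7) 2)
  qed (rule free_green_mult_closed)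
qed (simp_all add: free_green_mult free_green_sel(5))

lemma green_rel_carrier: "x \<in> green_rel D \<Longrightarrow> x \<in> carrier FG"
proof -
  have "{frag_of (cls (sum_module M N)) - (frag_of (cls M) + frag_of (cls N)) | (M :: ('g, 'k) hmod) (N :: ('g, 'k) hmod).
      hmodule D M \<and> hmodule D N} \<subseteq> carrier (free_Abelian_group (iso_classes D))" (is "?R \<subseteq> _")
  proof clarify
    fix M N :: "('g, 'k) hmod" assume h: "hmodule D M" "hmodule D N"
    have "frag_of (cls M) + frag_of (cls N) \<in> carrier (free_Abelian_group (iso_classes D))"
      using iso_class_in[OF h(1)] iso_class_in[OF h(2)] by (auto dest!: subsetD[OF keys_add])
    then show "frag_of (cls (sum_module M N)) - (frag_of (cls M) + frag_of (cls N)) \<in> carrier (free_Abelian_group (iso_classes D))"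
      using iso_class_in[OF sum_hmodule[OF D h]] by (auto dest!: subsetD[OF keys_diff])
  qed
  then have sub: "green_rel D \<subseteq> carrier (free_Abelian_group (iso_classes D))"
    unfolding green_rel_def by (rule group.generate_incl[OF group_free_Abelian_group])
  show "x \<in> green_rel D \<Longrightarrow> x \<in> carrier FG"
    using subsetD[OF sub, of x] unfolding carrier_free_Abelian_group_iff free_green_sel(1) by this
qed

lemma green_rel_subgroup: "subgroup (green_rel D) (free_Abelian_group (iso_classes D))"
proof -
  have "{frag_of (cls (sum_module M N)) - (frag_of (cls M) + frag_of (cls N)) | (M :: ('g, 'k) hmod) (N :: ('g, 'k) hmod).
      hmodule D M \<and> hmodule D N} \<subseteq> carrier (free_Abelian_group (iso_classes D))" (is "?R \<subseteq> _")
  proof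
    fix x assume "x \<in> ?R"
    then have "x \<in> green_rel D" unfolding green_rel_def by (rule generate.incl)
    then show "x \<in> carrier (free_Abelian_group (iso_classes D))" using green_rel_carrier by (simp add: free_green_sel(1))
  qed
  then show ?thesis
    unfolding green_rel_def by (rule group.generate_is_subgroup[OF group_free_Abelian_group])
qed

lemma green_rel_zero: "0 \<in> green_rel D"
  and green_rel_add: "x \<in> green_rel D \<Longrightarrow> y \<in> green_rel D \<Longrightarrow> x + y \<in> green_rel D"
  and green_rel_minus: "x \<in> green_rel D \<Longrightarrow> - x \<in> green_rel D"
  and green_rel_diff: "x \<in> green_rel D \<Longrightarrow> y \<in> green_rel D \<Longrightarrow> x - y \<in> green_rel D"
proof -
  show 0: "0 \<in> green_rel D" using subgroup.one_closed[OF green_rel_subgroup] by simp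
  show a: "x \<in> green_rel D \<Longrightarrow> y \<in> green_rel D \<Longrightarrow> x + y \<in> green_rel D" for x y
    using subgroup.m_closed[OF green_rel_subgroup, of x y] by simp
  show m: "x \<in> green_rel D \<Longrightarrow> - x \<in> green_rel D" for x
    using subgroup.m_inv_closed[OF green_rel_subgroup, of x] green_rel_carrier[of x] by (simp add: free_green_sel(1))
  show "x \<in> green_rel D \<Longrightarrow> y \<in> green_rel D \<Longrightarrow> x - y \<in> green_rel D"
    using a[of x "- y"] m[of y] by simp
qed

text \<open>The generating relations are stated for natural indices. Passing to representatives
  extends them to tensor products and duals, whose indices have other types.\<close>

lemma green_rel_sum:
  assumes M: "hmodule D M" and N: "hmodule D N"
  shows "frag_of (cls (sum_module M N)) - (frag_of (cls M) + frag_of (cls N)) \<in> green_rel D"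
proof -
  let ?M = "repr (cls M)" and ?N = "repr (cls N)"
  note h = repr_iso_class[OF M] repr_iso_class[OF N]
  have "frag_of (cls (sum_module ?M ?N)) - (frag_of (cls ?M) + frag_of (cls ?N)) \<in> green_rel D"
    unfolding green_rel_def using h by (intro generate.incl) blast
  moreover have "cls (sum_module ?M ?N) = cls (sum_module M N)"
    using h M N by (intro iso_class_eqI sum_hmodule[OF D] sum_iso[OF D] rep_iso_sym[OF h(2)] rep_iso_sym[OF h(4)]) auto
  ultimately show ?thesis using M N by (simp add: iso_class_repr)
qed

lemma green_rel_induct [consumes 1, case_names rel zero add minus]:
  assumes "x \<in> green_rel D"
    and rel: "\<And>(M :: ('g, 'k) hmod) (N :: ('g, 'k) hmod). hmodule D M \<Longrightarrow> hmodule D N \<Longrightarrow>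
      P (frag_of (cls (sum_module M N)) - (frag_of (cls M) + frag_of (cls N)))"
    and "P 0" and add: "\<And>x y. P x \<Longrightarrow> P y \<Longrightarrow> P (x + y)" and minus: "\<And>x. P x \<Longrightarrow> P (- x)"
  shows "P x"
  using assms(1) unfolding green_rel_def
proof (induction rule: generate.induct)
  case (inv h)
  have "h \<in> green_rel D" unfolding green_rel_def using inv by (rule generate.incl)
  then have "Poly_Mapping.keys h \<subseteq> iso_classes D" using green_rel_carrier by (simp add: free_green_sel(1))
  then have "inv\<^bsub>free_Abelian_group (iso_classes D)\<^esub> h = - h" by (rule inv_free_Abelian_group)
  moreover have "P h" using inv rel by auto
  ultimately show ?case using minus by simp
qed (use rel \<open>P 0\<close> add in auto)

text \<open>Tensor products distribute over direct sums on either side, so multiplying a generating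
  relation by a class gives another such relation.\<close>

lemma green_rel_ideal: "ideal (green_rel D) FG"
proof (rule idealI[OF free_green_ring])
  show "subgroup (green_rel D) (add_monoid FG)" unfolding add_monoid_free_green by (rule green_rel_subgroup)
  have l: "frag_of c \<otimes>\<^bsub>FG\<^esub> a \<in> green_rel D" if a: "a \<in> green_rel D" and c: "c \<in> iso_classes D" for a c
    using a
  proof (induction a rule: green_rel_induct)
    case (rel M N)
    note h = repr_hmodule[OF c] rel
    have "tcls (cls (repr c)) (cls (sum_module M N)) = cls (sum_module (tensor_module D (repr c) M) (tensor_module D (repr c) N))"
      using h by (simp add: tcls_cls sum_hmodule[OF D] tensor_hmodule[OF D] iso_class_eqI[OF _ _ tensor_sum_right[OF D]])
    moreover have "tcls (cls (repr c)) (cls M) = cls (tensor_module D (repr c) M)"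
      "tcls (cls (repr c)) (cls N) = cls (tensor_module D (repr c) N)" using h by (simp_all add: tcls_cls)
    ultimately show ?case
      using green_rel_sum[OF tensor_hmodule[OF D h(1,2)] tensor_hmodule[OF D h(1,3)]]
      by (simp add: free_green_mult cls_repr[OF c])
  qed (auto simp: free_green_mult green_rel_zero green_rel_add green_rel_minus)
  have r: "a \<otimes>\<^bsub>FG\<^esub> frag_of c \<in> green_rel D" if a: "a \<in> green_rel D" and c: "c \<in> iso_classes D" for a c
    using a
  proof (induction a rule: green_rel_induct)
    case (rel M N)
    note h = repr_hmodule[OF c] rel
    have "tcls (cls (sum_module M N)) (cls (repr c)) = cls (sum_module (tensor_module D M (repr c)) (tensor_module D N (repr c)))"
      using h by (simp add: tcls_cls sum_hmodule[OF D] tensor_hmodule[OF D] iso_class_eqI[OF _ _ tensor_sum_left[OF D]])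
    moreover have "tcls (cls M) (cls (repr c)) = cls (tensor_module D M (repr c))"
      "tcls (cls N) (cls (repr c)) = cls (tensor_module D N (repr c))" using h by (simp_all add: tcls_cls)
    ultimately show ?case
      using green_rel_sum[OF tensor_hmodule[OF D h(2,1)] tensor_hmodule[OF D h(3,1)]]
      by (simp add: free_green_mult cls_repr[OF c])
  qed (auto simp: free_green_mult green_rel_zero green_rel_add green_rel_minus)
  fix a x assume a: "a \<in> green_rel D" and x: "x \<in> carrier FG"
  show "x \<otimes>\<^bsub>FG\<^esub> a \<in> green_rel D"
    using x unfolding free_green_sel(1)
    by (rule free_Abelian_group_induct) (auto simp: free_green_mult green_rel_zero green_rel_diff l[OF a])
  show "a \<otimes>\<^bsub>FG\<^esub> x \<in> green_rel D"
    using x unfolding free_green_sel(1)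
    by (rule free_Abelian_group_induct) (auto simp: free_green_mult green_rel_zero green_rel_diff r[OF a])
qed

section \<open>The quotient ring with its form, dimension and duality\<close>

interpretation I: ideal "green_rel D" FG by (rule green_rel_ideal)

lemma green_ring_ring: "ring (green_ring D)"
  unfolding green_ring_def by (rule I.quotient_is_ring)

interpretation R: ring "green_ring D" by (rule green_ring_ring)

abbreviation kcls where "kcls x \<equiv> green_rel D +>\<^bsub>FG\<^esub> x"

interpretation K: ring_hom_ring FG "green_ring D" kcls
  unfolding green_ring_def by (rule I.rcos_ring_hom_ring)

lemma kcls_mem: "x' \<in> kcls x \<longleftrightarrow> (\<exists>i\<in>green_rel D. x' = i + x)"
  by (auto simp: a_r_coset_def' free_green_sel)

lemma green_carrier_cases:
  assumes "X \<in> carrier (green_ring D)"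
  obtains x where "x \<in> carrier FG" "X = kcls x"
proof -
  have "X \<in> a_rcosets\<^bsub>FG\<^esub> (green_rel D)"
    using assms unfolding green_ring_def FactRing_def partial_object.simps .
  then show ?thesis unfolding A_RCOSETS_def' using that by (elim UN_E singletonE)
qed

lemma kcls_diff: "x \<in> carrier FG \<Longrightarrow> y \<in> carrier FG \<Longrightarrow> kcls (x - y) = kcls x \<ominus>\<^bsub>green_ring D\<^esub> kcls y"
proof -
  assume x: "x \<in> carrier FG" and y: "y \<in> carrier FG"
  have m: "\<ominus>\<^bsub>FG\<^esub> y = - y"
    using y unfolding a_inv_def add_monoid_free_green by (simp add: free_green_sel(1))
  have "kcls (x \<oplus>\<^bsub>FG\<^esub> (\<ominus>\<^bsub>FG\<^esub> y)) = kcls x \<oplus>\<^bsub>green_ring D\<^esub> (\<ominus>\<^bsub>green_ring D\<^esub> kcls y)"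
    using x y by simp
  then show ?thesis by (simp add: m free_green_sel(5) a_minus_def)
qed

lemma green_class_kcls: "green_class D M = kcls (frag_of (cls M))"
  by (simp add: green_class_def)

lemma frag_of_carrier: "hmodule D M \<Longrightarrow> frag_of (cls M) \<in> carrier FG"
  by (simp add: free_green_sel(1) iso_class_in)

lemma green_class_closed: "hmodule D M \<Longrightarrow> green_class D M \<in> carrier (green_ring D)"
  unfolding green_class_kcls by (rule K.hom_closed[OF frag_of_carrier])

lemma green_class_iso: "hmodule D M \<Longrightarrow> hmodule D N \<Longrightarrow> rep_iso (carrier (hopf_alg D)) M N \<Longrightarrow> green_class D M = green_class D N"
  by (simp add: green_class_kcls iso_class_eqI)

lemma green_class_sum:
  assumes M: "hmodule D M" and N: "hmodule D N"
  shows "green_class D (sum_module M N) = green_class D M \<oplus>\<^bsub>green_ring D\<^esub> green_class D N"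
proof -
  have "frag_of (cls (sum_module M N)) \<in> kcls (frag_of (cls M) + frag_of (cls N))"
    unfolding kcls_mem by (intro bexI[OF _ green_rel_sum[OF M N]]) simp
  moreover have "frag_of (cls M) + frag_of (cls N) \<in> carrier FG"
    using I.add.m_closed[OF frag_of_carrier[OF M] frag_of_carrier[OF N]] by (simp add: free_green_sel(5))
  ultimately have "kcls (frag_of (cls M) + frag_of (cls N)) = kcls (frag_of (cls (sum_module M N)))"
    by (intro I.a_repr_independence')
  then show ?thesis
    unfolding green_class_kcls using frag_of_carrier[OF M] frag_of_carrier[OF N] K.hom_add by (simp add: free_green_sel(5))
qed

lemma green_class_tensor:
  assumes M: "hmodule D M" and N: "hmodule D N"
  shows "green_class D M \<otimes>\<^bsub>green_ring D\<^esub> green_class D N = green_class D (tensor_module D M N)"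
  unfolding green_class_kcls using K.hom_mult[OF frag_of_carrier[OF M] frag_of_carrier[OF N]]
  by (simp add: free_green_mult tcls_cls[OF M N])

lemma green_one: "\<one>\<^bsub>green_ring D\<^esub> = green_class D triv"
  using K.hom_one by (simp add: green_class_kcls free_green_sel(3))

text \<open>The Green ring is generated additively by classes, so every additive identity in it
  needs to be checked on modules only.\<close>

lemma green_induct [consumes 1, case_names cls zero diff]:
  assumes X: "X \<in> carrier (green_ring D)"
    and c: "\<And>M :: ('g, 'k) hmod. hmodule D M \<Longrightarrow> P (green_class D M)"
    and z: "P \<zero>\<^bsub>green_ring D\<^esub>"
    and d: "\<And>X Y. X \<in> carrier (green_ring D) \<Longrightarrow> Y \<in> carrier (green_ring D) \<Longrightarrow> P X \<Longrightarrow> P Y \<Longrightarrow> P (X \<ominus>\<^bsub>green_ring D\<^esub> Y)"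
  shows "P X"
proof -
  obtain x where x: "x \<in> carrier FG" "X = kcls x" by (rule green_carrier_cases[OF X])
  have "Poly_Mapping.keys x \<subseteq> iso_classes D" using x by (simp add: free_green_sel(1))
  then have "P (kcls x)"
  proof (rule free_Abelian_group_induct)
    show "P (kcls 0)" using z K.hom_zero by (simp add: free_green_sel(4))
    show "P (kcls (x - y))" if "Poly_Mapping.keys x \<subseteq> iso_classes D" "Poly_Mapping.keys y \<subseteq> iso_classes D"
      "P (kcls x)" "P (kcls y)" for x y
      using that d[of "kcls x" "kcls y"] by (simp add: kcls_diff free_green_sel(1))
    show "P (kcls (frag_of a))" if "a \<in> iso_classes D" for a
      using c[OF repr_hmodule[OF that]] by (simp add: green_class_kcls cls_repr[OF that])
  qed
  then show ?thesis using x by simp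
qed

definition hd :: "('g, 'k) hmod set \<Rightarrow> ('g, 'k) hmod set \<Rightarrow> int" where
  "hd c d = hom_dim D (repr c) (dual_module D (repr d))"

lemma hd_cls:
  assumes M: "hmodule D M" and N: "hmodule D N"
  shows "hd (cls M) (cls N) = hom_dim D M (dual_module D N)"
  unfolding hd_def using repr_iso_class[OF M] repr_iso_class[OF N] M N
  by (intro hom_dim_iso[OF D] dual_hmodule[OF D] dual_iso[OF D] rep_iso_sym[OF repr_iso_class(2)]) auto

lemma hd_sym: "c \<in> iso_classes D \<Longrightarrow> d \<in> iso_classes D \<Longrightarrow> hd c d = hd d c"
  unfolding hd_def by (intro hom_dim_dual_sym[OF D] repr_hmodule)

definition bform :: "(('g, 'k) hmod set \<Rightarrow>\<^sub>0 int) \<Rightarrow> (('g, 'k) hmod set \<Rightarrow>\<^sub>0 int) \<Rightarrow> int" where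
  "bform x y = zext (\<lambda>c. zext (hd c) y) x"

lemma bform_sym:
  assumes "x \<in> carrier FG" "y \<in> carrier FG" shows "bform x y = bform y x"
  unfolding bform_def using assms
  by (subst zext_swap, intro zext_cong[of _ "iso_classes D"] hd_sym) (simp_all add: free_green_sel(1))

text \<open>Additivity of Hom in its first argument makes the form vanish on the generating
  relations.\<close>

lemma bform_rel:
  assumes x: "x \<in> green_rel D" and y: "y \<in> carrier FG"
  shows "bform x y = 0"
  using x unfolding bform_def
proof (induction x rule: green_rel_induct)
  case (rel M N)
  have "hd (cls (sum_module M N)) d = hd (cls M) d + hd (cls N) d" if d: "d \<in> iso_classes D" for d
    using hom_dim_sum[OF D rel dual_hmodule[OF D repr_hmodule[OF d]]] hd_cls[OF sum_hmodule[OF D rel] repr_hmodule[OF d]]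
      hd_cls[OF rel(1) repr_hmodule[OF d]] hd_cls[OF rel(2) repr_hmodule[OF d]] by (simp add: cls_repr[OF d])
  then have "zext (hd (cls (sum_module M N))) y = zext (\<lambda>d. hd (cls M) d + hd (cls N) d) y"
    using y by (intro zext_cong[of _ "iso_classes D"]) (simp_all add: free_green_sel(1))
  then show ?case by (simp add: zext_diff zext_add zext_fun_add)
qed (simp_all add: zext_add zext_minus)

lemma bform_add: "bform (x + x') y = bform x y + bform x' y" "bform x (y + y') = bform x y + bform x y'"
  by (simp_all add: bform_def zext_add zext_fun_add)

lemma green_form_kcls:
  assumes x: "x \<in> carrier FG" and y: "y \<in> carrier FG"
  shows "green_form D (kcls x) (kcls y) = bform x y"
proof -
  have e: "(\<Sum>c\<in>Poly_Mapping.keys x. \<Sum>d\<in>Poly_Mapping.keys y. Poly_Mapping.lookup x c * Poly_Mapping.lookup y d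
        * hom_dim D (repr c) (dual_module D (repr d))) = bform x y" for x y
    by (simp add: bform_def zext_def hd_def sum_distrib_left mult.assoc)
  have inv: "bform x' y' = bform x y" if x': "x' \<in> kcls x" and y': "y' \<in> kcls y" for x' y'
  proof -
    obtain i where i: "i \<in> green_rel D" "x' = i + x" using x' unfolding kcls_mem by (rule bexE)
    obtain j where j: "j \<in> green_rel D" "y' = j + y" using y' unfolding kcls_mem by (rule bexE)
    note ij = i j
    have "bform x' y' = bform i y' + bform x j + bform x y" by (simp add: ij bform_add)
    moreover have "bform i y' = 0"
      using ij y I.add.m_closed[OF green_rel_carrier[OF ij(3)] y] by (intro bform_rel) (simp_all add: free_green_sel(5))
    \<comment> \<open>For the second argument, vanishing on relations is transferred from the first
      one by symmetry.\<close>
    moreover have "bform x j = 0"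
      using bform_sym[OF x green_rel_carrier[OF ij(3)]] bform_rel[OF ij(3) x] by simp
    ultimately show ?thesis by simp
  qed
  show ?thesis
    unfolding green_form_def e
  proof (rule the_equality)
    show "\<forall>x'\<in>kcls x. \<forall>y'\<in>kcls y. bform x' y' = bform x y" using inv by simp
    fix z assume "\<forall>x'\<in>kcls x. \<forall>y'\<in>kcls y. bform x' y' = z"
    from bspec[OF bspec[OF this I.a_rcos_self[OF x]] I.a_rcos_self[OF y]] show "z = bform x y" by (rule sym)
  qed
qed

lemma green_form_class: "hmodule D M \<Longrightarrow> hmodule D N \<Longrightarrow> green_form D (green_class D M) (green_class D N) = hom_dim D M (dual_module D N)"
  by (simp add: green_class_kcls green_form_kcls frag_of_carrier bform_def hd_cls)

lemma green_form_sym: "X \<in> carrier (green_ring D) \<Longrightarrow> Y \<in> carrier (green_ring D) \<Longrightarrow> green_form D X Y = green_form D Y X"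
  by (elim green_carrier_cases) (simp add: green_form_kcls bform_sym)

lemma green_form_add:
  assumes "X \<in> carrier (green_ring D)" "X' \<in> carrier (green_ring D)" "Y \<in> carrier (green_ring D)"
  shows "green_form D (X \<oplus>\<^bsub>green_ring D\<^esub> X') Y = green_form D X Y + green_form D X' Y"
proof -
  obtain x x' y where x: "x \<in> carrier FG" "X = kcls x" "x' \<in> carrier FG" "X' = kcls x'" "y \<in> carrier FG" "Y = kcls y"
    using assms by (elim green_carrier_cases)
  have "X \<oplus>\<^bsub>green_ring D\<^esub> X' = kcls (x + x')" using x K.hom_add[of x x'] by (simp add: free_green_sel(5))
  moreover have "x + x' \<in> carrier FG" using x I.add.m_closed[of x x'] by (simp add: free_green_sel(5))
  ultimately show ?thesis using x by (simp add: green_form_kcls bform_add)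
qed

lemma zext_card_rel: "x \<in> green_rel D \<Longrightarrow> zext (\<lambda>c. int (card (idx (repr c)))) x = 0"
proof (induction x rule: green_rel_induct)
  case (rel M N)
  have c': "card (idx (repr (cls L))) = card (idx L)" if "hmodule D L" for L :: "('g, 'k) hmod"
    using rep_iso_card[OF _ _ repr_iso_class(2)[OF that]] repr_iso_class(1)[OF that] that by (simp add: hmodule_finite[OF D])
  have "card (idx (repr (cls (sum_module M N)))) = card (idx (sum_module M N))"
    using rep_iso_card[OF _ _ repr_iso_class(2)[OF sum_hmodule[OF D rel]]] repr_iso_class(1)[OF sum_hmodule[OF D rel]]
      sum_hmodule[OF D rel] hmodule_finite[OF D] by metis
  then show ?case
    using rel hmodule_finite[OF D rel(1)] hmodule_finite[OF D rel(2)] by (simp add: zext_diff zext_add c' card_Plus)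
qed (simp_all add: zext_add zext_minus)

lemma green_dim_kcls:
  assumes x: "x \<in> carrier FG"
  shows "green_dim D (kcls x) = zext (\<lambda>c. int (card (idx (repr c)))) x"
proof -
  let ?f = "zext (\<lambda>c. int (card (idx (repr c))))"
  have inv: "?f x' = ?f x" if x': "x' \<in> kcls x" for x'
  proof -
    obtain i where "i \<in> green_rel D" "x' = i + x" using x' unfolding kcls_mem by (rule bexE)
    then show ?thesis by (simp add: zext_add zext_card_rel)
  qed
  show ?thesis
    unfolding green_dim_def zext_def[symmetric]
  proof (rule the_equality)
    show "\<forall>x'\<in>kcls x. ?f x' = ?f x" using inv by simp
    fix z assume "\<forall>x'\<in>kcls x. ?f x' = z"
    from bspec[OF this I.a_rcos_self[OF x]] show "z = ?f x" by (rule sym)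
  qed
qed

lemma green_dim_class:
  assumes M: "hmodule D M"
  shows "green_dim D (green_class D M) = int (card (idx M))"
  using rep_iso_card[OF _ _ repr_iso_class(2)[OF M]] repr_iso_class(1)[OF M] M
  by (simp add: green_class_kcls green_dim_kcls frag_of_carrier hmodule_finite[OF D])

lemma green_dim_add:
  assumes "X \<in> carrier (green_ring D)" "X' \<in> carrier (green_ring D)"
  shows "green_dim D (X \<oplus>\<^bsub>green_ring D\<^esub> X') = green_dim D X + green_dim D X'"
proof -
  obtain x x' where x: "x \<in> carrier FG" "X = kcls x" "x' \<in> carrier FG" "X' = kcls x'"
    using assms by (elim green_carrier_cases)
  have "X \<oplus>\<^bsub>green_ring D\<^esub> X' = kcls (x + x')" using x K.hom_add[of x x'] by (simp add: free_green_sel(5))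
  moreover have "x + x' \<in> carrier FG" using x I.add.m_closed[of x x'] by (simp add: free_green_sel(5))
  ultimately show ?thesis using x by (simp add: green_dim_kcls zext_add)
qed

definition dfrag :: "(('g, 'k) hmod set \<Rightarrow>\<^sub>0 int) \<Rightarrow> (('g, 'k) hmod set \<Rightarrow>\<^sub>0 int)" where
  "dfrag = frag_extend (\<lambda>c. frag_of (cls (dual_module D (repr c))))"

lemma dual_cls: "hmodule D M \<Longrightarrow> cls (dual_module D (repr (cls M))) = cls (dual_module D M)"
  using repr_iso_class[of M]
  by (intro iso_class_eqI dual_hmodule[OF D] dual_iso[OF D] rep_iso_sym[OF repr_iso_class(2)]) auto

lemma dfrag_closed: "x \<in> carrier FG \<Longrightarrow> dfrag x \<in> carrier FG"
  unfolding free_green_sel(1) dfrag_def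
  by (rule keys_frag_extend_subset) (auto intro: iso_class_in dual_hmodule[OF D] repr_hmodule)

text \<open>The dual of a direct sum is literally the sum of the duals, so duality maps generating
  relations to generating relations.\<close>

lemma dfrag_rel: "x \<in> green_rel D \<Longrightarrow> dfrag x \<in> green_rel D"
proof (induction x rule: green_rel_induct)
  case (rel M N)
  show ?case
    using green_rel_sum[OF dual_hmodule[OF D rel(1)] dual_hmodule[OF D rel(2)]] rel
    by (simp add: dfrag_def frag_extend_diff frag_extend_add dual_cls sum_hmodule[OF D] dual_sum_module)
qed (auto simp: dfrag_def frag_extend_add frag_extend_minus green_rel_zero green_rel_add green_rel_minus)

lemma green_dual_kcls:
  assumes x: "x \<in> carrier FG"
  shows "green_dual D (kcls x) = kcls (dfrag x)"
proof -
  have inv: "kcls (dfrag x') = kcls (dfrag x)" if x': "x' \<in> kcls x" for x'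
  proof -
    obtain i where i: "i \<in> green_rel D" "x' = i + x" using x' unfolding kcls_mem by (rule bexE)
    then have "dfrag x' = dfrag i + dfrag x" by (simp add: dfrag_def frag_extend_add)
    then have "dfrag x' \<in> kcls (dfrag x)" using dfrag_rel[OF i(1)] unfolding kcls_mem by (rule bexI)
    then show ?thesis by (rule I.a_repr_independence'[OF _ dfrag_closed[OF x], symmetric])
  qed
  show ?thesis unfolding green_dual_def dfrag_def[symmetric] by (rule UN_constant_eq[OF I.a_rcos_self[OF x]]) (use inv in blast)
qed

lemma green_dual_closed: "X \<in> carrier (green_ring D) \<Longrightarrow> green_dual D X \<in> carrier (green_ring D)"
  by (elim green_carrier_cases) (simp add: green_dual_kcls dfrag_closed)

lemma green_dual_class: "hmodule D M \<Longrightarrow> green_dual D (green_class D M) = green_class D (dual_module D M)"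
  using frag_of_carrier[of M] by (simp add: green_class_kcls green_dual_kcls dfrag_def dual_cls)

lemma green_dual_add:
  assumes "X \<in> carrier (green_ring D)" "X' \<in> carrier (green_ring D)"
  shows "green_dual D (X \<oplus>\<^bsub>green_ring D\<^esub> X') = green_dual D X \<oplus>\<^bsub>green_ring D\<^esub> green_dual D X'"
proof -
  obtain x x' where x: "x \<in> carrier FG" "X = kcls x" "x' \<in> carrier FG" "X' = kcls x'"
    using assms by (elim green_carrier_cases)
  have "X \<oplus>\<^bsub>green_ring D\<^esub> X' = kcls (x + x')" using x K.hom_add[of x x'] by (simp add: free_green_sel(5))
  moreover have "x + x' \<in> carrier FG" using x I.add.m_closed[of x x'] by (simp add: free_green_sel(5))
  moreover have "kcls (dfrag x + dfrag x') = kcls (dfrag x) \<oplus>\<^bsub>green_ring D\<^esub> kcls (dfrag x')"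
    using dfrag_closed[OF x(1)] dfrag_closed[OF x(3)] K.hom_add[of "dfrag x" "dfrag x'"] by (simp add: free_green_sel(5))
  ultimately show ?thesis using x by (simp add: green_dual_kcls) (simp add: dfrag_def frag_extend_add)
qed

end

section \<open>Dual bases and the Casimir element\<close>

lemma hom_finprod:
  assumes G: "comm_group G" and H: "comm_group H" and h: "h \<in> hom G H" and f: "f \<in> S \<rightarrow> carrier G"
  shows "h (finprod G f S) = finprod H (\<lambda>s. h (f s)) S"
proof -
  interpret G: comm_group G by (rule G)
  interpret H: comm_group H by (rule H)
  show ?thesis
    using f
  proof (induction S rule: infinite_finite_induct)
    case (insert s S)
    have "h (f s \<otimes>\<^bsub>G\<^esub> finprod G f S) = h (f s) \<otimes>\<^bsub>H\<^esub> h (finprod G f S)"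
      using insert.prems by (intro hom_mult[OF h] G.finprod_closed) auto
    moreover have "h (f s) \<in> carrier H" "(\<lambda>s. h (f s)) \<in> S \<rightarrow> carrier H"
      using insert.prems by (auto intro!: hom_in_carrier[OF h])
    ultimately show ?case using insert by simp
  qed (use hom_one[OF h G.is_group H.is_group] in simp_all)
qed

lemma (in comm_group) finprod_swap:
  assumes f: "\<And>s t. s \<in> S \<Longrightarrow> t \<in> T \<Longrightarrow> f s t \<in> carrier G"
  shows "(\<Otimes>s\<in>S. \<Otimes>t\<in>T. f s t) = (\<Otimes>t\<in>T. \<Otimes>s\<in>S. f s t)"
  using f
proof (induction S rule: infinite_finite_induct)
  case (insert s S)
  have 1: "(\<lambda>s. \<Otimes>t\<in>T. f s t) \<in> S \<rightarrow> carrier G" "(\<Otimes>t\<in>T. f s t) \<in> carrier G"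
    "f s \<in> T \<rightarrow> carrier G" "(\<lambda>t. \<Otimes>s\<in>S. f s t) \<in> T \<rightarrow> carrier G"
    using insert.prems by (auto intro!: finprod_closed)
  have "(\<Otimes>t\<in>T. \<Otimes>s\<in>insert s S. f s t) = (\<Otimes>t\<in>T. f s t \<otimes> (\<Otimes>s\<in>S. f s t))"
    using insert by (intro finprod_cong' refl finprod_insert) (auto intro!: finprod_closed)
  then show ?case using 1 insert by simp
qed simp_all

locale symmetric_form = ring R for R (structure) +
  fixes \<beta> :: "'a \<Rightarrow> 'a \<Rightarrow> int"
  assumes form_add: "x \<in> carrier R \<Longrightarrow> y \<in> carrier R \<Longrightarrow> z \<in> carrier R \<Longrightarrow> \<beta> (x \<oplus> y) z = \<beta> x z + \<beta> y z"
    and form_sym: "x \<in> carrier R \<Longrightarrow> y \<in> carrier R \<Longrightarrow> \<beta> x y = \<beta> y x"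
begin

lemma form_hom: "z \<in> carrier R \<Longrightarrow> (\<lambda>x. \<beta> x z) \<in> hom (add_monoid R) integer_group"
  by (simp add: hom_def form_add)

lemma form_zero: "z \<in> carrier R \<Longrightarrow> \<beta> \<zero> z = 0"
  using form_add[of \<zero> \<zero> z] by simp

lemma form_int:
  assumes "x \<in> carrier R" "z \<in> carrier R"
  shows "\<beta> ([(k::int)] \<cdot> x) z = k * \<beta> x z"
  using hom_int_pow[OF form_hom[OF assms(2)], of x k] assms
  by (simp add: add_pow_def a_group)

lemma form_minus:
  assumes "x \<in> carrier R" "y \<in> carrier R" "z \<in> carrier R"
  shows "\<beta> (x \<ominus> y) z = \<beta> x z - \<beta> y z"
  using form_add[of "x \<ominus> y" y z] assms by (simp add: a_minus_def a_assoc l_neg)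

lemma form_finsum:
  assumes f: "f \<in> S \<rightarrow> carrier R" and z: "z \<in> carrier R"
  shows "\<beta> (\<Oplus>s\<in>S. f s) z = (\<Sum>s\<in>S. \<beta> (f s) z)"
  using f
proof (induction S rule: infinite_finite_induct)
  case (insert s S)
  then show ?case using z by (simp add: form_add finsum_closed Pi_def)
qed (use z in \<open>simp_all add: form_zero\<close>)

lemma form_combination:
  assumes "b \<in> S \<rightarrow> carrier R" "z \<in> carrier R"
  shows "\<beta> (\<Oplus>s\<in>S. [(f s :: int)] \<cdot> b s) z = (\<Sum>s\<in>S. f s * \<beta> (b s) z)"
  using assms by (subst form_finsum) (auto intro!: sum.cong form_int)

lemma form_coeff:
  assumes S: "finite S" and b: "b \<in> S \<rightarrow> carrier R" and c: "c \<in> S \<rightarrow> carrier R"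
    and bc: "\<And>s t. s \<in> S \<Longrightarrow> t \<in> S \<Longrightarrow> \<beta> (b s) (c t) = (if s = t then 1 else 0)" and t: "t \<in> S"
  shows "\<beta> (\<Oplus>s\<in>S. [(f s :: int)] \<cdot> b s) (c t) = f t"
proof -
  have "\<beta> (\<Oplus>s\<in>S. [(f s :: int)] \<cdot> b s) (c t) = (\<Sum>s\<in>S. f s * \<beta> (b s) (c t))"
    using b c t by (intro form_combination) auto
  also have "\<dots> = (\<Sum>s\<in>S. if s = t then f t else 0)"
    using bc t by (intro sum.cong) auto
  finally show ?thesis using S t by simp
qed

text \<open>The coefficient of z at b_s is (z, c_s). Expanding c_s in the spanning family b and
  using symmetry turns it into a combination of the numbers (b_t, z), all of which are 0.\<close>

lemma nondegenerate:
  assumes S: "finite S" and b: "b \<in> S \<rightarrow> carrier R" and c: "c \<in> S \<rightarrow> carrier R"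
    and bc: "\<And>s t. s \<in> S \<Longrightarrow> t \<in> S \<Longrightarrow> \<beta> (b s) (c t) = (if s = t then 1 else 0)"
    and span: "\<And>x. x \<in> carrier R \<Longrightarrow> \<exists>f :: 's \<Rightarrow> int. x = (\<Oplus>s\<in>S. [f s] \<cdot> b s)"
    and z: "z \<in> carrier R" "\<And>s. s \<in> S \<Longrightarrow> \<beta> (b s) z = 0"
  shows "z = \<zero>"
proof -
  obtain f :: "'s \<Rightarrow> int" where f: "z = (\<Oplus>s\<in>S. [f s] \<cdot> b s)" using span[OF z(1)] by blast
  have "f s = 0" if s: "s \<in> S" for s
  proof -
    have cs: "c s \<in> carrier R" using c s by auto
    obtain g :: "'s \<Rightarrow> int" where g: "c s = (\<Oplus>t\<in>S. [g t] \<cdot> b t)" using span[OF cs] by blast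
    have "f s = \<beta> z (c s)" using form_coeff[OF S b c bc s] f by simp
    also have "\<dots> = \<beta> (c s) z" by (rule form_sym[OF z(1) cs])
    also have "\<dots> = (\<Sum>t\<in>S. g t * \<beta> (b t) z)" unfolding g by (rule form_combination[OF b z(1)])
    finally show ?thesis using z(2) by simp
  qed
  then show ?thesis
    unfolding f by (intro add.finprod_one_eqI) (use b in \<open>auto simp: add_pow_def\<close>)
qed

text \<open>Pairing with c_t recovers the coefficient at b_t, which gives independence of b. For c,
  the difference of x and the sum of (x, b_s) c_s is orthogonal to all b_s, hence 0, and pairing
  with b_t gives independence.\<close>

lemma dual_pairI:
  assumes S: "finite S" and b: "b \<in> S \<rightarrow> carrier R" and c: "c \<in> S \<rightarrow> carrier R"
    and bc: "\<And>s t. s \<in> S \<Longrightarrow> t \<in> S \<Longrightarrow> \<beta> (b s) (c t) = (if s = t then 1 else 0)"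
    and span: "\<And>x. x \<in> carrier R \<Longrightarrow> \<exists>f :: 's \<Rightarrow> int. x = (\<Oplus>s\<in>S. [f s] \<cdot> b s)"
  shows "dual_pair R \<beta> S b c"
proof -
  have cb: "\<beta> (c s) (b t) = (if s = t then 1 else 0)" if "s \<in> S" "t \<in> S" for s t
    using bc[OF that(2,1)] form_sym[OF Pi_mem[OF c that(1)] Pi_mem[OF b that(2)]] by auto
  have r: "(\<Oplus>s\<in>S. [(restrict f S s)] \<cdot> e s) = (\<Oplus>s\<in>S. [(f s)] \<cdot> e s)" if "e \<in> S \<rightarrow> carrier R" for f :: "'s \<Rightarrow> int" and e
    using that by (intro add.finprod_cong') auto
  have Zb: "Z_basis R S b"
    unfolding Z_basis_def
  proof (intro conjI ballI S b)
    fix x assume "x \<in> carrier R"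
    then obtain f :: "'s \<Rightarrow> int" where f: "x = (\<Oplus>s\<in>S. [f s] \<cdot> b s)" using span by blast
    show "\<exists>!f :: 's \<Rightarrow> int. f \<in> extensional S \<and> x = (\<Oplus>s\<in>S. [f s] \<cdot> b s)"
    proof (rule ex1I)
      show "restrict f S \<in> extensional S \<and> x = (\<Oplus>s\<in>S. [restrict f S s] \<cdot> b s)" using r[OF b] f by simp
      fix g :: "'s \<Rightarrow> int" assume g: "g \<in> extensional S \<and> x = (\<Oplus>s\<in>S. [g s] \<cdot> b s)"
      have "g s = f s" if "s \<in> S" for s
        using form_coeff[OF S b c bc that, of f] form_coeff[OF S b c bc that, of g] f g by simp
      then show "g = restrict f S" using g by (intro extensionalityI[of g S]) auto
    qed
  qed
  have Zc: "Z_basis R S c"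
    unfolding Z_basis_def
  proof (intro conjI ballI S c)
    fix x assume x: "x \<in> carrier R"
    define f where "f = (\<lambda>s. \<beta> x (b s))"
    let ?y = "\<Oplus>s\<in>S. [(f s)] \<cdot> c s"
    have y: "?y \<in> carrier R" using c by (intro finsum_closed) auto
    have "x \<ominus> ?y = \<zero>"
    proof (rule nondegenerate[OF S b c bc span])
      show "x \<ominus> ?y \<in> carrier R" using x y by simp
      fix s assume s: "s \<in> S"
      have "b s \<in> carrier R" using b s by auto
      then show "\<beta> (b s) (x \<ominus> ?y) = 0"
        using form_coeff[OF S c b cb s, of f] x y form_sym[of "b s" "x \<ominus> ?y"] form_minus[of x ?y "b s"]
        by (simp add: f_def)
    qed
    then have xy: "x = ?y" using x y by simp
    show "\<exists>!f :: 's \<Rightarrow> int. f \<in> extensional S \<and> x = (\<Oplus>s\<in>S. [f s] \<cdot> c s)"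
    proof (rule ex1I)
      show "restrict f S \<in> extensional S \<and> x = (\<Oplus>s\<in>S. [restrict f S s] \<cdot> c s)" using r[OF c, of f] xy by simp
      fix g :: "'s \<Rightarrow> int" assume g: "g \<in> extensional S \<and> x = (\<Oplus>s\<in>S. [g s] \<cdot> c s)"
      have "g s = f s" if "s \<in> S" for s
        using form_coeff[OF S c b cb that, of g] g by (simp add: f_def)
      then show "g = restrict f S" using g by (intro extensionalityI[of g S]) auto
    qed
  qed
  show ?thesis unfolding dual_pair_def using Zb Zc bc by blast
qed

lemma dual_pair_sym: "dual_pair R \<beta> S b c \<Longrightarrow> dual_pair R \<beta> S c b"
  unfolding dual_pair_def Z_basis_def using form_sym by (auto simp: Pi_iff)

lemma dual_pair_expand:
  assumes bc: "dual_pair R \<beta> S b c" and x: "x \<in> carrier R"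
  shows "x = (\<Oplus>s\<in>S. [\<beta> x (c s)] \<cdot> b s)"
proof -
  have S: "finite S" "b \<in> S \<rightarrow> carrier R" "c \<in> S \<rightarrow> carrier R"
    "\<And>s t. s \<in> S \<Longrightarrow> t \<in> S \<Longrightarrow> \<beta> (b s) (c t) = (if s = t then 1 else 0)"
    using bc by (auto simp: dual_pair_def Z_basis_def)
  have "Z_basis R S b" using bc by (simp add: dual_pair_def)
  then have "\<exists>!f. f \<in> extensional S \<and> x = (\<Oplus>s\<in>S. [(f s::int)] \<cdot> b s)"
    using x by (simp only: Z_basis_def)
  then obtain f where f: "x = (\<Oplus>s\<in>S. [(f s::int)] \<cdot> b s)" by auto
  have "f s = \<beta> x (c s)" if "s \<in> S" for s
    unfolding f by (rule form_coeff[OF S that, symmetric])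
  then show ?thesis using f S by (subst f, intro add.finprod_cong') auto
qed

end

section \<open>The tensor square of a ring over the integers\<close>

context ring
begin

lemma tensor_rel_subgroup: "subgroup (tensor_rel R) (free_Abelian_group (carrier R \<times> carrier R))"
  unfolding tensor_rel_def
proof (rule group.generate_is_subgroup[OF group_free_Abelian_group])
  have k: "frag_of p - (frag_of q + frag_of r) \<in> carrier (free_Abelian_group A)"
    if "p \<in> A" "q \<in> A" "r \<in> A" for p q r and A :: "('a \<times> 'a) set"
    using that by (auto dest!: subsetD[OF keys_diff] subsetD[OF keys_add])
  show "{frag_of (x \<oplus> y, z) - (frag_of (x, z) + frag_of (y, z)) |x y z. x \<in> carrier R \<and> y \<in> carrier R \<and> z \<in> carrier R} \<union>
      {frag_of (z, x \<oplus> y) - (frag_of (z, x) + frag_of (z, y)) |x y z. x \<in> carrier R \<and> y \<in> carrier R \<and> z \<in> carrier R}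
      \<subseteq> carrier (free_Abelian_group (carrier R \<times> carrier R))"
    by (intro Un_least; clarify; intro k) auto
qed

lemma tensor_square_comm_group: "comm_group (tensor_square R)"
  unfolding tensor_square_def
  by (rule comm_group.abelian_FactGroup[OF abelian_free_Abelian_group tensor_rel_subgroup])

lemma tensor_closed: "x \<in> carrier R \<Longrightarrow> y \<in> carrier R \<Longrightarrow> tensor R x y \<in> carrier (tensor_square R)"
  unfolding tensor_def tensor_square_def carrier_FactGroup by (rule imageI) simp

text \<open>Both generating relations of the tensor square have this shape, so additivity on the
  left and on the right follow from one computation with cosets.\<close>

lemma tensor_relI:
  assumes xyz: "frag_of p - (frag_of q + frag_of r) \<in> tensor_rel R"
    and c: "q \<in> carrier R \<times> carrier R" "r \<in> carrier R \<times> carrier R"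
  shows "tensor_rel R #>\<^bsub>free_Abelian_group (carrier R \<times> carrier R)\<^esub> frag_of p =
    (tensor_rel R #>\<^bsub>free_Abelian_group (carrier R \<times> carrier R)\<^esub> frag_of q) \<otimes>\<^bsub>tensor_square R\<^esub>
    (tensor_rel R #>\<^bsub>free_Abelian_group (carrier R \<times> carrier R)\<^esub> frag_of r)"
proof -
  let ?F = "free_Abelian_group (carrier R \<times> carrier R)"
  interpret F: comm_group ?F by (rule abelian_free_Abelian_group)
  have N: "tensor_rel R \<lhd> ?F" using tensor_rel_subgroup by (simp add: F.normal_iff_subgroup)
  have q: "frag_of q \<in> carrier ?F" "frag_of r \<in> carrier ?F" using c by simp_all
  have "frag_of p \<in> tensor_rel R #>\<^bsub>?F\<^esub> (frag_of q \<otimes>\<^bsub>?F\<^esub> frag_of r)"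
    unfolding r_coset_def by (rule UN_I[OF xyz]) simp
  from F.repr_independence[OF this F.m_closed[OF q] tensor_rel_subgroup] show ?thesis
    using normal.rcos_sum[OF N q] unfolding tensor_square_def by simp
qed

lemma tensor_add_left:
  assumes "x \<in> carrier R" "y \<in> carrier R" "z \<in> carrier R"
  shows "tensor R (x \<oplus> y) z = tensor R x z \<otimes>\<^bsub>tensor_square R\<^esub> tensor R y z"
  unfolding tensor_def
proof (rule tensor_relI)
  show "frag_of (x \<oplus> y, z) - (frag_of (x, z) + frag_of (y, z)) \<in> tensor_rel R"
    unfolding tensor_rel_def by (rule generate.incl, rule UnI1) (use assms in blast)
qed (use assms in auto)

lemma tensor_add_right:
  assumes "x \<in> carrier R" "y \<in> carrier R" "z \<in> carrier R"
  shows "tensor R z (x \<oplus> y) = tensor R z x \<otimes>\<^bsub>tensor_square R\<^esub> tensor R z y"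
  unfolding tensor_def
proof (rule tensor_relI)
  show "frag_of (z, x \<oplus> y) - (frag_of (z, x) + frag_of (z, y)) \<in> tensor_rel R"
    unfolding tensor_rel_def by (rule generate.incl, rule UnI2) (use assms in blast)
qed (use assms in auto)

lemma hom_combination:
  assumes H: "comm_group H" and h: "h \<in> hom (add_monoid R) H" and b: "b \<in> S \<rightarrow> carrier R"
  shows "h (\<Oplus>s\<in>S. [(f s :: int)] \<cdot> b s) = (\<Otimes>\<^bsub>H\<^esub>s\<in>S. h (b s) [^]\<^bsub>H\<^esub> f s)"
proof -
  interpret H: comm_group H by (rule H)
  have "h (\<Oplus>s\<in>S. [(f s :: int)] \<cdot> b s) = (\<Otimes>\<^bsub>H\<^esub>s\<in>S. h ([(f s :: int)] \<cdot> b s))"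
    unfolding finsum_def using b by (intro hom_finprod[OF a_comm_group H h]) auto
  also have "\<dots> = (\<Otimes>\<^bsub>H\<^esub>s\<in>S. h (b s) [^]\<^bsub>H\<^esub> f s)"
    using b hom_int_pow[OF h _ a_group H.is_group] hom_in_carrier[OF h]
    by (intro H.finprod_cong') (auto simp: add_pow_def intro!: H.int_pow_closed)
  finally show ?thesis .
qed

lemma tensor_combination_left:
  assumes "b \<in> S \<rightarrow> carrier R" "z \<in> carrier R"
  shows "tensor R (\<Oplus>s\<in>S. [(f s :: int)] \<cdot> b s) z
    = (\<Otimes>\<^bsub>tensor_square R\<^esub>s\<in>S. tensor R (b s) z [^]\<^bsub>tensor_square R\<^esub> f s)"
  using assms by (intro hom_combination[OF tensor_square_comm_group, of "\<lambda>x. tensor R x z"])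
    (auto simp: hom_def tensor_closed tensor_add_left)

lemma tensor_combination_right:
  assumes "b \<in> S \<rightarrow> carrier R" "z \<in> carrier R"
  shows "tensor R z (\<Oplus>s\<in>S. [(f s :: int)] \<cdot> b s)
    = (\<Otimes>\<^bsub>tensor_square R\<^esub>s\<in>S. tensor R z (b s) [^]\<^bsub>tensor_square R\<^esub> f s)"
  using assms by (intro hom_combination[OF tensor_square_comm_group, of "\<lambda>x. tensor R z x"])
    (auto simp: hom_def tensor_closed tensor_add_right)

end

context symmetric_form
begin

text \<open>Expanding b_s in the basis b' uses the coefficients (b_s, c'_t), and expanding c'_t in
  the basis c uses (c'_t, b_s). By symmetry both tensors unfold to the same double sum over c_s
  \<otimes> b'_t.\<close>

lemma casimir_independent:
  assumes bc: "dual_pair R \<beta> S b c" and bc': "dual_pair R \<beta> S' b' c'"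
  shows "(\<Otimes>\<^bsub>tensor_square R\<^esub>s\<in>S. tensor R (c s) (b s)) = (\<Otimes>\<^bsub>tensor_square R\<^esub>t\<in>S'. tensor R (c' t) (b' t))"
proof -
  interpret T: comm_group "tensor_square R" by (rule tensor_square_comm_group)
  let ?k = "\<lambda>s t. tensor R (c s) (b' t) [^]\<^bsub>tensor_square R\<^esub> \<beta> (b s) (c' t)"
  have S: "b \<in> S \<rightarrow> carrier R" "c \<in> S \<rightarrow> carrier R" "b' \<in> S' \<rightarrow> carrier R" "c' \<in> S' \<rightarrow> carrier R"
    using bc bc' by (auto simp: dual_pair_def Z_basis_def)
  have k: "?k s t \<in> carrier (tensor_square R)" if "s \<in> S" "t \<in> S'" for s t
    using S that by (auto intro!: T.int_pow_closed tensor_closed)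
  have 1: "tensor R (c s) (b s) = (\<Otimes>\<^bsub>tensor_square R\<^esub>t\<in>S'. ?k s t)" if s: "s \<in> S" for s
  proof -
    have m: "b s \<in> carrier R" "c s \<in> carrier R" using S s by auto
    have "b s = (\<Oplus>t\<in>S'. [\<beta> (b s) (c' t)] \<cdot> b' t)" by (rule dual_pair_expand[OF bc' m(1)])
    then have "tensor R (c s) (b s) = tensor R (c s) (\<Oplus>t\<in>S'. [\<beta> (b s) (c' t)] \<cdot> b' t)" by simp
    also have "\<dots> = (\<Otimes>\<^bsub>tensor_square R\<^esub>t\<in>S'. ?k s t)" by (rule tensor_combination_right[OF S(3) m(2)])
    finally show ?thesis .
  qed
  have 2: "tensor R (c' t) (b' t) = (\<Otimes>\<^bsub>tensor_square R\<^esub>s\<in>S. ?k s t)" if t: "t \<in> S'" for t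
  proof -
    have m: "b' t \<in> carrier R" "c' t \<in> carrier R" using S t by auto
    have "c' t = (\<Oplus>s\<in>S. [\<beta> (c' t) (b s)] \<cdot> c s)" by (rule dual_pair_expand[OF dual_pair_sym[OF bc] m(2)])
    then have "tensor R (c' t) (b' t) = tensor R (\<Oplus>s\<in>S. [\<beta> (c' t) (b s)] \<cdot> c s) (b' t)" by simp
    also have "\<dots> = (\<Otimes>\<^bsub>tensor_square R\<^esub>s\<in>S. tensor R (c s) (b' t) [^]\<^bsub>tensor_square R\<^esub> \<beta> (c' t) (b s))"
      by (rule tensor_combination_left[OF S(2) m(1)])
    also have "\<dots> = (\<Otimes>\<^bsub>tensor_square R\<^esub>s\<in>S. ?k s t)"
    proof (rule T.finprod_cong'[OF refl])
      show "tensor R (c s) (b' t) [^]\<^bsub>tensor_square R\<^esub> \<beta> (c' t) (b s) = ?k s t" if "s \<in> S" for s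
        using form_sym[OF m(2) Pi_mem[OF S(1) that]] by simp
    qed (use k t in auto)
    finally show ?thesis .
  qed
  have "(\<Otimes>\<^bsub>tensor_square R\<^esub>s\<in>S. tensor R (c s) (b s)) = (\<Otimes>\<^bsub>tensor_square R\<^esub>s\<in>S. \<Otimes>\<^bsub>tensor_square R\<^esub>t\<in>S'. ?k s t)"
    using k by (intro T.finprod_cong' refl 1) (auto intro!: T.finprod_closed)
  also have "\<dots> = (\<Otimes>\<^bsub>tensor_square R\<^esub>t\<in>S'. \<Otimes>\<^bsub>tensor_square R\<^esub>s\<in>S. ?k s t)"
    by (rule T.finprod_swap[OF k])
  also have "\<dots> = (\<Otimes>\<^bsub>tensor_square R\<^esub>t\<in>S'. tensor R (c' t) (b' t))"
    using k S by (intro T.finprod_cong' refl 2[symmetric]) (auto intro!: tensor_closed)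
  finally show ?thesis .
qed

lemma casimir_element_eq:
  assumes bc: "dual_pair R \<beta> S b c"
  shows "casimir_element R \<beta> = (\<Otimes>\<^bsub>tensor_square R\<^esub>s\<in>S. tensor R (c s) (b s))"
  unfolding casimir_element_def
proof (rule the_equality)
  have S: "finite S" "b \<in> S \<rightarrow> carrier R" "c \<in> S \<rightarrow> carrier R"
    "\<And>s t. s \<in> S \<Longrightarrow> t \<in> S \<Longrightarrow> \<beta> (b s) (c t) = (if s = t then 1 else 0)"
    using bc by (auto simp: dual_pair_def Z_basis_def)
  obtain h where h: "bij_betw h {..<card S} S" using ex_bij_betw_nat_finite[OF S(1)] by (auto simp: atLeast0LessThan)
  have i: "inj_on h {..<card S}" and im: "h ` {..<card S} = S" using h by (auto simp: bij_betw_def)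
  have hS: "h i \<in> S" if "i < card S" for i using im that by auto
  \<comment> \<open>The definition of the Casimir element quantifies over bases indexed by an
    initial segment of the naturals, so the given dual pair is first numbered.\<close>
  have bc': "dual_pair R \<beta> {..<card S} (\<lambda>i. b (h i)) (\<lambda>i. c (h i))"
  proof (rule dual_pairI)
    show "(\<lambda>i. b (h i)) \<in> {..<card S} \<rightarrow> carrier R" "(\<lambda>i. c (h i)) \<in> {..<card S} \<rightarrow> carrier R"
      using S hS by auto
    show "\<beta> (b (h s)) (c (h t)) = (if s = t then 1 else 0)" if "s \<in> {..<card S}" "t \<in> {..<card S}" for s t
      using S(4)[OF hS hS, of s t] that inj_onD[OF i, of s t] by auto
    fix x assume x: "x \<in> carrier R"
    have "x = (\<Oplus>s\<in>h ` {..<card S}. [\<beta> x (c s)] \<cdot> b s)" unfolding im by (rule dual_pair_expand[OF bc x])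
    also have "\<dots> = (\<Oplus>i\<in>{..<card S}. [\<beta> x (c (h i))] \<cdot> b (h i))"
      using S(2) by (intro finsum_reindex i) (auto simp: im)
    finally show "\<exists>f :: nat \<Rightarrow> int. x = (\<Oplus>i\<in>{..<card S}. [f i] \<cdot> b (h i))" by (rule exI[of _ "\<lambda>i. \<beta> x (c (h i))"])
  qed simp
  then show "\<exists>(N :: nat) b' c'. dual_pair R \<beta> {..<N} b' c' \<and>
      (\<Otimes>\<^bsub>tensor_square R\<^esub>s\<in>S. tensor R (c s) (b s)) = (\<Otimes>\<^bsub>tensor_square R\<^esub>s\<in>{..<N}. tensor R (c' s) (b' s))"
    using casimir_independent[OF bc bc'] by blast
  show "z = (\<Otimes>\<^bsub>tensor_square R\<^esub>s\<in>S. tensor R (c s) (b s))"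
    if "\<exists>(N :: nat) b c. dual_pair R \<beta> {..<N} b c \<and> z = (\<Otimes>\<^bsub>tensor_square R\<^esub>s\<in>{..<N}. tensor R (c s) (b s))" for z
    using that casimir_independent[OF _ bc] by blast
qed

end

text \<open>The situation of the Green ring with \<epsilon> = dim and h = [H]: a nondegenerate
  associative form in which h represents the augmentation.\<close>

locale augmented_form = symmetric_form +
  fixes \<epsilon> :: "'a \<Rightarrow> int" and h
  assumes form_assoc: "x \<in> carrier R \<Longrightarrow> y \<in> carrier R \<Longrightarrow> \<beta> x y = \<beta> (x \<otimes> y) \<one>"
    and form_nondegenerate: "z \<in> carrier R \<Longrightarrow> (\<And>x. x \<in> carrier R \<Longrightarrow> \<beta> z x = 0) \<Longrightarrow> z = \<zero>"
    and h_closed: "h \<in> carrier R" and form_h: "x \<in> carrier R \<Longrightarrow> \<beta> h x = \<epsilon> x"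
    and augmentation_mult: "x \<in> carrier R \<Longrightarrow> y \<in> carrier R \<Longrightarrow> \<epsilon> (x \<otimes> y) = \<epsilon> x * \<epsilon> y"
    and augmentation_one: "\<epsilon> \<one> = 1"
begin

lemma form_eqI:
  assumes "y \<in> carrier R" "z \<in> carrier R" "\<And>x. x \<in> carrier R \<Longrightarrow> \<beta> y x = \<beta> z x"
  shows "y = z"
proof -
  have "y \<ominus> z = \<zero>" using assms by (intro form_nondegenerate) (simp_all add: form_minus)
  then show ?thesis using assms by simp
qed

lemma h_mult: 
  assumes x: "x \<in> carrier R"
  shows "h \<otimes> x = [\<epsilon> x] \<cdot> h"
proof (rule form_eqI)
  fix z assume z: "z \<in> carrier R"
  have "\<beta> (h \<otimes> x) z = \<beta> (h \<otimes> (x \<otimes> z)) \<one>" using form_assoc[of "h \<otimes> x" z] x z h_closed by (simp add: m_assoc)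
  also have "\<dots> = \<epsilon> x * \<epsilon> z" using form_assoc[of h "x \<otimes> z"] x z h_closed by (simp add: form_h augmentation_mult)
  finally show "\<beta> (h \<otimes> x) z = \<beta> ([\<epsilon> x] \<cdot> h) z" using x z h_closed by (simp add: form_int form_h)
qed (use x h_closed in auto)

text \<open>Associativity gives (x h, z) = (x, h z), and symmetry moves x to the right, where
  \<open>h_mult\<close> applies.\<close>

lemma mult_h: 
  assumes x: "x \<in> carrier R"
  shows "x \<otimes> h = [\<epsilon> x] \<cdot> h"
proof (rule form_eqI)
  fix z assume z: "z \<in> carrier R"
  have "\<beta> (x \<otimes> h) z = \<beta> (x \<otimes> (h \<otimes> z)) \<one>" using form_assoc[of "x \<otimes> h" z] x z h_closed by (simp add: m_assoc)
  also have "\<dots> = \<beta> (h \<otimes> z) x" using form_assoc[of x "h \<otimes> z"] form_sym[of x "h \<otimes> z"] x z h_closed by simp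
  also have "\<dots> = \<epsilon> z * \<epsilon> x" using x z h_closed by (simp add: h_mult form_int form_h)
  finally show "\<beta> (x \<otimes> h) z = \<beta> ([\<epsilon> x] \<cdot> h) z" using x z h_closed by (simp add: form_int form_h)
qed (use x h_closed in auto)

lemma add_pow_mult: "x \<in> carrier R \<Longrightarrow> [(k::int)] \<cdot> ([(l::int)] \<cdot> x) = [(l * k)] \<cdot> x"
  using add.int_pow_pow[of x k l] by simp

text \<open>For an integral b one has (b, x) = (b x, 1) = \<epsilon>(x) (b, 1), so b and (b, 1) h
  pair equally with every x.\<close>

lemma integrals_eq: "integrals R \<epsilon> = range (\<lambda>k::int. [k] \<cdot> h)"
proof (intro equalityI subsetI)
  fix b assume "b \<in> integrals R \<epsilon>"
  then have b: "b \<in> carrier R" "\<And>x. x \<in> carrier R \<Longrightarrow> b \<otimes> x = [\<epsilon> x] \<cdot> b" by (auto simp: integrals_def)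
  have "b = [\<beta> b \<one>] \<cdot> h"
  proof (rule form_eqI[OF b(1)])
    fix x assume x: "x \<in> carrier R"
    have "\<beta> b x = \<epsilon> x * \<beta> b \<one>" unfolding form_assoc[OF b(1) x] b(2)[OF x] by (rule form_int[OF b(1) one_closed])
    then show "\<beta> b x = \<beta> ([\<beta> b \<one>] \<cdot> h) x" using x h_closed by (simp add: form_int form_h)
  qed (use h_closed in simp)
  then show "b \<in> range (\<lambda>k::int. [k] \<cdot> h)" by blast
next
  fix b assume "b \<in> range (\<lambda>k::int. [k] \<cdot> h)"
  then show "b \<in> integrals R \<epsilon>" using h_closed
    by (auto simp: integrals_def add_pow_ldistr_int h_mult add_pow_mult mult.commute)
qed

lemma h_integral: "h \<in> integrals R \<epsilon>"
  using h_closed by (auto simp: integrals_eq intro!: image_eqI[of _ _ 1])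

lemma integrals_ideal: "ideal (integrals R \<epsilon>) R"
proof (rule idealI[OF ring_axioms])
  show "subgroup (integrals R \<epsilon>) (add_monoid R)"
  proof (rule add.subgroupI)
    fix a assume "a \<in> integrals R \<epsilon>"
    then obtain k :: int where k: "a = [k] \<cdot> h" by (auto simp: integrals_eq)
    have "\<ominus> a = [(-k)] \<cdot> h" unfolding k using h_closed add.int_pow_neg[of h k] by simp
    then show "\<ominus> a \<in> integrals R \<epsilon>" by (auto simp: integrals_eq)
    fix b assume "b \<in> integrals R \<epsilon>"
    then obtain l :: int where l: "b = [l] \<cdot> h" by (auto simp: integrals_eq)
    have "a \<oplus> b = [(k + l)] \<cdot> h" unfolding k l using h_closed add.int_pow_mult[of h k l] by simp
    then show "a \<oplus> b \<in> integrals R \<epsilon>" by (auto simp: integrals_eq)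
  qed (use h_closed in \<open>auto simp: integrals_eq\<close>)
  fix a x assume "a \<in> integrals R \<epsilon>" and x: "x \<in> carrier R"
  then obtain k :: int where k: "a = [k] \<cdot> h" by (auto simp: integrals_eq)
  show "x \<otimes> a \<in> integrals R \<epsilon>"
    using x h_closed by (auto simp: k add_pow_rdistr_int mult_h add_pow_mult integrals_eq)
  show "a \<otimes> x \<in> integrals R \<epsilon>"
    using x h_closed by (auto simp: k add_pow_ldistr_int h_mult add_pow_mult integrals_eq)
qed

lemma integrals_genideal: "integrals R \<epsilon> = Idl {h}"
proof (rule equalityI)
  interpret I: ideal "Idl {h}" R using h_closed by (intro genideal_ideal) simp
  have "h \<in> Idl {h}" using genideal_self'[OF h_closed] .
  then have "[(k::int)] \<cdot> h \<in> Idl {h}" for k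
    using add.subgroup_int_pow_closed[OF I.a_subgroup] by simp
  then show "integrals R \<epsilon> \<subseteq> Idl {h}" by (auto simp: integrals_eq)
  show "Idl {h} \<subseteq> integrals R \<epsilon>" using h_integral by (intro genideal_minimal integrals_ideal) simp
qed

text \<open>The multiples of h are distinct because pairing k h with 1 returns k \<epsilon>(1) =
  k.\<close>

lemma integrals_rank: "has_Z_rank R (integrals R \<epsilon>) 1"
proof -
  let ?I = "integrals R \<epsilon>"
  interpret I: ideal ?I R by (rule integrals_ideal)
  have am: "add_monoid (R\<lparr>carrier := ?I\<rparr>) = add_monoid R\<lparr>carrier := ?I\<rparr>" by simp
  interpret C: comm_monoid "add_monoid R\<lparr>carrier := ?I\<rparr>"
    by (rule comm_monoid.submonoid_is_comm_monoid[OF a_comm_monoid subgroup.subgroup_is_submonoid[OF I.a_subgroup]])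
  have "(\<Oplus>\<^bsub>R\<lparr>carrier := ?I\<rparr>\<^esub>s\<in>{..<1::nat}. [(f s :: int)] \<cdot>\<^bsub>R\<lparr>carrier := ?I\<rparr>\<^esub> h) = [(f 0)] \<cdot> h" for f
  proof -
    have "[(f 0)] \<cdot>\<^bsub>R\<lparr>carrier := ?I\<rparr>\<^esub> h = [(f 0)] \<cdot> h"
      using add.int_pow_consistent[OF I.a_subgroup h_integral, of "f 0"] by (simp add: add_pow_def)
    moreover have "[(f 0)] \<cdot> h \<in> ?I" by (auto simp: integrals_eq)
    ultimately show ?thesis
      unfolding finsum_def am lessThan_Suc One_nat_def lessThan_0
      by (subst C.finprod_insert; (subst C.finprod_empty)?) (use h_closed in auto)
  qed
  then have "Z_basis (R\<lparr>carrier := ?I\<rparr>) {..<1::nat} (\<lambda>_. h)"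
    unfolding Z_basis_def using h_integral
  proof (simp, intro ballI)
    fix x assume "x \<in> ?I"
    then obtain k :: int where k: "x = [k] \<cdot> h" by (auto simp: integrals_eq)
    have u: "l = \<beta> x \<one>" if "x = [l] \<cdot> h" for l :: int
      using that h_closed by (simp add: form_int form_h augmentation_one)
    show "\<exists>!f::nat \<Rightarrow> int. f \<in> extensional {..<Suc 0} \<and> x = [(f 0)] \<cdot> h"
    proof (rule ex1I)
      show "(\<lambda>i\<in>{..<Suc 0}. k) \<in> extensional {..<Suc 0} \<and> x = [((\<lambda>i\<in>{..<Suc 0}. k) 0)] \<cdot> h" using k by simp
      fix f :: "nat \<Rightarrow> int" assume f: "f \<in> extensional {..<Suc 0} \<and> x = [(f 0)] \<cdot> h"
      then show "f = (\<lambda>i\<in>{..<Suc 0}. k)"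
        using u[OF k] u[of "f 0"] by (intro extensionalityI[of f "{..<Suc 0}"]) auto
    qed
  qed
  then show ?thesis unfolding has_Z_rank_def by blast
qed

end

section \<open>Integer spans\<close>

definition Z_span :: "('r, 'm) ring_scheme \<Rightarrow> 's set \<Rightarrow> ('s \<Rightarrow> 'r) \<Rightarrow> 'r set" where
  "Z_span R S b = range (\<lambda>f :: 's \<Rightarrow> int. \<Oplus>\<^bsub>R\<^esub>s\<in>S. [f s] \<cdot>\<^bsub>R\<^esub> b s)"

lemma Z_spanI: "x = (\<Oplus>\<^bsub>R\<^esub>s\<in>S. [(f s :: int)] \<cdot>\<^bsub>R\<^esub> b s) \<Longrightarrow> x \<in> Z_span R S b"
  unfolding Z_span_def by (rule image_eqI[of _ _ f]) simp_all

context ring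
begin

lemma Z_span_add:
  assumes b: "b \<in> S \<rightarrow> carrier R" and x: "x \<in> Z_span R S b" and y: "y \<in> Z_span R S b"
  shows "x \<oplus> y \<in> Z_span R S b"
proof -
  obtain f :: "_ \<Rightarrow> int" where f: "x = (\<Oplus>s\<in>S. [f s] \<cdot> b s)" using x by (auto simp: Z_span_def)
  obtain g :: "_ \<Rightarrow> int" where g: "y = (\<Oplus>s\<in>S. [g s] \<cdot> b s)" using y by (auto simp: Z_span_def)
  have "x \<oplus> y = (\<Oplus>s\<in>S. [f s] \<cdot> b s \<oplus> [g s] \<cdot> b s)"
    unfolding f g using b by (intro finsum_addf[symmetric]) auto
  also have "\<dots> = (\<Oplus>s\<in>S. [(f s + g s)] \<cdot> b s)"
    using b by (intro add.finprod_cong') (auto simp: Pi_iff add.int_pow_mult)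
  finally show ?thesis by (rule Z_spanI)
qed

lemma Z_span_minus:
  assumes b: "b \<in> S \<rightarrow> carrier R" and x: "x \<in> Z_span R S b" and y: "y \<in> Z_span R S b"
  shows "x \<ominus> y \<in> Z_span R S b"
proof -
  obtain g :: "_ \<Rightarrow> int" where g: "y = (\<Oplus>s\<in>S. [g s] \<cdot> b s)" using y by (auto simp: Z_span_def)
  let ?z = "\<Oplus>s\<in>S. [(- g s)] \<cdot> b s"
  have c: "y \<in> carrier R" "?z \<in> carrier R"
    unfolding g using b by (auto intro!: finsum_closed)
  have "?z \<oplus> y = (\<Oplus>s\<in>S. [(- g s)] \<cdot> b s \<oplus> [g s] \<cdot> b s)"
    unfolding g using b by (intro finsum_addf[symmetric]) auto
  also have "\<dots> = \<zero>"
    using b by (intro add.finprod_one_eqI) (simp add: Pi_iff add.int_pow_neg l_neg)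
  finally have "\<ominus> y = ?z" using c by (intro minus_equality) auto
  then have "\<ominus> y \<in> Z_span R S b" by (rule Z_spanI)
  then show ?thesis unfolding minus_eq using b x by (intro Z_span_add)
qed

lemma Z_span_member:
  assumes b: "b \<in> S \<rightarrow> carrier R" and S: "finite S" and t: "t \<in> S"
  shows "b t \<in> Z_span R S b"
proof -
  have zero: "[(0::int)] \<cdot> x = \<zero>" for x by (simp add: add_pow_def)
  have "(\<Oplus>s\<in>S. if t = s then b s else \<zero>) = b t" using b by (intro add.finprod_singleton[OF t S])
  then have "b t = (\<Oplus>s\<in>S. if t = s then b s else \<zero>)" by simp
  also have "\<dots> = (\<Oplus>s\<in>S. [(if t = s then 1 else 0 :: int)] \<cdot> b s)"
    using b add.int_pow_1 zero by (intro add.finprod_cong') (auto simp: Pi_iff)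
  finally show ?thesis by (rule Z_spanI)
qed

lemma Z_span_zero:
  assumes b: "b \<in> S \<rightarrow> carrier R" and x: "x \<in> Z_span R S b"
  shows "\<zero> \<in> Z_span R S b"
proof -
  have "x \<in> carrier R" using x b by (auto simp: Z_span_def intro!: finsum_closed)
  then have "x \<ominus> x = \<zero>" by (simp add: minus_eq r_neg)
  then show ?thesis using Z_span_minus[OF b x x] by simp
qed

end

section \<open>Duality and integrals in the Green ring\<close>

context
  fixes D :: "('g, 'k::field) datum"
  assumes D: "nilpotent_datum D"
begin

lemma green_symmetric_form: "symmetric_form (green_ring D) (green_form D)"
  using green_ring_ring[OF D] green_form_add[OF D] green_form_sym[OF D]
  by (auto simp: symmetric_form_def symmetric_form_axioms_def)

interpretation GR: symmetric_form "green_ring D" "green_form D"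
  by (rule green_symmetric_form)

lemma green_dim_minus:
  assumes "X \<in> carrier (green_ring D)" "Y \<in> carrier (green_ring D)"
  shows "green_dim D (X \<ominus>\<^bsub>green_ring D\<^esub> Y) = green_dim D X - green_dim D Y"
  using green_dim_add[OF D, of "X \<ominus>\<^bsub>green_ring D\<^esub> Y" Y] assms
  by (simp add: GR.minus_eq GR.a_assoc GR.l_neg)

lemma green_dim_zero: "green_dim D \<zero>\<^bsub>green_ring D\<^esub> = 0"
  using green_dim_add[OF D, of "\<zero>\<^bsub>green_ring D\<^esub>" "\<zero>\<^bsub>green_ring D\<^esub>"] by simp

lemma green_dim_one: "green_dim D \<one>\<^bsub>green_ring D\<^esub> = 1"
  using green_dim_class[OF D triv_hmodule[OF D]] by (simp add: green_one[OF D] inflate_def gen_module_def char_rep_def)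

lemma green_dim_mult:
  assumes X: "X \<in> carrier (green_ring D)" and Y: "Y \<in> carrier (green_ring D)"
  shows "green_dim D (X \<otimes>\<^bsub>green_ring D\<^esub> Y) = green_dim D X * green_dim D Y"
  using X
proof (induction X rule: green_induct[OF D, consumes 1, case_names cls zero diff])
  case (cls M)
  note M = cls
  show ?case
    using Y
  proof (induction Y rule: green_induct[OF D, consumes 1, case_names cls zero diff])
    case (cls N)
    then show ?case
      using green_dim_class[OF D tensor_hmodule[OF D M cls]] M
      by (simp add: green_class_tensor[OF D] green_dim_class[OF D] tensor_module_def card_cartesian_product)
  next
    case zero
    then show ?case using green_class_closed[OF D M] by (simp add: green_dim_zero)
  next
    case (diff Y Y')
    then show ?case
      using green_class_closed[OF D M]
      by (simp add: GR.minus_eq GR.r_distr GR.r_minus right_diff_distrib flip: green_dim_minus)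
        (simp add: green_dim_minus right_diff_distrib flip: GR.minus_eq)
  qed
next
  case zero
  then show ?case using Y by (simp add: green_dim_zero)
next
  case (diff X X')
  have "(X \<ominus>\<^bsub>green_ring D\<^esub> X') \<otimes>\<^bsub>green_ring D\<^esub> Y = X \<otimes>\<^bsub>green_ring D\<^esub> Y \<ominus>\<^bsub>green_ring D\<^esub> X' \<otimes>\<^bsub>green_ring D\<^esub> Y"
    using diff Y by (simp add: GR.minus_eq GR.l_distr GR.l_minus)
  then show ?case using diff Y by (simp add: green_dim_minus left_diff_distrib)
qed

lemma green_form_assoc:
  assumes X: "X \<in> carrier (green_ring D)" and Y: "Y \<in> carrier (green_ring D)"
  shows "green_form D X Y = green_form D (X \<otimes>\<^bsub>green_ring D\<^esub> Y) \<one>\<^bsub>green_ring D\<^esub>"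
  using X
proof (induction X rule: green_induct[OF D, consumes 1, case_names cls zero diff])
  case (cls M)
  note M = cls
  note Mc = green_class_closed[OF D M]
  show ?case
    using Y
  proof (induction Y rule: green_induct[OF D, consumes 1, case_names cls zero diff])
    case (cls N)
    then show ?case
      using hom_dim_adjunction[OF D M cls] tensor_hmodule[OF D M cls] triv_hmodule[OF D] M
      by (simp add: green_class_tensor[OF D] green_form_class[OF D] green_one[OF D])
  next
    case zero
    then show ?case using Mc GR.form_sym[OF Mc GR.zero_closed] by (simp add: GR.form_zero)
  next
    case (diff Y Y')
    have "green_class D M \<otimes>\<^bsub>green_ring D\<^esub> (Y \<ominus>\<^bsub>green_ring D\<^esub> Y')
      = green_class D M \<otimes>\<^bsub>green_ring D\<^esub> Y \<ominus>\<^bsub>green_ring D\<^esub> green_class D M \<otimes>\<^bsub>green_ring D\<^esub> Y'"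
      using diff Mc by (simp add: GR.minus_eq GR.r_distr GR.r_minus)
    then show ?case
      using diff Mc GR.form_sym[OF Mc, of "Y \<ominus>\<^bsub>green_ring D\<^esub> Y'"] GR.form_sym[OF Mc, of Y] GR.form_sym[OF Mc, of Y']
      by (simp add: GR.form_minus)
  qed
next
  case zero
  then show ?case using Y by (simp add: GR.form_zero)
next
  case (diff X X')
  have "(X \<ominus>\<^bsub>green_ring D\<^esub> X') \<otimes>\<^bsub>green_ring D\<^esub> Y = X \<otimes>\<^bsub>green_ring D\<^esub> Y \<ominus>\<^bsub>green_ring D\<^esub> X' \<otimes>\<^bsub>green_ring D\<^esub> Y"
    using diff Y by (simp add: GR.minus_eq GR.l_distr GR.l_minus)
  then show ?case using diff Y by (simp add: GR.form_minus)
qed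

text \<open>On a class [M] the form counts the maps from H to the dual of M, whose dimension is that
  of the dual and hence of M.\<close>

lemma green_form_regular:
  assumes X: "X \<in> carrier (green_ring D)"
  shows "green_form D (green_class D (regular_module D)) X = green_dim D X"
proof -
  note H = regular_hmodule[OF D]
  note Hc = green_class_closed[OF D H]
  have s: "green_form D (green_class D (regular_module D)) X = green_form D X (green_class D (regular_module D))"
    if "X \<in> carrier (green_ring D)" for X using GR.form_sym[OF Hc that] .
  show ?thesis
    using X
  proof (induction X rule: green_induct[OF D, consumes 1, case_names cls zero diff])
    case (cls M)
    show ?case
      using hom_dim_regular[OF D dual_hmodule[OF D cls]] cls
      by (simp add: green_form_class[OF D H cls] green_dim_class[OF D] dual_module_def)
  qed (use Hc in \<open>simp_all add: s GR.form_zero GR.form_minus green_dim_zero green_dim_minus\<close>)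
qed

text \<open>Putting y = 1 in (x, y) = \<phi>(x y) determines \<phi>; conversely, associativity of
  the form shows that pairing with 1 has this property.\<close>

lemma frobenius_hom_iff:
  "frobenius_hom (green_ring D) (green_form D) \<phi> \<longleftrightarrow>
    (\<forall>x\<in>carrier (green_ring D). \<phi> x = green_form D x \<one>\<^bsub>green_ring D\<^esub>)"
proof
  assume \<phi>: "frobenius_hom (green_ring D) (green_form D) \<phi>"
  show "\<forall>x\<in>carrier (green_ring D). \<phi> x = green_form D x \<one>\<^bsub>green_ring D\<^esub>"
  proof
    fix x assume x: "x \<in> carrier (green_ring D)"
    have "green_form D x \<one>\<^bsub>green_ring D\<^esub> = \<phi> (x \<otimes>\<^bsub>green_ring D\<^esub> \<one>\<^bsub>green_ring D\<^esub>)"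
      using \<phi> x by (simp only: frobenius_hom_def GR.one_closed)
    then show "\<phi> x = green_form D x \<one>\<^bsub>green_ring D\<^esub>" using x by simp
  qed
next
  assume "\<forall>x\<in>carrier (green_ring D). \<phi> x = green_form D x \<one>\<^bsub>green_ring D\<^esub>"
  then have \<phi>: "\<phi> x = green_form D x \<one>\<^bsub>green_ring D\<^esub>" if "x \<in> carrier (green_ring D)" for x using that by blast
  have m: "green_form D x y = \<phi> (x \<otimes>\<^bsub>green_ring D\<^esub> y)" if "x \<in> carrier (green_ring D)" "y \<in> carrier (green_ring D)" for x y
    unfolding \<phi>[OF GR.m_closed[OF that]] by (rule green_form_assoc[OF that])
  show "frobenius_hom (green_ring D) (green_form D) \<phi>"
    unfolding frobenius_hom_def
    by (intro conjI ballI m) (simp only: \<phi> GR.form_add GR.a_closed GR.one_closed)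
qed

text \<open>The form dualizes its second argument. Since the double dual of N is isomorphic to N,
  pairing with starred elements counts ordinary homomorphisms.\<close>

lemma green_form_dual_class:
  assumes M: "hmodule D M" and N: "hmodule D N"
  shows "green_form D (green_class D M) (green_dual D (green_class D N)) = hom_dim D M N"
  using hom_dim_iso[OF D M M dual_hmodule[OF D dual_hmodule[OF D N]] N hiso_refl[OF D M] rep_iso_sym[OF double_dual_iso[OF D N]]]
  by (simp add: green_dual_class[OF D N] green_form_class[OF D M dual_hmodule[OF D N]])

lemma green_form_dual_add:
  assumes "X \<in> carrier (green_ring D)" "Y \<in> carrier (green_ring D)" "Z \<in> carrier (green_ring D)"
  shows "green_form D Z (green_dual D (X \<oplus>\<^bsub>green_ring D\<^esub> Y))
    = green_form D Z (green_dual D X) + green_form D Z (green_dual D Y)"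
  using assms green_dual_closed[OF D] GR.form_sym[OF assms(3)]
  by (simp add: green_dual_add[OF D] GR.form_add)

lemma green_form_dual_minus:
  assumes "X \<in> carrier (green_ring D)" "Y \<in> carrier (green_ring D)" "Z \<in> carrier (green_ring D)"
  shows "green_form D Z (green_dual D (X \<ominus>\<^bsub>green_ring D\<^esub> Y))
    = green_form D Z (green_dual D X) - green_form D Z (green_dual D Y)"
  using green_form_dual_add[of "X \<ominus>\<^bsub>green_ring D\<^esub> Y" Y Z] assms
  by (simp add: GR.minus_eq GR.a_assoc GR.l_neg)

text \<open>A zero module is isomorphic to its sum with itself, so its class x satisfies x = x +
  x.\<close>

lemma green_class_empty:
  assumes M: "hmodule D M" and e: "idx M = {}"
  shows "green_class D M = \<zero>\<^bsub>green_ring D\<^esub>"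
proof -
  have "rep_iso (carrier (hopf_alg D)) M (sum_module M M)"
    unfolding rep_iso_def
  proof (intro bexI)
    show "mmul (idx (sum_module M M)) 0 0 = idmat (idx M) \<and> mmul (idx M) 0 0 = idmat (idx (sum_module M M))"
      by (auto simp: mmul_def idmat_def e sum_module_def fun_eq_iff)
  qed (auto simp: Hom_def e sum_module_def fspace_def mmul_def)
  from green_class_iso[OF D M sum_hmodule[OF D M M] this]
  have "green_class D M = green_class D M \<oplus>\<^bsub>green_ring D\<^esub> green_class D M" by (simp add: green_class_sum[OF D M M])
  then show ?thesis using green_class_closed[OF D M] by simp
qed

end

section \<open>The indecomposables over an algebraically closed field of characteristic zero\<close>

context
  fixes D :: "('g, 'k::{alg_closed_field, field_char_0}) datum" and V :: "nat \<Rightarrow> ('g, 'k, nat) rep" and m :: nat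
  assumes D: "nilpotent_datum D" and V: "complete_simples D m V"
begin

interpretation GS: symmetric_form "green_ring D" "green_form D"
  by (rule green_symmetric_form[OF D])

lemma simples_grep: "i \<in> {1..m} \<Longrightarrow> grep D (V i)"
  using complete_simples_simple[OF V] by (simp add: simple_grep_def)

lemma indecomposable_hmodule: "i \<in> {1..m} \<Longrightarrow> j \<le> nil_ord D \<Longrightarrow> hmodule D (Mmod D (V i) j)"
  by (rule Mmod_hmodule[OF D simples_grep])

lemma Mcls_closed: "i \<in> {1..m} \<Longrightarrow> j \<le> nil_ord D \<Longrightarrow> Mcls D V i j \<in> carrier (green_ring D)"
  unfolding Mcls_def by (intro green_class_closed[OF D] indecomposable_hmodule)

lemma Mcls_funcset: "(\<lambda>(i, j). Mcls D V i j) \<in> {1..m} \<times> {1..nil_ord D} \<rightarrow> carrier (green_ring D)"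
  using Mcls_closed by auto

text \<open>Induction on the dimension: a nonzero module splits off some M(i, j), and the complement
  is smaller.\<close>

lemma green_class_in_span:
  fixes M :: "(nat \<times> 'g \<Rightarrow> 'k, 'k, nat) rep"
  assumes "hmodule D M"
  shows "green_class D M \<in> Z_span (green_ring D) ({1..m} \<times> {1..nil_ord D}) (\<lambda>(i, j). Mcls D V i j)"
    (is "_ \<in> Z_span _ ?S ?b")
  using assms
proof (induction "card (idx M)" arbitrary: M rule: less_induct)
  case less
  note M = less.prems
  have "group (grp D)" "finite (carrier (grp D))" using D by (auto simp: nilpotent_datum_def)
  then have char: "of_nat (card (carrier (grp D))) \<noteq> (0::'k)"
    using group.is_monoid[THEN monoid.one_closed] by (simp add: card_eq_0_iff) blast
  show ?case
  proof (cases "idx M = {}")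
    case True
    have "green_class D M = (\<Oplus>\<^bsub>green_ring D\<^esub>s\<in>?S. [(0::int)] \<cdot>\<^bsub>green_ring D\<^esub> ?b s)"
      unfolding green_class_empty[OF D M True]
      by (rule GS.add.finprod_one_eqI[symmetric]) (simp add: add_pow_def)
    then show ?thesis by (rule Z_spanI)
  next
    case False
    obtain i j and L :: "(nat \<times> 'g \<Rightarrow> 'k, 'k, nat) rep" where ij: "i \<in> {1..m}" "j \<in> {1..nil_ord D}"
      and L: "hmodule D L" and iso: "rep_iso (carrier (hopf_alg D)) M (sum_module (Mmod D (V i) j) L)"
      by (rule split_indecomposable[OF D char V M False])
    have N: "hmodule D (Mmod D (V i) j)" using indecomposable_hmodule ij by simp
    have "green_class D M = ?b (i, j) \<oplus>\<^bsub>green_ring D\<^esub> green_class D L"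
      using green_class_iso[OF D M sum_hmodule[OF D N L] iso] green_class_sum[OF D N L] by (simp add: Mcls_def)
    moreover have "green_class D L \<in> Z_span (green_ring D) ?S ?b"
    proof (rule less.hyps[OF _ L])
      have "idx (V i) \<noteq> {}" using complete_simples_simple[OF V ij(1)] by (simp add: simple_grep_def)
      then have "card (idx (Mmod D (V i) j)) \<noteq> 0"
        using ij hmodule_finite[OF D N] by (simp add: card_eq_0_iff lessThan_empty_iff)
      moreover have "card (idx M) = card (idx (Mmod D (V i) j)) + card (idx L)"
        using rep_iso_card[OF _ _ iso] hmodule_finite[OF D M] hmodule_finite[OF D L] hmodule_finite[OF D N]
        by (simp add: card_Plus)
      ultimately show "card (idx L) < card (idx M)" by simp
    qed
    moreover have "?b (i, j) \<in> Z_span (green_ring D) ?S ?b"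
      using ij by (intro GS.Z_span_member Mcls_funcset) auto
    ultimately show ?thesis using GS.Z_span_add[OF Mcls_funcset] by simp
  qed
qed

lemma green_span:
  assumes "X \<in> carrier (green_ring D)"
  shows "X \<in> Z_span (green_ring D) ({1..m} \<times> {1..nil_ord D}) (\<lambda>(i, j). Mcls D V i j)"
  using assms
proof (induction X rule: green_induct[OF D, consumes 1, case_names cls zero diff])
  case (cls M)
  then show ?case by (rule green_class_in_span)
next
  case zero
  show ?case using GS.Z_span_zero[OF Mcls_funcset green_class_in_span[OF triv_hmodule[OF D]]] .
next
  case (diff X Y)
  show ?case using diff(3,4) by (rule GS.Z_span_minus[OF Mcls_funcset])
qed

context
  assumes m: "1 \<le> m" and V1: "rep_iso (carrier (grp D)) (V 1) (char_rep (\<lambda>_. 1))"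
begin

lemma acls_hmodule: "hmodule D (inflate D (char_rep (\<lambda>h. inverse (chr D h))))"
  by (rule inflate_hmodule[OF D trivial_twist_grep[OF D]])

lemma acls_closed: "acls D \<in> carrier (green_ring D)"
  unfolding acls_def by (rule green_class_closed[OF D acls_hmodule])

lemma Mcls_one_two: "Mcls D V 1 2 = green_class D (Mmod D (char_rep (\<lambda>_. 1)) 2)"
  unfolding Mcls_def using m indecomposable_hmodule[of 1 2] nil_ord_ge[OF D]
  by (intro green_class_iso[OF D] Mtwo_hmodule[OF D] Mmod_iso[OF D] V1 simples_grep trivial_grep[OF D]) auto

lemma delta_closed:
  assumes "i \<in> {1..m}" "j \<in> {1..nil_ord D}"
  shows "delta D V i j \<in> carrier (green_ring D)"
  unfolding delta_def using assms acls_closed Mcls_closed m nil_ord_ge[OF D] by auto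

text \<open>Expanding delta into its summands turns the pairing into the signed sums of Hom
  dimensions of \<open>hom_dim_delta\<close> and \<open>hom_dim_delta_top\<close>; the dimension of
  the G-maps from V i to V k then contributes the Kronecker delta in i and k.\<close>

lemma delta_star_pairing:
  assumes i: "i \<in> {1..m}" and j: "j \<in> {1..nil_ord D}" and k: "k \<in> {1..m}" and l: "l \<in> {1..nil_ord D}"
  shows "green_form D (Mcls D V i j) (delta_star D V k l) = (if i = k \<and> j = l then 1 else 0)"
proof -
  let ?A = "inflate D (char_rep (\<lambda>h. inverse (chr D h)))" and ?T = "Mmod D (char_rep (\<lambda>_. 1)) 2 :: (nat \<times> 'g \<Rightarrow> 'k, 'k, nat \<times> nat) rep"
  let ?R = "green_ring D"
  have M: "hmodule D (Mmod D (V i) j)" using indecomposable_hmodule i j by simp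
  note Mc = green_class_closed[OF D M]
  have d: "int (fvs.dim (Hom (carrier (grp D)) (V i) (V k))) = (if i = k then 1 else 0)"
    by (simp add: dim_Hom_simple[OF D V i k])
  show ?thesis
  proof (cases "l < nil_ord D")
    case True
    have N: "hmodule D (Mmod D (V k) l)" using indecomposable_hmodule k l by simp
    note Nc = green_class_closed[OF D N]
    note AN = tensor_hmodule[OF D acls_hmodule N] and TN = tensor_hmodule[OF D Mtwo_hmodule[OF D] N]
    note ANc = green_class_closed[OF D AN] and TNc = green_class_closed[OF D TN]
    have "delta D V k l = green_class D (Mmod D (V k) l) \<oplus>\<^bsub>?R\<^esub> green_class D (tensor_module D ?A (Mmod D (V k) l))
        \<ominus>\<^bsub>?R\<^esub> green_class D (tensor_module D ?T (Mmod D (V k) l))"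
      using True acls_closed Nc green_class_closed[OF D Mtwo_hmodule[OF D]] unfolding delta_def Mcls_one_two
      by (simp add: Mcls_def acls_def GS.minus_eq GS.l_distr GS.l_minus
          green_class_tensor[OF D acls_hmodule N, symmetric] green_class_tensor[OF D Mtwo_hmodule[OF D] N, symmetric])
    then have "green_form D (Mcls D V i j) (delta_star D V k l)
      = hom_dim D (Mmod D (V i) j) (Mmod D (V k) l) + hom_dim D (Mmod D (V i) j) (tensor_module D ?A (Mmod D (V k) l))
        - hom_dim D (Mmod D (V i) j) (tensor_module D ?T (Mmod D (V k) l))"
      using Mc Nc ANc TNc
      by (simp add: delta_star_def Mcls_def green_form_dual_minus[OF D] green_form_dual_add[OF D]
          green_form_dual_class[OF D M N] green_form_dual_class[OF D M AN] green_form_dual_class[OF D M TN])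
    also have "\<dots> = (if j = l then int (fvs.dim (Hom (carrier (grp D)) (V i) (V k))) else 0)"
      using hom_dim_delta[OF D simples_grep[OF i] simples_grep[OF k], of j l] j l True by simp
    finally show ?thesis unfolding d by simp
  next
    case False
    then have l: "l = nil_ord D" using l by simp
    have N: "hmodule D (Mmod D (V k) (nil_ord D))" and N': "hmodule D (Mmod D (V k) (nil_ord D - 1))"
      using indecomposable_hmodule[OF k] by simp_all
    note AN = tensor_hmodule[OF D acls_hmodule N']
    note Nc = green_class_closed[OF D N] and ANc = green_class_closed[OF D AN]
    have "delta D V k l = green_class D (Mmod D (V k) (nil_ord D)) \<ominus>\<^bsub>?R\<^esub> green_class D (tensor_module D ?A (Mmod D (V k) (nil_ord D - 1)))"
      unfolding delta_def Mcls_def acls_def green_class_tensor[OF D acls_hmodule N'] by (simp add: l)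
    then have "green_form D (Mcls D V i j) (delta_star D V k l)
      = hom_dim D (Mmod D (V i) j) (Mmod D (V k) (nil_ord D))
        - hom_dim D (Mmod D (V i) j) (tensor_module D ?A (Mmod D (V k) (nil_ord D - 1)))"
      using Mc Nc ANc
      by (simp add: delta_star_def Mcls_def green_form_dual_minus[OF D]
          green_form_dual_class[OF D M N] green_form_dual_class[OF D M AN] del: One_nat_def)
    also have "\<dots> = (if j = nil_ord D then int (fvs.dim (Hom (carrier (grp D)) (V i) (V k))) else 0)"
      using hom_dim_delta_top[OF D simples_grep[OF i] simples_grep[OF k], of j] j by simp
    finally show ?thesis unfolding d l by simp
  qed
qed

lemma delta_star_funcset: "(\<lambda>(i, j). delta_star D V i j) \<in> {1..m} \<times> {1..nil_ord D} \<rightarrow> carrier (green_ring D)"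
  unfolding delta_star_def using green_dual_closed[OF D delta_closed] by auto

lemma Mcls_delta_star_kronecker:
  assumes "s \<in> {1..m} \<times> {1..nil_ord D}" "t \<in> {1..m} \<times> {1..nil_ord D}"
  shows "green_form D (case s of (i, j) \<Rightarrow> Mcls D V i j) (case t of (i, j) \<Rightarrow> delta_star D V i j) = (if s = t then 1 else 0)"
  using assms by (cases s; cases t) (simp add: delta_star_pairing)

lemma green_span_ex:
  assumes "X \<in> carrier (green_ring D)"
  shows "\<exists>f :: nat \<times> nat \<Rightarrow> int. X = (\<Oplus>\<^bsub>green_ring D\<^esub>s\<in>{1..m} \<times> {1..nil_ord D}. [f s] \<cdot>\<^bsub>green_ring D\<^esub> (case s of (i, j) \<Rightarrow> Mcls D V i j))"
  using green_span[OF assms] by (auto simp: Z_span_def)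

lemma Mcls_delta_star_dual_pair:
  "dual_pair (green_ring D) (green_form D) ({1..m} \<times> {1..nil_ord D})
    (\<lambda>(i, j). Mcls D V i j) (\<lambda>(i, j). delta_star D V i j)"
  by (rule GS.dual_pairI[OF _ Mcls_funcset delta_star_funcset Mcls_delta_star_kronecker green_span_ex]) auto

lemma green_augmented_form:
  "augmented_form (green_ring D) (green_form D) (green_dim D) (green_class D (regular_module D))"
proof unfold_locales
  show "z = \<zero>\<^bsub>green_ring D\<^esub>" if z: "z \<in> carrier (green_ring D)"
    "\<And>x. x \<in> carrier (green_ring D) \<Longrightarrow> green_form D z x = 0" for z
  proof (rule GS.nondegenerate[OF _ Mcls_funcset delta_star_funcset Mcls_delta_star_kronecker green_span_ex z(1)])
    fix s assume "s \<in> {1..m} \<times> {1..nil_ord D}"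
    then have s: "(case s of (i, j) \<Rightarrow> Mcls D V i j) \<in> carrier (green_ring D)" using Mcls_closed by auto
    show "green_form D (case s of (i, j) \<Rightarrow> Mcls D V i j) z = 0"
      unfolding GS.form_sym[OF s z(1)] by (rule z(2)[OF s])
  qed auto
qed (fact green_form_assoc[OF D] green_class_closed[OF D regular_hmodule[OF D]] green_form_regular[OF D]
    green_dim_mult[OF D] green_dim_one[OF D])+

end

end

theorem proposition4p10:
  fixes D :: "('g, 'k::{alg_closed_field, field_char_0}) datum"
    and V :: "nat \<Rightarrow> ('g, 'k, nat) rep" and m :: nat
  assumes "nilpotent_datum D"
    and "complete_simples D m V"
    and "1 \<le> m" and "rep_iso (carrier (grp D)) (V 1) (char_rep (\<lambda>_. 1))"
  shows
    "dual_pair (green_ring D) (green_form D) ({1..m} \<times> {1..nil_ord D})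
       (\<lambda>(i, j). Mcls D V i j) (\<lambda>(i, j). delta_star D V i j)
     \<and>
     (\<forall>\<phi>. frobenius_hom (green_ring D) (green_form D) \<phi> \<longleftrightarrow>
        (\<forall>x\<in>carrier (green_ring D). \<phi> x = green_form D x \<one>\<^bsub>green_ring D\<^esub>))
     \<and>
     casimir_element (green_ring D) (green_form D) =
       finprod (tensor_square (green_ring D))
         (\<lambda>(i, j). tensor (green_ring D) (delta_star D V i j) (Mcls D V i j))
         ({1..m} \<times> {1..nil_ord D})
     \<and>
     casimir_element (green_ring D) (green_form D) =
       finprod (tensor_square (green_ring D))
         (\<lambda>(i, j). tensor (green_ring D) (Mcls D V i j) (delta_star D V i j))
         ({1..m} \<times> {1..nil_ord D})
     \<and>
     ideal (integrals (green_ring D) (green_dim D)) (green_ring D)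
     \<and>
     integrals (green_ring D) (green_dim D)
       = Idl\<^bsub>green_ring D\<^esub> {green_class D (regular_module D)}
     \<and>
     has_Z_rank (green_ring D) (integrals (green_ring D) (green_dim D)) 1
     \<and>
     (\<forall>x\<in>carrier (green_ring D).
        green_form D (green_class D (regular_module D)) x = green_dim D x)"
proof -
  interpret augmented_form "green_ring D" "green_form D" "green_dim D" "green_class D (regular_module D)"
    by (rule green_augmented_form[OF assms])
  note dp = Mcls_delta_star_dual_pair[OF assms]
  have 1: "casimir_element (green_ring D) (green_form D) =
       finprod (tensor_square (green_ring D))
         (\<lambda>(i, j). tensor (green_ring D) (delta_star D V i j) (Mcls D V i j))
         ({1..m} \<times> {1..nil_ord D})"
    using casimir_element_eq[OF dp] by (simp only: split_def)
  have 2: "casimir_element (green_ring D) (green_form D) =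
       finprod (tensor_square (green_ring D))
         (\<lambda>(i, j). tensor (green_ring D) (Mcls D V i j) (delta_star D V i j))
         ({1..m} \<times> {1..nil_ord D})"
    using casimir_element_eq[OF dual_pair_sym[OF dp]] by (simp only: split_def)
  show ?thesis
    by (intro conjI allI ballI dp 1 2 frobenius_hom_iff[OF assms(1)] integrals_ideal integrals_genideal integrals_rank form_h)
qed

end
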